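(* Let $N\ge1$ and let $E^0\subseteq\mathbb{R}^N$ be closed and non-empty. Let $(K^\varepsilon)_{\varepsilon>0}$ be a family of kernels $K^\varepsilon=(K^\varepsilon_j)_{j\in\varepsilon\mathbb{Z}^N}$ such that: (1) $K^\varepsilon_j=K^\varepsilon_{-j}\ge0$ for all $j\in\varepsilon\mathbb{Z}^N$; (2) $\sum_{j\in\varepsilon\mathbb{Z}^N}K^\varepsilon_j=1$; (3) $h=h(\varepsilon):=\frac1{2N}\sum_{j\in\varepsilon\mathbb{Z}^N}|j|^2K^\varepsilon_j\to0$ as $\varepsilon\to0$; (4) for every $\xi\in\mathbb{R}^N$, $\displaystyle\lim_{\varepsilon\to0}\frac{1-\widetilde{K^\varepsilon}(\xi)}{h}=4\pi^2|\xi|^2$, where $\widetilde{K^\varepsilon}(\xi)=\sum_{j\in\varepsilon\mathbb{Z}^N}K^\varepsilon_je^{-2i\pi j\cdot\xi}$; and assume $h(\varepsilon)\ge\varepsilon^2$. Let $\gamma(s)=\tanh(s)$ and let $(u^{k,\varepsilon})_{k\in\mathbb{N}}$ be generated by $$u^{k+1,\varepsilon}=\mathrm{sd}\big[\gamma^{-1}(K^\varepsilon*\gamma(u^{k,\varepsilon}))\big],\qquad k\in\mathbb{N},$$ with $u^{0,\varepsilon}=\mathrm{sd}^{0,\varepsilon}$ defined from $E^0$ as in the context. Set $d^\varepsilon(t)_i=u^{[t/h],\varepsilon}_i$ for $t\ge0$, $i\in\varepsilon\mathbb{Z}^N$ ($[\cdot]$ is the integer part). Then, as $\varepsilon\to0$,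 the functions $d^\varepsilon$ converge up to subsequences, for almost all times $t\ge0$ and locally uniformly in space, to a function $d(x,t)$ such that: (i) $d^+=\max\{d,0\}$ is the distance function to a supersolution of the generalized mean curvature flow starting from $E^0$, i.e. there is a superflow $E$ with initial datum $E^0$ such that $d^+(\cdot,t)=\mathrm{dist}(\cdot,E(t))$ for a.e. $t$; (ii) $d^-=\max\{-d,0\}$ is, in the same sense, the distance function to a supersolution of the generalized mean curvature flow starting from $\overline{\mathbb{R}^N\setminus E^0}$.
   Context: Notation: $|\cdot|$ is the Euclidean norm, $\inf\emptyset=+\infty$, $\sup\emptyset=-\infty$, $\mathrm{dist}(\cdot,\emptyset)=+\infty$, $\gamma(\pm\infty)=\pm1$. Functions identically $+\infty$ or $-\infty$ are allowed (they occur after extinction of the set or of its complement), and convergence to them is understood in the obvious sense. A function $(u_i)_{i\in\varepsilon\mathbb{Z}^N}$ is $1$-Lipschitz if $|u_i-u_j|\le|i-j|$ for all $i,j$. The discrete convolution is $(u*v)_i=\sum_{j\in\varepsilon\mathbb{Z}^N}u_jv_{i-j}$; $\gamma$ and $\gamma^{-1}$ are applied pointwise. (If $u$ is $1$-Lipschitz then so is $\gamma^{-1}(K^\varepsilon*\gamma(u))$, so the algorithm is well defined.) Locally uniform convergence of a grid function $w^\varepsilon$ means locally uniform convergence in $\mathbb{R}^N$ of $\sum_i w^\varepsilon_i\chi_{i+[0,\varepsilon)^N}$. Redistancing. For $u$ $1$-Lipschitz on $\varepsilon\mathbb{Z}^N$: $$\mathrm{d}^+[u]_i=\inf_{j:u_j<0}(u_j+|j-i|),\qquad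 \mathrm{sd}^+[u]_i=\sup_{j:u_j\ge0}(\mathrm{d}^+[u]_j-|j-i|),$$ $$\mathrm{d}^-[u]_i=\sup_{j:u_j>0}(u_j-|j-i|),\qquad \mathrm{sd}^-[u]_i=\inf_{j:u_j\le0}(\mathrm{d}^-[u]_j+|j-i|).$$ $\mathrm{sd}[\cdot]$ denotes one of the two operators $\mathrm{sd}^+[\cdot]$, $\mathrm{sd}^-[\cdot]$, fixed once and for all. Initialization. Let $E^{0,\varepsilon}=\{i\in\varepsilon\mathbb{Z}^N:(i+[0,\varepsilon)^N)\cap E^0\ne\emptyset\}$, let $w^{0,\varepsilon}$ be a $1$-Lipschitz function on $\varepsilon\mathbb{Z}^N$ with $w^{0,\varepsilon}<0$ on $E^{0,\varepsilon}$ and $w^{0,\varepsilon}>0$ elsewhere, and let $\mathrm{sd}^{0,\varepsilon}=\mathrm{sd}[w^{0,\varepsilon}]$. Superflows. Let $E^0\subset\mathbb{R}^N$ be closed. A closed set $E\subset\mathbb{R}^N\times[0,+\infty)$, with slices $E(t)=\{x:(x,t)\in E\}$, is a supersolution of the mean curvature flow (superflow) with initial datum $E^0$ (or "starting from $E^0$") if: (a) $E(0)\subseteq E^0$; (b) if $E(t)=\emptyset$ then $E(s)=\emptyset$ for all $s>t$; (c) $E(s)\to E(t)$ in the Kuratowski sense as $s\uparrow t$, for all $t>0$; (d) setting $T^*=\inf\{t>0:E(s)=\emptyset\text{ for }s\ge t\}$ and $d(x,t)=\mathrm{dist}(x,E(t))$, one has $\partial_td\ge\Delta d$ in the sense of distributions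 in $(\mathbb{R}^N\times(0,T^* ))\setminus E$. *)

theory Defs
  imports "HOL-Analysis.Analysis"
begin

section \<open>Grid functions\<close>

text \<open>Grid functions are total functions on \<open>real^'n\<close>; only their values on the grid are used.
  They are \<open>ereal\<close>-valued because the functions identically \<open>\<infinity>\<close> or \<open>-\<infinity>\<close> are allowed.\<close>

definition grid :: "real \<Rightarrow> (real^'n) set" where
  "grid \<epsilon> = {x. \<forall>k. \<exists>m::int. x $ k = \<epsilon> * of_int m}"

definition cell :: "real \<Rightarrow> real^'n \<Rightarrow> (real^'n) set" where
  "cell \<epsilon> i = {x. \<forall>k. i $ k \<le> x $ k \<and> x $ k < i $ k + \<epsilon>}"

text \<open>If one value on the grid is \<open>\<infinity>\<close> or \<open>-\<infinity>\<close>, this inequality, required for all ordered pairs,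
  forces all values on the grid to be the same infinity; otherwise it says
  \<open>\<bar>u i - u j\<bar> \<le> norm (i - j)\<close>.\<close>

definition grid_1_lipschitz :: "real \<Rightarrow> (real^'n \<Rightarrow> ereal) \<Rightarrow> bool" where
  "grid_1_lipschitz \<epsilon> u \<longleftrightarrow> (\<forall>i\<in>grid \<epsilon>. \<forall>j\<in>grid \<epsilon>. u i \<le> u j + ereal (norm (i - j)))"

definition grid_conv :: "real \<Rightarrow> (real^'n \<Rightarrow> real) \<Rightarrow> (real^'n \<Rightarrow> real) \<Rightarrow> real^'n \<Rightarrow> real" where
  "grid_conv \<epsilon> u v i = (\<Sum>\<^sub>\<infinity>j\<in>grid \<epsilon>. u j * v (i - j))"

definition grid_extension :: "real \<Rightarrow> (real^'n \<Rightarrow> ereal) \<Rightarrow> real^'n \<Rightarrow> ereal" where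
  "grid_extension \<epsilon> u x = (\<Sum>\<^sub>\<infinity>i\<in>grid \<epsilon>. u i * indicator (cell \<epsilon> i) x)"


section \<open>Redistancing\<close>

definition d_plus :: "real \<Rightarrow> (real^'n \<Rightarrow> ereal) \<Rightarrow> real^'n \<Rightarrow> ereal" where
  "d_plus \<epsilon> u i = (INF j\<in>{j\<in>grid \<epsilon>. u j < 0}. u j + ereal (norm (j - i)))"

definition sd_plus :: "real \<Rightarrow> (real^'n \<Rightarrow> ereal) \<Rightarrow> real^'n \<Rightarrow> ereal" where
  "sd_plus \<epsilon> u i = (SUP j\<in>{j\<in>grid \<epsilon>. 0 \<le> u j}. d_plus \<epsilon> u j - ereal (norm (j - i)))"

definition d_minus :: "real \<Rightarrow> (real^'n \<Rightarrow> ereal) \<Rightarrow> real^'n \<Rightarrow> ereal" where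
  "d_minus \<epsilon> u i = (SUP j\<in>{j\<in>grid \<epsilon>. 0 < u j}. u j - ereal (norm (j - i)))"

definition sd_minus :: "real \<Rightarrow> (real^'n \<Rightarrow> ereal) \<Rightarrow> real^'n \<Rightarrow> ereal" where
  "sd_minus \<epsilon> u i = (INF j\<in>{j\<in>grid \<epsilon>. u j \<le> 0}. d_minus \<epsilon> u j + ereal (norm (j - i)))"


section \<open>Kernels and the scheme\<close>

definition kernel_h :: "real \<Rightarrow> (real^'n \<Rightarrow> real) \<Rightarrow> real" where
  "kernel_h \<epsilon> k = (\<Sum>\<^sub>\<infinity>j\<in>grid \<epsilon>. (norm j)\<^sup>2 * k j) / (2 * real CARD('n))"

definition kernel_fourier :: "real \<Rightarrow> (real^'n \<Rightarrow> real) \<Rightarrow> real^'n \<Rightarrow> complex" where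
  "kernel_fourier \<epsilon> k \<xi> =
     (\<Sum>\<^sub>\<infinity>j\<in>grid \<epsilon>. of_real (k j) * exp (- 2 * \<i> * of_real pi * of_real (j \<bullet> \<xi>)))"

text \<open>\<open>gamma\<close> is a bijection from \<open>ereal\<close> onto the interval \<open>[-1, 1]\<close>, so \<open>inv gamma\<close> is its
  inverse there.\<close>

function gamma :: "ereal \<Rightarrow> real" where
  "gamma (ereal s) = tanh s"
| "gamma \<infinity> = 1"
| "gamma (-\<infinity>) = -1"
  by (auto intro: ereal_cases)
termination by lexicographic_order

text \<open>The operator \<open>sd\<close> takes the mesh size as its first argument.\<close>

primrec scheme ::
  "(real \<Rightarrow> (real^'n \<Rightarrow> ereal) \<Rightarrow> real^'n \<Rightarrow> ereal) \<Rightarrow> real \<Rightarrow> (real^'n \<Rightarrow> real) \<Rightarrow>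
   (real^'n \<Rightarrow> ereal) \<Rightarrow> nat \<Rightarrow> real^'n \<Rightarrow> ereal" where
  "scheme sd \<epsilon> k w 0 = sd \<epsilon> w"
| "scheme sd \<epsilon> k w (Suc n) =
     sd \<epsilon> (\<lambda>i. inv gamma (grid_conv \<epsilon> k (\<lambda>j. gamma (scheme sd \<epsilon> k w n j)) i))"

definition initial_grid_set :: "real \<Rightarrow> (real^'n) set \<Rightarrow> (real^'n) set" where
  "initial_grid_set \<epsilon> E0 = {i\<in>grid \<epsilon>. cell \<epsilon> i \<inter> E0 \<noteq> {}}"

definition discrete_flow ::
  "(real \<Rightarrow> (real^'n \<Rightarrow> ereal) \<Rightarrow> real^'n \<Rightarrow> ereal) \<Rightarrow> real \<Rightarrow> (real^'n \<Rightarrow> real) \<Rightarrow>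
   (real^'n \<Rightarrow> ereal) \<Rightarrow> real \<Rightarrow> real^'n \<Rightarrow> ereal" where
  "discrete_flow sd \<epsilon> k w t = scheme sd \<epsilon> k w (nat \<lfloor>t / kernel_h \<epsilon> k\<rfloor>)"


section \<open>Convergence and distance with infinite values\<close>

definition locally_uniform_limit ::
  "('b \<Rightarrow> 'a::topological_space \<Rightarrow> ereal) \<Rightarrow> ('a \<Rightarrow> ereal) \<Rightarrow> 'b filter \<Rightarrow> bool" where
  "locally_uniform_limit f l F \<longleftrightarrow>
     (\<exists>g :: 'a \<Rightarrow> real. l = (\<lambda>x. ereal (g x)) \<and>
        (\<forall>C. compact C \<longrightarrow> (\<forall>e>0. \<forall>\<^sub>F n in F. \<forall>x\<in>C. \<bar>f n x - ereal (g x)\<bar> < ereal e))) \<or>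
     (l = (\<lambda>x. \<infinity>) \<and> (\<forall>C. compact C \<longrightarrow> (\<forall>M::real. \<forall>\<^sub>F n in F. \<forall>x\<in>C. ereal M < f n x))) \<or>
     (l = (\<lambda>x. -\<infinity>) \<and> (\<forall>C. compact C \<longrightarrow> (\<forall>M::real. \<forall>\<^sub>F n in F. \<forall>x\<in>C. f n x < ereal M)))"

text \<open>Unlike \<open>infdist\<close>, this is \<open>\<infinity>\<close> when the set is empty.\<close>

definition edist_set :: "'a::metric_space \<Rightarrow> 'a set \<Rightarrow> ereal" where
  "edist_set x A = (INF y\<in>A. ereal (dist x y))"

text \<open>The Kuratowski lower limit and the Kuratowski upper limit both equal \<open>L\<close>.\<close>

definition kuratowski_tendsto :: "('b \<Rightarrow> 'a::topological_space set) \<Rightarrow> 'a set \<Rightarrow> 'b filter \<Rightarrow> bool" where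
  "kuratowski_tendsto A L F \<longleftrightarrow>
     {x. \<forall>U. open U \<and> x \<in> U \<longrightarrow> (\<forall>\<^sub>F s in F. A s \<inter> U \<noteq> {})} = L \<and>
     {x. \<forall>U. open U \<and> x \<in> U \<longrightarrow> (\<exists>\<^sub>F s in F. A s \<inter> U \<noteq> {})} = L"


section \<open>The distributional inequality\<close>

fun iter_deriv :: "'a::real_normed_vector list \<Rightarrow> ('a \<Rightarrow> real) \<Rightarrow> 'a \<Rightarrow> real" where
  "iter_deriv [] f = f"
| "iter_deriv (v # vs) f = (\<lambda>z. frechet_derivative (iter_deriv vs f) (at z) v)"

text \<open>All iterated directional derivatives exist and are differentiable (hence continuous):
  \<open>f\<close> is of class \<open>C\<^sup>\<infinity>\<close>.\<close>

definition smooth_fun :: "('a::real_normed_vector \<Rightarrow> real) \<Rightarrow> bool" where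
  "smooth_fun f \<longleftrightarrow> (\<forall>vs. iter_deriv vs f differentiable_on UNIV)"

definition test_function :: "'a::real_normed_vector set \<Rightarrow> ('a \<Rightarrow> real) \<Rightarrow> bool" where
  "test_function \<Omega> \<phi> \<longleftrightarrow>
     smooth_fun \<phi> \<and> compact (closure {z. \<phi> z \<noteq> 0}) \<and> closure {z. \<phi> z \<noteq> 0} \<subseteq> \<Omega>"

definition time_deriv :: "((real^'n) \<times> real \<Rightarrow> real) \<Rightarrow> (real^'n) \<times> real \<Rightarrow> real" where
  "time_deriv \<phi> = iter_deriv [(0, 1)] \<phi>"

definition space_laplacian :: "((real^'n) \<times> real \<Rightarrow> real) \<Rightarrow> (real^'n) \<times> real \<Rightarrow> real" where
  "space_laplacian \<phi> z = (\<Sum>k\<in>UNIV. iter_deriv [(axis k 1, 0), (axis k 1, 0)] \<phi> z)"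

text \<open>\<open>\<partial>\<^sub>t u \<ge> \<Delta> u\<close> in the sense of distributions in the open set \<open>\<Omega>\<close>; local
  integrability is what makes \<open>u\<close> a distribution in \<open>\<Omega>\<close>, and it makes the integrals below
  meaningful.\<close>

definition distributional_heat_supersol :: "((real^'n) \<times> real) set \<Rightarrow> ((real^'n) \<times> real \<Rightarrow> real) \<Rightarrow> bool" where
  "distributional_heat_supersol \<Omega> u \<longleftrightarrow>
     (\<forall>C. compact C \<and> C \<subseteq> \<Omega> \<longrightarrow> set_integrable lborel C u) \<and>
     (\<forall>\<phi>. test_function \<Omega> \<phi> \<and> (\<forall>z. 0 \<le> \<phi> z) \<longrightarrow>
        - (\<integral>z. u z * time_deriv \<phi> z \<partial>lborel) \<ge> (\<integral>z. u z * space_laplacian \<phi> z \<partial>lborel))"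


section \<open>Superflows\<close>

definition time_slice :: "('a \<times> real) set \<Rightarrow> real \<Rightarrow> 'a set" where
  "time_slice E t = {x. (x, t) \<in> E}"

definition extinction_time :: "('a \<times> real) set \<Rightarrow> ereal" where
  "extinction_time E = Inf (ereal ` {t. 0 < t \<and> (\<forall>s\<ge>t. time_slice E s = {})})"

text \<open>The third-to-last condition makes \<open>time_slice E t\<close> non-empty for \<open>0 < t < extinction_time E\<close>,
  so \<open>infdist\<close> is the distance to the slice at every point where the last condition looks at it.\<close>

definition superflow :: "(real^'n) set \<Rightarrow> ((real^'n) \<times> real) set \<Rightarrow> bool" where
  "superflow E0 E \<longleftrightarrow>
     closed E \<and> E \<subseteq> UNIV \<times> {0..} \<and>
     time_slice E 0 \<subseteq> E0 \<and>
     (\<forall>t\<ge>0. time_slice E t = {} \<longrightarrow> (\<forall>s>t. time_slice E s = {})) \<and>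
     (\<forall>t>0. kuratowski_tendsto (time_slice E) (time_slice E t) (at_left t)) \<and>
     distributional_heat_supersol
       ({(x, t). 0 < t \<and> ereal t < extinction_time E} - E)
       (\<lambda>(x, t). infdist x (time_slice E t))"

end

theory Submission
  imports Defs "HOL-Library.Diagonal_Subsequence"
begin

text \<open>The positive part \<open>U\<close> of the scheme has three properties. It is \<open>1\<close>-Lipschitz; where the
  convolution of \<open>gamma U\<close> is positive, redistancing only increases it; and, up to an error of order
  \<open>\<epsilon>\<close>, its value is attained as the distance to a zero of \<open>U\<close>. The same holds for the negative
  part, so both are treated at once. Comparison with shrinking paraboloids shows that \<open>U\<close> drops by
  at most a multiple of \<open>sqrt \<tau>\<close> during a time \<open>\<tau>\<close>. This one-sided bound gives compactness, as for
  monotone functions of time: a subsequence converges outside countably many times, to a limit which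
  by the third property is exactly the distance to its zero set. For the heat inequality one uses
  that the fourth condition on the kernels forces their second moments to become isotropic and to
  concentrate near \<open>0\<close>, so that convolution followed by redistancing makes \<open>U\<close> a supersolution
  of the discrete heat equation up to errors small compared with \<open>h\<close>. The rounding errors of order
  \<open>\<epsilon>\<close>, which need not be small compared with \<open>h\<close>, are avoided by working with an inf-convolution
  of a strictly convex function of \<open>U\<close>.\<close>

section \<open>The hyperbolic tangent\<close>

text \<open>Applying \<open>gamma\<close> places all values in a compact interval: an extinct flow
  becomes the constant 1, and one limit argument serves finite and infinite distances. The square
  root in the speed bound is the lifetime of balls: radius R survives for a time of order R^2. In
  the heat inequality the same nonlinearity is the obstacle. At height a the second derivative of
  tanh is of order a, so a step creates an error of order a h, harmless only near the zero set,
  while the inequality is wanted at every distance. It is translated from a minimizer p of U(p) + |p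
  - i|; but for a distance function every point of a segment from i to a nearest zero is a
  minimizer, zeros included. A convex weight whose slope passes through 1 at \<delta> selects those
  with U of order \<delta>. Its price is an error of order \<delta> h in the inequality and
  \<delta>^3 in the values; both vanish when \<delta> tends to 0 after \<epsilon>. For the kernels
  the point is a trace argument: the definition of h fixes the sum of the directional second
  moments, the Fourier limits bound each from below, so none can exceed its share.\<close>

lemma tanh_real_add: "tanh (x + y) = (tanh x + tanh y) / (1 + tanh x * tanh y)" for x y :: real
  by (simp add: tanh_add)

lemma abs_tanh_real_less_1: "\<bar>tanh x\<bar> < 1" for x :: real
  using tanh_real_bounds[of x] by (auto simp: abs_less_iff)

lemma tanh_sq_le_1: "(tanh x)\<^sup>2 \<le> 1" for x :: real
  using abs_tanh_real_less_1[of x] by (simp add: abs_square_le_1)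

lemma tanh_diff_mean_value:
  fixes x y :: real
  assumes "x < y"
  shows "\<exists>z. x < z \<and> z < y \<and> tanh y - tanh x = (y - x) * (1 - (tanh z)\<^sup>2)"
proof (rule MVT2[OF assms])
  fix z show "(tanh has_real_derivative 1 - (tanh z)\<^sup>2) (at z)"
    by (auto intro!: derivative_eq_intros)
qed

lemma tanh_diff_le:
  fixes x y :: real
  assumes "x \<le> y"
  shows "tanh y - tanh x \<le> y - x"
proof (cases "x = y")
  case False
  then obtain z where "tanh y - tanh x = (y - x) * (1 - (tanh z)\<^sup>2)"
    using tanh_diff_mean_value[of x y] assms by auto
  then show ?thesis using assms mult_left_mono[of "1 - (tanh z)\<^sup>2" 1 "y - x"] by auto
qed simp

lemma abs_tanh_diff_le: "\<bar>tanh x - tanh y\<bar> \<le> \<bar>x - y\<bar>" for x y :: real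
  using tanh_diff_le[of x y] tanh_diff_le[of y x] by (cases "x \<le> y") (auto simp: abs_if)

lemma tanh_le_self: "0 \<le> x \<Longrightarrow> tanh x \<le> x" for x :: real
  using tanh_diff_le[of 0 x] by simp

lemma abs_tanh_le: "\<bar>tanh x\<bar> \<le> \<bar>x\<bar>" for x :: real
  using abs_tanh_diff_le[of x 0] by simp

lemma tanh_slope_pos: "0 < 1 - (tanh (1::real))\<^sup>2"
  using abs_tanh_real_less_1[of 1] by (simp add: abs_square_less_1)

text \<open>The slope of tanh decreases on [0, 1], so its value at 1 is the minimum there. The
  constant \<open>1 - (tanh 1)\<^sup>2\<close> converts gaps between heights into gaps between their
  tanh and reappears in all rates below.\<close>

lemma tanh_diff_ge:
  fixes x y :: real
  assumes "0 \<le> x" "x \<le> y" "y \<le> 1"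
  shows "(1 - (tanh 1)\<^sup>2) * (y - x) \<le> tanh y - tanh x"
proof (cases "x = y")
  case False
  then obtain z where z: "x < z" "z < y" "tanh y - tanh x = (y - x) * (1 - (tanh z)\<^sup>2)"
    using tanh_diff_mean_value[of x y] assms by auto
  have "(tanh z)\<^sup>2 \<le> (tanh 1)\<^sup>2" using z assms by (intro power_mono) auto
  then show ?thesis using z assms mult_left_mono[of "1 - (tanh 1)\<^sup>2" "1 - (tanh z)\<^sup>2" "y - x"]
    by (simp add: mult.commute)
qed simp

text \<open>From tanh' = 1 - tanh^2 and tanh z \<le> z. There is no quadratic term because tanh''(0)
  = 0; \<open>tanh_add_ge_fine\<close> rests on this.\<close>

lemma tanh_ge_cubic:
  fixes x :: real
  shows "x - \<bar>x\<bar> * x\<^sup>2 \<le> tanh x"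
proof (cases "0 < x")
  case True
  then obtain z where z: "0 < z" "z < x" "tanh x = x * (1 - (tanh z)\<^sup>2)"
    using tanh_diff_mean_value[of 0 x] by auto
  have "tanh z \<le> x" using tanh_le_self[of z] z by simp
  then have "(tanh z)\<^sup>2 \<le> x\<^sup>2" using z by (intro power_mono) auto
  then have "x * (tanh z)\<^sup>2 \<le> x * x\<^sup>2" using True by (intro mult_left_mono) auto
  then show ?thesis using True z(3) unfolding right_diff_distrib by simp
next
  case False
  have "tanh (-x) \<le> - x" using False by (intro tanh_le_self) auto
  moreover have "0 \<le> \<bar>x\<bar> * x\<^sup>2" by simp
  ultimately show ?thesis unfolding tanh_minus by linarith
qed

lemma tanh_ge_quadratic:
  fixes x :: real
  shows "x - x\<^sup>2 \<le> tanh x"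
proof (cases "\<bar>x\<bar> \<le> 1")
  case True
  then have "\<bar>x\<bar> * x\<^sup>2 \<le> 1 * x\<^sup>2" by (intro mult_right_mono) auto
  then show ?thesis using tanh_ge_cubic[of x] by simp
next
  case False
  show ?thesis
  proof (cases "0 < x")
    case True
    then have "x * 1 \<le> x * x" using False by (intro mult_left_mono) auto
    moreover have "0 \<le> tanh x" using True by simp
    ultimately show ?thesis unfolding power2_eq_square by linarith
  next
    case False
    have "tanh (-x) \<le> - x" using False by (intro tanh_le_self) auto
    moreover have "0 \<le> x\<^sup>2" by simp
    ultimately show ?thesis unfolding tanh_minus by linarith
  qed
qed

text \<open>An exact identity from the addition law instead of a Taylor formula: it is valid for
  every \<open>y\<close>, which is needed because kernels have unbounded support. The last two terms
  are the remainder.\<close>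

lemma tanh_add_expansion:
  fixes a y :: real
  shows "tanh (a + y) = tanh a + (1 - (tanh a)\<^sup>2) * y + (1 - (tanh a)\<^sup>2) * (tanh y - y)
           - (1 - (tanh a)\<^sup>2) * (tanh a * (tanh y)\<^sup>2 / (1 + tanh a * tanh y))"
proof -
  have nz: "1 + tanh a * tanh y \<noteq> 0"
    using abs_tanh_real_less_1[of a] abs_tanh_real_less_1[of y]
      mult_strict_mono[of "\<bar>tanh a\<bar>" 1 "\<bar>tanh y\<bar>" 1]
    by (auto simp: abs_mult[symmetric])
  have "(A + S) / (1 + A * S) = A + (1 - A\<^sup>2) * S - (1 - A\<^sup>2) * (A * S\<^sup>2 / (1 + A * S))"
    if "1 + A * S \<noteq> 0" for A S :: real
    using that by (simp add: field_simps) (simp add: power2_eq_square algebra_simps)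
  from this[OF nz] show ?thesis unfolding tanh_real_add by (simp add: algebra_simps)
qed

text \<open>The coefficient of \<open>y\<^sup>2\<close> is small together with \<open>a\<close> and
  \<open>y\<close>. This is the estimate used near the zero set, where tanh is almost
  linear.\<close>

lemma tanh_add_ge_fine:
  fixes a y :: real
  assumes "0 \<le> a" "a \<le> 1/2"
  shows "tanh a + (1 - (tanh a)\<^sup>2) * y - (2 * a + \<bar>y\<bar>) * y\<^sup>2 \<le> tanh (a + y)"
proof -
  let ?A = "tanh a" and ?S = "tanh y"
  have A: "0 \<le> ?A" "?A \<le> a" using assms tanh_le_self[of a] by auto
  have q: "0 \<le> 1 - ?A\<^sup>2" "1 - ?A\<^sup>2 \<le> 1" using tanh_sq_le_1[of a] by auto
  have S2: "?S\<^sup>2 \<le> y\<^sup>2" using abs_tanh_le[of y] by (simp add: abs_le_square_iff)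
  have "\<bar>?A * ?S\<bar> \<le> 1/2 * 1" unfolding abs_mult using A assms abs_tanh_real_less_1[of y]
    by (intro mult_mono) auto
  then have den: "1/2 \<le> 1 + ?A * ?S" by (auto simp: abs_le_iff)
  have "?A * ?S\<^sup>2 / (1 + ?A * ?S) \<le> ?A * ?S\<^sup>2 / (1/2)"
    using A den by (intro divide_left_mono) auto
  also have "\<dots> \<le> 2 * a * y\<^sup>2" using A S2 assms by (auto intro!: mult_mono)
  finally have 1: "(1 - ?A\<^sup>2) * (?A * ?S\<^sup>2 / (1 + ?A * ?S)) \<le> 2 * a * y\<^sup>2"
    using q mult_mono[of "1 - ?A\<^sup>2" 1 "?A * ?S\<^sup>2 / (1 + ?A * ?S)" "2 * a * y\<^sup>2"] A den by auto
  have 2: "(1 - ?A\<^sup>2) * (y - ?S) \<le> 1 * (\<bar>y\<bar> * y\<^sup>2)"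
  proof (rule order_trans)
    show "(1 - ?A\<^sup>2) * (y - ?S) \<le> (1 - ?A\<^sup>2) * (\<bar>y\<bar> * y\<^sup>2)"
      using q tanh_ge_cubic[of y] by (intro mult_left_mono) auto
    show "(1 - ?A\<^sup>2) * (\<bar>y\<bar> * y\<^sup>2) \<le> 1 * (\<bar>y\<bar> * y\<^sup>2)"
      using q by (intro mult_right_mono) auto
  qed
  from 1 2 show ?thesis unfolding tanh_add_expansion[of a y] by (simp add: algebra_simps)
qed

text \<open>For large \<open>a\<close> the denominator of the remainder may be as small as 1 - tanh
  a; the prefactor 1 - (tanh a)^2 contains the same factor and cancels it, which keeps the constant
  independent of \<open>a\<close>.\<close>

lemma tanh_add_ge_coarse:
  fixes a y :: real
  assumes "0 \<le> a"
  shows "tanh a + (1 - (tanh a)\<^sup>2) * y - 3 * y\<^sup>2 \<le> tanh (a + y)"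
proof -
  let ?A = "tanh a" and ?S = "tanh y"
  have A: "0 \<le> ?A" "?A < 1" using assms tanh_real_lt_1[of a] by auto
  have q: "0 \<le> 1 - ?A\<^sup>2" "1 - ?A\<^sup>2 \<le> 1" using tanh_sq_le_1[of a] by auto
  have S2: "?S\<^sup>2 \<le> y\<^sup>2" using abs_tanh_le[of y] by (simp add: abs_le_square_iff)
  have "\<bar>?A * ?S\<bar> \<le> ?A * 1" unfolding abs_mult using A abs_tanh_real_less_1[of y]
    by (intro mult_mono) auto
  then have den: "1 - ?A \<le> 1 + ?A * ?S" by (auto simp: abs_le_iff)
  have "?A * ?S\<^sup>2 / (1 + ?A * ?S) \<le> ?A * ?S\<^sup>2 / (1 - ?A)"
    using A den by (intro divide_left_mono) auto
  then have "(1 - ?A\<^sup>2) * (?A * ?S\<^sup>2 / (1 + ?A * ?S)) \<le> (1 - ?A\<^sup>2) * (?A * ?S\<^sup>2 / (1 - ?A))"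
    using q by (intro mult_left_mono) auto
  also have "\<dots> = (1 + ?A) * ?A * ?S\<^sup>2"
    using A by (simp add: field_simps power2_eq_square)
  also have "\<dots> \<le> 2 * 1 * y\<^sup>2" using A S2 by (intro mult_mono) auto
  finally have 1: "(1 - ?A\<^sup>2) * (?A * ?S\<^sup>2 / (1 + ?A * ?S)) \<le> 2 * y\<^sup>2" by simp
  have 2: "(1 - ?A\<^sup>2) * (y - ?S) \<le> 1 * y\<^sup>2"
  proof (rule order_trans)
    show "(1 - ?A\<^sup>2) * (y - ?S) \<le> (1 - ?A\<^sup>2) * y\<^sup>2"
      using q tanh_ge_quadratic[of y] by (intro mult_left_mono) auto
    show "(1 - ?A\<^sup>2) * y\<^sup>2 \<le> 1 * y\<^sup>2"
      using q by (intro mult_right_mono) auto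
  qed
  from 1 2 show ?thesis unfolding tanh_add_expansion[of a y] by (simp add: algebra_simps)
qed

section \<open>Extended real values through \<open>gamma\<close>\<close>

lemma gamma_bounds: "-1 \<le> gamma x" "gamma x \<le> 1" "\<bar>gamma x\<bar> \<le> 1"
  using tanh_real_bounds by (cases x; force simp: abs_le_iff less_imp_le)+

lemma gamma_less_iff [simp]: "gamma x < gamma y \<longleftrightarrow> x < y"
  using tanh_real_lt_1 tanh_real_gt_neg1
  by (cases x; cases y) (auto simp: not_less less_imp_le)

lemma gamma_le_iff [simp]: "gamma x \<le> gamma y \<longleftrightarrow> x \<le> y"
  by (simp add: not_less[symmetric])

lemma inj_gamma: "inj gamma"
  by (rule linorder_injI) (metis gamma_less_iff less_irrefl)

lemma gamma_eq_iff [simp]: "gamma x = gamma y \<longleftrightarrow> x = y"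
  using inj_gamma by (auto dest: injD)

lemma inv_gamma_gamma [simp]: "inv gamma (gamma x) = x"
  by (simp add: inv_f_f inj_gamma)

lemma gamma_0 [simp]: "gamma 0 = 0"
  using gamma.simps(1)[of 0] by (simp only: zero_ereal_def tanh_0)

lemma gamma_minus [simp]: "gamma (- x) = - gamma x"
  by (cases x) auto

lemma gamma_pos_iff [simp]: "0 < gamma x \<longleftrightarrow> 0 < x"
  using gamma_less_iff[of 0 x] by (simp del: gamma_less_iff)

lemma gamma_nonneg_iff [simp]: "0 \<le> gamma x \<longleftrightarrow> 0 \<le> x"
  using gamma_le_iff[of 0 x] by (simp del: gamma_le_iff)

lemma gamma_eq_0_iff [simp]: "gamma x = 0 \<longleftrightarrow> x = 0"
  using gamma_eq_iff[of x 0] by (simp del: gamma_eq_iff)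

lemma gamma_eq_1_iff [simp]: "gamma x = 1 \<longleftrightarrow> x = \<infinity>"
  using gamma_eq_iff[of x \<infinity>] by (simp del: gamma_eq_iff)

lemma gamma_surj:
  assumes "\<bar>c\<bar> \<le> 1"
  shows "\<exists>x. gamma x = c"
proof -
  consider "c = 1" | "c = -1" | "\<bar>c\<bar> < 1" using assms by linarith
  then show ?thesis
  proof cases
    case 3
    have "tanh (artanh c) = c"
    proof -
      define z where "z = (1 + c) / (1 - c)"
      have z: "0 < z" using 3 by (auto simp: z_def abs_less_iff)
      have "artanh c = ln z / 2" by (simp add: artanh_def z_def)
      then have "artanh c = ln (sqrt z)" using z by (simp add: ln_sqrt)
      then have "tanh (artanh c) = ((sqrt z)\<^sup>2 - 1) / ((sqrt z)\<^sup>2 + 1)"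
        using z tanh_ln_real[of "sqrt z"] by simp
      also have "\<dots> = (z - 1) / (z + 1)" using z by simp
      also have "\<dots> = c" using 3 by (simp add: z_def field_simps abs_less_iff)
      finally show ?thesis .
    qed
    then show ?thesis by (metis gamma.simps(1))
  qed (metis gamma.simps)+
qed

lemma gamma_inv_gamma: "\<bar>c\<bar> \<le> 1 \<Longrightarrow> gamma (inv gamma c) = c"
  using gamma_surj[of c] by (auto simp: f_inv_into_f)

text \<open>Addition of reals transported to the interval by tanh (the relativistic addition of
  velocities). Lipschitz bounds written with it keep their meaning at infinite values and pass to
  limits by continuity.\<close>

definition tadd :: "real \<Rightarrow> real \<Rightarrow> real" where
  "tadd a b = (a + b) / (1 + a * b)"

lemma gamma_add: "gamma (x + ereal r) = tadd (gamma x) (tanh r)"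
proof (cases x)
  case MInf
  have "1 - tanh r \<noteq> 0" using tanh_real_lt_1[of r] by auto
  then show ?thesis using MInf by (simp add: tadd_def field_simps)
next
  case PInf
  have "1 + tanh r \<noteq> 0" using tanh_real_gt_neg1[of r] by auto
  then show ?thesis using PInf by (simp add: tadd_def)
qed (simp add: tadd_def tanh_real_add)

lemma tadd_0 [simp]: "tadd a 0 = a" "tadd 0 b = b"
  by (simp_all add: tadd_def)

lemma tadd_mono:
  assumes "-1 \<le> a" "a \<le> a'" "a' \<le> 1" "\<bar>b\<bar> < 1"
  shows "tadd a b \<le> tadd a' b"
proof -
  have "0 < 1 + c * b" if "\<bar>c\<bar> \<le> 1" for c
  proof -
    have "\<bar>c * b\<bar> < 1" using that assms mult_right_mono[of "\<bar>c\<bar>" 1 "\<bar>b\<bar>"] by (simp add: abs_mult)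
    then show ?thesis by (auto simp: abs_less_iff)
  qed
  then have p: "0 < 1 + a * b" "0 < 1 + a' * b" using assms by (auto simp: abs_le_iff)
  have "b\<^sup>2 \<le> 1" using assms by (simp add: abs_square_le_1)
  then have "0 \<le> (a' - a) * (1 - b\<^sup>2)" using assms by simp
  then have "(a + b) * (1 + a' * b) \<le> (a' + b) * (1 + a * b)"
    by (simp add: algebra_simps power2_eq_square)
  then show ?thesis using p by (simp add: tadd_def divide_le_eq pos_le_divide_eq mult.commute field_simps)
qed

lemma tadd_le_add:
  assumes "0 \<le> a" "0 \<le> b"
  shows "tadd a b \<le> a + b"
proof -
  have "0 < 1 + a * b" using assms by (simp add: add_pos_nonneg)
  moreover have "(a + b) * 1 \<le> (a + b) * (1 + a * b)" using assms by (intro mult_left_mono) auto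
  ultimately show ?thesis by (simp add: tadd_def divide_le_eq)
qed

text \<open>A finite displacement neither creates nor removes an infinite value. This is how
  extinction is propagated in time.\<close>

lemma tadd_eq_1_iff:
  assumes "0 \<le> a" "a \<le> 1" "0 \<le> b" "b < 1"
  shows "tadd a b = 1 \<longleftrightarrow> a = 1"
proof -
  have "1 + a * b \<noteq> 0" using assms by (smt (verit) mult_nonneg_nonneg)
  then have "tadd a b = 1 \<longleftrightarrow> (1 - a) * (1 - b) = 0"
    by (auto simp: tadd_def field_simps)
  then show ?thesis using assms by auto
qed

lemma tadd_le_1:
  assumes "0 \<le> a" "a \<le> 1" "0 \<le> b" "b \<le> 1"
  shows "tadd a b \<le> 1"
proof -
  have "0 \<le> (1 - a) * (1 - b)" using assms by simp
  then show ?thesis using assms by (auto simp: tadd_def divide_le_eq algebra_simps add_pos_nonneg)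
qed

lemma tadd_tendsto:
  assumes "(f \<longlongrightarrow> a) F" "(g \<longlongrightarrow> b) F" "0 \<le> a" "0 \<le> b"
  shows "((\<lambda>x. tadd (f x) (g x)) \<longlongrightarrow> tadd a b) F"
proof -
  have "1 + a * b \<noteq> 0" using assms by (smt (verit) mult_nonneg_nonneg)
  then show ?thesis unfolding tadd_def by (intro tendsto_intros assms) auto
qed

section \<open>The grid\<close>

lemma grid_0 [simp]: "0 \<in> grid \<epsilon>"
  by (auto simp: grid_def intro!: exI[of _ 0])

lemma grid_uminus_iff [simp]: "- x \<in> grid \<epsilon> \<longleftrightarrow> x \<in> grid \<epsilon>"
proof -
  have "- x \<in> grid \<epsilon>" if "x \<in> grid \<epsilon>" for x :: "real^'n"
    using that unfolding grid_def
    by simp (metis minus_mult_right of_int_minus)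
  from this[of x] this[of "- x"] show ?thesis by auto
qed

lemma grid_add: "x \<in> grid \<epsilon> \<Longrightarrow> y \<in> grid \<epsilon> \<Longrightarrow> x + y \<in> grid \<epsilon>"
  unfolding grid_def by simp (metis distrib_left of_int_add)

lemma grid_diff: "x \<in> grid \<epsilon> \<Longrightarrow> y \<in> grid \<epsilon> \<Longrightarrow> x - y \<in> grid \<epsilon>"
  using grid_add[of x \<epsilon> "- y"] by simp

definition grid_floor :: "real \<Rightarrow> real^'n \<Rightarrow> real^'n" where
  "grid_floor \<epsilon> x = (\<chi> k. \<epsilon> * of_int \<lfloor>x $ k / \<epsilon>\<rfloor>)"

lemma grid_floor_in_grid [simp]: "grid_floor \<epsilon> x \<in> grid \<epsilon>"
  by (auto simp: grid_floor_def grid_def)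

lemma grid_floor_diff:
  assumes "0 < \<epsilon>" "j \<in> grid \<epsilon>"
  shows "grid_floor \<epsilon> (x - j) = grid_floor \<epsilon> x - j"
proof -
  have "\<epsilon> * of_int \<lfloor>(x - j) $ k / \<epsilon>\<rfloor> = \<epsilon> * of_int \<lfloor>x $ k / \<epsilon>\<rfloor> - j $ k" for k
  proof -
    obtain m :: int where m: "j $ k = \<epsilon> * of_int m" using assms(2) unfolding grid_def by blast
    have "(x - j) $ k / \<epsilon> = x $ k / \<epsilon> - of_int m" using m assms(1) by (simp add: field_simps)
    then have "\<lfloor>(x - j) $ k / \<epsilon>\<rfloor> = \<lfloor>x $ k / \<epsilon>\<rfloor> - m" by simp
    then show ?thesis using m by (simp only: of_int_diff right_diff_distrib)
  qed
  then show ?thesis by (simp add: vec_eq_iff grid_floor_def)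
qed

lemma grid_floor_id: "0 < \<epsilon> \<Longrightarrow> j \<in> grid \<epsilon> \<Longrightarrow> grid_floor \<epsilon> j = j"
proof -
  assume a: "0 < \<epsilon>" "j \<in> grid \<epsilon>"
  have "grid_floor \<epsilon> 0 = (0::real^'n)" by (simp add: grid_floor_def vec_eq_iff)
  then show ?thesis using grid_floor_diff[OF a, of j] by (metis diff_self right_minus_eq)
qed

lemma mem_cell_iff:
  assumes "0 < \<epsilon>" "i \<in> grid \<epsilon>"
  shows "x \<in> cell \<epsilon> i \<longleftrightarrow> i = grid_floor \<epsilon> x"
proof -
  have "i $ k \<le> x $ k \<and> x $ k < i $ k + \<epsilon> \<longleftrightarrow> i $ k = \<epsilon> * of_int \<lfloor>x $ k / \<epsilon>\<rfloor>" for k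
  proof -
    obtain m :: int where m: "i $ k = \<epsilon> * of_int m" using assms(2) unfolding grid_def by blast
    have "i $ k \<le> x $ k \<and> x $ k < i $ k + \<epsilon> \<longleftrightarrow> of_int m \<le> x $ k / \<epsilon> \<and> x $ k / \<epsilon> < of_int m + 1"
      using m assms(1) by (simp add: field_simps)
    also have "\<dots> \<longleftrightarrow> \<lfloor>x $ k / \<epsilon>\<rfloor> = m" by (simp add: floor_eq_iff)
    also have "\<dots> \<longleftrightarrow> i $ k = \<epsilon> * of_int \<lfloor>x $ k / \<epsilon>\<rfloor>" using m assms(1) by auto
    finally show ?thesis .
  qed
  then show ?thesis by (simp add: cell_def grid_floor_def vec_eq_iff)
qed

lemma mem_cell_grid_floor: "0 < \<epsilon> \<Longrightarrow> x \<in> cell \<epsilon> (grid_floor \<epsilon> x)"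
  by (simp add: mem_cell_iff)

lemma norm_le_card_mult:
  fixes x :: "real^'n"
  assumes "\<And>k. \<bar>x $ k\<bar> \<le> c"
  shows "norm x \<le> real CARD('n) * c"
  using norm_le_l1_cart[of x] sum_bounded_above[of UNIV "\<lambda>k. \<bar>x $ k\<bar>" c] assms by fastforce

lemma norm_cell_diff:
  fixes x y :: "real^'n"
  assumes "x \<in> cell \<epsilon> i" "y \<in> cell \<epsilon> i"
  shows "norm (x - y) \<le> real CARD('n) * \<epsilon>"
proof (rule norm_le_card_mult)
  fix k show "\<bar>(x - y) $ k\<bar> \<le> \<epsilon>"
    using assms unfolding cell_def by (simp add: abs_le_iff) (smt (verit))
qed

lemma norm_grid_floor:
  fixes x :: "real^'n"
  assumes "0 < \<epsilon>"
  shows "norm (x - grid_floor \<epsilon> x) \<le> real CARD('n) * \<epsilon>"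
  using norm_cell_diff[OF mem_cell_grid_floor[OF assms, of x], of "grid_floor \<epsilon> x"] assms
  by (simp add: mem_cell_iff grid_floor_id)

lemma finite_grid_cball: "0 < \<epsilon> \<Longrightarrow> finite {j\<in>grid \<epsilon>. norm (j :: real^'n) \<le> r}"
proof -
  assume e: "0 < \<epsilon>"
  have "{j\<in>grid \<epsilon>. norm (j :: real^'n) \<le> r} \<subseteq>
      vec_lambda ` (PiE UNIV (\<lambda>_. (\<lambda>m. \<epsilon> * of_int m) ` {-\<lceil>r/\<epsilon>\<rceil>..\<lceil>r/\<epsilon>\<rceil>}))"
  proof
    fix j :: "real^'n" assume j: "j \<in> {j\<in>grid \<epsilon>. norm j \<le> r}"
    have "j $ k \<in> (\<lambda>m. \<epsilon> * of_int m) ` {-\<lceil>r/\<epsilon>\<rceil>..\<lceil>r/\<epsilon>\<rceil>}" for k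
    proof -
      obtain m :: int where m: "j $ k = \<epsilon> * of_int m" using j unfolding grid_def by blast
      have "\<bar>j $ k\<bar> \<le> r" using j component_le_norm_cart[of j k] by auto
      then have "\<bar>real_of_int m\<bar> \<le> r / \<epsilon>" using e m by (simp add: abs_mult field_simps)
      then have "m \<le> \<lceil>r/\<epsilon>\<rceil>" "- m \<le> \<lceil>r/\<epsilon>\<rceil>" by linarith+
      then show ?thesis using m by auto
    qed
    then have "vec_nth j \<in> PiE UNIV (\<lambda>_. (\<lambda>m. \<epsilon> * of_int m) ` {-\<lceil>r/\<epsilon>\<rceil>..\<lceil>r/\<epsilon>\<rceil>})" by auto
    then show "j \<in> vec_lambda ` (PiE UNIV (\<lambda>_. (\<lambda>m. \<epsilon> * of_int m) ` {-\<lceil>r/\<epsilon>\<rceil>..\<lceil>r/\<epsilon>\<rceil>}))"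
      by (metis image_eqI vec_nth_inverse)
  qed
  moreover have "finite (vec_lambda ` (PiE (UNIV :: 'n set) (\<lambda>_. (\<lambda>m. \<epsilon> * of_int m) ` {-\<lceil>r/\<epsilon>\<rceil>..\<lceil>r/\<epsilon>\<rceil>})))"
    by (intro finite_imageI finite_PiE) auto
  ultimately show ?thesis by (rule finite_subset)
qed

text \<open>The cells partition the space, so a single summand survives and no sum of infinite
  values arises.\<close>

lemma grid_extension_eq:
  assumes "0 < \<epsilon>"
  shows "grid_extension \<epsilon> u x = u (grid_floor \<epsilon> x)"
proof -
  have "grid_extension \<epsilon> u x = (\<Sum>\<^sub>\<infinity>i\<in>{grid_floor \<epsilon> x}. u i * indicator (cell \<epsilon> i) x)"
    unfolding grid_extension_def
    by (rule infsum_cong_neutral) (use assms in \<open>auto simp: mem_cell_iff indicator_def\<close>)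
  also have "\<dots> = u (grid_floor \<epsilon> x)"
    using assms by (simp add: infsum_finite mem_cell_grid_floor)
  finally show ?thesis .
qed

text \<open>The point at distance \<open>r\<close> from \<open>i\<close> on the segment is rounded
  to the grid. It replaces points of geodesics below, at the cost of one cell diameter towards each
  end.\<close>

lemma grid_point_on_segment:
  fixes i j :: "real^'n"
  assumes "0 < \<epsilon>" "0 \<le> r" "r \<le> norm (j - i)"
  obtains p where "p \<in> grid \<epsilon>" "\<bar>norm (p - i) - r\<bar> \<le> real CARD('n) * \<epsilon>"
    "norm (j - p) \<le> norm (j - i) - r + real CARD('n) * \<epsilon>"
proof -
  define x where "x = (if j = i then i else i + (r / norm (j - i)) *\<^sub>R (j - i))"
  have x: "norm (x - i) = r" "norm (j - x) = norm (j - i) - r"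
  proof -
    show "norm (x - i) = r" using assms by (auto simp: x_def)
    have "j - x = (1 - r / norm (j - i)) *\<^sub>R (j - i)" if "j \<noteq> i"
      using that by (simp add: x_def algebra_simps)
    moreover have "r / norm (j - i) \<le> 1" if "j \<noteq> i" using assms that by (simp add: divide_le_eq)
    ultimately show "norm (j - x) = norm (j - i) - r"
      using assms by (cases "j = i") (auto simp: x_def left_diff_distrib)
  qed
  let ?p = "grid_floor \<epsilon> x"
  have d: "norm (x - ?p) \<le> real CARD('n) * \<epsilon>" by (rule norm_grid_floor[OF assms(1)])
  show thesis
  proof
    show "\<bar>norm (?p - i) - r\<bar> \<le> real CARD('n) * \<epsilon>"
      using d x norm_triangle_ineq3[of "?p - i" "x - i"] by (simp add: norm_minus_commute)
    show "norm (j - ?p) \<le> norm (j - i) - r + real CARD('n) * \<epsilon>"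
      using d x norm_triangle_ineq[of "j - x" "x - ?p"] by simp
  qed simp
qed

section \<open>Redistancing\<close>

lemma grid_1_lipschitzD:
  "grid_1_lipschitz \<epsilon> u \<Longrightarrow> i \<in> grid \<epsilon> \<Longrightarrow> j \<in> grid \<epsilon> \<Longrightarrow> u i \<le> u j + ereal (norm (i - j))"
  by (auto simp: grid_1_lipschitz_def)

lemma grid_1_lipschitz_uminus:
  assumes "grid_1_lipschitz \<epsilon> u"
  shows "grid_1_lipschitz \<epsilon> (\<lambda>i. - u i)"
  unfolding grid_1_lipschitz_def
proof (intro ballI)
  fix i j :: "real^'a" assume ij: "i \<in> grid \<epsilon>" "j \<in> grid \<epsilon>"
  show "- u i \<le> - u j + ereal (norm (i - j))"
    using grid_1_lipschitzD[OF assms ij(2,1)]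
    by (cases "u i"; cases "u j") (auto simp: norm_minus_commute)
qed

lemma SUP_cone_lipschitz:
  fixes f :: "'a::real_normed_vector \<Rightarrow> ereal"
  shows "(SUP j\<in>A. f j - ereal (norm (j - i))) \<le> (SUP j\<in>A. f j - ereal (norm (j - i'))) + ereal (norm (i - i'))"
proof (rule SUP_least)
  fix j assume j: "j \<in> A"
  have "norm (j - i') \<le> norm (j - i) + norm (i - i')"
    using norm_triangle_ineq[of "j - i" "i - i'"] by simp
  then have "f j - ereal (norm (j - i)) \<le> (f j - ereal (norm (j - i'))) + ereal (norm (i - i'))"
    by (cases "f j") auto
  also have "\<dots> \<le> (SUP j\<in>A. f j - ereal (norm (j - i'))) + ereal (norm (i - i'))"
    using j by (intro add_right_mono SUP_upper)
  finally show "f j - ereal (norm (j - i)) \<le> (SUP j\<in>A. f j - ereal (norm (j - i'))) + ereal (norm (i - i'))" .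
qed

lemma ereal_SUP_uminus_cone:
  "- (SUP j\<in>A. f j - ereal (r j)) = (INF j\<in>A. - f j + ereal (r j))" for f :: "'a \<Rightarrow> ereal"
proof -
  have "f j - ereal (r j) = - (- f j + ereal (r j))" for j by (cases "f j") auto
  then show ?thesis by (simp add: ereal_SUP_uminus_eq)
qed

text \<open>Negation exchanges suprema with infima and the two sign conditions, so facts about
  \<open>sd_minus\<close> at positive values are facts about \<open>sd_plus\<close> at negative
  ones.\<close>

lemma d_minus_uminus: "d_minus \<epsilon> (\<lambda>i. - v i) i = - d_plus \<epsilon> v i"
proof -
  have "- d_minus \<epsilon> (\<lambda>i. - v i) i = d_plus \<epsilon> v i"
    unfolding d_minus_def d_plus_def ereal_SUP_uminus_cone by simp
  then show ?thesis by (metis ereal_uminus_uminus)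
qed

lemma sd_minus_uminus: "sd_minus \<epsilon> (\<lambda>i. - v i) i = - sd_plus \<epsilon> v i"
  unfolding sd_plus_def sd_minus_def ereal_SUP_uminus_cone by (simp add: d_minus_uminus)

lemma sd_plus_uminus: "sd_plus \<epsilon> (\<lambda>i. - v i) i = - sd_minus \<epsilon> v i"
  using sd_minus_uminus[of \<epsilon> "\<lambda>i. - v i" i] by simp

lemma sd_plus_lipschitz: "grid_1_lipschitz \<epsilon> (sd_plus \<epsilon> v)"
  unfolding grid_1_lipschitz_def sd_plus_def by (intro ballI SUP_cone_lipschitz)

lemma sd_minus_lipschitz: "grid_1_lipschitz \<epsilon> (sd_minus \<epsilon> v)"
  using grid_1_lipschitz_uminus[OF sd_plus_lipschitz[of \<epsilon> "\<lambda>i. - v i"]]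
  by (simp add: sd_plus_uminus)

text \<open>The Lipschitz bound makes \<open>v i\<close> a lower bound of every term in
  \<open>d_plus\<close>, and \<open>i\<close> itself is admissible in the supremum.\<close>

lemma sd_plus_ge:
  assumes "grid_1_lipschitz \<epsilon> v" "i \<in> grid \<epsilon>" "0 \<le> v i"
  shows "v i \<le> sd_plus \<epsilon> v i"
proof -
  have "v i \<le> d_plus \<epsilon> v i"
    unfolding d_plus_def
    using grid_1_lipschitzD[OF assms(1,2)] by (auto intro!: INF_greatest simp: norm_minus_commute)
  also have "d_plus \<epsilon> v i = d_plus \<epsilon> v i - ereal (norm (i - i))"
    by (simp flip: zero_ereal_def)
  also have "\<dots> \<le> sd_plus \<epsilon> v i"
    unfolding sd_plus_def using assms by (intro SUP_upper) auto
  finally show ?thesis .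
qed

text \<open>The point \<open>i\<close> competes in each infimum
  \<open>d_plus \<epsilon> v j\<close>, and the cone in \<open>sd_plus\<close> subtracts exactly the
  distance that this competitor added.\<close>

lemma sd_plus_le:
  assumes "i \<in> grid \<epsilon>" "v i < 0"
  shows "sd_plus \<epsilon> v i \<le> v i"
  unfolding sd_plus_def
proof (rule SUP_least)
  fix j assume "j \<in> {j \<in> grid \<epsilon>. 0 \<le> v j}"
  have "d_plus \<epsilon> v j \<le> v i + ereal (norm (i - j))"
    unfolding d_plus_def using assms by (intro INF_lower) auto
  then show "d_plus \<epsilon> v j - ereal (norm (j - i)) \<le> v i"
    by (cases "d_plus \<epsilon> v j"; cases "v i") (auto simp: norm_minus_commute)
qed

lemma sd_minus_ge:
  assumes "i \<in> grid \<epsilon>" "0 < v i"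
  shows "v i \<le> sd_minus \<epsilon> v i"
proof -
  have "sd_plus \<epsilon> (\<lambda>i. - v i) i \<le> - v i" using assms by (intro sd_plus_le) (auto simp: ereal_uminus_less_reorder)
  then show ?thesis by (simp add: sd_plus_uminus)
qed

lemma sd_minus_le:
  assumes "grid_1_lipschitz \<epsilon> v" "i \<in> grid \<epsilon>" "v i \<le> 0"
  shows "sd_minus \<epsilon> v i \<le> v i"
proof -
  have "- v i \<le> sd_plus \<epsilon> (\<lambda>i. - v i) i"
    using assms by (intro sd_plus_ge grid_1_lipschitz_uminus) auto
  then show ?thesis by (simp add: sd_plus_uminus)
qed

text \<open>An almost optimal \<open>j\<close> in \<open>d_plus\<close> has \<open>v j < 0\<close>
  and \<open>v j + norm (j - i)\<close> close to the value \<open>s\<close>. If \<open>j\<close>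
  lies much further than \<open>s\<close>, then \<open>v j\<close> is very negative, and by the
  Lipschitz bound \<open>v\<close> stays negative when one walks from \<open>j\<close> towards
  \<open>i\<close> down to distance about \<open>s\<close>.\<close>

lemma sd_plus_close_zero:
  fixes v :: "real^'n \<Rightarrow> ereal"
  assumes eps: "0 < \<epsilon>" and lip: "grid_1_lipschitz \<epsilon> v" and i: "i \<in> grid \<epsilon>" and fin: "sd_plus \<epsilon> v i < \<infinity>"
  shows "\<exists>j\<in>grid \<epsilon>. sd_plus \<epsilon> v j \<le> 0 \<and>
    ereal (norm (i - j)) \<le> max (sd_plus \<epsilon> v i) 0 + ereal (4 * real CARD('n) * \<epsilon>)"
proof (cases "sd_plus \<epsilon> v i \<le> 0")
  case True
  then show ?thesis using i eps by (intro bexI[of _ i]) (auto simp: max_def)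
next
  case False
  then obtain s where s: "sd_plus \<epsilon> v i = ereal s" "0 < s" using fin by (cases "sd_plus \<epsilon> v i") auto
  let ?\<kappa> = "real CARD('n)"
  have \<kappa>: "1 \<le> ?\<kappa>" by (simp add: Suc_leI)
  have vi: "0 \<le> v i" using sd_plus_le[OF i, of v] False by (meson dual_order.trans not_le less_imp_le)
  have "d_plus \<epsilon> v i - ereal (norm (i - i)) \<le> sd_plus \<epsilon> v i"
    unfolding sd_plus_def using i vi by (intro SUP_upper) auto
  then have "d_plus \<epsilon> v i < ereal (s + \<epsilon>)" using s eps by (cases "d_plus \<epsilon> v i") auto
  then obtain j where j: "j \<in> grid \<epsilon>" "v j < 0" "v j + ereal (norm (j - i)) < ereal (s + \<epsilon>)"
    unfolding d_plus_def INF_less_iff by auto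
  have "v i \<le> v j + ereal (norm (i - j))" using lip i j by (intro grid_1_lipschitzD)
  then obtain a where a: "v j = ereal a" "a < 0" using vi j by (cases "v j") auto
  have aj: "a + norm (j - i) < s + \<epsilon>" using j a by simp
  \<comment> \<open>The summand \<open>\<epsilon>\<close> is the tolerance in the infimum; the other
    one absorbs the rounding of the point \<open>p\<close> chosen on the segment.\<close>
  define \<rho> where "\<rho> = s + (1 + ?\<kappa>) * \<epsilon>"
  have bound: "\<rho> + ?\<kappa> * \<epsilon> \<le> s + 4 * ?\<kappa> * \<epsilon>"
  proof -
    have "1 * \<epsilon> \<le> ?\<kappa> * \<epsilon>" using \<kappa> eps by (intro mult_right_mono) auto
    moreover have "\<rho> + ?\<kappa> * \<epsilon> = s + \<epsilon> + 2 * (?\<kappa> * \<epsilon>)" "4 * ?\<kappa> * \<epsilon> = 4 * (?\<kappa> * \<epsilon>)"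
      by (simp_all add: \<rho>_def algebra_simps)
    ultimately show ?thesis using eps by linarith
  qed
  have "\<exists>p\<in>grid \<epsilon>. v p < 0 \<and> norm (i - p) \<le> \<rho> + ?\<kappa> * \<epsilon>"
  proof (cases "norm (j - i) \<le> \<rho>")
    case True
    then show ?thesis using j eps by (intro bexI[of _ j]) (auto simp: norm_minus_commute intro: add_increasing2)
  next
    case False
    then obtain p where p: "p \<in> grid \<epsilon>" "\<bar>norm (p - i) - \<rho>\<bar> \<le> ?\<kappa> * \<epsilon>"
      "norm (j - p) \<le> norm (j - i) - \<rho> + ?\<kappa> * \<epsilon>"
      using grid_point_on_segment[OF eps, of \<rho> j i] s eps by (auto simp: \<rho>_def)
    have "v p \<le> v j + ereal (norm (p - j))" using lip p j by (intro grid_1_lipschitzD)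
    also have "\<dots> = ereal (a + norm (j - p))" by (simp add: a norm_minus_commute)
    also have "a + norm (j - p) < 0" using p aj by (simp add: \<rho>_def algebra_simps)
    finally show ?thesis using p by (intro bexI[of _ p]) (auto simp: norm_minus_commute zero_ereal_def)
  qed
  then obtain p where p: "p \<in> grid \<epsilon>" "v p < 0" "norm (i - p) \<le> \<rho> + ?\<kappa> * \<epsilon>" by blast
  have "sd_plus \<epsilon> v p \<le> 0" using sd_plus_le[OF p(1), of v] p(2) by (meson order_trans less_imp_le)
  moreover have "norm (i - p) \<le> s + 4 * ?\<kappa> * \<epsilon>" using p(3) bound by (rule order_trans)
  ultimately show ?thesis using p s by (intro bexI[of _ p]) (auto simp: max_def)
qed

text \<open>Here the infimum runs over cones whose heights \<open>d_minus \<epsilon> v j\<close> may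
  be negative. If the optimal vertex is far away, its height is very negative, and this limits how
  large \<open>v\<close> can be along the segment towards \<open>i\<close>.\<close>

lemma sd_minus_close_zero:
  fixes v :: "real^'n \<Rightarrow> ereal"
  assumes eps: "0 < \<epsilon>" and lip: "grid_1_lipschitz \<epsilon> v" and i: "i \<in> grid \<epsilon>" and fin: "sd_minus \<epsilon> v i < \<infinity>"
  shows "\<exists>j\<in>grid \<epsilon>. sd_minus \<epsilon> v j \<le> 0 \<and>
    ereal (norm (i - j)) \<le> max (sd_minus \<epsilon> v i) 0 + ereal (4 * real CARD('n) * \<epsilon>)"
proof (cases "sd_minus \<epsilon> v i \<le> 0")
  case True
  then show ?thesis using i eps by (intro bexI[of _ i]) (auto simp: max_def)
next
  case False
  then obtain s where s: "sd_minus \<epsilon> v i = ereal s" "0 < s" using fin by (cases "sd_minus \<epsilon> v i") auto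
  let ?\<kappa> = "real CARD('n)"
  have \<kappa>: "1 \<le> ?\<kappa>" by (simp add: Suc_leI)
  have "sd_minus \<epsilon> v i < ereal (s + \<epsilon>)" using s eps by simp
  then obtain j where j: "j \<in> grid \<epsilon>" "v j \<le> 0" "d_minus \<epsilon> v j + ereal (norm (j - i)) < ereal (s + \<epsilon>)"
    unfolding sd_minus_def INF_less_iff by auto
  define \<rho> where "\<rho> = s + (1 + ?\<kappa>) * \<epsilon>"
  have bound: "\<rho> + ?\<kappa> * \<epsilon> \<le> s + 4 * ?\<kappa> * \<epsilon>"
  proof -
    have "1 * \<epsilon> \<le> ?\<kappa> * \<epsilon>" using \<kappa> eps by (intro mult_right_mono) auto
    moreover have "\<rho> + ?\<kappa> * \<epsilon> = s + \<epsilon> + 2 * (?\<kappa> * \<epsilon>)" "4 * ?\<kappa> * \<epsilon> = 4 * (?\<kappa> * \<epsilon>)"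
      by (simp_all add: \<rho>_def algebra_simps)
    ultimately show ?thesis using eps by linarith
  qed
  have "\<exists>p\<in>grid \<epsilon>. v p \<le> 0 \<and> norm (i - p) \<le> \<rho> + ?\<kappa> * \<epsilon>"
  proof (cases "norm (j - i) \<le> \<rho>")
    case True
    then show ?thesis using j eps by (intro bexI[of _ j]) (auto simp: norm_minus_commute intro: add_increasing2)
  next
    case False
    then obtain p where p: "p \<in> grid \<epsilon>" "\<bar>norm (p - i) - \<rho>\<bar> \<le> ?\<kappa> * \<epsilon>"
      "norm (j - p) \<le> norm (j - i) - \<rho> + ?\<kappa> * \<epsilon>"
      using grid_point_on_segment[OF eps, of \<rho> j i] s eps by (auto simp: \<rho>_def)
    \<comment> \<open>Otherwise \<open>p\<close> would compete in the supremum
      \<open>d_minus \<epsilon> v j\<close> and lift the vertex at \<open>j\<close> above the height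
      that its distance from \<open>i\<close> allows.\<close>
    have "v p \<le> 0"
    proof (rule ccontr)
      assume "\<not> v p \<le> 0"
      then have vp: "0 < v p" by simp
      have "v p - ereal (norm (p - j)) \<le> d_minus \<epsilon> v j"
        unfolding d_minus_def using p vp by (intro SUP_upper) auto
      then have "v p - ereal (norm (p - j)) + ereal (norm (j - i)) < ereal (s + \<epsilon>)"
        using j(3) by (meson add_right_mono le_less_trans)
      moreover have "v p \<noteq> \<infinity>" using calculation by auto
      ultimately obtain b where b: "v p = ereal b" "0 < b" "b - norm (p - j) + norm (j - i) < s + \<epsilon>"
        using vp by (cases "v p") auto
      then show False using p by (simp add: \<rho>_def algebra_simps norm_minus_commute)
    qed
    then show ?thesis using p by (intro bexI[of _ p]) (auto simp: norm_minus_commute)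
  qed
  then obtain p where p: "p \<in> grid \<epsilon>" "v p \<le> 0" "norm (i - p) \<le> \<rho> + ?\<kappa> * \<epsilon>" by blast
  have "sd_minus \<epsilon> v p \<le> 0" using sd_minus_le[OF lip p(1,2)] p(2) by simp
  moreover have "norm (i - p) \<le> s + 4 * ?\<kappa> * \<epsilon>" using p(3) bound by (rule order_trans)
  ultimately show ?thesis using p s by (intro bexI[of _ p]) (auto simp: max_def)
qed

section \<open>Averages with respect to a kernel\<close>

locale grid_kernel =
  fixes \<epsilon> :: real and K :: "real^'n \<Rightarrow> real"
  assumes eps_pos: "0 < \<epsilon>"
    and K_sym: "\<And>j. j \<in> grid \<epsilon> \<Longrightarrow> K (- j) = K j"
    and K_nonneg: "\<And>j. j \<in> grid \<epsilon> \<Longrightarrow> 0 \<le> K j"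
    and K_mass: "(K has_sum 1) (grid \<epsilon>)"
    and K_moment: "(\<lambda>j. (norm j)\<^sup>2 * K j) summable_on grid \<epsilon>"
    and h_ge_eps_sq: "\<epsilon>\<^sup>2 \<le> kernel_h \<epsilon> K"
begin

abbreviation h :: real where "h \<equiv> kernel_h \<epsilon> K"

lemma h_pos: "0 < h"
  using h_ge_eps_sq eps_pos by (smt (verit) zero_less_power)

lemma kappa_ge_1: "1 \<le> real CARD('n)"
  by (simp add: Suc_leI)

lemma K_second_moment: "(\<Sum>\<^sub>\<infinity>j\<in>grid \<epsilon>. K j * (norm j)\<^sup>2) = 2 * real CARD('n) * h"
  using kappa_ge_1 by (simp add: kernel_h_def mult.commute)

lemma K_summable_growth:
  assumes "\<And>j. j \<in> grid \<epsilon> \<Longrightarrow> \<bar>f j\<bar> \<le> a + b * (norm j)\<^sup>2"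
  shows "(\<lambda>j. K j * f j) summable_on grid \<epsilon>"
proof -
  have "(\<lambda>j. a * K j + b * ((norm j)\<^sup>2 * K j)) summable_on grid \<epsilon>"
    using K_mass K_moment by (intro summable_on_add summable_on_cmult_right) (auto simp: summable_on_def)
  moreover have "norm (K j * f j) \<le> a * K j + b * ((norm j)\<^sup>2 * K j)" if "j \<in> grid \<epsilon>" for j
    using mult_left_mono[OF assms[OF that] K_nonneg[OF that]] K_nonneg[OF that]
    by (simp add: abs_mult algebra_simps)
  ultimately have "(\<lambda>j. norm (K j * f j)) summable_on grid \<epsilon>"
    by (rule summable_on_comparison_test) auto
  then show ?thesis by (rule abs_summable_summable)
qed

lemma K_summable_bounded:
  assumes "\<And>j. j \<in> grid \<epsilon> \<Longrightarrow> \<bar>f j\<bar> \<le> a"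
  shows "(\<lambda>j. K j * f j) summable_on grid \<epsilon>"
  using assms by (intro K_summable_growth[of f a 0]) auto

lemma norm_le_1_add_sq: "norm x \<le> 1 + (norm x)\<^sup>2"
  using zero_le_power2[of "norm x - 1"] by (simp add: power2_eq_square algebra_simps) (smt (verit) norm_ge_zero)

lemma abs_inner_le_growth: "\<bar>w \<bullet> j\<bar> \<le> norm w + norm w * (norm j)\<^sup>2"
proof -
  have "\<bar>w \<bullet> j\<bar> \<le> norm w * norm j" by (rule Cauchy_Schwarz_ineq2)
  also have "\<dots> \<le> norm w * (1 + (norm j)\<^sup>2)" by (intro mult_left_mono norm_le_1_add_sq) auto
  finally show ?thesis by (simp add: algebra_simps)
qed

lemma K_first_moment: "((\<lambda>j. K j * (w \<bullet> j)) has_sum 0) (grid \<epsilon>)"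
proof -
  have s: "(\<lambda>j. K j * (w \<bullet> j)) summable_on grid \<epsilon>"
    by (rule K_summable_growth[OF abs_inner_le_growth])
  have "(\<Sum>\<^sub>\<infinity>j\<in>grid \<epsilon>. K j * (w \<bullet> j)) = (\<Sum>\<^sub>\<infinity>j\<in>uminus ` grid \<epsilon>. K j * (w \<bullet> j))"
    by (rule arg_cong[where f = "infsum _"]) (auto intro!: image_eqI[where x = "- _"])
  also have "\<dots> = (\<Sum>\<^sub>\<infinity>j\<in>grid \<epsilon>. K (- j) * (w \<bullet> (- j)))"
    by (subst infsum_reindex) (auto simp: o_def inj_on_def)
  also have "\<dots> = (\<Sum>\<^sub>\<infinity>j\<in>grid \<epsilon>. - (K j * (w \<bullet> j)))"
    by (intro infsum_cong) (auto simp: K_sym)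
  also have "\<dots> = - (\<Sum>\<^sub>\<infinity>j\<in>grid \<epsilon>. K j * (w \<bullet> j))" by (rule infsum_uminus)
  finally show ?thesis using s by (simp add: has_sum_infsum[OF s, simplified] has_sum_iff)
qed

text \<open>Symmetry of the kernel kills the linear term, and the quadratic one costs its
  coefficient times the second moment. Convolutions are bounded from below by finding such a
  paraboloid under the data; \<open>w\<close> is at the user's disposal.\<close>

lemma K_average_ge:
  fixes f :: "real^'n \<Rightarrow> real"
  assumes bdd: "\<And>j. j \<in> grid \<epsilon> \<Longrightarrow> \<bar>f j\<bar> \<le> B"
    and ge: "\<And>j. j \<in> grid \<epsilon> \<Longrightarrow> A + w \<bullet> j - q * (norm j)\<^sup>2 \<le> f j"
  shows "A - 2 * real CARD('n) * h * q \<le> (\<Sum>\<^sub>\<infinity>j\<in>grid \<epsilon>. K j * f j)"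
proof -
  have "((\<lambda>j. K j * (norm j)\<^sup>2) has_sum (2 * real CARD('n) * h)) (grid \<epsilon>)"
    using K_moment K_second_moment by (simp add: has_sum_iff mult.commute)
  then have "((\<lambda>j. A * K j + K j * (w \<bullet> j) + (- q) * (K j * (norm j)\<^sup>2)) has_sum (A * 1 + 0 + (- q) * (2 * real CARD('n) * h))) (grid \<epsilon>)"
    using K_mass by (intro has_sum_add has_sum_cmult_right K_first_moment)
  moreover have "((\<lambda>j. K j * f j) has_sum (\<Sum>\<^sub>\<infinity>j\<in>grid \<epsilon>. K j * f j)) (grid \<epsilon>)"
    using K_summable_bounded[OF bdd] by (rule has_sum_infsum)
  ultimately have "A * 1 + 0 + (- q) * (2 * real CARD('n) * h) \<le> (\<Sum>\<^sub>\<infinity>j\<in>grid \<epsilon>. K j * f j)"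
  proof (rule has_sum_mono)
    fix j :: "real^'n" assume j: "j \<in> grid \<epsilon>"
    show "A * K j + K j * (w \<bullet> j) + (- q) * (K j * (norm j)\<^sup>2) \<le> K j * f j"
      using mult_left_mono[OF ge[OF j] K_nonneg[OF j]] by (simp add: algebra_simps)
  qed
  then show ?thesis by (simp add: algebra_simps)
qed

lemma K_average_le_1:
  fixes f :: "real^'n \<Rightarrow> real"
  assumes "\<And>j. j \<in> grid \<epsilon> \<Longrightarrow> \<bar>f j\<bar> \<le> 1"
  shows "\<bar>\<Sum>\<^sub>\<infinity>j\<in>grid \<epsilon>. K j * f j\<bar> \<le> 1"
proof -
  have 1: "-1 \<le> (\<Sum>\<^sub>\<infinity>j\<in>grid \<epsilon>. K j * f j)"
    using K_average_ge[of f 1 "-1" 0 0] assms by (force simp: abs_le_iff)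
  have "-1 \<le> (\<Sum>\<^sub>\<infinity>j\<in>grid \<epsilon>. K j * (- f j))"
    using K_average_ge[of "\<lambda>j. - f j" 1 "-1" 0 0] assms by (force simp: abs_le_iff)
  then show ?thesis using 1 by (simp add: infsum_uminus)
qed

lemma abs_grid_conv_gamma_le_1: "\<bar>grid_conv \<epsilon> K (\<lambda>j. gamma (u j)) i\<bar> \<le> 1"
  unfolding grid_conv_def by (intro K_average_le_1 gamma_bounds)

lemma grid_conv_gamma_uminus:
  "grid_conv \<epsilon> K (\<lambda>j. gamma (- u j)) i = - grid_conv \<epsilon> K (\<lambda>j. gamma (u j)) i"
  unfolding grid_conv_def by (simp add: infsum_uminus)

text \<open>By Jensen's inequality: for \<open>b \<ge> 0\<close> the map \<open>\<lambda>a. tadd a b\<close> is concave.\<close>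

lemma inv_gamma_conv_lipschitz:
  assumes lip: "grid_1_lipschitz \<epsilon> u"
  shows "grid_1_lipschitz \<epsilon> (\<lambda>i. inv gamma (grid_conv \<epsilon> K (\<lambda>j. gamma (u j)) i))"
  unfolding grid_1_lipschitz_def
proof (intro ballI)
  fix i j :: "real^'n" assume ij: "i \<in> grid \<epsilon>" "j \<in> grid \<epsilon>"
  define T where "T = tanh (norm (i - j))"
  have T: "0 \<le> T" "T < 1" by (auto simp: T_def tanh_real_lt_1)
  have T2: "0 \<le> 1 - T\<^sup>2" using T by (simp add: abs_square_le_1)
  define A where "A = grid_conv \<epsilon> K (\<lambda>j. gamma (u j)) j"
  have A: "\<bar>A\<bar> \<le> 1" unfolding A_def by (rule abs_grid_conv_gamma_le_1)
  have pos: "0 < 1 + U * T" if "\<bar>U\<bar> \<le> 1" for U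
  proof -
    have "\<bar>U * T\<bar> < 1" using that T mult_right_mono[of "\<bar>U\<bar>" 1 T] by (simp add: abs_mult)
    then show ?thesis by (auto simp: abs_less_iff)
  qed
  \<comment> \<open>The derivative of \<open>\<lambda>U. tadd U T\<close> at \<open>A\<close>. The
    tangent line at the average \<open>A\<close> is averaged exactly by the kernel, which is the
    equality case of Jensen's inequality.\<close>
  define s where "s = (1 - T\<^sup>2) / (1 + A * T)\<^sup>2"
  have tangent: "tadd U T \<le> tadd A T + s * (U - A)" if "\<bar>U\<bar> \<le> 1" for U
  proof -
    have p: "0 < 1 + U * T" "0 < 1 + A * T" using pos that A by auto
    have "(U + T) / (1 + U * T) = (A + T) / (1 + A * T) + (1 - T\<^sup>2) / (1 + A * T)\<^sup>2 * (U - A)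
        - (1 - T\<^sup>2) * T * (U - A)\<^sup>2 / ((1 + A * T)\<^sup>2 * (1 + U * T))"
    proof -
      have "(U + T) / q = (A + T) / p + (1 - T\<^sup>2) / p\<^sup>2 * (U - A) - (1 - T\<^sup>2) * T * (U - A)\<^sup>2 / (p\<^sup>2 * q)"
        if "p = 1 + A * T" "q = 1 + U * T" "p \<noteq> 0" "q \<noteq> 0" for p q
      proof -
        have "(U + T) * p\<^sup>2 = (A + T) * p * q + (1 - T\<^sup>2) * (U - A) * q - (1 - T\<^sup>2) * T * (U - A)\<^sup>2"
          unfolding that(1,2) by algebra
        then have "(U + T) * p\<^sup>2 / (p\<^sup>2 * q) = (A + T) * p * q / (p\<^sup>2 * q) + (1 - T\<^sup>2) * (U - A) * q / (p\<^sup>2 * q)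
            - (1 - T\<^sup>2) * T * (U - A)\<^sup>2 / (p\<^sup>2 * q)"
          by (simp only: add_divide_distrib diff_divide_distrib)
        then show ?thesis using that(3,4) by (simp add: power2_eq_square)
      qed
      then show ?thesis using p by (metis less_irrefl)
    qed
    moreover have "0 \<le> (1 - T\<^sup>2) * T * (U - A)\<^sup>2 / ((1 + A * T)\<^sup>2 * (1 + U * T))"
      using p T T2 by simp
    ultimately show ?thesis by (simp add: tadd_def s_def)
  qed
  have s0: "0 \<le> s" using T2 by (simp add: s_def)
  let ?U = "\<lambda>l. gamma (u (j - l))"
  have sumU: "((\<lambda>l. K l * ?U l) has_sum A) (grid \<epsilon>)"
    unfolding A_def grid_conv_def
    by (intro has_sum_infsum K_summable_bounded[of _ 1] gamma_bounds)
  have upper: "((\<lambda>l. (tadd A T - s * A) * K l + s * (K l * ?U l)) has_sum ((tadd A T - s * A) * 1 + s * A)) (grid \<epsilon>)"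
    by (intro has_sum_add has_sum_cmult_right sumU K_mass)
  have lower: "((\<lambda>l. K l * gamma (u (i - l))) has_sum grid_conv \<epsilon> K (\<lambda>j. gamma (u j)) i) (grid \<epsilon>)"
    unfolding grid_conv_def
    by (intro has_sum_infsum K_summable_bounded[of _ 1] gamma_bounds)
  have "grid_conv \<epsilon> K (\<lambda>j. gamma (u j)) i \<le> (tadd A T - s * A) * 1 + s * A"
  proof (rule has_sum_mono[OF lower upper])
    fix l :: "real^'n" assume l: "l \<in> grid \<epsilon>"
    have "u (i - l) \<le> u (j - l) + ereal (norm (i - j))"
      using grid_1_lipschitzD[OF lip, of "i - l" "j - l"] ij l by (simp add: grid_diff)
    then have "gamma (u (i - l)) \<le> tadd (?U l) T" by (simp add: T_def flip: gamma_add)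
    also have "\<dots> \<le> tadd A T + s * (?U l - A)" by (intro tangent gamma_bounds)
    finally show "K l * gamma (u (i - l)) \<le> (tadd A T - s * A) * K l + s * (K l * ?U l)"
      using mult_left_mono[OF _ K_nonneg[OF l]] by (fastforce simp: algebra_simps)
  qed
  then have "grid_conv \<epsilon> K (\<lambda>j. gamma (u j)) i \<le> tadd A T" by simp
  then have "gamma (inv gamma (grid_conv \<epsilon> K (\<lambda>j. gamma (u j)) i)) \<le> gamma (inv gamma A + ereal (norm (i - j)))"
    by (simp add: gamma_add gamma_inv_gamma A abs_grid_conv_gamma_le_1 T_def del: gamma_le_iff)
  then show "inv gamma (grid_conv \<epsilon> K (\<lambda>j. gamma (u j)) i)
      \<le> inv gamma (grid_conv \<epsilon> K (\<lambda>j. gamma (u j)) j) + ereal (norm (i - j))"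
    by (simp add: A_def)
qed

end

text \<open>The properties of the scheme from which the statement about the positive part is derived;
  by the symmetry \<open>u \<mapsto> - u\<close>, which exchanges \<open>sd_plus\<close> and \<open>sd_minus\<close>, they are also available
  for the negative of the scheme.\<close>

locale grid_flow = grid_kernel \<epsilon> K for \<epsilon> and K :: "real^'n \<Rightarrow> real" +
  fixes u :: "nat \<Rightarrow> real^'n \<Rightarrow> ereal"
  assumes lip: "\<And>k. grid_1_lipschitz \<epsilon> (u k)"
    and step: "\<And>k i. i \<in> grid \<epsilon> \<Longrightarrow> 0 < grid_conv \<epsilon> K (\<lambda>j. gamma (u k j)) i \<Longrightarrow>
          grid_conv \<epsilon> K (\<lambda>j. gamma (u k j)) i \<le> gamma (u (Suc k) i)"
    and close_zero: "\<And>k i. i \<in> grid \<epsilon> \<Longrightarrow> u k i < \<infinity> \<Longrightarrow>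
          \<exists>j\<in>grid \<epsilon>. u k j \<le> 0 \<and> ereal (norm (i - j)) \<le> max (u k i) 0 + ereal (4 * real CARD('n) * \<epsilon>)"

text \<open>The properties common to both operators. Each of them satisfies one of the two one-step
  comparisons also at the value 0, but not the same one; with strict signs both hold for
  both.\<close>

locale redistancing =
  fixes sd :: "real \<Rightarrow> (real^'n \<Rightarrow> ereal) \<Rightarrow> real^'n \<Rightarrow> ereal"
  assumes sd_lip: "\<And>\<epsilon> v. grid_1_lipschitz \<epsilon> (sd \<epsilon> v)"
    and sd_ge: "\<And>\<epsilon> v i. grid_1_lipschitz \<epsilon> v \<Longrightarrow> i \<in> grid \<epsilon> \<Longrightarrow> 0 < v i \<Longrightarrow> v i \<le> sd \<epsilon> v i"
    and sd_le: "\<And>\<epsilon> v i. grid_1_lipschitz \<epsilon> v \<Longrightarrow> i \<in> grid \<epsilon> \<Longrightarrow> v i < 0 \<Longrightarrow> sd \<epsilon> v i \<le> v i"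
    and sd_close_zero: "\<And>\<epsilon> v i. 0 < \<epsilon> \<Longrightarrow> grid_1_lipschitz \<epsilon> v \<Longrightarrow> i \<in> grid \<epsilon> \<Longrightarrow> sd \<epsilon> v i < \<infinity> \<Longrightarrow>
          \<exists>j\<in>grid \<epsilon>. sd \<epsilon> v j \<le> 0 \<and>
            ereal (norm (i - j)) \<le> max (sd \<epsilon> v i) 0 + ereal (4 * real CARD('n) * \<epsilon>)"
    and sd_close_zero_neg: "\<And>\<epsilon> v i. 0 < \<epsilon> \<Longrightarrow> grid_1_lipschitz \<epsilon> v \<Longrightarrow> i \<in> grid \<epsilon> \<Longrightarrow> - \<infinity> < sd \<epsilon> v i \<Longrightarrow>
          \<exists>j\<in>grid \<epsilon>. 0 \<le> sd \<epsilon> v j \<and>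
            ereal (norm (i - j)) \<le> max (- sd \<epsilon> v i) 0 + ereal (4 * real CARD('n) * \<epsilon>)"

lemma redistancing_sd_plus: "redistancing (sd_plus :: real \<Rightarrow> (real^'n \<Rightarrow> ereal) \<Rightarrow> real^'n \<Rightarrow> ereal)"
proof
  fix \<epsilon> :: real and v :: "real^'n \<Rightarrow> ereal" and i :: "real^'n"
  assume a: "0 < \<epsilon>" "grid_1_lipschitz \<epsilon> v" "i \<in> grid \<epsilon>"
  show "sd_plus \<epsilon> v i < \<infinity> \<Longrightarrow>
          \<exists>j\<in>grid \<epsilon>. sd_plus \<epsilon> v j \<le> 0 \<and>
            ereal (norm (i - j)) \<le> max (sd_plus \<epsilon> v i) 0 + ereal (4 * real CARD('n) * \<epsilon>)"
    by (rule sd_plus_close_zero[OF a])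
  show "- \<infinity> < sd_plus \<epsilon> v i \<Longrightarrow>
          \<exists>j\<in>grid \<epsilon>. 0 \<le> sd_plus \<epsilon> v j \<and>
            ereal (norm (i - j)) \<le> max (- sd_plus \<epsilon> v i) 0 + ereal (4 * real CARD('n) * \<epsilon>)"
    using sd_minus_close_zero[OF a(1) grid_1_lipschitz_uminus[OF a(2)] a(3)]
    by (cases "sd_plus \<epsilon> v i") (simp_all add: sd_minus_uminus)
qed (rule sd_plus_lipschitz sd_plus_ge sd_plus_le; simp)+

lemma redistancing_sd_minus: "redistancing (sd_minus :: real \<Rightarrow> (real^'n \<Rightarrow> ereal) \<Rightarrow> real^'n \<Rightarrow> ereal)"
proof
  fix \<epsilon> :: real and v :: "real^'n \<Rightarrow> ereal" and i :: "real^'n"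
  assume a: "0 < \<epsilon>" "grid_1_lipschitz \<epsilon> v" "i \<in> grid \<epsilon>"
  show "sd_minus \<epsilon> v i < \<infinity> \<Longrightarrow>
          \<exists>j\<in>grid \<epsilon>. sd_minus \<epsilon> v j \<le> 0 \<and>
            ereal (norm (i - j)) \<le> max (sd_minus \<epsilon> v i) 0 + ereal (4 * real CARD('n) * \<epsilon>)"
    by (rule sd_minus_close_zero[OF a])
  show "- \<infinity> < sd_minus \<epsilon> v i \<Longrightarrow>
          \<exists>j\<in>grid \<epsilon>. 0 \<le> sd_minus \<epsilon> v j \<and>
            ereal (norm (i - j)) \<le> max (- sd_minus \<epsilon> v i) 0 + ereal (4 * real CARD('n) * \<epsilon>)"
    using sd_plus_close_zero[OF a(1) grid_1_lipschitz_uminus[OF a(2)] a(3)]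
    by (cases "sd_minus \<epsilon> v i") (simp_all add: sd_plus_uminus)
qed (rule sd_minus_lipschitz sd_minus_ge sd_minus_le; simp)+

locale redistancing_scheme = grid_kernel \<epsilon> K + redistancing sd
  for \<epsilon> and K :: "real^'n \<Rightarrow> real" and sd :: "real \<Rightarrow> (real^'n \<Rightarrow> ereal) \<Rightarrow> real^'n \<Rightarrow> ereal" +
  fixes w :: "real^'n \<Rightarrow> ereal"
  assumes w_lip: "grid_1_lipschitz \<epsilon> w"
begin

lemma scheme_lipschitz: "grid_1_lipschitz \<epsilon> (scheme sd \<epsilon> K w k)"
  by (cases k) (simp_all add: sd_lip)

text \<open>The function that is redistanced to give step \<open>k\<close>. Including the initial
  function as step 0 lets the properties of \<open>sd\<close> be applied uniformly in
  \<open>k\<close>.\<close>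

definition pre :: "nat \<Rightarrow> real^'n \<Rightarrow> ereal" where
  "pre k = (case k of 0 \<Rightarrow> w | Suc m \<Rightarrow> (\<lambda>i. inv gamma (grid_conv \<epsilon> K (\<lambda>j. gamma (scheme sd \<epsilon> K w m j)) i)))"

lemma scheme_eq_sd_pre: "scheme sd \<epsilon> K w k = sd \<epsilon> (pre k)"
  by (cases k) (simp_all add: pre_def)

lemma pre_lipschitz: "grid_1_lipschitz \<epsilon> (pre k)"
  by (cases k) (simp_all add: pre_def w_lip inv_gamma_conv_lipschitz scheme_lipschitz)

lemma gamma_pre_Suc: "gamma (pre (Suc k) i) = grid_conv \<epsilon> K (\<lambda>j. gamma (scheme sd \<epsilon> K w k j)) i"
  by (simp add: pre_def gamma_inv_gamma abs_grid_conv_gamma_le_1)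

lemma grid_flow_scheme: "grid_flow \<epsilon> K (scheme sd \<epsilon> K w)"
proof
  fix k and i :: "real^'n" assume i: "i \<in> grid \<epsilon>"
  show "grid_conv \<epsilon> K (\<lambda>j. gamma (scheme sd \<epsilon> K w k j)) i \<le> gamma (scheme sd \<epsilon> K w (Suc k) i)"
    if "0 < grid_conv \<epsilon> K (\<lambda>j. gamma (scheme sd \<epsilon> K w k j)) i"
  proof -
    have "0 < pre (Suc k) i" using that by (simp flip: gamma_pre_Suc)
    then have "pre (Suc k) i \<le> scheme sd \<epsilon> K w (Suc k) i"
      unfolding scheme_eq_sd_pre by (rule sd_ge[OF pre_lipschitz i])
    then show ?thesis unfolding gamma_pre_Suc[symmetric] gamma_le_iff .
  qed
  show "\<exists>j\<in>grid \<epsilon>. scheme sd \<epsilon> K w k j \<le> 0 \<and>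
        ereal (norm (i - j)) \<le> max (scheme sd \<epsilon> K w k i) 0 + ereal (4 * real CARD('n) * \<epsilon>)"
    if "scheme sd \<epsilon> K w k i < \<infinity>"
    using sd_close_zero[OF eps_pos pre_lipschitz i] that by (simp add: scheme_eq_sd_pre)
qed (rule scheme_lipschitz)

lemma grid_flow_uminus_scheme: "grid_flow \<epsilon> K (\<lambda>k i. - scheme sd \<epsilon> K w k i)"
proof
  fix k and i :: "real^'n" assume i: "i \<in> grid \<epsilon>"
  show "grid_conv \<epsilon> K (\<lambda>j. gamma (- scheme sd \<epsilon> K w k j)) i \<le> gamma (- scheme sd \<epsilon> K w (Suc k) i)"
    if "0 < grid_conv \<epsilon> K (\<lambda>j. gamma (- scheme sd \<epsilon> K w k j)) i"
  proof -
    have "gamma (pre (Suc k) i) < 0" using that by (simp only: grid_conv_gamma_uminus gamma_pre_Suc)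
    then have "pre (Suc k) i < 0" using gamma_less_iff[of _ 0] by simp
    then have "scheme sd \<epsilon> K w (Suc k) i \<le> pre (Suc k) i"
      unfolding scheme_eq_sd_pre by (rule sd_le[OF pre_lipschitz i])
    then show ?thesis
      unfolding grid_conv_gamma_uminus unfolding gamma_pre_Suc[symmetric] gamma_minus neg_le_iff_le gamma_le_iff .
  qed
  show "\<exists>j\<in>grid \<epsilon>. - scheme sd \<epsilon> K w k j \<le> 0 \<and>
        ereal (norm (i - j)) \<le> max (- scheme sd \<epsilon> K w k i) 0 + ereal (4 * real CARD('n) * \<epsilon>)"
    if "- scheme sd \<epsilon> K w k i < \<infinity>"
    using sd_close_zero_neg[OF eps_pos pre_lipschitz i, of k] that
    unfolding scheme_eq_sd_pre by (cases "sd \<epsilon> (pre k) i") simp_all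
qed (intro grid_1_lipschitz_uminus scheme_lipschitz)

end

section \<open>The initial datum\<close>

lemma edist_set_le: "y \<in> A \<Longrightarrow> edist_set x A \<le> ereal (dist x y)"
  unfolding edist_set_def by (rule INF_lower)

text \<open>A nearby point with nonpositive value cannot satisfy \<open>0 < w j\<close>, so its cell
  meets \<open>E0\<close>. The fifth cell diameter leads from that grid point into
  \<open>E0\<close>.\<close>

lemma (in redistancing_scheme) initial_ge:
  assumes w_pos: "\<And>i. i \<in> grid \<epsilon> - initial_grid_set \<epsilon> E0 \<Longrightarrow> 0 < w i" and i: "i \<in> grid \<epsilon>"
  shows "edist_set i E0 \<le> max (scheme sd \<epsilon> K w 0 i) 0 + ereal (5 * real CARD('n) * \<epsilon>)"
proof (cases "scheme sd \<epsilon> K w 0 i < \<infinity>")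
  case True
  then obtain j where j: "j \<in> grid \<epsilon>" "sd \<epsilon> w j \<le> 0"
    and d: "ereal (norm (i - j)) \<le> max (sd \<epsilon> w i) 0 + ereal (4 * real CARD('n) * \<epsilon>)"
    using sd_close_zero[OF eps_pos w_lip i] by auto
  have "\<not> 0 < w j" using sd_ge[OF w_lip j(1)] j(2) by auto
  then have "j \<in> initial_grid_set \<epsilon> E0" using w_pos j by blast
  then obtain x where x: "x \<in> E0" "x \<in> cell \<epsilon> j" unfolding initial_grid_set_def by auto
  have "norm (j - x) \<le> real CARD('n) * \<epsilon>"
    using norm_cell_diff[OF _ x(2), of j] eps_pos j by (simp add: mem_cell_iff grid_floor_id)
  then have "dist i x \<le> norm (i - j) + real CARD('n) * \<epsilon>"
    using norm_triangle_ineq[of "i - j" "j - x"] by (simp add: dist_norm)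
  then have "edist_set i E0 \<le> ereal (norm (i - j)) + ereal (real CARD('n) * \<epsilon>)"
    using edist_set_le[OF x(1), of i] by (simp add: order_trans)
  also have "\<dots> \<le> (max (sd \<epsilon> w i) 0 + ereal (4 * real CARD('n) * \<epsilon>)) + ereal (real CARD('n) * \<epsilon>)"
    by (intro add_right_mono d)
  finally show ?thesis by (simp add: add.assoc) (simp add: algebra_simps)
qed auto

text \<open>A grid point belongs to its own half-open cell. Hence if the cell misses
  \<open>E0\<close>, the grid point itself lies in the complement; the constant 5 is kept to match
  \<open>initial_ge\<close>.\<close>

lemma (in redistancing_scheme) initial_ge_neg:
  assumes w_neg: "\<And>i. i \<in> initial_grid_set \<epsilon> E0 \<Longrightarrow> w i < 0" and i: "i \<in> grid \<epsilon>"
  shows "edist_set i (closure (- E0)) \<le> max (- scheme sd \<epsilon> K w 0 i) 0 + ereal (5 * real CARD('n) * \<epsilon>)"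
proof (cases "- \<infinity> < scheme sd \<epsilon> K w 0 i")
  case True
  then obtain j where j: "j \<in> grid \<epsilon>" "0 \<le> sd \<epsilon> w j"
    and d: "ereal (norm (i - j)) \<le> max (- sd \<epsilon> w i) 0 + ereal (4 * real CARD('n) * \<epsilon>)"
    using sd_close_zero_neg[OF eps_pos w_lip i] by auto
  have "\<not> w j < 0" using sd_le[OF w_lip j(1)] j(2) by auto
  then have "j \<notin> initial_grid_set \<epsilon> E0" using w_neg j by blast
  moreover have "j \<in> cell \<epsilon> j" using eps_pos j by (simp add: mem_cell_iff grid_floor_id)
  ultimately have "j \<in> closure (- E0)"
    using j closure_subset[of "- E0"] by (auto simp: initial_grid_set_def)
  then have "edist_set i (closure (- E0)) \<le> ereal (norm (i - j))"
    using edist_set_le[of j "closure (- E0)" i] by (simp add: dist_norm)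
  also note d
  also have "max (- sd \<epsilon> w i) 0 + ereal (4 * real CARD('n) * \<epsilon>) \<le> max (- sd \<epsilon> w i) 0 + ereal (5 * real CARD('n) * \<epsilon>)"
    using eps_pos by (intro add_left_mono) auto
  finally show ?thesis by simp
next
  case False
  then have "scheme sd \<epsilon> K w 0 i = - \<infinity>" by auto
  then show ?thesis by simp
qed

section \<open>Control of the speed\<close>

text \<open>One step lowers the tanh of a paraboloid of radius R0 by at most 2 * 26 = 52 times
  \<kappa> h / R0; 53 makes the comparison strict, and the denominator converts from tanh back to
  heights.\<close>

definition barrier_rate :: "real \<Rightarrow> real" where
  "barrier_rate \<kappa> = 53 * \<kappa> / (1 - (tanh 1)\<^sup>2)"

lemma barrier_rate_pos: "1 \<le> \<kappa> \<Longrightarrow> 0 < barrier_rate \<kappa>"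
  using tanh_slope_pos by (simp add: barrier_rate_def)

context grid_flow
begin

text \<open>The paraboloids \<open>R - (norm (p - i))\<^sup>2 / R\<close> with slowly decreasing \<open>R\<close> are barriers: they are
  smooth at the centre, and beyond their zero set they lie below the cone \<open>R - norm (p - i)\<close>, where
  the Lipschitz bound suffices.\<close>

lemma paraboloid_barrier:
  assumes R0: "0 < R0" "R0 \<le> 1" and i: "i \<in> grid \<epsilon>" and init: "ereal (5 * R0 / 4) \<le> u k i"
    and m: "real m * barrier_rate (real CARD('n)) * h \<le> R0\<^sup>2 / 2" and p: "p \<in> grid \<epsilon>"
    and R_def: "\<And>m. R m = R0 - real m * barrier_rate (real CARD('n)) * h / R0"
  shows "ereal (R m - (norm (p - i))\<^sup>2 / R m) \<le> u (k + m) p"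
  using m p
proof (induction m arbitrary: p)
  case 0
  let ?r = "norm (i - p)"
  have "ereal (5 * R0 / 4) \<le> u k p + ereal ?r"
    using init grid_1_lipschitzD[OF lip i 0(2), of k] by (rule order_trans)
  then have "ereal (5 * R0 / 4 - ?r) \<le> u k p" by (cases "u k p") auto
  \<comment> \<open>Completing the square: the cone of height 5 R0 / 4 touches the paraboloid at
    distance R0 / 2. This is the origin of the factor 5/4.\<close>
  moreover have "R0 - ?r\<^sup>2 / R0 \<le> 5 * R0 / 4 - ?r"
  proof -
    have "0 \<le> (?r - R0 / 2)\<^sup>2 / R0" using R0 by simp
    also have "\<dots> = ?r\<^sup>2 / R0 - ?r + R0 / 4"
      using R0 by (simp add: power2_eq_square field_simps)
    finally show ?thesis by simp
  qed
  ultimately show ?case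
    by (simp add: R_def norm_minus_commute[of p]) (meson ereal_less_eq(3) order_trans)
next
  case (Suc m)
  let ?\<theta> = "barrier_rate (real CARD('n))" and ?\<kappa> = "real CARD('n)" and ?\<sigma> = "1 - (tanh (1::real))\<^sup>2"
  have \<theta>: "0 < ?\<theta>" using barrier_rate_pos kappa_ge_1 by simp
  have rate: "R (Suc m) = R m - ?\<theta> * h / R0" by (simp add: R_def add_divide_distrib distrib_right)
  have "real m * ?\<theta> * h \<le> real (Suc m) * ?\<theta> * h" using \<theta> h_pos by (intro mult_right_mono) auto
  then have m: "real m * ?\<theta> * h \<le> R0\<^sup>2 / 2" using Suc.prems by linarith
  \<comment> \<open>The restriction on time keeps the radius above half of its initial value, so 1 /
    R stays of order 1 / R0.\<close>
  have "real (Suc m) * ?\<theta> * h / R0 \<le> (R0\<^sup>2 / 2) / R0" using Suc.prems R0 by (intro divide_right_mono) auto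
  then have R': "R0 / 2 \<le> R (Suc m)" using R0 by (simp add: R_def power2_eq_square)
  have RR: "R (Suc m) \<le> R m" using rate \<theta> h_pos R0 by simp
  have R: "R m \<le> R0" using \<theta> h_pos R0 by (simp add: R_def)
  have pos: "0 < R (Suc m)" "0 < R m" using R' RR R0 by linarith+
  have IH: "ereal (R m - (norm (q - i))\<^sup>2 / R m) \<le> u (k + m) q" if "q \<in> grid \<epsilon>" for q
    using Suc.IH[OF m that] .
  have near: "ereal (R (Suc m) - (norm (p - i))\<^sup>2 / R (Suc m)) \<le> u (k + Suc m) p"
    if p: "p \<in> grid \<epsilon>" and r: "norm (p - i) \<le> R (Suc m)" for p
  proof -
    let ?r = "norm (p - i)"
    define \<beta> where "\<beta> = R m - ?r\<^sup>2 / R m"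
    define b where "b = R (Suc m) - ?r\<^sup>2 / R (Suc m)"
    have "?r\<^sup>2 \<le> (R (Suc m))\<^sup>2" using r by (intro power_mono) auto
    then have b0: "0 \<le> b" using pos by (simp add: b_def power2_eq_square divide_le_eq)
    have "?r\<^sup>2 / R m \<le> ?r\<^sup>2 / R (Suc m)" using pos RR by (intro divide_left_mono) auto
    then have gap: "b + ?\<theta> * h / R0 \<le> \<beta>" using rate by (simp add: b_def \<beta>_def)
    have "0 \<le> ?\<theta> * h / R0" using \<theta> h_pos R0 by simp
    then have \<beta>: "0 \<le> \<beta>" "b \<le> \<beta>" using gap b0 by linarith+
    have "0 \<le> ?r\<^sup>2 / R m" using pos by simp
    then have \<beta>1: "\<beta> \<le> 1" using R R0 by (simp add: \<beta>_def)
    let ?f = "\<lambda>j. gamma (u (k + m) (p - j))"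
    define s where "s = 1 - (tanh \<beta>)\<^sup>2"
    \<comment> \<open>Expansion of the paraboloid shifted by \<open>j\<close>: below,
      \<open>y\<close> is the part linear in \<open>j\<close> and \<open>z\<close> the quadratic
      one. Inside the radius \<open>\<bar>y\<bar> \<le> 2 * norm j\<close>, so the loss
      \<open>3 * y\<^sup>2\<close> contributes the coefficient 12.\<close>
    have lower: "tanh \<beta> + ((s * 2 / R m) *\<^sub>R (p - i)) \<bullet> j - (12 + 1 / R m) * (norm j)\<^sup>2 \<le> ?f j"
      if j: "j \<in> grid \<epsilon>" for j
    proof -
      define y where "y = 2 * ((p - i) \<bullet> j) / R m"
      define z where "z = (norm j)\<^sup>2 / R m"
      have z: "0 \<le> z" using pos by (simp add: z_def)
      have "\<bar>y\<bar> = 2 * \<bar>(p - i) \<bullet> j\<bar> / R m" using pos by (simp add: y_def abs_mult)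
      also have "\<dots> \<le> 2 * (R m * norm j) / R m"
        using pos r RR order_trans[OF Cauchy_Schwarz_ineq2[of "p - i" j] mult_right_mono[of ?r "R m" "norm j"]]
        by (intro divide_right_mono) auto
      also have "\<dots> = 2 * norm j" using pos by simp
      finally have "y\<^sup>2 \<le> (2 * norm j)\<^sup>2" using power_mono[of "\<bar>y\<bar>" "2 * norm j" 2] by simp
      then have y: "y\<^sup>2 \<le> 4 * (norm j)\<^sup>2" by (simp add: power_mult_distrib)
      have n: "(norm (p - j - i))\<^sup>2 = ?r\<^sup>2 - 2 * ((p - i) \<bullet> j) + (norm j)\<^sup>2"
        by (simp add: power2_norm_eq_inner inner_diff_left inner_diff_right inner_commute algebra_simps)
      have eq: "R m - (norm (p - j - i))\<^sup>2 / R m = \<beta> + y - z"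
        unfolding n \<beta>_def y_def z_def by (simp add: add_divide_distrib diff_divide_distrib)
      have "tanh \<beta> + s * y - 3 * y\<^sup>2 - z \<le> tanh (\<beta> + y) - z"
        using tanh_add_ge_coarse[OF \<beta>(1), of y] by (simp add: s_def)
      also have "\<dots> \<le> tanh (\<beta> + y - z)" using tanh_diff_le[of "\<beta> + y - z" "\<beta> + y"] z by simp
      also have "\<dots> = gamma (ereal (R m - (norm (p - j - i))\<^sup>2 / R m))" by (simp add: eq)
      also have "\<dots> \<le> ?f j" unfolding gamma_le_iff using IH[OF grid_diff[OF p j]] .
      finally have "tanh \<beta> + s * y - 3 * y\<^sup>2 - z \<le> ?f j" .
      moreover have "((s * 2 / R m) *\<^sub>R (p - i)) \<bullet> j = s * y" by (simp add: y_def)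
      moreover have "(12 + 1 / R m) * (norm j)\<^sup>2 = 12 * (norm j)\<^sup>2 + z" by (simp add: z_def algebra_simps)
      ultimately show ?thesis using y by linarith
    qed
    let ?c = "grid_conv \<epsilon> K (\<lambda>j. gamma (u (k + m) j)) p"
    have "tanh \<beta> - 2 * ?\<kappa> * h * (12 + 1 / R m) \<le> ?c"
      unfolding grid_conv_def by (rule K_average_ge[OF gamma_bounds(3) lower])
    moreover have "2 * ?\<kappa> * h * (12 + 1 / R m) \<le> 2 * ?\<kappa> * h * (26 / R0)"
    proof (intro mult_left_mono)
      have "1 / R m \<le> 1 / (R0 / 2)" using R' RR R0 by (intro divide_left_mono) auto
      moreover have "12 \<le> 12 * (2 / R0)" using R0 by (simp add: field_simps)
      ultimately show "12 + 1 / R m \<le> 26 / R0" by simp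
    qed (use h_pos in auto)
    moreover have "53 * ?\<kappa> * h / R0 \<le> tanh \<beta> - tanh b"
    proof -
      have "53 * ?\<kappa> * h / R0 = ?\<sigma> * (?\<theta> * h / R0)"
        using tanh_slope_pos by (simp add: barrier_rate_def)
      also have "\<dots> \<le> ?\<sigma> * (\<beta> - b)" using gap tanh_slope_pos by (intro mult_left_mono) auto
      also have "\<dots> \<le> tanh \<beta> - tanh b" using b0 \<beta> \<beta>1 by (intro tanh_diff_ge)
      finally show ?thesis .
    qed
    \<comment> \<open>Strictness matters: \<open>b\<close> may be 0, and \<open>step\<close> speaks
      only of points with positive convolution.\<close>
    moreover have "2 * ?\<kappa> * h * (26 / R0) < 53 * ?\<kappa> * h / R0"
      using h_pos R0 kappa_ge_1 by (simp add: field_simps)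
    ultimately have c: "tanh b < ?c" by linarith
    moreover have "0 \<le> tanh b" using b0 by simp
    ultimately have "?c \<le> gamma (u (Suc (k + m)) p)" by (intro step p) linarith
    then have "gamma (ereal b) \<le> gamma (u (k + Suc m) p)" using c by simp
    then show ?thesis unfolding gamma_le_iff b_def .
  qed
  show ?case
  proof (cases "norm (p - i) \<le> R (Suc m)")
    case True
    then show ?thesis using near Suc.prems by blast
  next
    case False
    let ?r = "norm (i - p)"
    have "ereal (R (Suc m)) \<le> u (k + Suc m) i" using near[OF i] pos by simp
    also have "\<dots> \<le> u (k + Suc m) p + ereal ?r" using lip i Suc.prems by (intro grid_1_lipschitzD)
    finally have "ereal (R (Suc m) - ?r) \<le> u (k + Suc m) p" by (cases "u (k + Suc m) p") auto
    moreover have "ereal (R (Suc m) - ?r\<^sup>2 / R (Suc m)) \<le> ereal (R (Suc m) - ?r)"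
      using False pos by (simp add: norm_minus_commute pos_le_divide_eq power2_eq_square mult_left_mono)
    ultimately show ?thesis unfolding norm_minus_commute[of p] by (rule order_trans[rotated])
  qed
qed

lemma stays_positive:
  assumes R0: "0 < R0" "R0 \<le> 1" and i: "i \<in> grid \<epsilon>" and init: "ereal (5 * R0 / 4) \<le> u k i"
    and m: "real m * barrier_rate (real CARD('n)) * h \<le> R0\<^sup>2 / 2"
  shows "0 < u (k + m) i"
proof -
  define R where "R m = R0 - real m * barrier_rate (real CARD('n)) * h / R0" for m
  have "real m * barrier_rate (real CARD('n)) * h / R0 \<le> (R0\<^sup>2 / 2) / R0"
    using m R0 by (intro divide_right_mono) auto
  also have "\<dots> = R0 / 2" using R0 by (simp add: power2_eq_square)
  finally have "0 < R m" using R0 unfolding R_def by linarith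
  moreover have "ereal (R m - (norm (i - i))\<^sup>2 / R m) \<le> u (k + m) i"
    by (rule paraboloid_barrier[OF assms i R_def])
  ultimately show ?thesis by (simp add: less_le_trans[of 0 "ereal (R m)"])
qed

section \<open>The positive part and its decrease in time\<close>

abbreviation U :: "nat \<Rightarrow> real^'n \<Rightarrow> ereal" where "U k i \<equiv> max (u k i) 0"

lemma U_lipschitz: "i \<in> grid \<epsilon> \<Longrightarrow> j \<in> grid \<epsilon> \<Longrightarrow> U k i \<le> U k j + ereal (norm (i - j))"
  using grid_1_lipschitzD[OF lip, of i j k]
  by (cases "u k i"; cases "u k j") (auto simp: max_def split: if_splits)

lemma U_close_zero:
  assumes "i \<in> grid \<epsilon>" "U k i < \<infinity>"
  shows "\<exists>j\<in>grid \<epsilon>. u k j \<le> 0 \<and> ereal (norm (i - j)) \<le> U k i + ereal (4 * real CARD('n) * \<epsilon>)"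
proof -
  have "u k i < \<infinity>" using assms(2) by (simp add: max_less_iff_conj del: ereal_infty_less)
  then show ?thesis by (rule close_zero[OF assms(1)])
qed

text \<open>Run backwards from a zero \<open>j\<close> near \<open>i\<close> at the later time: had
  the value at \<open>j\<close> been at least \<open>5 * R0 / 4\<close>, it would still be positive.
  The Lipschitz bound carries this from \<open>j\<close> to \<open>i\<close>.\<close>

lemma U_speed:
  assumes R0: "0 < R0" "R0 \<le> 1" and i: "i \<in> grid \<epsilon>"
    and m: "real m * barrier_rate (real CARD('n)) * h \<le> R0\<^sup>2 / 2"
  shows "U k i \<le> U (k + m) i + ereal (5 * R0 / 4 + 4 * real CARD('n) * \<epsilon>)"
proof (cases "U (k + m) i < \<infinity>")
  case True
  then obtain j where j: "j \<in> grid \<epsilon>" "u (k + m) j \<le> 0"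
    "ereal (norm (i - j)) \<le> U (k + m) i + ereal (4 * real CARD('n) * \<epsilon>)"
    using U_close_zero[OF i] by blast
  have "\<not> ereal (5 * R0 / 4) \<le> u k j" using stays_positive[OF R0 j(1) _ m] j(2) by (meson not_le)
  then have "U k j \<le> ereal (5 * R0 / 4)" using R0 by (auto simp: zero_ereal_def[symmetric] less_imp_le)
  then have "U k j + ereal (norm (i - j)) \<le> ereal (5 * R0 / 4) + (U (k + m) i + ereal (4 * real CARD('n) * \<epsilon>))"
    by (intro add_mono j)
  then have "U k i \<le> ereal (5 * R0 / 4) + (U (k + m) i + ereal (4 * real CARD('n) * \<epsilon>))"
    using U_lipschitz[OF i j(1), of k] by (rule order_trans[rotated])
  then show ?thesis by (cases "U (k + m) i") (auto simp: algebra_simps)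
qed auto

text \<open>\<open>U_speed\<close> reaches only times with \<open>R0 \<le> 1\<close>. Longer times
  are cut into pieces, each costing at most 5/4 + 3/4 = 2. The resulting crude bound is what
  prevents an infinite loss in finite time.\<close>

lemma U_speed_long:
  assumes i: "i \<in> grid \<epsilon>" and small: "h \<le> 1 / (4 * barrier_rate (real CARD('n)))" "16 * real CARD('n) * \<epsilon> \<le> 3"
    and m: "real m * (4 * barrier_rate (real CARD('n))) * h \<le> real q"
  shows "U k i \<le> U (k + m) i + ereal (2 * real q)"
  using m
proof (induction q arbitrary: k m)
  let ?\<theta> = "barrier_rate (real CARD('n))"
  have \<theta>: "0 < ?\<theta>" using barrier_rate_pos kappa_ge_1 by simp
  {
    case 0
    then have "m = 0" using \<theta> h_pos by (simp add: mult_le_0_iff not_le)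
    then show ?case by simp
  next
    case (Suc q)
    have h2: "?\<theta> * h \<le> 1 / 4" using small(1) \<theta> by (simp add: field_simps)
    show ?case
    proof (cases "real m * ?\<theta> * h \<le> 1 / 2")
      case True
      then have "U k i \<le> U (k + m) i + ereal (5 * 1 / 4 + 4 * real CARD('n) * \<epsilon>)"
        by (intro U_speed i) auto
      also have "\<dots> \<le> U (k + m) i + ereal (2 * real (Suc q))"
        using small(2) by (intro add_left_mono) auto
      finally show ?thesis .
    next
      case False
      \<comment> \<open>The largest number of steps allowed by \<open>U_speed\<close> with
        \<open>R0 = 1\<close>. Since \<open>?\<theta> * h \<le> 1 / 4\<close>, it still covers a
        quarter of the unit \<open>1 / ?\<theta>\<close>, so every piece uses up one unit of
        \<open>q\<close>.\<close>
      define m1 where "m1 = nat \<lfloor>1 / (2 * (?\<theta> * h))\<rfloor>"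
      have th: "0 < ?\<theta> * h" using \<theta> h_pos by simp
      have m1: "real m1 \<le> 1 / (2 * (?\<theta> * h))" "1 / (2 * (?\<theta> * h)) < real m1 + 1"
        unfolding m1_def using th by (auto simp: of_nat_nat)
      have up: "real m1 * ?\<theta> * h \<le> 1 / 2" using m1(1) th by (simp add: field_simps)
      have "1 / 2 < (real m1 + 1) * (?\<theta> * h)" using m1(2) th by (simp add: field_simps)
      then have low: "1 / 4 \<le> real m1 * (?\<theta> * h)" using h2 by (simp add: algebra_simps)
      have "real m1 * (?\<theta> * h) \<le> real m * (?\<theta> * h)" using up False by (simp add: mult.assoc)
      then have le: "m1 \<le> m" using mult_right_le_imp_le[OF _ th] by fastforce
      have "real (m - m1) * (4 * ?\<theta>) * h = real m * (4 * ?\<theta>) * h - 4 * (real m1 * (?\<theta> * h))"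
        using le by (simp add: of_nat_diff algebra_simps)
      then have "real (m - m1) * (4 * ?\<theta>) * h \<le> real q" using Suc.prems low by simp
      then have IH: "U (k + m1) i \<le> U (k + m1 + (m - m1)) i + ereal (2 * real q)" by (rule Suc.IH)
      have "U k i \<le> U (k + m1) i + ereal (5 * 1 / 4 + 4 * real CARD('n) * \<epsilon>)"
        using up by (intro U_speed i) auto
      also have "\<dots> \<le> (U (k + m) i + ereal (2 * real q)) + ereal 2"
        using IH le small(2) by (intro add_mono) auto
      also have "\<dots> = U (k + m) i + ereal (2 * real (Suc q))"
        by (simp add: add.assoc) (simp add: algebra_simps)
      finally show ?thesis .
    qed
  }
qed

end

section \<open>The discrete heat inequality\<close>

context grid_kernel
begin

definition tail :: "real \<Rightarrow> real" where
  "tail r = (\<Sum>\<^sub>\<infinity>j\<in>{j\<in>grid \<epsilon>. r < norm j}. K j * (norm j)\<^sup>2)"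

text \<open>Truncation at the fixed radius 1 makes the sums finite and the shifts of test functions
  bounded. The mass left out is at most \<open>tail 1\<close>, which becomes small compared with
  \<open>h\<close>.\<close>

definition stencil :: "(real^'n) set" where
  "stencil = {j\<in>grid \<epsilon>. norm j \<le> 1}"

lemma finite_stencil [simp]: "finite stencil"
  unfolding stencil_def by (rule finite_grid_cball[OF eps_pos])

lemma stencil_in_grid: "j \<in> stencil \<Longrightarrow> j \<in> grid \<epsilon>"
  by (simp add: stencil_def)

lemma K_second_moment_summable: "(\<lambda>j. K j * (norm j)\<^sup>2) summable_on grid \<epsilon>"
  using K_moment by (simp add: mult.commute)

lemma has_sum_second_moment: "((\<lambda>j. K j * (norm j)\<^sup>2) has_sum (2 * real CARD('n) * h)) (grid \<epsilon>)"
  using K_second_moment_summable K_second_moment by (simp add: has_sum_iff)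

lemma has_sum_tail: "((\<lambda>j. K j * ((norm j)\<^sup>2 * of_bool (r < norm j))) has_sum tail r) (grid \<epsilon>)"
proof -
  have "(\<lambda>j. K j * (norm j)\<^sup>2) summable_on {j\<in>grid \<epsilon>. r < norm j}"
    by (rule summable_on_subset_banach[OF K_second_moment_summable]) auto
  then have "((\<lambda>j. K j * (norm j)\<^sup>2) has_sum tail r) {j\<in>grid \<epsilon>. r < norm j}"
    unfolding tail_def by (rule has_sum_infsum)
  then show ?thesis by (rule has_sum_cong_neutral[THEN iffD1, rotated -1]) auto
qed

lemma tail_nonneg: "0 \<le> tail r"
  unfolding tail_def by (intro infsum_nonneg) (auto simp: K_nonneg)

text \<open>A pointwise bound by four functions whose full kernel sums are known. The left side is
  extended by 0, so the bound has to be checked outside the stencil too, where \<open>A\<close> and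
  \<open>g\<close> still carry their share of the mass.\<close>

lemma sum_stencil_le:
  assumes g: "\<And>j. j \<in> grid \<epsilon> \<Longrightarrow> \<bar>g j\<bar> \<le> 1"
    and le: "\<And>j. j \<in> grid \<epsilon> \<Longrightarrow>
      (if j \<in> stencil then F j else 0) \<le> A + l * g j + q * (norm j)\<^sup>2 + C * ((norm j)\<^sup>2 * of_bool (r < norm j))"
  shows "(\<Sum>j\<in>stencil. K j * F j) \<le> A + l * (\<Sum>\<^sub>\<infinity>j\<in>grid \<epsilon>. K j * g j) + q * (2 * real CARD('n) * h) + C * tail r"
proof -
  have "((\<lambda>j. K j * F j) has_sum (\<Sum>j\<in>stencil. K j * F j)) stencil"
    by (rule has_sum_finite) simp
  then have left: "((\<lambda>j. K j * (if j \<in> stencil then F j else 0)) has_sum (\<Sum>j\<in>stencil. K j * F j)) (grid \<epsilon>)"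
    by (rule has_sum_cong_neutral[THEN iffD1, rotated -1]) (auto simp: stencil_in_grid)
  have "((\<lambda>j. K j * g j) has_sum (\<Sum>\<^sub>\<infinity>j\<in>grid \<epsilon>. K j * g j)) (grid \<epsilon>)"
    by (intro has_sum_infsum K_summable_bounded[of _ 1] g)
  then have right: "((\<lambda>j. A * K j + l * (K j * g j) + q * (K j * (norm j)\<^sup>2) + C * (K j * ((norm j)\<^sup>2 * of_bool (r < norm j))))
      has_sum (A * 1 + l * (\<Sum>\<^sub>\<infinity>j\<in>grid \<epsilon>. K j * g j) + q * (2 * real CARD('n) * h) + C * tail r)) (grid \<epsilon>)"
    by (intro has_sum_add has_sum_cmult_right K_mass has_sum_second_moment has_sum_tail)
  have "(\<Sum>j\<in>stencil. K j * F j) \<le> A * 1 + l * (\<Sum>\<^sub>\<infinity>j\<in>grid \<epsilon>. K j * g j) + q * (2 * real CARD('n) * h) + C * tail r"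
  proof (rule has_sum_mono[OF left right])
    fix j :: "real^'n" assume j: "j \<in> grid \<epsilon>"
    show "K j * (if j \<in> stencil then F j else 0) \<le> A * K j + l * (K j * g j) + q * (K j * (norm j)\<^sup>2)
        + C * (K j * ((norm j)\<^sup>2 * of_bool (r < norm j)))"
      using mult_left_mono[OF le[OF j] K_nonneg[OF j]] by (simp add: algebra_simps)
  qed
  then show ?thesis by simp
qed

lemma sum_stencil_K_le_1: "(\<Sum>j\<in>stencil. K j) \<le> 1"
  using sum_stencil_le[of "\<lambda>_. 0" "\<lambda>_. 1" 1 0 0 0 0] by simp

lemma sum_stencil_second_moment_le: "(\<Sum>j\<in>stencil. K j * (norm j)\<^sup>2) \<le> 2 * real CARD('n) * h"
  using sum_stencil_le[of "\<lambda>_. 0" "\<lambda>j. (norm j)\<^sup>2" 0 0 1 0 0] by simp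

end

text \<open>The weight \<open>bend \<delta>\<close> is convex with slope \<open>1\<close> at \<open>\<delta>\<close> and second derivative \<open>\<delta>\<close>. The
  inf-convolution of \<open>bend \<delta> \<circ> U\<close> with the norm differs little from \<open>U\<close>, but its
  minimizers stay at a distance of order \<open>\<delta>\<close> from the zero set. There \<open>tanh\<close> is almost
  linear, and redistancing only increases the values, so the heat inequality can be translated from
  the minimizer without the rounding errors of order \<open>\<epsilon>\<close> that redistancing produces.\<close>

definition bend :: "real \<Rightarrow> real \<Rightarrow> real" where
  "bend \<delta> s = s + \<delta> / 2 * (s - \<delta>)\<^sup>2"

lemma bend_ge: "0 \<le> \<delta> \<Longrightarrow> s \<le> bend \<delta> s"
  by (simp add: bend_def)

lemma bend_nonneg: "0 \<le> \<delta> \<Longrightarrow> 0 \<le> s \<Longrightarrow> 0 \<le> bend \<delta> s"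
  using bend_ge[of \<delta> s] by simp

lemma bend_diff: "bend \<delta> t - bend \<delta> s = (t - s) * (1 + \<delta> / 2 * (s + t - 2 * \<delta>))"
  by (simp add: bend_def power2_eq_square field_simps)

lemma bend_expand: "bend \<delta> (a + x) = bend \<delta> a + (1 + \<delta> * (a - \<delta>)) * x + \<delta> / 2 * x\<^sup>2"
  by (simp add: bend_def power2_eq_square algebra_simps)

lemma bend_mono:
  assumes "0 < \<delta>" "\<delta> \<le> 1/4" "0 \<le> s" "s \<le> t"
  shows "bend \<delta> s \<le> bend \<delta> t"
proof -
  have "\<delta> * \<delta> \<le> 1" using assms mult_mono[of \<delta> 1 \<delta> 1] by simp
  moreover have "0 \<le> \<delta> / 2 * (s + t)" using assms by simp
  moreover have "1 + \<delta> / 2 * (s + t - 2 * \<delta>) = 1 + \<delta> / 2 * (s + t) - \<delta> * \<delta>"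
    by (simp add: field_simps)
  ultimately have "0 \<le> 1 + \<delta> / 2 * (s + t - 2 * \<delta>)" by linarith
  then have "0 \<le> bend \<delta> t - bend \<delta> s" unfolding bend_diff using assms by simp
  then show ?thesis by simp
qed

text \<open>\<open>heat_M \<kappa> * sqrt h\<close> bounds the drop of the value at one point in one
  step: a cone averaged by the kernel loses at most (\<kappa> + 1/2) \<open>sqrt h\<close> in
  tanh.\<close>

definition heat_M :: "real \<Rightarrow> real" where
  "heat_M \<kappa> = (\<kappa> + 1) / (1 - (tanh 1)\<^sup>2)"

text \<open>10 is 2 * 5: the slope \<open>l\<close> below is at most 2 over the minimal slope of
  tanh, and \<open>2 * a + \<bar>x\<bar>\<close> is at most 5 \<delta>. The 1 covers the second
  derivative of \<open>bend\<close>.\<close>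

definition heat_C1 :: real where
  "heat_C1 = 10 / (1 - (tanh 1)\<^sup>2) + 1"

text \<open>The charge per \<open>(norm j)\<^sup>2\<close> for shifts longer than \<delta> / 4:
  quadratic terms with |x| \<le> 2 |j|, and a jump of size \<open>2 * l\<close>, converted by 1
  \<le> 16 |j|^2 / \<delta>^2.\<close>

definition heat_C3 :: "real \<Rightarrow> real" where
  "heat_C3 \<delta> = 4 * heat_C1 + 2 * (2 / (1 - (tanh 1)\<^sup>2)) * (16 / \<delta>\<^sup>2)"

text \<open>The quadratic errors of a step at height of order \<delta>, plus one \<delta> h for the
  tail of the kernel and one for the tolerance in the choice of a minimizer.\<close>

definition heat_C :: "real \<Rightarrow> real" where
  "heat_C \<kappa> = heat_C1 * (4 * \<kappa> + 2 * (heat_M \<kappa>)\<^sup>2) + 2"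

lemma heat_C1_ge_1: "1 \<le> heat_C1"
  using tanh_slope_pos by (simp add: heat_C1_def)

text \<open>\<open>l\<close> is the slope of \<open>bend \<delta>\<close> relative to tanh at
  \<open>a\<close>, so the linear terms agree and the difference is quadratic: with a factor
  \<delta> for small \<open>x\<close> by the fine expansion, without it in general by the coarse
  one.\<close>

lemma bend_le_tanh:
  assumes \<delta>: "0 < \<delta>" "\<delta> \<le> 1/4" and a: "\<delta> / 2 \<le> a" "a \<le> 2 * \<delta>"
    and l_def: "l = (1 + \<delta> * (a - \<delta>)) / (1 - (tanh a)\<^sup>2)"
  shows "0 \<le> l" "l \<le> 2 / (1 - (tanh 1)\<^sup>2)"
    and "\<bar>x\<bar> \<le> \<delta> \<Longrightarrow> bend \<delta> (a + x) \<le> bend \<delta> a + l * (tanh (a + x) - tanh a) + heat_C1 * \<delta> * x\<^sup>2"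
    and "bend \<delta> (a + x) \<le> bend \<delta> a + l * (tanh (a + x) - tanh a) + heat_C1 * x\<^sup>2"
proof -
  let ?\<sigma> = "1 - (tanh (1::real))\<^sup>2" and ?s = "1 - (tanh a)\<^sup>2"
  have a1: "0 < a" "a \<le> 1/2" using \<delta> a by auto
  have "(tanh a)\<^sup>2 \<le> (tanh 1)\<^sup>2" using a1 by (intro power_mono) auto
  then have s: "?\<sigma> \<le> ?s" "0 < ?s" using tanh_slope_pos by auto
  have "- (\<delta> * \<delta>) \<le> \<delta> * (a - \<delta>)" "\<delta> * (a - \<delta>) \<le> \<delta> * \<delta>"
    using \<delta> a mult_left_mono[of "-\<delta>" "a - \<delta>" \<delta>] mult_left_mono[of "a - \<delta>" \<delta> \<delta>] by auto
  moreover have "\<delta> * \<delta> \<le> 1" using \<delta> mult_mono[of \<delta> 1 \<delta> 1] by simp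
  ultimately have num: "0 \<le> 1 + \<delta> * (a - \<delta>)" "1 + \<delta> * (a - \<delta>) \<le> 2" by linarith+
  show l: "0 \<le> l" "l \<le> 2 / ?\<sigma>" using num s tanh_slope_pos unfolding l_def by (auto intro!: frac_le)
  have ls: "l * ?s = 1 + \<delta> * (a - \<delta>)" using s by (simp add: l_def)
  have gen: "bend \<delta> (a + x) \<le> bend \<delta> a + l * (tanh (a + x) - tanh a) + (l * e + \<delta> / 2) * x\<^sup>2"
    if "tanh a + ?s * x - e * x\<^sup>2 \<le> tanh (a + x)" for e
  proof -
    have "l * (?s * x - e * x\<^sup>2) \<le> l * (tanh (a + x) - tanh a)" using that l by (intro mult_left_mono) auto
    moreover have "l * (?s * x) = (1 + \<delta> * (a - \<delta>)) * x" unfolding mult.assoc[symmetric] ls ..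
    ultimately show ?thesis unfolding bend_expand by (simp add: algebra_simps)
  qed
  show "bend \<delta> (a + x) \<le> bend \<delta> a + l * (tanh (a + x) - tanh a) + heat_C1 * x\<^sup>2"
  proof -
    have "(l * 3 + \<delta> / 2) * x\<^sup>2 \<le> heat_C1 * x\<^sup>2"
    proof (rule mult_right_mono)
      have "l * 3 \<le> 2 / ?\<sigma> * 5" using l tanh_slope_pos by (intro mult_mono) auto
      then show "l * 3 + \<delta> / 2 \<le> heat_C1" using \<delta> tanh_slope_pos by (simp add: heat_C1_def)
    qed simp
    then show ?thesis using gen[OF tanh_add_ge_coarse] a1 by linarith
  qed
  show "bend \<delta> (a + x) \<le> bend \<delta> a + l * (tanh (a + x) - tanh a) + heat_C1 * \<delta> * x\<^sup>2" if x: "\<bar>x\<bar> \<le> \<delta>"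
  proof -
    have "(l * (2 * a + \<bar>x\<bar>) + \<delta> / 2) * x\<^sup>2 \<le> heat_C1 * \<delta> * x\<^sup>2"
    proof (rule mult_right_mono)
      have "l * (2 * a + \<bar>x\<bar>) \<le> 2 / ?\<sigma> * (5 * \<delta>)" using l x a a1 tanh_slope_pos by (intro mult_mono) auto
      moreover have "heat_C1 * \<delta> = 2 / ?\<sigma> * (5 * \<delta>) + \<delta>" by (simp add: heat_C1_def distrib_right)
      ultimately show "l * (2 * a + \<bar>x\<bar>) + \<delta> / 2 \<le> heat_C1 * \<delta>" using \<delta> by linarith
    qed simp
    then show ?thesis using gen[OF tanh_add_ge_fine] a1 by linarith
  qed
qed

text \<open>Used with \<open>q = sqrt h\<close>, which balances the mass 1 of the kernel against its
  second moment of order h.\<close>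

lemma le_half_add_square:
  fixes q x :: real
  assumes "0 < q"
  shows "x \<le> q / 2 + 1 / (2 * q) * x\<^sup>2"
proof -
  have "0 \<le> (x - q)\<^sup>2 / (2 * q)" using assms by simp
  also have "\<dots> = q / 2 + 1 / (2 * q) * x\<^sup>2 - x"
    using assms by (simp add: power2_eq_square field_simps)
  finally show ?thesis by simp
qed

section \<open>Finite flows and one step at small heights\<close>

context grid_flow
begin

text \<open>One infinite value forces all of them by the Lipschitz bound; then the convolution
  equals 1 and \<open>step\<close> returns infinity. Read backwards, finiteness at one time gives
  finiteness at all earlier times.\<close>

lemma infinite_stays:
  assumes "i \<in> grid \<epsilon>" "j \<in> grid \<epsilon>" "u k i = \<infinity>"
  shows "u (k + m) j = \<infinity>"
proof -
  have 0: "u k j = \<infinity>" if "j \<in> grid \<epsilon>" for j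
    using grid_1_lipschitzD[OF lip assms(1) that, of k] assms(3) by (cases "u k j") auto
  have "\<forall>j\<in>grid \<epsilon>. u (k + m) j = \<infinity>"
  proof (induction m)
    case (Suc m)
    have "u (k + Suc m) j = \<infinity>" if j: "j \<in> grid \<epsilon>" for j
    proof -
      have "grid_conv \<epsilon> K (\<lambda>j. gamma (u (k + m) j)) j = (\<Sum>\<^sub>\<infinity>l\<in>grid \<epsilon>. K l)"
        unfolding grid_conv_def using Suc j by (intro infsum_cong) (simp add: grid_diff)
      also have "\<dots> = 1" using K_mass by (simp add: has_sum_iff)
      finally have "1 \<le> gamma (u (Suc (k + m)) j)" using step[OF j, of "k + m"] by simp
      then show ?thesis using gamma_bounds(2)[of "u (Suc (k + m)) j"] by (simp flip: gamma_eq_1_iff)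
    qed
    then show ?case by blast
  qed (simp add: 0)
  then show ?thesis using assms(2) by blast
qed

text \<open>\<open>real_of_ereal\<close> turns infinity into 0, so \<open>Ur\<close> represents
  \<open>U\<close> only at times with \<open>finite_at k\<close>; testing finiteness at the origin
  decides it on the whole grid.\<close>

definition Ur :: "nat \<Rightarrow> real^'n \<Rightarrow> real" where
  "Ur k i = real_of_ereal (U k i)"

definition finite_at :: "nat \<Rightarrow> bool" where
  "finite_at k \<longleftrightarrow> u k 0 < \<infinity>"

lemma finite_at_mono: "finite_at (k + m) \<Longrightarrow> finite_at k"
  using infinite_stays[of 0 0 k m] by (auto simp: finite_at_def)

lemma finite_atD: "finite_at k \<Longrightarrow> i \<in> grid \<epsilon> \<Longrightarrow> u k i < \<infinity>"
  using infinite_stays[of i 0 k 0] by (auto simp: finite_at_def)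

lemma ereal_Ur: "finite_at k \<Longrightarrow> i \<in> grid \<epsilon> \<Longrightarrow> ereal (Ur k i) = U k i"
  using finite_atD[of k i] by (cases "u k i") (auto simp: Ur_def max_def zero_ereal_def)

lemma Ur_nonneg: "0 \<le> Ur k i"
  by (cases "u k i") (auto simp: Ur_def max_def)

lemma Ur_lipschitz:
  assumes "finite_at k" "i \<in> grid \<epsilon>" "j \<in> grid \<epsilon>"
  shows "Ur k i \<le> Ur k j + norm (i - j)"
  using U_lipschitz[OF assms(2,3), of k] by (simp flip: ereal_Ur[OF assms(1,2)] ereal_Ur[OF assms(1,3)])

lemma Ur_close_zero:
  assumes "finite_at k" "i \<in> grid \<epsilon>"
  shows "\<exists>j\<in>grid \<epsilon>. Ur k j = 0 \<and> norm (i - j) \<le> Ur k i + 4 * real CARD('n) * \<epsilon>"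
proof -
  have "U k i < \<infinity>" using assms by (simp flip: ereal_Ur)
  then obtain j where j: "j \<in> grid \<epsilon>" "u k j \<le> 0" "ereal (norm (i - j)) \<le> U k i + ereal (4 * real CARD('n) * \<epsilon>)"
    using U_close_zero[OF assms(2)] by blast
  have "Ur k j = 0" using j(2) by (simp add: Ur_def max_def)
  then show ?thesis using j(1,3) by (auto simp flip: ereal_Ur[OF assms])
qed

lemma Ur_pos: "0 < Ur k i \<Longrightarrow> u k i = ereal (Ur k i)"
  by (cases "u k i") (auto simp: Ur_def max_def split: if_splits)

lemma conv_le_tanh:
  assumes "i \<in> grid \<epsilon>" "0 < Ur (Suc k) i"
  shows "grid_conv \<epsilon> K (\<lambda>j. gamma (u k j)) i \<le> tanh (Ur (Suc k) i)"
proof (cases "0 < grid_conv \<epsilon> K (\<lambda>j. gamma (u k j)) i")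
  case True
  show ?thesis using step[OF assms(1) True] by (simp add: Ur_pos[OF assms(2)])
next
  case False
  moreover have "0 \<le> tanh (Ur (Suc k) i)" using assms by simp
  ultimately show ?thesis by linarith
qed

text \<open>The heat inequality at a point whose new value \<open>a\<close> is of order \<delta>. It
  cannot have dropped by more than \<open>M\<close> from the old value \<open>V 0\<close>. If it
  rose by more than \<open>M\<close>, cones alone suffice; otherwise old and new value agree up to
  \<open>M\<close> and everything is expanded around \<open>a\<close>.\<close>

lemma bend_step:
  assumes \<delta>: "0 < \<delta>" "\<delta> \<le> 1/4" and p: "p \<in> grid \<epsilon>" and fin: "finite_at (Suc k)"
    and a: "\<delta> / 2 \<le> Ur (Suc k) p" "Ur (Suc k) p \<le> 2 * \<delta>"
    and h1: "heat_M (real CARD('n)) * sqrt h \<le> \<delta> / 8"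
    and h2: "heat_C3 \<delta> * tail (\<delta> / 4) \<le> \<delta> * h"
  shows "(\<Sum>j\<in>stencil. K j * bend \<delta> (Ur k (p - j))) \<le> bend \<delta> (Ur (Suc k) p) + (heat_C (real CARD('n)) - 1) * \<delta> * h"
proof -
  define a where "a = Ur (Suc k) p"
  define V where "V j = Ur k (p - j)" for j
  define g where "g j = gamma (u k (p - j))" for j
  define M where "M = heat_M (real CARD('n)) * sqrt h"
  let ?\<kappa> = "real CARD('n)" and ?\<sigma> = "1 - (tanh (1::real))\<^sup>2"
  have a: "\<delta> / 2 \<le> a" "a \<le> 2 * \<delta>" using a by (auto simp: a_def)
  have s: "0 < sqrt h" "sqrt h * sqrt h = h" using h_pos by auto
  have "0 \<le> heat_M ?\<kappa>" using tanh_slope_pos by (simp add: heat_M_def)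
  then have M0: "0 \<le> M" "M \<le> \<delta> / 8" "M\<^sup>2 = (heat_M ?\<kappa>)\<^sup>2 * h"
    using h1 s by (auto simp: M_def power_mult_distrib)
  have fin: "finite_at k" using finite_at_mono[of k 1] fin by simp
  have grid: "p - j \<in> grid \<epsilon>" if "j \<in> grid \<epsilon>" for j using p that by (rule grid_diff)
  have V_nonneg: "0 \<le> V j" for j unfolding V_def by (rule Ur_nonneg)
  have V_le: "V j \<le> V 0 + norm j" if "j \<in> grid \<epsilon>" for j
    using Ur_lipschitz[OF fin grid[OF that] p] by (simp add: V_def)
  have V_ge: "V 0 - norm j \<le> V j" if "j \<in> grid \<epsilon>" for j
    using Ur_lipschitz[OF fin p grid[OF that]] by (simp add: V_def)
  have g_bdd: "\<bar>g j\<bar> \<le> 1" for j unfolding g_def by (rule gamma_bounds)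
  define c where "c = (\<Sum>\<^sub>\<infinity>j\<in>grid \<epsilon>. K j * g j)"
  have c: "c \<le> tanh a" using conv_le_tanh[OF p, of k] \<delta> a by (simp add: c_def g_def grid_conv_def a_def)
  have norm_le: "norm j \<le> sqrt h / 2 + 1 / (2 * sqrt h) * (norm j)\<^sup>2" for j :: "real^'n"
    by (rule le_half_add_square[OF s(1)])
  have hs: "h / sqrt h = sqrt h" using s by (simp add: real_div_sqrt)
  have V0_le: "V 0 \<le> a + M"
  proof (rule ccontr)
    assume neg: "\<not> V 0 \<le> a + M"
    then have V0: "a + M < V 0" "0 < V 0" using a \<delta> M0 by auto
    \<comment> \<open>The data lie above the cone with vertex at \<open>p\<close> and height
      \<open>V 0\<close>, whose average is smaller by at most (\<kappa> + 1/2) \<open>sqrt h\<close>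
      after applying tanh.\<close>
    have "tanh (V 0) - sqrt h / 2 + 0 \<bullet> j - 1 / (2 * sqrt h) * (norm j)\<^sup>2 \<le> g j" if j: "j \<in> grid \<epsilon>" for j
    proof -
      have "u k p \<le> u k (p - j) + ereal (norm j)" using grid_1_lipschitzD[OF lip p grid[OF j], of k] by simp
      then have "ereal (V 0) \<le> u k (p - j) + ereal (norm j)" using V0 Ur_pos[of k p] by (simp add: V_def)
      then have "ereal (V 0 - norm j) \<le> u k (p - j)" by (cases "u k (p - j)") auto
      then have "gamma (ereal (V 0 - norm j)) \<le> g j" unfolding g_def gamma_le_iff .
      then have "tanh (V 0 - norm j) \<le> g j" by simp
      moreover have "tanh (V 0) - norm j \<le> tanh (V 0 - norm j)"
        using tanh_diff_le[of "V 0 - norm j" "V 0"] by simp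
      ultimately show ?thesis using norm_le[of j] by simp
    qed
    from K_average_ge[OF g_bdd this] have "tanh (V 0) - sqrt h / 2 - 2 * ?\<kappa> * h * (1 / (2 * sqrt h)) \<le> c"
      by (simp add: c_def)
    moreover have "2 * ?\<kappa> * h * (1 / (2 * sqrt h)) = ?\<kappa> * (h / sqrt h)" by simp
    then have "2 * ?\<kappa> * h * (1 / (2 * sqrt h)) = ?\<kappa> * sqrt h" unfolding hs .
    ultimately have "tanh (V 0) \<le> tanh a + (?\<kappa> + 1 / 2) * sqrt h" using c by (simp add: algebra_simps)
    moreover have "(?\<kappa> + 1) * sqrt h \<le> tanh (a + M) - tanh a"
      using tanh_diff_ge[of a "a + M"] a \<delta> M0 tanh_slope_pos by (simp add: M_def heat_M_def)
    moreover have "tanh (a + M) < tanh (V 0)" using V0 by simp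
    moreover have "(?\<kappa> + 1 / 2) * sqrt h < (?\<kappa> + 1) * sqrt h" using s by simp
    ultimately show False by linarith
  qed
  have final: "heat_C1 * \<delta> * (2 * (2 * ?\<kappa> * h) + 2 * M\<^sup>2) + \<delta> * h \<le> (heat_C ?\<kappa> - 1) * \<delta> * h"
    by (simp add: heat_C_def M0(3) algebra_simps)
  have sq: "(x + y)\<^sup>2 \<le> 2 * x\<^sup>2 + 2 * y\<^sup>2" for x y :: real
    using zero_le_power2[of "x - y"] by (simp add: power2_eq_square algebra_simps)
  show ?thesis
  proof (cases "V 0 < a - M")
    case True
    \<comment> \<open>The old values lie below the cone a - M + |j|. Its gain \<open>M\<close>
      outweighs the average of |j|, so the first order term, with slope \<open>?d\<close> of the
      weight at \<open>a\<close>, is nonpositive.\<close>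
    let ?d = "1 + \<delta> * (a - \<delta>)"
    have "\<delta> * (\<delta> - a) \<le> \<delta> * (1 / 8)" using \<delta> a by (intro mult_left_mono) auto
    moreover have "?d = 1 - \<delta> * (\<delta> - a)" by (simp add: algebra_simps)
    ultimately have d: "0 \<le> ?d" using \<delta> by linarith
    let ?A = "bend \<delta> a + ?d * (sqrt h / 2 - M) + \<delta> * M\<^sup>2" and ?q = "?d / (2 * sqrt h) + \<delta>"
    have "(if j \<in> stencil then bend \<delta> (V j) else 0) \<le> ?A + 0 * g j + ?q * (norm j)\<^sup>2 + 0 * ((norm j)\<^sup>2 * of_bool (0 < norm j))"
      if j: "j \<in> grid \<epsilon>" for j
    proof -
      have "?d * (norm j - M) \<le> ?d * (sqrt h / 2 + 1 / (2 * sqrt h) * (norm j)\<^sup>2 - M)"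
        using norm_le[of j] d by (intro mult_left_mono) auto
      also have "\<dots> = ?d * (sqrt h / 2 - M) + ?d / (2 * sqrt h) * (norm j)\<^sup>2"
        by (simp add: algebra_simps)
      finally have 1: "?d * (norm j - M) \<le> ?d * (sqrt h / 2 - M) + ?d / (2 * sqrt h) * (norm j)\<^sup>2" .
      have "(norm j - M)\<^sup>2 \<le> 2 * (norm j)\<^sup>2 + 2 * M\<^sup>2" using sq[of "norm j" "- M"] by simp
      then have 2: "\<delta> / 2 * (norm j - M)\<^sup>2 \<le> \<delta> * (norm j)\<^sup>2 + \<delta> * M\<^sup>2"
        using \<delta> mult_left_mono[of _ _ "\<delta> / 2", OF \<open>(norm j - M)\<^sup>2 \<le> _\<close>] by (simp add: distrib_left)
      have 3: "bend \<delta> (a + (norm j - M)) \<le> ?A + ?q * (norm j)\<^sup>2"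
        unfolding bend_expand using 1 2 by (simp add: algebra_simps)
      show ?thesis
      proof (cases "j \<in> stencil")
        case True
        have "bend \<delta> (V j) \<le> bend \<delta> (a + (norm j - M))"
          using \<open>V 0 < a - M\<close> V_le[OF j] by (intro bend_mono \<delta> V_nonneg) auto
        then show ?thesis using True 3 by simp
      next
        case False
        then have "1 < norm j" using j by (auto simp: stencil_def)
        then have "0 \<le> a + (norm j - M)" using a \<delta> M0 by auto
        then have "0 \<le> bend \<delta> (a + (norm j - M))" using bend_ge[of \<delta> "a + (norm j - M)"] \<delta> by simp
        then show ?thesis using False 3 by simp
      qed
    qed
    from sum_stencil_le[OF g_bdd this]
    have "(\<Sum>j\<in>stencil. K j * bend \<delta> (V j)) \<le> ?A + ?q * (2 * ?\<kappa> * h)" by simp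
    also have "\<dots> = bend \<delta> a + ?d * (sqrt h / 2 - M + ?\<kappa> * (h / sqrt h)) + (\<delta> * M\<^sup>2 + \<delta> * (2 * ?\<kappa> * h))"
    proof -
      have "A + D * X + B + (D / (2 * sqrt h) + \<delta>) * (2 * ?\<kappa> * h) =
          A + D * (X + ?\<kappa> * (h / sqrt h)) + (B + \<delta> * (2 * ?\<kappa> * h))" for A B D X :: real
        by (simp add: distrib_left distrib_right)
      then show ?thesis .
    qed
    also have "\<dots> \<le> bend \<delta> a + 0 + (\<delta> * M\<^sup>2 + \<delta> * (2 * ?\<kappa> * h))"
    proof -
      have "(?\<kappa> + 1) / 1 \<le> heat_M ?\<kappa>"
        unfolding heat_M_def using tanh_slope_pos by (intro divide_left_mono) auto
      then have "(?\<kappa> + 1) * sqrt h \<le> M" unfolding M_def using s by (intro mult_right_mono) auto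
      then have "sqrt h / 2 - M + ?\<kappa> * (h / sqrt h) \<le> 0" unfolding hs distrib_right using s(1) by linarith
      then have "?d * (sqrt h / 2 - M + ?\<kappa> * (h / sqrt h)) \<le> 0" using d by (intro mult_nonneg_nonpos) auto
      then show ?thesis by linarith
    qed
    also have "\<dots> \<le> bend \<delta> a + (heat_C ?\<kappa> - 1) * \<delta> * h"
    proof -
      have "1 * (\<delta> * (2 * (2 * ?\<kappa> * h) + 2 * M\<^sup>2)) \<le> heat_C1 * (\<delta> * (2 * (2 * ?\<kappa> * h) + 2 * M\<^sup>2))"
        using heat_C1_ge_1 \<delta> h_pos by (intro mult_right_mono) auto
      moreover have "0 \<le> \<delta> * M\<^sup>2 + \<delta> * (2 * ?\<kappa> * h)" "0 \<le> \<delta> * h" using \<delta> h_pos by auto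
      ultimately show ?thesis using final by (simp add: algebra_simps)
    qed
    finally show ?thesis by (simp add: V_def a_def)
  next
    case False
    then have V0: "\<bar>V 0 - a\<bar> \<le> M" "\<delta> / 4 < V 0" using V0_le a M0 \<delta> by auto
    \<comment> \<open>With this slope the bound by \<open>g\<close> is linear in the convolution
      \<open>c\<close>, and \<open>c \<le> tanh a\<close> closes the estimate.\<close>
    define l where "l = (1 + \<delta> * (a - \<delta>)) / (1 - (tanh a)\<^sup>2)"
    note bl = bend_le_tanh[OF \<delta> a l_def]
    let ?A = "bend \<delta> a - l * tanh a + heat_C1 * \<delta> * (2 * M\<^sup>2)" and ?q = "heat_C1 * \<delta> * 2"
    have "(if j \<in> stencil then bend \<delta> (V j) else 0) \<le> ?A + l * g j + ?q * (norm j)\<^sup>2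
        + heat_C3 \<delta> * ((norm j)\<^sup>2 * of_bool (\<delta> / 4 < norm j))"
      if j: "j \<in> grid \<epsilon>" for j
    proof -
      define x where "x = V j - a"
      have x: "\<bar>x\<bar> \<le> norm j + M" using V_le[OF j] V_ge[OF j] V0 by (auto simp: x_def abs_le_iff)
      have "x\<^sup>2 \<le> (norm j + M)\<^sup>2" using power_mono[OF x, of 2] by simp
      also have "\<dots> \<le> 2 * (norm j)\<^sup>2 + 2 * M\<^sup>2" by (rule sq)
      finally have x2: "heat_C1 * \<delta> * x\<^sup>2 \<le> heat_C1 * \<delta> * (2 * (norm j)\<^sup>2 + 2 * M\<^sup>2)"
        using heat_C1_ge_1 \<delta> by (intro mult_left_mono) auto
      have fine: "bend \<delta> (V j) \<le> ?A + l * tanh (V j) + ?q * (norm j)\<^sup>2" if "\<bar>x\<bar> \<le> \<delta>"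
        using bl(3)[OF that] x2 by (simp add: x_def algebra_simps)
      have nn: "0 \<le> heat_C1 * \<delta> * (2 * M\<^sup>2)" "0 \<le> ?q * (norm j)\<^sup>2" "0 \<le> 4 * heat_C1 * (norm j)\<^sup>2"
        using heat_C1_ge_1 \<delta> by auto
      show ?thesis
      proof (cases "norm j \<le> \<delta> / 4")
        case True
        then have st: "j \<in> stencil" using j \<delta> by (simp add: stencil_def)
        have "0 < V j" using V_ge[OF j] V0 True by linarith
        then have "g j = tanh (V j)" using Ur_pos[of k "p - j"] by (simp add: V_def g_def)
        moreover have "\<bar>x\<bar> \<le> \<delta>" using x True M0 \<delta> by linarith
        ultimately show ?thesis using fine st True by simp
      next
        \<comment> \<open>For long shifts \<open>u\<close> may be negative where \<open>V\<close>
          vanishes, so \<open>g j\<close> and \<open>tanh (V j)\<close> can differ by almost 2.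
          \<open>heat_C3\<close> charges this to the tail of the kernel.\<close>
        case False
        then have big: "\<delta> / 4 < norm j" by simp
        have "(\<delta> / 4)\<^sup>2 \<le> (norm j)\<^sup>2" using big \<delta> by (intro power_mono) auto
        then have "1 \<le> 16 / \<delta>\<^sup>2 * (norm j)\<^sup>2" using \<delta> by (simp add: field_simps power2_eq_square)
        then have "2 * l * 1 \<le> 2 * (2 / ?\<sigma>) * (16 / \<delta>\<^sup>2 * (norm j)\<^sup>2)"
          using bl(1,2) tanh_slope_pos by (intro mult_mono) auto
        then have l2: "2 * l + 4 * heat_C1 * (norm j)\<^sup>2 \<le> heat_C3 \<delta> * (norm j)\<^sup>2"
          by (simp add: heat_C3_def algebra_simps)
        have gl: "l * t \<le> l * g j + 2 * l" if "t \<le> 1" for t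
          using mult_left_mono[of t "g j + 2" l] that g_bdd[of j] bl(1) by (simp add: algebra_simps abs_le_iff)
        show ?thesis
        proof (cases "j \<in> stencil")
          case True
          have "bend \<delta> (V j) \<le> ?A + l * tanh (V j) + ?q * (norm j)\<^sup>2 + 4 * heat_C1 * (norm j)\<^sup>2"
          proof (cases "\<bar>x\<bar> \<le> \<delta>")
            case True
            then show ?thesis using fine nn by linarith
          next
            case False
            then have "\<bar>x\<bar> \<le> 2 * norm j" using x M0 \<delta> by linarith
            then have "x\<^sup>2 \<le> 4 * (norm j)\<^sup>2" using power_mono[of "\<bar>x\<bar>" "2 * norm j" 2] by (simp add: power_mult_distrib)
            then have "heat_C1 * x\<^sup>2 \<le> heat_C1 * (4 * (norm j)\<^sup>2)" using heat_C1_ge_1 by (intro mult_left_mono) auto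
            then show ?thesis using bl(4)[of x] nn by (simp add: x_def algebra_simps)
          qed
          then show ?thesis using True big l2 gl[of "tanh (V j)"] tanh_real_lt_1[of "V j"] by simp
        next
          case False
          have "0 \<le> bend \<delta> a" using bend_ge[of \<delta> a] a \<delta> by simp
          then show ?thesis using False big l2 gl[of "tanh a"] tanh_real_lt_1[of a] nn by simp
        qed
      qed
    qed
    from sum_stencil_le[OF g_bdd this]
    have "(\<Sum>j\<in>stencil. K j * bend \<delta> (V j)) \<le> ?A + l * c + ?q * (2 * ?\<kappa> * h) + heat_C3 \<delta> * tail (\<delta> / 4)"
      by (simp add: c_def)
    also have "\<dots> \<le> bend \<delta> a + (heat_C1 * \<delta> * (2 * (2 * ?\<kappa> * h) + 2 * M\<^sup>2) + \<delta> * h)"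
      using h2 mult_left_mono[OF c bl(1)] by (simp add: algebra_simps)
    also have "\<dots> \<le> bend \<delta> a + (heat_C ?\<kappa> - 1) * \<delta> * h" using final by simp
    finally show ?thesis by (simp add: V_def a_def)
  qed
qed

section \<open>The inf-convolution and its heat inequality\<close>

definition Y :: "real \<Rightarrow> nat \<Rightarrow> real^'n \<Rightarrow> real" where
  "Y \<delta> k i = (INF p\<in>grid \<epsilon>. bend \<delta> (Ur k p) + norm (p - i))"

lemma Y_le:
  assumes "0 < \<delta>" "p \<in> grid \<epsilon>"
  shows "Y \<delta> k i \<le> bend \<delta> (Ur k p) + norm (p - i)"
  unfolding Y_def
proof (rule cINF_lower)
  show "bdd_below ((\<lambda>p. bend \<delta> (Ur k p) + norm (p - i)) ` grid \<epsilon>)"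
    using assms Ur_nonneg by (intro bdd_belowI2[of _ 0] add_nonneg_nonneg bend_nonneg) auto
qed fact

lemma Y_ge:
  assumes "0 < \<delta>" "finite_at k" "i \<in> grid \<epsilon>"
  shows "Ur k i \<le> Y \<delta> k i"
  unfolding Y_def
proof (rule cINF_greatest)
  show "grid \<epsilon> \<noteq> {}" using grid_0 by blast
  fix p :: "real^'n" assume p: "p \<in> grid \<epsilon>"
  show "Ur k i \<le> bend \<delta> (Ur k p) + norm (p - i)"
    using Ur_lipschitz[OF assms(2,3) p] bend_ge[of \<delta> "Ur k p"] assms(1) by (simp add: norm_minus_commute)
qed

text \<open>The competitor is a zero of \<open>Ur\<close> near \<open>i\<close>, where the weight is
  \<delta>^3 / 2. With \<open>Y_ge\<close> this traps \<open>Y\<close> near \<open>Ur\<close> up to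
  an error that does not depend on \<open>i\<close>.\<close>

lemma Y_le_Ur:
  assumes "0 < \<delta>" "finite_at k" "i \<in> grid \<epsilon>"
  shows "Y \<delta> k i \<le> Ur k i + 4 * real CARD('n) * \<epsilon> + \<delta> ^ 3 / 2"
proof -
  obtain j where j: "j \<in> grid \<epsilon>" "Ur k j = 0" "norm (i - j) \<le> Ur k i + 4 * real CARD('n) * \<epsilon>"
    using Ur_close_zero[OF assms(2,3)] by blast
  have "bend \<delta> 0 = \<delta> ^ 3 / 2" by (simp add: bend_def power3_eq_cube power2_eq_square)
  then show ?thesis using Y_le[OF assms(1) j(1), of k i] j by (simp add: norm_minus_commute)
qed

lemma Y_nonneg: "0 < \<delta> \<Longrightarrow> finite_at k \<Longrightarrow> i \<in> grid \<epsilon> \<Longrightarrow> 0 \<le> Y \<delta> k i"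
  using Y_ge Ur_nonneg order_trans by blast

text \<open>If \<open>p\<close> almost minimizes for \<open>i\<close> at the new time, then
  \<open>p - j\<close> is a competitor for \<open>i - j\<close> at the old time with the same
  distance \<open>norm (p - i)\<close>. So the inequality of \<open>bend_step\<close> at
  \<open>p\<close> passes to \<open>i\<close>. It remains to locate \<open>p\<close> at a height
  between \<delta> / 2 and 2 \<delta>.\<close>

lemma heat_step:
  assumes \<delta>: "0 < \<delta>" "\<delta> \<le> 1/4" and i: "i \<in> grid \<epsilon>" and fin: "finite_at (Suc k)"
    and pos: "2 * \<delta> < Ur (Suc k) i"
    and h1: "heat_M (real CARD('n)) * sqrt h \<le> \<delta> / 8"
    and h2: "heat_C3 \<delta> * tail (\<delta> / 4) \<le> \<delta> * h"
    and h3: "6 * real CARD('n) * \<epsilon> \<le> \<delta> ^ 3 / 64"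
  shows "(\<Sum>j\<in>stencil. K j * Y \<delta> k (i - j)) \<le> Y \<delta> (Suc k) i + heat_C (real CARD('n)) * \<delta> * h"
proof -
  define \<tau> where "\<tau> = min (\<delta> * h) (\<delta> ^ 3 / 64)"
  define e where "e = real CARD('n) * \<epsilon>"
  have e: "0 < e" using eps_pos by (simp add: e_def)
  have \<tau>: "0 < \<tau>" "\<tau> \<le> \<delta> * h" "\<tau> + 6 * e \<le> \<delta> ^ 3 / 32"
    using \<delta> h_pos h3 by (auto simp: \<tau>_def e_def)
  have d2: "\<delta>\<^sup>2 \<le> 1" using \<delta> by (simp add: power_le_one)
  have "\<delta> ^ 3 \<le> \<delta>" using \<delta> power_decreasing[of 1 3 \<delta>] by simp
  then have e\<delta>: "5 * e \<le> \<delta> / 8" using \<tau> e by linarith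
  have ne: "grid \<epsilon> \<noteq> ({} :: (real^'n) set)" using grid_0 by blast
  have "Y \<delta> (Suc k) i < Y \<delta> (Suc k) i + \<tau>" using \<tau> by simp
  then obtain p where p: "p \<in> grid \<epsilon>" "bend \<delta> (Ur (Suc k) p) + norm (p - i) < Y \<delta> (Suc k) i + \<tau>"
    unfolding Y_def[of _ _ i] using ne
    by (subst (asm) cINF_less_iff)
      (auto intro!: bdd_belowI2[of _ 0] add_nonneg_nonneg bend_nonneg Ur_nonneg simp: \<delta> less_imp_le)
  let ?V = "Ur (Suc k)"
  have better: "bend \<delta> (?V p) + norm (p - i) < bend \<delta> (?V q) + norm (q - i) + \<tau>" if "q \<in> grid \<epsilon>" for q
    using Y_le[OF \<delta>(1) that, of "Suc k" i] p(2) by linarith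
  \<comment> \<open>Below \<delta> the weight has slope less than 1: moving \<open>p\<close> by
    \<delta> / 4 towards \<open>i\<close> raises the weight by less than the distance it saves, with
    a margin of \<delta>^3 / 32.\<close>
  have low: "\<delta> / 2 \<le> ?V p"
  proof (rule ccontr)
    assume neg: "\<not> \<delta> / 2 \<le> ?V p"
    have "?V i \<le> ?V p + norm (i - p)" by (rule Ur_lipschitz[OF fin i p(1)])
    then have far: "\<delta> / 4 \<le> norm (i - p)" using pos neg \<delta> by linarith
    obtain q where q: "q \<in> grid \<epsilon>" "\<bar>norm (q - p) - \<delta> / 4\<bar> \<le> e" "norm (i - q) \<le> norm (i - p) - \<delta> / 4 + e"
      using grid_point_on_segment[OF eps_pos _ far] \<delta> by (auto simp: e_def)
    have "?V q \<le> ?V p + norm (q - p)" by (rule Ur_lipschitz[OF fin q(1) p(1)])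
    then have Vq: "?V q - ?V p \<le> \<delta> / 4 + e" "?V q \<le> 7 * \<delta> / 8" using q neg e\<delta> e by linarith+
    have "bend \<delta> (?V q) - bend \<delta> (?V p) \<le> (\<delta> / 4 + e) * (1 - \<delta>\<^sup>2 / 8)"
    proof (cases "?V p \<le> ?V q")
      case True
      have "\<delta> / 2 * (?V p + ?V q - 2 * \<delta>) \<le> \<delta> / 2 * (- (\<delta> / 4))" using \<delta> Vq neg by (intro mult_left_mono) auto
      then have "1 + \<delta> / 2 * (?V p + ?V q - 2 * \<delta>) \<le> 1 - \<delta>\<^sup>2 / 8" by (simp add: power2_eq_square)
      then show ?thesis unfolding bend_diff using True Vq d2
        by (intro order_trans[OF mult_left_mono mult_right_mono]) auto
    next
      case False
      then have "bend \<delta> (?V q) \<le> bend \<delta> (?V p)" using \<delta> Ur_nonneg by (intro bend_mono) auto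
      moreover have "0 \<le> (\<delta> / 4 + e) * (1 - \<delta>\<^sup>2 / 8)" using \<delta> e d2 by simp
      ultimately show ?thesis by linarith
    qed
    also have "\<dots> \<le> \<delta> / 4 + e - \<delta> ^ 3 / 32"
      using \<delta> e by (simp add: algebra_simps power2_eq_square power3_eq_cube)
    finally show False using better[OF q(1)] q(3) \<tau> e by (simp add: norm_minus_commute)
  qed
  \<comment> \<open>Above \<delta> the slope exceeds 1: moving \<open>p\<close> by \<delta> / 4
    towards a zero of \<open>?V\<close> lowers the weight by more than the distance it adds.\<close>
  have up: "?V p \<le> 2 * \<delta>"
  proof (rule ccontr)
    assume neg: "\<not> ?V p \<le> 2 * \<delta>"
    obtain z where z: "z \<in> grid \<epsilon>" "?V z = 0" "norm (p - z) \<le> ?V p + 4 * real CARD('n) * \<epsilon>"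
      using Ur_close_zero[OF fin p(1)] by blast
    have z3: "norm (z - p) \<le> ?V p + 4 * e" using z(3) by (simp add: e_def norm_minus_commute)
    have "?V p \<le> ?V z + norm (p - z)" by (rule Ur_lipschitz[OF fin p(1) z(1)])
    then have far: "\<delta> / 4 \<le> norm (z - p)" using neg z \<delta> by (simp add: norm_minus_commute)
    obtain q where q: "q \<in> grid \<epsilon>" "\<bar>norm (q - p) - \<delta> / 4\<bar> \<le> e" "norm (z - q) \<le> norm (z - p) - \<delta> / 4 + e"
      using grid_point_on_segment[OF eps_pos _ far] \<delta> by (auto simp: e_def)
    have "?V q \<le> ?V z + norm (q - z)" by (rule Ur_lipschitz[OF fin q(1) z(1)])
    define l where "l = \<delta> / 4 - 5 * e"
    have l: "\<delta> / 8 \<le> l" "l \<le> \<delta> / 4" using e e\<delta> by (auto simp: l_def)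
    have Vq: "?V q \<le> ?V p - l"
      using \<open>?V q \<le> ?V z + norm (q - z)\<close> z q z3 by (simp add: l_def norm_minus_commute)
    have "bend \<delta> (?V q) \<le> bend \<delta> (?V p - l)" using Vq \<delta> Ur_nonneg by (intro bend_mono) auto
    moreover have "l * (1 + \<delta>\<^sup>2 / 2) \<le> bend \<delta> (?V p) - bend \<delta> (?V p - l)"
    proof -
      have "\<delta> / 2 * \<delta> \<le> \<delta> / 2 * (?V p - l + ?V p - 2 * \<delta>)" using \<delta> neg l by (intro mult_left_mono) auto
      then have "l * (1 + \<delta>\<^sup>2 / 2) \<le> l * (1 + \<delta> / 2 * (?V p - l + ?V p - 2 * \<delta>))"
        using l \<delta> by (intro mult_left_mono) (auto simp: power2_eq_square)
      then show ?thesis unfolding bend_diff by simp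
    qed
    moreover have "\<delta> ^ 3 / 16 \<le> l * (\<delta>\<^sup>2 / 2)"
      using mult_right_mono[OF l(1), of "\<delta>\<^sup>2 / 2"] by (simp add: power2_eq_square power3_eq_cube)
    moreover have "norm (q - i) \<le> norm (p - i) + norm (q - p)"
      using norm_triangle_ineq[of "p - i" "q - p"] by simp
    moreover have "l * (1 + \<delta>\<^sup>2 / 2) = l + l * (\<delta>\<^sup>2 / 2)" by (simp add: algebra_simps)
    moreover have "0 \<le> \<delta> ^ 3" using \<delta> by simp
    ultimately show False using better[OF q(1)] q(2) \<tau> e unfolding l_def abs_le_iff by linarith
  qed
  have "(\<Sum>j\<in>stencil. K j * Y \<delta> k (i - j)) \<le> (\<Sum>j\<in>stencil. K j * bend \<delta> (Ur k (p - j)) + K j * norm (p - i))"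
  proof (rule sum_mono)
    fix j assume "j \<in> stencil"
    then have j: "j \<in> grid \<epsilon>" by (rule stencil_in_grid)
    have "Y \<delta> k (i - j) \<le> bend \<delta> (Ur k (p - j)) + norm (p - i)"
      using Y_le[OF \<delta>(1) grid_diff[OF p(1) j], of k "i - j"] by simp
    from mult_left_mono[OF this K_nonneg[OF j]]
    show "K j * Y \<delta> k (i - j) \<le> K j * bend \<delta> (Ur k (p - j)) + K j * norm (p - i)"
      by (simp add: algebra_simps)
  qed
  also have "\<dots> = (\<Sum>j\<in>stencil. K j * bend \<delta> (Ur k (p - j))) + (\<Sum>j\<in>stencil. K j) * norm (p - i)"
    by (simp add: sum.distrib sum_distrib_right)
  also have "\<dots> \<le> (bend \<delta> (?V p) + (heat_C (real CARD('n)) - 1) * \<delta> * h) + 1 * norm (p - i)"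
    by (intro add_mono bend_step[OF \<delta> p(1) fin low up h1 h2] mult_right_mono sum_stencil_K_le_1) auto
  also have "\<dots> \<le> Y \<delta> (Suc k) i + heat_C (real CARD('n)) * \<delta> * h"
    using p(2) \<tau> by (simp add: algebra_simps)
  finally show ?thesis .
qed

end

section \<open>Consistency of the kernels\<close>

lemma one_minus_cos_le: "1 - cos y \<le> y\<^sup>2 / 2" for y :: real
proof -
  have "1 - cos y = 2 * (sin (y / 2))\<^sup>2" using cos_double_sin[of "y / 2"] by simp
  also have "\<dots> \<le> 2 * (y / 2)\<^sup>2"
    using abs_sin_x_le_abs_x[of "y / 2"] by (simp add: abs_le_square_iff[symmetric] del: power_divide)
  finally show ?thesis by (simp add: power2_eq_square)
qed

lemma cos_gap:
  fixes y :: real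
  assumes "4 \<le> \<bar>y\<bar>"
  shows "y\<^sup>2 / 4 \<le> y\<^sup>2 / 2 - (1 - cos y)"
proof -
  have "16 \<le> y\<^sup>2" using power_mono[OF assms, of 2] by simp
  then show ?thesis using cos_ge_minus_one[of y] by linarith
qed

context grid_kernel
begin

text \<open>The second moment in direction \<xi> in units of \<open>h\<close>; \<open>four\<close>
  is the real part of the Fourier quotient in the consistency condition. As 1 - cos y \<le> y^2 / 2,
  the gap \<open>2 * pi\<^sup>2 * quad \<xi> - four \<xi>\<close> is nonnegative, and it is large if
  mass sits far from 0.\<close>

definition quad :: "real^'n \<Rightarrow> real" where
  "quad \<xi> = (\<Sum>\<^sub>\<infinity>j\<in>grid \<epsilon>. K j * (j \<bullet> \<xi>)\<^sup>2) / h"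

definition four :: "real^'n \<Rightarrow> real" where
  "four \<xi> = (\<Sum>\<^sub>\<infinity>j\<in>grid \<epsilon>. K j * (1 - cos (2 * pi * (j \<bullet> \<xi>)))) / h"

definition cov :: "'n \<Rightarrow> 'n \<Rightarrow> real" where
  "cov a b = (\<Sum>j\<in>stencil. K j * (j $ a * j $ b)) / h"

lemma has_sum_K_growth:
  assumes "\<And>j. j \<in> grid \<epsilon> \<Longrightarrow> \<bar>f j\<bar> \<le> a + b * (norm j)\<^sup>2"
  shows "((\<lambda>j. K j * f j) has_sum (\<Sum>\<^sub>\<infinity>j\<in>grid \<epsilon>. K j * f j)) (grid \<epsilon>)"
  by (rule has_sum_infsum[OF K_summable_growth[OF assms]])

lemma inner_sq_le: "(j \<bullet> \<xi>)\<^sup>2 \<le> (norm \<xi>)\<^sup>2 * (norm j)\<^sup>2" for j \<xi> :: "real^'n"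
  using power_mono[OF Cauchy_Schwarz_ineq2[of j \<xi>], of 2] by (simp add: power_mult_distrib mult.commute)

lemma has_sum_quad: "((\<lambda>j. K j * (j \<bullet> \<xi>)\<^sup>2) has_sum (h * quad \<xi>)) (grid \<epsilon>)"
proof -
  have "((\<lambda>j. K j * (j \<bullet> \<xi>)\<^sup>2) has_sum (\<Sum>\<^sub>\<infinity>j\<in>grid \<epsilon>. K j * (j \<bullet> \<xi>)\<^sup>2)) (grid \<epsilon>)"
    by (rule has_sum_K_growth[of _ 0 "(norm \<xi>)\<^sup>2"]) (use inner_sq_le in auto)
  then show ?thesis using h_pos by (simp add: quad_def)
qed

lemma has_sum_four: "((\<lambda>j. K j * (1 - cos (2 * pi * (j \<bullet> \<xi>)))) has_sum (h * four \<xi>)) (grid \<epsilon>)"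
proof -
  have "\<bar>1 - cos x\<bar> \<le> 2" for x :: real
    using cos_ge_minus_one[of x] cos_le_one[of x] by (simp add: abs_le_iff)
  then have "((\<lambda>j. K j * (1 - cos (2 * pi * (j \<bullet> \<xi>)))) has_sum
      (\<Sum>\<^sub>\<infinity>j\<in>grid \<epsilon>. K j * (1 - cos (2 * pi * (j \<bullet> \<xi>))))) (grid \<epsilon>)"
    by (intro has_sum_K_growth[of _ 2 0]) auto
  then show ?thesis using h_pos by (simp add: four_def)
qed

lemma Re_kernel_fourier: "Re ((1 - kernel_fourier \<epsilon> K \<xi>) / of_real h) = four \<xi>"
proof -
  let ?f = "\<lambda>j. of_real (K j) * exp (- 2 * \<i> * of_real pi * of_real (j \<bullet> \<xi>)) :: complex"
  have Kabs: "(\<lambda>j. norm (?f j)) summable_on grid \<epsilon>"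
  proof (rule summable_on_cong[THEN iffD2])
    show "norm (?f j) = K j" if "j \<in> grid \<epsilon>" for j
      using K_nonneg[OF that] by (simp add: norm_mult)
    show "K summable_on grid \<epsilon>" using K_mass by (auto simp: summable_on_def)
  qed
  then have "?f summable_on grid \<epsilon>" by (rule abs_summable_summable)
  then have "(?f has_sum kernel_fourier \<epsilon> K \<xi>) (grid \<epsilon>)"
    unfolding kernel_fourier_def by (rule has_sum_infsum)
  then have "((\<lambda>j. Re (?f j)) has_sum Re (kernel_fourier \<epsilon> K \<xi>)) (grid \<epsilon>)" by (rule has_sum_Re)
  then have 1: "((\<lambda>j. K j * cos (2 * pi * (j \<bullet> \<xi>))) has_sum Re (kernel_fourier \<epsilon> K \<xi>)) (grid \<epsilon>)"
    by (simp add: Re_exp)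
  have "((\<lambda>j. K j + (-1) * (K j * (1 - cos (2 * pi * (j \<bullet> \<xi>))))) has_sum (1 + (-1) * (h * four \<xi>))) (grid \<epsilon>)"
    by (intro has_sum_add has_sum_cmult_right K_mass has_sum_four)
  then have "((\<lambda>j. K j * cos (2 * pi * (j \<bullet> \<xi>))) has_sum (1 - h * four \<xi>)) (grid \<epsilon>)"
    by (simp add: algebra_simps)
  from has_sum_unique[OF 1 this] have "Re (kernel_fourier \<epsilon> K \<xi>) = 1 - h * four \<xi>" .
  moreover have "Re ((1 - kernel_fourier \<epsilon> K \<xi>) / of_real h) = (1 - Re (kernel_fourier \<epsilon> K \<xi>)) / h"
    by (simp only: Re_divide_of_real minus_complex.simps one_complex.simps)
  ultimately show ?thesis using h_pos by simp
qed

lemma has_sum_gap: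
  "((\<lambda>j. K j * ((2 * pi * (j \<bullet> \<xi>))\<^sup>2 / 2 - (1 - cos (2 * pi * (j \<bullet> \<xi>))))) has_sum
     (h * (2 * pi\<^sup>2 * quad \<xi> - four \<xi>))) (grid \<epsilon>)"
proof -
  have "((\<lambda>j. 2 * pi\<^sup>2 * (K j * (j \<bullet> \<xi>)\<^sup>2) + (-1) * (K j * (1 - cos (2 * pi * (j \<bullet> \<xi>))))) has_sum
      (2 * pi\<^sup>2 * (h * quad \<xi>) + (-1) * (h * four \<xi>))) (grid \<epsilon>)"
    by (intro has_sum_add has_sum_cmult_right has_sum_quad has_sum_four)
  then show ?thesis by (simp add: algebra_simps power2_eq_square)
qed

lemma four_le_quad: "four \<xi> \<le> 2 * pi\<^sup>2 * quad \<xi>"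
proof -
  have "0 \<le> h * (2 * pi\<^sup>2 * quad \<xi> - four \<xi>)"
    using has_sum_gap
    by (rule has_sum_nonneg) (intro mult_nonneg_nonneg K_nonneg diff_ge_0_iff_ge[THEN iffD2] one_minus_cos_le)
  then show ?thesis using h_pos by (simp add: zero_le_mult_iff)
qed

lemma has_sum_sum_components:
  assumes "\<And>k. ((\<lambda>j. K j * f k j) has_sum S k) (grid \<epsilon>)"
  shows "((\<lambda>j. K j * (\<Sum>k\<in>(UNIV :: 'n set). f k j)) has_sum (\<Sum>k\<in>UNIV. S k)) (grid \<epsilon>)"
proof -
  have "((\<lambda>j. \<Sum>k\<in>A. K j * f k j) has_sum (\<Sum>k\<in>A. S k)) (grid \<epsilon>)" if "finite A" for A :: "'n set"
    using that by (induction A) (auto intro!: has_sum_add assms)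
  from this[of UNIV] show ?thesis by (simp add: sum_distrib_left)
qed

lemma norm_sq_components: "(norm j)\<^sup>2 = (\<Sum>k\<in>UNIV. (j $ k)\<^sup>2)" for j :: "real^'n"
  by (simp add: norm_vec_def L2_set_def sum_nonneg)

text \<open>The trace of the second moment matrix is fixed by the definition of \<open>h\<close>.
  This turns the one-sided bounds \<open>four_le_quad\<close> into equalities in the limit.\<close>

lemma sum_quad: "(\<Sum>k\<in>UNIV. quad (axis k 1)) = 2 * real CARD('n)"
proof -
  have "((\<lambda>j. K j * (\<Sum>k\<in>UNIV. (j \<bullet> axis k 1)\<^sup>2)) has_sum (\<Sum>k\<in>UNIV. h * quad (axis k 1))) (grid \<epsilon>)"
    by (intro has_sum_sum_components has_sum_quad)
  then have "((\<lambda>j. K j * (norm j)\<^sup>2) has_sum (h * (\<Sum>k\<in>UNIV. quad (axis k 1)))) (grid \<epsilon>)"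
    by (simp add: norm_sq_components inner_axis sum_distrib_left)
  from has_sum_unique[OF this has_sum_second_moment] show ?thesis using h_pos by simp
qed

text \<open>A long \<open>j\<close> has a component of size at least r / \<kappa>. The frequency
  \<open>l\<close> is so large that the phase of this component is at least 4 in absolute value,
  where the gap of \<open>cos_gap\<close> is a fixed part of the square and hence controls
  |j|^2.\<close>

lemma tail_le_gap:
  assumes r: "0 < r" and l: "0 < l" "4 * real CARD('n) \<le> 2 * pi * l * r"
  shows "tail r / h \<le> real CARD('n) / (pi\<^sup>2 * l\<^sup>2) *
    (\<Sum>k\<in>UNIV. 2 * pi\<^sup>2 * quad (l *\<^sub>R axis k 1) - four (l *\<^sub>R axis k 1))"
proof -
  let ?\<kappa> = "real CARD('n)"
  let ?g = "\<lambda>k j. (2 * pi * (j \<bullet> (l *\<^sub>R axis k 1)))\<^sup>2 / 2 - (1 - cos (2 * pi * (j \<bullet> (l *\<^sub>R axis k 1))))"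
  let ?S = "\<Sum>k\<in>UNIV. h * (2 * pi\<^sup>2 * quad (l *\<^sub>R axis k 1) - four (l *\<^sub>R axis k 1))"
  have g0: "0 \<le> ?g k j" for k :: 'n and j using one_minus_cos_le by simp
  have "((\<lambda>j. K j * (\<Sum>k\<in>UNIV. ?g k j)) has_sum ?S) (grid \<epsilon>)"
    by (intro has_sum_sum_components has_sum_gap)
  then have up: "((\<lambda>j. (?\<kappa> / (pi\<^sup>2 * l\<^sup>2)) * (K j * (\<Sum>k\<in>UNIV. ?g k j))) has_sum ((?\<kappa> / (pi\<^sup>2 * l\<^sup>2)) * ?S)) (grid \<epsilon>)"
    by (rule has_sum_cmult_right)
  have "tail r \<le> (?\<kappa> / (pi\<^sup>2 * l\<^sup>2)) * ?S"
  proof (rule has_sum_mono[OF has_sum_tail[of r] up])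
    fix j :: "real^'n" assume j: "j \<in> grid \<epsilon>"
    have "(norm j)\<^sup>2 * of_bool (r < norm j) \<le> (?\<kappa> / (pi\<^sup>2 * l\<^sup>2)) * (\<Sum>k\<in>UNIV. ?g k j)"
    proof (cases "r < norm j")
      case True
      obtain k where k: "\<And>k'. \<bar>j $ k'\<bar> \<le> \<bar>j $ k\<bar>"
      proof -
        obtain k where "\<bar>j $ k\<bar> = Max (range (\<lambda>k. \<bar>j $ k\<bar>))"
          using Max_in[of "range (\<lambda>k. \<bar>j $ k\<bar>)"] by fastforce
        then have "\<bar>j $ k'\<bar> \<le> \<bar>j $ k\<bar>" for k' by simp
        then show ?thesis by (rule that)
      qed
      have "norm j \<le> ?\<kappa> * \<bar>j $ k\<bar>" by (rule norm_le_card_mult[OF k])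
      then have rk: "r \<le> ?\<kappa> * \<bar>j $ k\<bar>" using True by simp
      have "(norm j)\<^sup>2 \<le> ?\<kappa> * (j $ k)\<^sup>2"
        unfolding norm_sq_components using k by (intro order_trans[OF sum_bounded_above]) (auto simp: abs_le_square_iff)
      also have "\<dots> = (?\<kappa> / (pi\<^sup>2 * l\<^sup>2)) * ((2 * pi * (j \<bullet> (l *\<^sub>R axis k 1)))\<^sup>2 / 4)"
        using l by (simp add: inner_axis power_mult_distrib)
      also have "\<dots> \<le> (?\<kappa> / (pi\<^sup>2 * l\<^sup>2)) * ?g k j"
      proof (intro mult_left_mono cos_gap)
        have "4 * ?\<kappa> \<le> 2 * pi * l * (?\<kappa> * \<bar>j $ k\<bar>)"
          using l(1) by (intro order_trans[OF l(2)] mult_left_mono rk) simp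
        also have "\<dots> = (2 * pi * l * \<bar>j $ k\<bar>) * ?\<kappa>" by simp
        finally have "4 \<le> 2 * pi * l * \<bar>j $ k\<bar>" by (rule mult_right_le_imp_le) simp
        then show "4 \<le> \<bar>2 * pi * (j \<bullet> (l *\<^sub>R axis k 1))\<bar>"
          using l(1) by (simp add: inner_axis abs_mult)
      qed simp
      also have "\<dots> \<le> (?\<kappa> / (pi\<^sup>2 * l\<^sup>2)) * (\<Sum>k\<in>UNIV. ?g k j)"
        by (intro mult_left_mono member_le_sum[where f = "\<lambda>k. ?g k j"] g0) auto
      finally show ?thesis using True by simp
    next
      case False
      then have "(norm j)\<^sup>2 * of_bool (r < norm j) = 0" by simp
      moreover have "0 \<le> (?\<kappa> / (pi\<^sup>2 * l\<^sup>2)) * (\<Sum>k\<in>UNIV. ?g k j)"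
        by (intro mult_nonneg_nonneg sum_nonneg g0) simp
      ultimately show ?thesis by (simp only:)
    qed
    from mult_left_mono[OF this K_nonneg[OF j]]
    show "K j * ((norm j)\<^sup>2 * of_bool (r < norm j)) \<le> (?\<kappa> / (pi\<^sup>2 * l\<^sup>2)) * (K j * (\<Sum>k\<in>UNIV. ?g k j))"
      by (simp only: mult.left_commute[of "K j" "?\<kappa> / (pi\<^sup>2 * l\<^sup>2)"])
  qed
  moreover have "?S = (\<Sum>k\<in>UNIV. 2 * pi\<^sup>2 * quad (l *\<^sub>R axis k 1) - four (l *\<^sub>R axis k 1)) * h"
    by (simp only: sum_distrib_right mult.commute[of h])
  ultimately show ?thesis using h_pos by (simp only: pos_divide_le_eq mult.assoc)
qed

lemma quad_scale: "quad (l *\<^sub>R \<xi>) = l\<^sup>2 * quad \<xi>"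
proof -
  have "((\<lambda>j. l\<^sup>2 * (K j * (j \<bullet> \<xi>)\<^sup>2)) has_sum (l\<^sup>2 * (h * quad \<xi>))) (grid \<epsilon>)"
    by (intro has_sum_cmult_right has_sum_quad)
  then have "((\<lambda>j. K j * (j \<bullet> (l *\<^sub>R \<xi>))\<^sup>2) has_sum (l\<^sup>2 * (h * quad \<xi>))) (grid \<epsilon>)"
    by (simp add: power_mult_distrib mult.left_commute)
  from has_sum_unique[OF has_sum_quad this] show ?thesis using h_pos by simp
qed

lemma quad_parallelogram: "quad (x + y) + quad (x - y) = 2 * quad x + 2 * quad y"
proof -
  have 1: "((\<lambda>j. K j * (j \<bullet> (x + y))\<^sup>2 + K j * (j \<bullet> (x - y))\<^sup>2) has_sum (h * quad (x + y) + h * quad (x - y))) (grid \<epsilon>)"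
    by (intro has_sum_add has_sum_quad)
  have "((\<lambda>j. 2 * (K j * (j \<bullet> x)\<^sup>2) + 2 * (K j * (j \<bullet> y)\<^sup>2)) has_sum (2 * (h * quad x) + 2 * (h * quad y))) (grid \<epsilon>)"
    by (intro has_sum_add has_sum_cmult_right has_sum_quad)
  moreover have "(\<lambda>j. 2 * (K j * (j \<bullet> x)\<^sup>2) + 2 * (K j * (j \<bullet> y)\<^sup>2)) = (\<lambda>j. K j * (j \<bullet> (x + y))\<^sup>2 + K j * (j \<bullet> (x - y))\<^sup>2)"
    by (simp add: fun_eq_iff inner_add_right inner_diff_right power2_eq_square algebra_simps)
  ultimately have "h * quad (x + y) + h * quad (x - y) = 2 * (h * quad x) + 2 * (h * quad y)"
    using has_sum_unique[OF 1] by simp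
  then have "h * (quad (x + y) + quad (x - y)) = h * (2 * quad x + 2 * quad y)" by (simp add: algebra_simps)
  then show ?thesis using h_pos by simp
qed

text \<open>Polarization gives the full covariance in terms of \<open>quad\<close>; restricting it
  to the stencil costs at most \<open>tail 1\<close>, because |j_a j_b| \<le> |j|^2.\<close>

lemma cov_quad:
  "\<bar>cov a b - (quad (axis a 1 + axis b 1) - quad (axis a 1) - quad (axis b 1)) / 2\<bar> \<le> tail 1 / h"
proof -
  let ?c = "(h * quad (axis a 1 + axis b 1) + (-1) * (h * quad (axis a 1)) + (-1) * (h * quad (axis b 1))) / 2"
  have "((\<lambda>j. (1/2) * (K j * (j \<bullet> (axis a 1 + axis b 1))\<^sup>2 + (-1) * (K j * (j \<bullet> axis a 1)\<^sup>2)
      + (-1) * (K j * (j \<bullet> axis b 1)\<^sup>2))) has_sum ((1/2) * (h * quad (axis a 1 + axis b 1) + (-1) * (h * quad (axis a 1))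
      + (-1) * (h * quad (axis b 1))))) (grid \<epsilon>)"
    by (intro has_sum_cmult_right has_sum_add has_sum_quad)
  then have full: "((\<lambda>j. K j * (j $ a * j $ b)) has_sum ?c) (grid \<epsilon>)"
    by (simp add: inner_add_right inner_axis power2_eq_square algebra_simps add_divide_distrib diff_divide_distrib)
  have "((\<lambda>j. K j * (j $ a * j $ b)) has_sum (h * cov a b)) stencil"
    using has_sum_finite[of stencil "\<lambda>j. K j * (j $ a * j $ b)"] h_pos by (simp add: cov_def)
  then have part: "((\<lambda>j. K j * (of_bool (norm j \<le> 1) * (j $ a * j $ b))) has_sum (h * cov a b)) (grid \<epsilon>)"
    by (rule has_sum_cong_neutral[THEN iffD1, rotated -1]) (auto simp: stencil_def)
  have le: "\<bar>j $ a * j $ b\<bar> \<le> (norm j)\<^sup>2" for j :: "real^'n"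
    unfolding abs_mult power2_eq_square by (intro mult_mono component_le_norm_cart) auto
  have pw: "\<bar>K j * (of_bool (norm j \<le> 1) * (j $ a * j $ b)) - K j * (j $ a * j $ b)\<bar> \<le> K j * ((norm j)\<^sup>2 * of_bool (1 < norm j))"
    if "j \<in> grid \<epsilon>" for j
    using mult_left_mono[OF le[of j] K_nonneg[OF that]] K_nonneg[OF that] by (auto simp: abs_mult of_bool_def)
  have "h * cov a b \<le> ?c + tail 1"
  proof (rule has_sum_mono[OF part has_sum_add[OF full has_sum_tail]])
    fix j :: "real^'n" assume "j \<in> grid \<epsilon>"
    from pw[OF this] show "K j * (of_bool (norm j \<le> 1) * (j $ a * j $ b)) \<le>
        K j * (j $ a * j $ b) + K j * ((norm j)\<^sup>2 * of_bool (1 < norm j))" by linarith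
  qed
  moreover have "?c \<le> h * cov a b + tail 1"
  proof (rule has_sum_mono[OF full has_sum_add[OF part has_sum_tail]])
    fix j :: "real^'n" assume "j \<in> grid \<epsilon>"
    from pw[OF this] show "K j * (j $ a * j $ b) \<le>
        K j * (of_bool (norm j \<le> 1) * (j $ a * j $ b)) + K j * ((norm j)\<^sup>2 * of_bool (1 < norm j))" by linarith
  qed
  ultimately have "\<bar>h * cov a b - ?c\<bar> \<le> tail 1" by linarith
  moreover have "h * cov a b - ?c = h * (cov a b - (quad (axis a 1 + axis b 1) - quad (axis a 1) - quad (axis b 1)) / 2)"
    by (simp add: algebra_simps)
  ultimately show ?thesis using h_pos by (simp add: abs_mult pos_le_divide_eq mult.commute)
qed

end

section \<open>Isotropy and concentration of the kernels in the limit\<close>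

locale kernel_sequence =
  fixes \<epsilon> :: "nat \<Rightarrow> real" and K :: "nat \<Rightarrow> real^'n \<Rightarrow> real"
  assumes kernel: "\<And>n. grid_kernel (\<epsilon> n) (K n)"
    and eps_lim: "\<epsilon> \<longlonglongrightarrow> 0"
    and h_lim: "(\<lambda>n. kernel_h (\<epsilon> n) (K n)) \<longlonglongrightarrow> 0"
    and fourier_lim: "\<And>\<xi>. (\<lambda>n. (1 - kernel_fourier (\<epsilon> n) (K n) \<xi>) / of_real (kernel_h (\<epsilon> n) (K n)))
           \<longlonglongrightarrow> of_real (4 * pi\<^sup>2 * (norm \<xi>)\<^sup>2)"
begin

abbreviation "hh n \<equiv> kernel_h (\<epsilon> n) (K n)"
abbreviation "quad n \<equiv> grid_kernel.quad (\<epsilon> n) (K n)"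
abbreviation "four n \<equiv> grid_kernel.four (\<epsilon> n) (K n)"
abbreviation "tail n \<equiv> grid_kernel.tail (\<epsilon> n) (K n)"
abbreviation "stencil n \<equiv> (grid_kernel.stencil (\<epsilon> n) :: (real^'n) set)"
abbreviation "cov n \<equiv> grid_kernel.cov (\<epsilon> n) (K n)"

lemma four_lim: "(\<lambda>n. four n \<xi>) \<longlonglongrightarrow> 4 * pi\<^sup>2 * (norm \<xi>)\<^sup>2"
  using tendsto_Re[OF fourier_lim[of \<xi>]] by (simp only: grid_kernel.Re_kernel_fourier[OF kernel] Re_complex_of_real)

text \<open>By the trace identity the first terms add up to an exact constant, and the Fourier
  limits along the axes make the second terms add up to the same constant.\<close>

lemma sum_gap_lim:
  "(\<lambda>n. \<Sum>k\<in>UNIV. 2 * pi\<^sup>2 * quad n (l *\<^sub>R axis k 1) - four n (l *\<^sub>R axis k 1)) \<longlonglongrightarrow> 0"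
proof -
  have eq: "(\<Sum>k\<in>UNIV. 2 * pi\<^sup>2 * quad n (l *\<^sub>R axis k 1) - four n (l *\<^sub>R axis k 1)) =
      4 * pi\<^sup>2 * l\<^sup>2 * real CARD('n) - (\<Sum>k\<in>UNIV. four n (l *\<^sub>R axis k 1))" for n
    using grid_kernel.sum_quad[OF kernel, of n]
    by (simp add: sum_subtractf grid_kernel.quad_scale[OF kernel] mult.assoc flip: sum_distrib_left)
  have "(\<lambda>n. 4 * pi\<^sup>2 * l\<^sup>2 * real CARD('n) - (\<Sum>k\<in>UNIV. four n (l *\<^sub>R axis k 1))) \<longlonglongrightarrow>
      4 * pi\<^sup>2 * l\<^sup>2 * real CARD('n) - (\<Sum>k\<in>(UNIV :: 'n set). 4 * pi\<^sup>2 * (norm (l *\<^sub>R axis k 1 :: real^'n))\<^sup>2)"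
    by (intro tendsto_intros four_lim)
  then show ?thesis unfolding eq by simp
qed

lemma tail_lim:
  assumes "0 < r"
  shows "(\<lambda>n. tail n r / hh n) \<longlonglongrightarrow> 0"
proof -
  define l where "l = 4 * real CARD('n) / (2 * pi * r)"
  have l: "0 < l" "4 * real CARD('n) \<le> 2 * pi * l * r" using assms by (auto simp: l_def)
  show ?thesis
  proof (rule tendsto_sandwich)
    show "\<forall>\<^sub>F n in sequentially. 0 \<le> tail n r / hh n"
      using grid_kernel.tail_nonneg[OF kernel] grid_kernel.h_pos[OF kernel] by (simp add: less_imp_le)
    show "\<forall>\<^sub>F n in sequentially. tail n r / hh n \<le> real CARD('n) / (pi\<^sup>2 * l\<^sup>2) *
        (\<Sum>k\<in>UNIV. 2 * pi\<^sup>2 * quad n (l *\<^sub>R axis k 1) - four n (l *\<^sub>R axis k 1))"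
      by (intro always_eventually allI grid_kernel.tail_le_gap[OF kernel assms l])
    show "(\<lambda>n. real CARD('n) / (pi\<^sup>2 * l\<^sup>2) *
        (\<Sum>k\<in>UNIV. 2 * pi\<^sup>2 * quad n (l *\<^sub>R axis k 1) - four n (l *\<^sub>R axis k 1))) \<longlonglongrightarrow> 0"
      using tendsto_mult_left[OF sum_gap_lim, of _ l] by (simp only: mult_zero_right)
  qed simp
qed

text \<open>The gaps are nonnegative and their sum tends to 0, so each of them does.\<close>

lemma quad_axis_lim: "(\<lambda>n. quad n (axis k 1)) \<longlonglongrightarrow> 2"
proof -
  have "(\<lambda>n. 2 * pi\<^sup>2 * quad n (axis k 1) - four n (axis k 1)) \<longlonglongrightarrow> 0"
  proof (rule tendsto_sandwich)
    have nn: "0 \<le> 2 * pi\<^sup>2 * quad n \<xi> - four n \<xi>" for n \<xi>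
      using grid_kernel.four_le_quad[OF kernel] by simp
    then show "\<forall>\<^sub>F n in sequentially. 0 \<le> 2 * pi\<^sup>2 * quad n (axis k 1) - four n (axis k 1)" by simp
    show "\<forall>\<^sub>F n in sequentially. 2 * pi\<^sup>2 * quad n (axis k 1) - four n (axis k 1) \<le>
        (\<Sum>k\<in>UNIV. 2 * pi\<^sup>2 * quad n (1 *\<^sub>R axis k 1) - four n (1 *\<^sub>R axis k 1))"
      using member_le_sum[of k UNIV "\<lambda>k. 2 * pi\<^sup>2 * quad _ (axis k 1) - four _ (axis k 1)"] nn
      by (intro always_eventually allI) simp
  qed (use sum_gap_lim[of 1] in simp_all)
  then have "(\<lambda>n. ((2 * pi\<^sup>2 * quad n (axis k 1) - four n (axis k 1)) + four n (axis k 1)) / (2 * pi\<^sup>2)) \<longlonglongrightarrow>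
      (0 + 4 * pi\<^sup>2 * (norm (axis k 1 :: real^'n))\<^sup>2) / (2 * pi\<^sup>2)"
    by (intro tendsto_intros four_lim) auto
  then show ?thesis by simp
qed

text \<open>The Fourier limit bounds each direction from below. For the upper bound in direction e_a
  + e_b the parallelogram law uses the lower bound in direction e_a - e_b.\<close>

lemma quad_axis_add_lim:
  assumes "a \<noteq> b"
  shows "(\<lambda>n. quad n (axis a 1 + axis b 1)) \<longlonglongrightarrow> 4"
proof (rule tendsto_sandwich)
  have n: "(norm (axis a 1 + axis b 1 :: real^'n))\<^sup>2 = 2" "(norm (axis a 1 - axis b 1 :: real^'n))\<^sup>2 = 2"
    using assms by (simp_all add: power2_norm_eq_inner inner_add_left inner_diff_left inner_add_right inner_diff_right inner_axis)
       (simp_all add: axis_def)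
  have low: "four n \<xi> / (2 * pi\<^sup>2) \<le> quad n \<xi>" for n \<xi>
    using grid_kernel.four_le_quad[OF kernel, of n \<xi>] by (simp add: divide_le_eq mult.commute)
  show "\<forall>\<^sub>F n in sequentially. four n (axis a 1 + axis b 1) / (2 * pi\<^sup>2) \<le> quad n (axis a 1 + axis b 1)"
    using low by simp
  show "(\<lambda>n. four n (axis a 1 + axis b 1) / (2 * pi\<^sup>2)) \<longlonglongrightarrow> 4"
    using tendsto_divide[OF four_lim[of "axis a 1 + axis b 1"] tendsto_const[of "2 * pi\<^sup>2"]] by (simp add: n)
  show "\<forall>\<^sub>F n in sequentially. quad n (axis a 1 + axis b 1) \<le>
      2 * quad n (axis a 1) + 2 * quad n (axis b 1) - four n (axis a 1 - axis b 1) / (2 * pi\<^sup>2)"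
  proof (intro always_eventually allI)
    fix n
    show "quad n (axis a 1 + axis b 1) \<le>
      2 * quad n (axis a 1) + 2 * quad n (axis b 1) - four n (axis a 1 - axis b 1) / (2 * pi\<^sup>2)"
      using low[of n "axis a 1 - axis b 1"] grid_kernel.quad_parallelogram[OF kernel, of n "axis a 1" "axis b 1"]
      by linarith
  qed
  have "(\<lambda>n. 2 * quad n (axis a 1) + 2 * quad n (axis b 1) - four n (axis a 1 - axis b 1) / (2 * pi\<^sup>2)) \<longlonglongrightarrow>
      2 * 2 + 2 * 2 - (4 * pi\<^sup>2 * (norm (axis a 1 - axis b 1 :: real^'n))\<^sup>2) / (2 * pi\<^sup>2)"
    by (intro tendsto_intros quad_axis_lim four_lim) auto
  then show "(\<lambda>n. 2 * quad n (axis a 1) + 2 * quad n (axis b 1) - four n (axis a 1 - axis b 1) / (2 * pi\<^sup>2)) \<longlonglongrightarrow> 4"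
    by (simp add: n)
qed

lemma cov_lim: "(\<lambda>n. cov n a b) \<longlonglongrightarrow> (if a = b then 2 else 0)"
proof -
  let ?q = "\<lambda>n. (quad n (axis a 1 + axis b 1) - quad n (axis a 1) - quad n (axis b 1)) / 2"
  have q: "?q \<longlonglongrightarrow> (if a = b then 2 else 0)"
  proof (cases "a = b")
    case True
    have "axis a 1 + axis a 1 = 2 *\<^sub>R (axis a 1 :: real^'n)" by (simp add: scaleR_2)
    then have "?q = (\<lambda>n. quad n (axis a 1))" using True by (simp add: grid_kernel.quad_scale[OF kernel] fun_eq_iff)
    then show ?thesis using True quad_axis_lim by simp
  next
    case False
    have "?q \<longlonglongrightarrow> (4 - 2 - 2) / 2" by (intro tendsto_intros quad_axis_add_lim quad_axis_lim False) auto
    then show ?thesis using False by simp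
  qed
  have "(\<lambda>n. cov n a b - ?q n) \<longlonglongrightarrow> 0"
  proof (rule Lim_null_comparison)
    show "\<forall>\<^sub>F n in sequentially. norm (cov n a b - ?q n) \<le> tail n 1 / hh n"
      unfolding real_norm_def by (intro always_eventually allI grid_kernel.cov_quad[OF kernel])
    show "(\<lambda>n. tail n 1 / hh n) \<longlonglongrightarrow> 0" by (rule tail_lim) simp
  qed
  from tendsto_add[OF this q] show ?thesis by simp
qed

end

section \<open>Test functions\<close>

lemma iter_deriv_has_derivative:
  assumes "smooth_fun f"
  shows "(iter_deriv vs f has_derivative (\<lambda>v. iter_deriv (v # vs) f z)) (at z)"
proof -
  have "iter_deriv vs f differentiable at z"
    using assms by (auto simp: smooth_fun_def differentiable_on_def)
  then show ?thesis by (simp add: frechet_derivative_works)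
qed

lemma iter_deriv_continuous: "smooth_fun f \<Longrightarrow> continuous_on UNIV (iter_deriv vs f)"
  by (simp add: smooth_fun_def differentiable_imp_continuous_on)

lemma iter_deriv_isCont: "smooth_fun f \<Longrightarrow> isCont (iter_deriv vs f) z"
  using iter_deriv_continuous continuous_on_eq_continuous_at open_UNIV by blast

lemma iter_deriv_linear: "smooth_fun f \<Longrightarrow> linear (\<lambda>v. iter_deriv (v # vs) f z)"
  by (rule has_derivative_linear[OF iter_deriv_has_derivative])

lemma iter_deriv_line:
  assumes "smooth_fun f"
  shows "((\<lambda>s. iter_deriv vs f (z + s *\<^sub>R v)) has_real_derivative iter_deriv (v # vs) f (z + s *\<^sub>R v)) (at s)"
proof -
  have "((\<lambda>s. z + s *\<^sub>R v) has_derivative (\<lambda>s. s *\<^sub>R v)) (at s)"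
    by (auto intro!: derivative_eq_intros)
  from diff_chain_at[OF this iter_deriv_has_derivative[OF assms]]
  have "((\<lambda>s. iter_deriv vs f (z + s *\<^sub>R v)) has_derivative (\<lambda>r. iter_deriv ((r *\<^sub>R v) # vs) f (z + s *\<^sub>R v))) (at s)"
    by (simp add: o_def)
  moreover have "iter_deriv ((r *\<^sub>R v) # vs) f w = r * iter_deriv (v # vs) f w" for r w
    using linear_scale[OF iter_deriv_linear[OF assms]] by auto
  ultimately show ?thesis by (simp add: has_field_derivative_def mult_commute_abs)
qed

lemma iter_deriv_mean_value:
  assumes "smooth_fun f" "0 < s"
  obtains r where "0 < r" "r < s" "f (z + s *\<^sub>R v) - f z = s * iter_deriv [v] f (z + r *\<^sub>R v)"
proof -
  have "\<exists>r. 0 < r \<and> r < s \<and> f (z + s *\<^sub>R v) - f (z + 0 *\<^sub>R v) = (s - 0) * iter_deriv [v] f (z + r *\<^sub>R v)"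
    using iter_deriv_line[OF assms(1), of "[]" z v] by (intro MVT2 assms) simp
  then show thesis using that by auto
qed

lemma iter_deriv_taylor:
  assumes "smooth_fun f"
  obtains r where "0 < r" "r < 1"
    "f (z + v) = f z + iter_deriv [v] f z + iter_deriv [v, v] f (z + r *\<^sub>R v) / 2"
proof -
  have "\<exists>r. 0 < r \<and> r < 1 \<and> f (z + 1 *\<^sub>R v) =
      (\<Sum>m<2. iter_deriv (replicate m v) f (z + 0 *\<^sub>R v) / fact m * 1 ^ m)
        + iter_deriv (replicate 2 v) f (z + r *\<^sub>R v) / fact 2 * 1 ^ 2"
    by (rule Maclaurin[where diff = "\<lambda>m s. iter_deriv (replicate m v) f (z + s *\<^sub>R v)"])
      (use iter_deriv_line[OF assms] in auto)
  then show thesis using that by (auto simp: numeral_2_eq_2)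
qed

lemma iter_deriv_zero_outside:
  assumes "z \<notin> closure {z. f z \<noteq> 0}"
  shows "iter_deriv vs f z = 0"
  using assms
proof (induction vs arbitrary: z)
  case Nil
  then show ?case using closure_subset[of "{z. f z \<noteq> 0}"] by auto
next
  case (Cons v vs)
  have "(iter_deriv vs f has_derivative (\<lambda>_. 0)) (at z)"
    by (rule has_derivative_transform_within_open[of "\<lambda>_. 0" _ _ _ "- closure {z. f z \<noteq> 0}"])
      (use Cons in auto)
  from fun_cong[OF frechet_derivative_at[OF this], of v] show ?case by simp
qed

lemma iter_deriv_bounded:
  assumes "smooth_fun f" "compact (closure {z. f z \<noteq> 0})"
  obtains C where "0 \<le> C" "\<And>z. \<bar>iter_deriv vs f z\<bar> \<le> C"
proof -
  have "compact (iter_deriv vs f ` closure {z. f z \<noteq> 0})"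
    by (intro compact_continuous_image assms(2) continuous_on_subset[OF iter_deriv_continuous[OF assms(1)] subset_UNIV])
  then obtain C where C: "\<And>z. z \<in> closure {z. f z \<noteq> 0} \<Longrightarrow> \<bar>iter_deriv vs f z\<bar> \<le> C"
    using compact_imp_bounded[of "iter_deriv vs f ` closure {z. f z \<noteq> 0}"] unfolding bounded_iff real_norm_def by blast
  show thesis
  proof (rule that[of "max C 0"])
    fix z show "\<bar>iter_deriv vs f z\<bar> \<le> max C 0"
      using C[of z] iter_deriv_zero_outside[of z f vs] by (cases "z \<in> closure {z. f z \<noteq> 0}") auto
  qed simp
qed

abbreviation space_axis :: "'n \<Rightarrow> (real^'n) \<times> real" where
  "space_axis k \<equiv> (axis k 1, 0)"

lemma space_axis_expansion: "(j, 0) = (\<Sum>k\<in>UNIV. j $ k *\<^sub>R space_axis k)" for j :: "real^'n"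
proof -
  have "j = (\<Sum>k\<in>UNIV. j $ k *\<^sub>R axis k 1)" using basis_expansion[of j] by (simp add: scalar_mult_eq_scaleR)
  then show ?thesis by (simp add: prod_eq_iff fst_sum snd_sum)
qed

lemma iter_deriv_space_first:
  fixes j :: "real^'n"
  assumes "smooth_fun f"
  shows "iter_deriv ((j, 0) # vs) f z = (\<Sum>k\<in>UNIV. j $ k * iter_deriv (space_axis k # vs) f z)"
  unfolding space_axis_expansion[of j]
  by (simp only: linear_sum[OF iter_deriv_linear[OF assms]] linear_scale[OF iter_deriv_linear[OF assms]] real_scaleR_def)

lemma iter_deriv_space_second:
  fixes j :: "real^'n"
  assumes "smooth_fun f"
  shows "iter_deriv [(j, 0), (j, 0)] f z =
    (\<Sum>a\<in>UNIV. \<Sum>b\<in>UNIV. j $ a * j $ b * iter_deriv [space_axis a, space_axis b] f z)"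
proof -
  have "iter_deriv [(j, 0)] f = (\<lambda>z. \<Sum>b\<in>UNIV. j $ b * iter_deriv [space_axis b] f z)"
    using iter_deriv_space_first[OF assms, of j "[]"] by (simp add: fun_eq_iff del: iter_deriv.simps)
  moreover have "((\<lambda>z. \<Sum>b\<in>UNIV. j $ b * iter_deriv [space_axis b] f z) has_derivative
      (\<lambda>v. \<Sum>b\<in>UNIV. j $ b * iter_deriv [v, space_axis b] f z)) (at z)"
    by (intro has_derivative_sum has_derivative_mult_right iter_deriv_has_derivative assms)
  ultimately have "(iter_deriv [(j, 0)] f has_derivative (\<lambda>v. \<Sum>b\<in>UNIV. j $ b * iter_deriv [v, space_axis b] f z)) (at z)"
    by simp
  from has_derivative_unique[OF iter_deriv_has_derivative[OF assms] this]
  have "iter_deriv [(j, 0), (j, 0)] f z = (\<Sum>b\<in>UNIV. j $ b * iter_deriv [(j, 0), space_axis b] f z)"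
    by (rule fun_cong)
  also have "\<dots> = (\<Sum>b\<in>UNIV. \<Sum>a\<in>UNIV. j $ a * j $ b * iter_deriv [space_axis a, space_axis b] f z)"
    by (simp only: iter_deriv_space_first[OF assms, of j] sum_distrib_left mult.assoc mult.left_commute)
  finally show ?thesis by (subst sum.swap)
qed

section \<open>The truncated kernel as an approximate Laplacian\<close>

context grid_kernel
begin

lemma sum_stencil_K_ge: "1 - tail 1 \<le> (\<Sum>j\<in>stencil. K j)"
proof -
  have "(K has_sum (\<Sum>j\<in>stencil. K j)) stencil" by (rule has_sum_finite) simp
  then have part: "((\<lambda>j. K j * of_bool (norm j \<le> 1)) has_sum (\<Sum>j\<in>stencil. K j)) (grid \<epsilon>)"
    by (rule has_sum_cong_neutral[THEN iffD1, rotated -1]) (auto simp: stencil_def)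
  have "1 \<le> (\<Sum>j\<in>stencil. K j) + tail 1"
  proof (rule has_sum_mono[OF K_mass has_sum_add[OF part has_sum_tail]])
    fix j :: "real^'n" assume "j \<in> grid \<epsilon>"
    then have K: "0 \<le> K j" by (rule K_nonneg)
    have "K j * 1 \<le> K j * (norm j)\<^sup>2" if "1 < norm j" using that K by (intro mult_left_mono) (auto simp: one_le_power)
    then show "K j \<le> K j * of_bool (norm j \<le> 1) + K j * ((norm j)\<^sup>2 * of_bool (1 < norm j))" by auto
  qed
  then show ?thesis by simp
qed

lemma tail_le: "tail r \<le> 2 * real CARD('n) * h"
  by (rule has_sum_mono[OF has_sum_tail has_sum_second_moment]) (auto intro!: mult_nonneg_nonneg K_nonneg)

lemma stencil_uminus: "j \<in> stencil \<Longrightarrow> - j \<in> stencil"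
  by (simp add: stencil_def)

lemma sum_stencil_odd:
  assumes "\<And>j. f (- j) = - f j"
  shows "(\<Sum>j\<in>stencil. K j * f j) = (0::real)"
proof -
  have "(\<Sum>j\<in>stencil. K j * f j) = (\<Sum>j\<in>stencil. K (- j) * f (- j))"
    by (rule sum.reindex_bij_witness[of _ uminus uminus]) (auto simp: stencil_uminus)
  also have "\<dots> = (\<Sum>j\<in>stencil. - (K j * f j))"
    by (intro sum.cong) (auto simp: assms K_sym stencil_in_grid)
  finally show ?thesis by (simp add: sum_negf)
qed

text \<open>First derivatives cancel by the symmetry of the stencil. The missing mass yields the
  first term on the right, and the second derivatives sit at intermediate points, of which only the
  distance to \<open>z\<close> is known.\<close>

lemma stencil_taylor:
  assumes "smooth_fun f"
  obtains w where "\<And>j. norm (w j - z) \<le> norm j"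
    "(\<Sum>j\<in>stencil. K j * f (z + (j, 0))) - f z = - ((1 - (\<Sum>j\<in>stencil. K j)) * f z)
      + (\<Sum>a\<in>UNIV. \<Sum>b\<in>UNIV. \<Sum>j\<in>stencil. K j * (j $ a * j $ b) * iter_deriv [space_axis a, space_axis b] f (w j)) / 2"
proof -
  have "\<exists>w. norm (w - z) \<le> norm j \<and> f (z + (j, 0)) = f z + iter_deriv [(j, 0)] f z + iter_deriv [(j, 0), (j, 0)] f w / 2"
    for j :: "real^'n"
  proof -
    obtain r where r: "0 < r" "r < 1"
      "f (z + (j, 0)) = f z + iter_deriv [(j, 0)] f z + iter_deriv [(j, 0), (j, 0)] f (z + r *\<^sub>R (j, 0)) / 2"
      by (rule iter_deriv_taylor[OF assms])
    have "norm (z + r *\<^sub>R (j, 0) - z) \<le> norm j" using r mult_right_mono[of r 1 "norm j"] by (simp add: norm_Pair)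
    then show ?thesis using r by blast
  qed
  then obtain w where w: "\<And>j :: real^'n. norm (w j - z) \<le> norm j"
    and f: "\<And>j :: real^'n. f (z + (j, 0)) = f z + iter_deriv [(j, 0)] f z + iter_deriv [(j, 0), (j, 0)] f (w j) / 2"
    by metis
  have "(\<Sum>j\<in>stencil. K j * f (z + (j, 0))) = (\<Sum>j\<in>stencil. K j * f z + K j * iter_deriv [(j, 0)] f z + K j * iter_deriv [(j, 0), (j, 0)] f (w j) / 2)"
    by (intro sum.cong refl) (simp add: f algebra_simps del: iter_deriv.simps)
  also have "\<dots> = (\<Sum>j\<in>stencil. K j) * f z + (\<Sum>j\<in>stencil. K j * iter_deriv [(j, 0)] f z) + (\<Sum>j\<in>stencil. K j * iter_deriv [(j, 0), (j, 0)] f (w j)) / 2"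
    by (simp add: sum.distrib sum_distrib_right sum_divide_distrib del: iter_deriv.simps)
  also have "(\<Sum>j\<in>stencil. K j * iter_deriv [(j, 0)] f z) = 0"
  proof (rule sum_stencil_odd)
    fix j :: "real^'n"
    show "iter_deriv [(- j, 0)] f z = - iter_deriv [(j, 0)] f z"
      unfolding iter_deriv_space_first[OF assms, of j] iter_deriv_space_first[OF assms, of "- j"]
      by (simp add: sum_negf del: iter_deriv.simps)
  qed
  also have "(\<Sum>j\<in>stencil. K j * iter_deriv [(j, 0), (j, 0)] f (w j)) =
      (\<Sum>j\<in>stencil. \<Sum>a\<in>UNIV. \<Sum>b\<in>UNIV. K j * (j $ a * j $ b) * iter_deriv [space_axis a, space_axis b] f (w j))"
    unfolding iter_deriv_space_second[OF assms] by (simp only: sum_distrib_left mult.assoc)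
  also have "\<dots> = (\<Sum>a\<in>UNIV. \<Sum>b\<in>UNIV. \<Sum>j\<in>stencil. K j * (j $ a * j $ b) * iter_deriv [space_axis a, space_axis b] f (w j))"
    by (subst sum.swap) (intro sum.cong refl sum.swap)
  finally show thesis using that[OF w] by (simp add: algebra_simps del: iter_deriv.simps)
qed

lemma abs_components_le: "\<bar>j $ a * j $ b\<bar> \<le> (norm j)\<^sup>2" for j :: "real^'n"
  unfolding abs_mult power2_eq_square by (intro mult_mono component_le_norm_cart) auto

end

context kernel_sequence
begin

abbreviation stencil_op :: "nat \<Rightarrow> ((real^'n) \<times> real \<Rightarrow> real) \<Rightarrow> (real^'n) \<times> real \<Rightarrow> real" where
  "stencil_op n f z \<equiv> (\<Sum>j\<in>stencil n. K n j * f (z + (j, 0))) - f z"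

lemma stencil_op_bounded:
  assumes f: "smooth_fun f" "compact (closure {z. f z \<noteq> 0})"
  obtains C where "\<And>n z. \<bar>stencil_op n f z\<bar> \<le> C * hh n"
proof -
  let ?\<kappa> = "real CARD('n)"
  have "\<exists>C. 0 \<le> C \<and> (\<forall>z. \<bar>iter_deriv [space_axis a, space_axis b] f z\<bar> \<le> C)" for a b :: 'n
    using iter_deriv_bounded[OF f] by metis
  then obtain C where C: "\<And>a b :: 'n. 0 \<le> C a b" "\<And>a b z. \<bar>iter_deriv [space_axis a, space_axis b] f z\<bar> \<le> C a b"
    by metis
  obtain C0 where C0: "0 \<le> C0" "\<And>z. \<bar>f z\<bar> \<le> C0" using iter_deriv_bounded[OF f, of "[]"] by auto
  show thesis
  proof (rule that)
    fix n z
    interpret k: grid_kernel "\<epsilon> n" "K n" by (rule kernel)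
    obtain w where w: "stencil_op n f z = - ((1 - (\<Sum>j\<in>stencil n. K n j)) * f z)
      + (\<Sum>a\<in>UNIV. \<Sum>b\<in>UNIV. \<Sum>j\<in>stencil n. K n j * (j $ a * j $ b) * iter_deriv [space_axis a, space_axis b] f (w j)) / 2"
      using k.stencil_taylor[OF f(1)] by blast
    have 1: "\<bar>(1 - (\<Sum>j\<in>stencil n. K n j)) * f z\<bar> \<le> (2 * ?\<kappa> * hh n) * C0"
      unfolding abs_mult using k.sum_stencil_K_ge k.sum_stencil_K_le_1 k.tail_le[of 1] C0
      by (intro mult_mono) auto
    have each: "\<bar>\<Sum>j\<in>stencil n. K n j * (j $ a * j $ b) * iter_deriv [space_axis a, space_axis b] f (w j)\<bar> \<le> (2 * ?\<kappa> * hh n) * C a b" for a b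
    proof -
      have "\<bar>\<Sum>j\<in>stencil n. K n j * (j $ a * j $ b) * iter_deriv [space_axis a, space_axis b] f (w j)\<bar>
          \<le> (\<Sum>j\<in>stencil n. K n j * (norm j)\<^sup>2 * C a b)"
      proof (rule order_trans[OF sum_abs], rule sum_mono)
        fix j :: "real^'n" assume "j \<in> stencil n"
        then have "0 \<le> K n j" by (intro k.K_nonneg k.stencil_in_grid)
        then show "\<bar>K n j * (j $ a * j $ b) * iter_deriv [space_axis a, space_axis b] f (w j)\<bar> \<le> K n j * (norm j)\<^sup>2 * C a b"
          unfolding abs_mult[of "_ * _"] abs_mult[of "K n j"]
          by (intro mult_mono C k.abs_components_le mult_nonneg_nonneg) auto
      qed
      also have "\<dots> \<le> (2 * ?\<kappa> * hh n) * C a b"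
        unfolding sum_distrib_right[symmetric] by (intro mult_right_mono k.sum_stencil_second_moment_le C)
      finally show ?thesis .
    qed
    have 2: "\<bar>\<Sum>a\<in>UNIV. \<Sum>b\<in>UNIV. \<Sum>j\<in>stencil n. K n j * (j $ a * j $ b) * iter_deriv [space_axis a, space_axis b] f (w j)\<bar>
        \<le> (\<Sum>a\<in>UNIV. \<Sum>b\<in>UNIV. (2 * ?\<kappa> * hh n) * C a b)"
    proof (rule order_trans[OF sum_abs], rule sum_mono)
      fix a
      show "\<bar>\<Sum>b\<in>UNIV. \<Sum>j\<in>stencil n. K n j * (j $ a * j $ b) * iter_deriv [space_axis a, space_axis b] f (w j)\<bar>
        \<le> (\<Sum>b\<in>UNIV. (2 * ?\<kappa> * hh n) * C a b)"
        by (rule order_trans[OF sum_abs], rule sum_mono, rule each)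
    qed
    have "\<bar>stencil_op n f z\<bar> \<le> (2 * ?\<kappa> * hh n) * C0 + (\<Sum>a\<in>UNIV. \<Sum>b\<in>UNIV. (2 * ?\<kappa> * hh n) * C a b) / 2"
      unfolding w using 1 2 by linarith
    also have "\<dots> = (2 * ?\<kappa> * (C0 + (\<Sum>a\<in>UNIV. \<Sum>b\<in>UNIV. C a b) / 2)) * hh n"
    proof -
      have "(2 * ?\<kappa> * H) * C0 + ((2 * ?\<kappa> * H) * S) / 2 = (2 * ?\<kappa> * (C0 + S / 2)) * H" for H S :: real
        by (simp add: algebra_simps)
      then show ?thesis by (simp only: sum_distrib_left[symmetric])
    qed
    finally show "\<bar>stencil_op n f z\<bar> \<le> (2 * ?\<kappa> * (C0 + (\<Sum>a\<in>UNIV. \<Sum>b\<in>UNIV. C a b) / 2)) * hh n" .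
  qed
qed

text \<open>Second derivatives are replaced by their values at \<open>z0\<close>: for short shifts
  by continuity and the bounded second moment, for long ones by \<open>tail_lim\<close>. Then
  \<open>cov_lim\<close> leaves twice the diagonal, which the factor 1/2 turns into the Laplacian.
  Moving points \<open>z n\<close> are allowed because the quotient below is evaluated one time step
  later.\<close>

lemma stencil_op_lim:
  assumes f: "smooth_fun f" "compact (closure {z. f z \<noteq> 0})" and z: "z \<longlonglongrightarrow> z0"
  shows "(\<lambda>n. stencil_op n f (z n) / hh n) \<longlonglongrightarrow> (\<Sum>a\<in>UNIV. iter_deriv [space_axis a, space_axis a] f z0)"
proof -
  let ?\<kappa> = "real CARD('n)"
  let ?g = "\<lambda>a b. iter_deriv [space_axis a, space_axis b] f"
  define T where "T n w \<longleftrightarrow> (\<forall>j. norm (w j - z n) \<le> norm j) \<and>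
      stencil_op n f (z n) = - ((1 - (\<Sum>j\<in>stencil n. K n j)) * f (z n))
      + (\<Sum>a\<in>UNIV. \<Sum>b\<in>UNIV. \<Sum>j\<in>stencil n. K n j * (j $ a * j $ b) * ?g a b (w j)) / 2" for n w
  have "\<exists>w. T n w" for n
    by (rule grid_kernel.stencil_taylor[OF kernel[of n] f(1), where z = "z n"]) (unfold T_def, blast)
  then obtain w where T: "\<And>n. T n (w n)" by metis
  have w: "norm (w n j - z n) \<le> norm j"
    "stencil_op n f (z n) = - ((1 - (\<Sum>j\<in>stencil n. K n j)) * f (z n))
      + (\<Sum>a\<in>UNIV. \<Sum>b\<in>UNIV. \<Sum>j\<in>stencil n. K n j * (j $ a * j $ b) * ?g a b (w n j)) / 2" for n j
    using T[of n] unfolding T_def by blast+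
  have mass: "(\<lambda>n. (1 - (\<Sum>j\<in>stencil n. K n j)) / hh n) \<longlonglongrightarrow> 0"
  proof (rule tendsto_sandwich[OF _ _ tendsto_const tail_lim[of 1]])
    show "\<forall>\<^sub>F n in sequentially. 0 \<le> (1 - (\<Sum>j\<in>stencil n. K n j)) / hh n"
      using grid_kernel.sum_stencil_K_le_1[OF kernel] grid_kernel.h_pos[OF kernel] by (simp add: less_imp_le)
    show "\<forall>\<^sub>F n in sequentially. (1 - (\<Sum>j\<in>stencil n. K n j)) / hh n \<le> tail n 1 / hh n"
      using grid_kernel.sum_stencil_K_ge[OF kernel] grid_kernel.h_pos[OF kernel]
      by (intro always_eventually allI divide_right_mono) (auto simp: less_imp_le algebra_simps)
  qed simp
  have main: "(\<lambda>n. (\<Sum>j\<in>stencil n. K n j * (j $ a * j $ b) * ?g a b (w n j)) / hh n) \<longlonglongrightarrow> (if a = b then 2 else 0) * ?g a b z0"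
    for a b
  proof -
    obtain C where C: "0 \<le> C" "\<And>z. \<bar>?g a b z\<bar> \<le> C" using iter_deriv_bounded[OF f] by blast
    have "(\<lambda>n. (\<Sum>j\<in>stencil n. K n j * (j $ a * j $ b) * (?g a b (w n j) - ?g a b z0)) / hh n) \<longlonglongrightarrow> 0"
    proof (rule LIMSEQ_I, unfold diff_0_right real_norm_def)
      fix e :: real assume e: "0 < e"
      define \<eta> where "\<eta> = e / (4 * ?\<kappa>)"
      have \<eta>: "0 < \<eta>" using e by (simp add: \<eta>_def)
      obtain r where r: "0 < r" "\<And>y. norm (y - z0) < r \<Longrightarrow> \<bar>?g a b y - ?g a b z0\<bar> < \<eta>"
        using iter_deriv_isCont[OF f(1), where vs = "[space_axis a, space_axis b]" and z = z0] \<eta>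
        unfolding continuous_at_eps_delta dist_norm real_norm_def by blast
      have "(\<lambda>n. 2 * C * (tail n (r / 2) / hh n)) \<longlonglongrightarrow> 2 * C * 0" using r by (intro tendsto_intros tail_lim) simp
      then have ev1: "\<forall>\<^sub>F n in sequentially. 2 * C * (tail n (r / 2) / hh n) < e / 2"
        using e by (intro order_tendstoD(2)[of _ "2 * C * 0"]) auto
      have ev2: "\<forall>\<^sub>F n in sequentially. norm (z n - z0) < r / 2"
        using z r unfolding tendsto_iff dist_norm by (metis half_gt_zero)
      have "\<forall>\<^sub>F n in sequentially. \<bar>(\<Sum>j\<in>stencil n. K n j * (j $ a * j $ b) * (?g a b (w n j) - ?g a b z0)) / hh n\<bar> < e"
        using ev1 ev2
      proof eventually_elim
        case (elim n)
        interpret k: grid_kernel "\<epsilon> n" "K n" by (rule kernel)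
        have "\<bar>\<Sum>j\<in>stencil n. K n j * (j $ a * j $ b) * (?g a b (w n j) - ?g a b z0)\<bar> \<le>
            (\<Sum>j\<in>stencil n. K n j * \<bar>(j $ a * j $ b) * (?g a b (w n j) - ?g a b z0)\<bar>)"
          by (rule order_trans[OF sum_abs]) (auto intro!: sum_mono simp: abs_mult k.K_nonneg k.stencil_in_grid)
        also have "\<dots> \<le> 0 + 0 * (\<Sum>\<^sub>\<infinity>j\<in>grid (\<epsilon> n). K n j * 0) + \<eta> * (2 * ?\<kappa> * hh n) + (2 * C) * tail n (r / 2)"
        proof (rule k.sum_stencil_le)
          fix j :: "real^'n" assume j: "j \<in> grid (\<epsilon> n)"
          have "\<bar>(j $ a * j $ b) * (?g a b (w n j) - ?g a b z0)\<bar> \<le> \<eta> * (norm j)\<^sup>2 + 2 * C * ((norm j)\<^sup>2 * of_bool (r / 2 < norm j))"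
          proof (cases "r / 2 < norm j")
            case True
            have "\<bar>?g a b (w n j) - ?g a b z0\<bar> \<le> 2 * C" using C(2)[of "w n j"] C(2)[of z0] by linarith
            then have "\<bar>(j $ a * j $ b) * (?g a b (w n j) - ?g a b z0)\<bar> \<le> (norm j)\<^sup>2 * (2 * C)"
              unfolding abs_mult[of "_ * _"] by (intro mult_mono k.abs_components_le) auto
            moreover have "0 \<le> \<eta> * (norm j)\<^sup>2" using \<eta> by simp
            moreover have "2 * C * ((norm j)\<^sup>2 * of_bool (r / 2 < norm j)) = (norm j)\<^sup>2 * (2 * C)" using True by simp
            ultimately show ?thesis by linarith
          next
            case False
            have "norm (w n j - z0) \<le> norm (w n j - z n) + norm (z n - z0)"
              using norm_triangle_ineq[of "w n j - z n" "z n - z0"] by simp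
            then have "norm (w n j - z0) < r" using w(1)[of n j] elim(2) False by linarith
            then have "\<bar>?g a b (w n j) - ?g a b z0\<bar> \<le> \<eta>" using r(2) by (simp add: less_imp_le)
            then have "\<bar>(j $ a * j $ b) * (?g a b (w n j) - ?g a b z0)\<bar> \<le> (norm j)\<^sup>2 * \<eta>"
              unfolding abs_mult[of "_ * _"] by (intro mult_mono k.abs_components_le) auto
            moreover have "2 * C * ((norm j)\<^sup>2 * of_bool (r / 2 < norm j)) = 0" using False by simp
            ultimately show ?thesis by (simp only: mult.commute)
          qed
          moreover have "0 \<le> \<eta> * (norm j)\<^sup>2 + 2 * C * ((norm j)\<^sup>2 * of_bool (r / 2 < norm j))" using \<eta> C by simp
          ultimately show "(if j \<in> stencil n then \<bar>(j $ a * j $ b) * (?g a b (w n j) - ?g a b z0)\<bar> else 0) \<le>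
              0 + 0 * 0 + \<eta> * (norm j)\<^sup>2 + 2 * C * ((norm j)\<^sup>2 * of_bool (r / 2 < norm j))" by simp
        qed simp
        finally have "\<bar>\<Sum>j\<in>stencil n. K n j * (j $ a * j $ b) * (?g a b (w n j) - ?g a b z0)\<bar> / hh n \<le>
            (\<eta> * (2 * ?\<kappa> * hh n) + (2 * C) * tail n (r / 2)) / hh n"
          using k.h_pos by (intro divide_right_mono) auto
        also have "\<dots> = e / 2 + 2 * C * (tail n (r / 2) / hh n)"
          using k.h_pos by (simp add: add_divide_distrib \<eta>_def)
        also have "\<dots> < e" using elim(1) by linarith
        finally show ?case using k.h_pos by (simp add: abs_divide del: iter_deriv.simps)
      qed
      then show "\<exists>no. \<forall>n\<ge>no. \<bar>(\<Sum>j\<in>stencil n. K n j * (j $ a * j $ b) * (?g a b (w n j) - ?g a b z0)) / hh n\<bar> < e"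
        by (simp only: eventually_sequentially)
    qed
    moreover have "(\<lambda>n. cov n a b * ?g a b z0) \<longlonglongrightarrow> (if a = b then 2 else 0) * ?g a b z0"
      by (intro tendsto_intros cov_lim)
    ultimately have "(\<lambda>n. (\<Sum>j\<in>stencil n. K n j * (j $ a * j $ b) * (?g a b (w n j) - ?g a b z0)) / hh n + cov n a b * ?g a b z0)
        \<longlonglongrightarrow> 0 + (if a = b then 2 else 0) * ?g a b z0" by (rule tendsto_add)
    moreover have "(\<Sum>j\<in>stencil n. K n j * (j $ a * j $ b) * (?g a b (w n j) - ?g a b z0)) / hh n + cov n a b * ?g a b z0 =
        (\<Sum>j\<in>stencil n. K n j * (j $ a * j $ b) * ?g a b (w n j)) / hh n" for n
      by (simp add: grid_kernel.cov_def[OF kernel] right_diff_distrib sum_subtractf diff_divide_distrib sum_distrib_right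
            sum_divide_distrib del: iter_deriv.simps)
    ultimately show ?thesis by (simp only: add_0)
  qed
  have fz: "(\<lambda>n. f (z n)) \<longlonglongrightarrow> f z0"
    using isCont_tendsto_compose[OF iter_deriv_isCont[OF f(1), where vs = "[]"] z] by simp
  have "(\<lambda>n. - ((1 - (\<Sum>j\<in>stencil n. K n j)) / hh n * f (z n)) + (\<Sum>a\<in>UNIV. \<Sum>b\<in>UNIV.
      (\<Sum>j\<in>stencil n. K n j * (j $ a * j $ b) * ?g a b (w n j)) / hh n) / 2) \<longlonglongrightarrow>
      - (0 * f z0) + (\<Sum>a\<in>UNIV. \<Sum>b\<in>UNIV. (if a = b then 2 else 0) * ?g a b z0) / 2"
    by (intro tendsto_intros mass main fz) auto
  moreover have "(\<Sum>b\<in>UNIV. (if a = b then 2 else 0) * ?g a b z0) = 2 * ?g a a z0" for a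
  proof -
    have "(\<Sum>b\<in>UNIV. (if a = b then 2 else 0) * ?g a b z0) = (\<Sum>b\<in>UNIV. if a = b then 2 * ?g a b z0 else 0)"
      by (intro sum.cong) auto
    then show ?thesis by (simp del: iter_deriv.simps)
  qed
  moreover have "stencil_op n f (z n) / hh n = - ((1 - (\<Sum>j\<in>stencil n. K n j)) / hh n * f (z n)) + (\<Sum>a\<in>UNIV. \<Sum>b\<in>UNIV.
      (\<Sum>j\<in>stencil n. K n j * (j $ a * j $ b) * ?g a b (w n j)) / hh n) / 2" for n
  proof -
    have "(- (m * F) + S / 2) / H = - (m / H * F) + (S / H) / 2" for m F S H :: real
      by (simp add: add_divide_distrib diff_divide_distrib)
    then show ?thesis unfolding w(2) by (simp only: sum_divide_distrib[symmetric])
  qed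
  ultimately show ?thesis by (simp add: sum_distrib_left[symmetric] del: iter_deriv.simps)
qed

end

section \<open>Passing to the limit in the discrete heat inequality\<close>

lemma lborel_integral_translate:
  fixes f :: "'a::euclidean_space \<Rightarrow> real"
  assumes "f \<in> borel_measurable borel"
  shows "(\<integral>z. f (z + c) \<partial>lborel) = (\<integral>z. f z \<partial>lborel)"
proof -
  have "(\<integral>z. f z \<partial>distr lborel borel ((+) c)) = (\<integral>z. f (c + z) \<partial>lborel)"
    using assms by (intro integral_distr) auto
  then show ?thesis by (simp add: lborel_distr_plus add.commute)
qed

lemma integrable_bounded_support:
  fixes f :: "'a::euclidean_space \<Rightarrow> real"
  assumes "f \<in> borel_measurable borel" "\<And>z. \<bar>f z\<bar> \<le> B" "\<And>z. f z \<noteq> 0 \<Longrightarrow> norm z \<le> \<rho>"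
  shows "integrable lborel f"
proof (rule integrableI_bounded_set[where A = "cball 0 \<rho>" and B = B])
  show "emeasure lborel (cball (0::'a) \<rho>) < \<infinity>" by (rule emeasure_bounded_finite) simp
qed (use assms in auto)

lemma test_integrable:
  fixes f g :: "'a::euclidean_space \<Rightarrow> real"
  assumes f: "continuous_on UNIV f" "\<And>z. \<bar>f z\<bar> \<le> B" "\<And>z. f z \<noteq> 0 \<Longrightarrow> norm z \<le> \<rho>"
    and g: "g \<in> borel_measurable borel" "\<And>z. \<bar>g z\<bar> \<le> C"
  shows "integrable lborel (\<lambda>z. f (z + v) * g z)"
proof (rule integrable_bounded_support)
  have f_meas [measurable]: "f \<in> borel_measurable borel" using f(1) by (rule borel_measurable_continuous_onI)
  have [measurable]: "g \<in> borel_measurable borel" by fact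
  show "(\<lambda>z. f (z + v) * g z) \<in> borel_measurable borel" by measurable
  show "\<bar>f (z + v) * g z\<bar> \<le> B * C" for z
    unfolding abs_mult using f(2)[of "z + v"] g(2)[of z] by (intro mult_mono) auto
  show "norm z \<le> \<rho> + norm v" if "f (z + v) * g z \<noteq> 0" for z
    using f(3)[of "z + v"] that norm_triangle_ineq4[of "z + v" v] by auto
qed

definition heat_adjoint :: "((real^'n) \<times> real \<Rightarrow> real) \<Rightarrow> (real^'n) \<times> real \<Rightarrow> real" where
  "heat_adjoint f z = - time_deriv f z - space_laplacian f z"

lemma heat_adjoint_continuous: "smooth_fun f \<Longrightarrow> continuous_on UNIV (heat_adjoint f)"
  unfolding heat_adjoint_def space_laplacian_def time_deriv_def
  by (intro continuous_intros iter_deriv_continuous)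

lemma heat_adjoint_zero_outside: "z \<notin> closure {z. f z \<noteq> 0} \<Longrightarrow> heat_adjoint f z = 0"
  unfolding heat_adjoint_def space_laplacian_def time_deriv_def
  by (simp add: iter_deriv_zero_outside del: iter_deriv.simps)

lemma heat_adjoint_bounded:
  fixes f :: "(real^'n) \<times> real \<Rightarrow> real"
  assumes "smooth_fun f" "compact (closure {z. f z \<noteq> 0})"
  obtains C where "0 \<le> C" "\<And>z. \<bar>heat_adjoint f z\<bar> \<le> C"
proof -
  obtain C0 where C0: "0 \<le> C0" "\<And>z. \<bar>time_deriv f z\<bar> \<le> C0"
    using iter_deriv_bounded[OF assms] unfolding time_deriv_def by blast
  have "\<exists>C. 0 \<le> C \<and> (\<forall>z. \<bar>iter_deriv [space_axis k, space_axis k] f z\<bar> \<le> C)" for k :: 'n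
    by (rule iter_deriv_bounded[OF assms, of "[space_axis k, space_axis k]"]) blast
  then obtain C where C: "\<And>k :: 'n. 0 \<le> C k" "\<And>k z. \<bar>iter_deriv [space_axis k, space_axis k] f z\<bar> \<le> C k"
    by metis
  have "\<bar>space_laplacian f z\<bar> \<le> (\<Sum>k\<in>UNIV. C k)" for z
    unfolding space_laplacian_def by (rule order_trans[OF sum_abs sum_mono[OF C(2)]])
  then have lap: "\<bar>space_laplacian f z\<bar> \<le> (\<Sum>k\<in>UNIV. C k)" for z .
  have "\<bar>heat_adjoint f z\<bar> \<le> C0 + (\<Sum>k\<in>UNIV. C k)" for z
    unfolding heat_adjoint_def using C0(2)[of z] lap[of z] by linarith
  moreover have "0 \<le> C0 + (\<Sum>k\<in>UNIV. C k)" using C0 C by (intro add_nonneg_nonneg sum_nonneg) auto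
  ultimately show thesis using that by blast
qed

context kernel_sequence
begin

text \<open>What multiplies the unknown once all its shifts in the discrete inequality are moved
  onto the test function; the old time level of the unknown meets \<open>f\<close> at the next
  one.\<close>

definition heat_quotient :: "nat \<Rightarrow> ((real^'n) \<times> real \<Rightarrow> real) \<Rightarrow> (real^'n) \<times> real \<Rightarrow> real" where
  "heat_quotient n f z = (f z - (\<Sum>j\<in>stencil n. K n j * f (z + (j, hh n)))) / hh n"

lemma hh_pos: "0 < hh n"
  by (rule grid_kernel.h_pos[OF kernel])

lemma heat_quotient_eq:
  "heat_quotient n f z = - ((f (z + hh n *\<^sub>R (0, 1)) - f z) / hh n) - stencil_op n f (z + (0, hh n)) / hh n"
proof -
  have "z + (0, hh n) + (j, 0) = z + (j, hh n)" for j :: "real^'n" by (simp add: prod_eq_iff)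
  then have "(\<Sum>j\<in>stencil n. K n j * f (z + (0, hh n) + (j, 0))) = (\<Sum>j\<in>stencil n. K n j * f (z + (j, hh n)))"
    by (simp only:)
  moreover have "(a - b) / H = - ((c - a) / H) - (b - c) / H" for a b c H :: real
    by (simp add: diff_divide_distrib)
  ultimately show ?thesis by (simp only: heat_quotient_def) simp
qed

lemma heat_quotient_lim:
  assumes f: "smooth_fun f" "compact (closure {z. f z \<noteq> 0})"
  shows "(\<lambda>n. heat_quotient n f z) \<longlonglongrightarrow> heat_adjoint f z"
proof -
  have "((\<lambda>s. f (z + s *\<^sub>R (0, 1))) has_real_derivative iter_deriv [(0, 1)] f (z + 0 *\<^sub>R (0, 1))) (at 0)"
    using iter_deriv_line[OF f(1), of "[]" z "(0, 1)" 0] by simp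
  then have "((\<lambda>s. (f (z + s *\<^sub>R (0, 1)) - f z) / s) \<longlongrightarrow> time_deriv f z) (at 0)"
    by (simp add: has_field_derivative_iff time_deriv_def zero_prod_def[symmetric] del: iter_deriv.simps)
  moreover have "filterlim hh (at 0) sequentially"
    using h_lim hh_pos by (intro filterlim_atI always_eventually) (auto simp: less_imp_neq[symmetric])
  ultimately have 1: "(\<lambda>n. (f (z + hh n *\<^sub>R (0, 1)) - f z) / hh n) \<longlonglongrightarrow> time_deriv f z"
    by (rule filterlim_compose)
  have "(\<lambda>n. z + (0, hh n)) \<longlonglongrightarrow> z + (0, 0)" by (intro tendsto_intros h_lim)
  then have "(\<lambda>n. z + (0, hh n)) \<longlonglongrightarrow> z" by (simp add: zero_prod_def[symmetric])
  from stencil_op_lim[OF f this] have 2: "(\<lambda>n. stencil_op n f (z + (0, hh n)) / hh n) \<longlonglongrightarrow> space_laplacian f z"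
    unfolding space_laplacian_def .
  show ?thesis unfolding heat_quotient_eq heat_adjoint_def by (intro tendsto_intros 1 2)
qed

lemma heat_quotient_bounded:
  assumes f: "smooth_fun f" "compact (closure {z. f z \<noteq> 0})"
  obtains C where "\<And>n z. \<bar>heat_quotient n f z\<bar> \<le> C"
proof -
  obtain C1 where C1: "\<And>z. \<bar>iter_deriv [(0, 1)] f z\<bar> \<le> C1" using iter_deriv_bounded[OF f] by blast
  obtain C2 where C2: "\<And>n z. \<bar>stencil_op n f z\<bar> \<le> C2 * hh n" using stencil_op_bounded[OF f] by blast
  show thesis
  proof (rule that)
    fix n z
    have h: "0 < hh n" by (rule hh_pos)
    obtain r where "f (z + hh n *\<^sub>R (0, 1)) - f z = hh n * iter_deriv [(0, 1)] f (z + r *\<^sub>R (0, 1))"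
      by (rule iter_deriv_mean_value[OF f(1) h])
    then have "\<bar>(f (z + hh n *\<^sub>R (0, 1)) - f z) / hh n\<bar> \<le> C1" using C1 h by (simp del: iter_deriv.simps)
    moreover have "\<bar>stencil_op n f (z + (0, hh n)) / hh n\<bar> \<le> C2"
      using C2[of n "z + (0, hh n)"] h by (simp only: abs_divide abs_of_pos pos_divide_le_eq)
    ultimately show "\<bar>heat_quotient n f z\<bar> \<le> C1 + C2" unfolding heat_quotient_eq by linarith
  qed
qed

text \<open>Discrete integration by parts: the inequality is multiplied by \<open>f\<close> at the
  new time and integrated, and translation invariance of Lebesgue measure moves each space-time
  shift onto \<open>f\<close>.\<close>

lemma discrete_heat_inequality_weak:
  assumes f: "smooth_fun f" "compact (closure {z. f z \<noteq> 0})" "\<And>z. 0 \<le> f z"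
    and Y: "Y \<in> borel_measurable borel" "\<And>z. \<bar>Y z\<bar> \<le> B"
    and ineq: "\<And>x t. f (x, t + hh n) \<noteq> 0 \<Longrightarrow> (\<Sum>j\<in>stencil n. K n j * Y (x - j, t)) \<le> Y (x, t + hh n) + c * hh n"
  shows "- c * (\<integral>z. f z \<partial>lborel) \<le> (\<integral>z. Y z * heat_quotient n f z \<partial>lborel)"
proof -
  have h: "0 < hh n" by (rule hh_pos)
  have Y_meas [measurable]: "Y \<in> borel_measurable borel" by fact
  have cont: "continuous_on UNIV f" using iter_deriv_continuous[OF f(1), of "[]"] by simp
  have f_meas [measurable]: "f \<in> borel_measurable borel" using cont by (rule borel_measurable_continuous_onI)
  obtain C where C: "\<And>z. \<bar>f z\<bar> \<le> C" using iter_deriv_bounded[OF f(1,2), where vs = "[]"] unfolding iter_deriv.simps by blast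
  obtain \<rho> where "\<And>z. z \<in> closure {z. f z \<noteq> 0} \<Longrightarrow> norm z \<le> \<rho>"
    using compact_imp_bounded[OF f(2)] unfolding bounded_iff by blast
  then have \<rho>: "norm z \<le> \<rho>" if "f z \<noteq> 0" for z using that closure_subset[of "{z. f z \<noteq> 0}"] by blast
  note int = test_integrable[OF cont C \<rho>]
  have iY: "integrable lborel (\<lambda>z. f (z + v) * Y (z + v'))" for v v'
    by (rule int[where C = B]) (auto intro: Y(2))
  have i1: "integrable lborel (\<lambda>z. f (z + v))" for v
    using int[of "\<lambda>_. 1" 1 v] by simp
  let ?e = "(0, hh n) :: (real^'n) \<times> real"
  have shift: "(\<integral>z. f (z + ?e) * Y (z + (- j, 0)) \<partial>lborel) = (\<integral>z. f (z + (j, hh n)) * Y z \<partial>lborel)" for j :: "real^'n"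
  proof -
    have "(\<integral>z. f (z + ?e) * Y (z + (- j, 0)) \<partial>lborel) = (\<integral>z. f (z + (j, 0) + ?e) * Y (z + (j, 0) + (- j, 0)) \<partial>lborel)"
      by (rule lborel_integral_translate[symmetric]) measurable
    then show ?thesis by (simp add: add.assoc zero_prod_def[symmetric])
  qed
  let ?P = "\<lambda>z. f (z + ?e) * Y (z + ?e) + c * hh n * f (z + ?e) - (\<Sum>j\<in>stencil n. K n j * (f (z + ?e) * Y (z + (- j, 0))))"
  have "0 \<le> ?P z" for z
  proof (cases "f (z + ?e) = 0")
    case False
    obtain x t where z: "z = (x, t)" by (cases z)
    have "0 \<le> f (z + ?e) * (Y (x, t + hh n) + c * hh n - (\<Sum>j\<in>stencil n. K n j * Y (x - j, t)))"
      using ineq[of x t] False f(3) by (intro mult_nonneg_nonneg) (auto simp: z)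
    also have "\<dots> = ?P z"
      by (simp add: z distrib_left right_diff_distrib sum_distrib_left ac_simps)
    finally show ?thesis .
  qed simp
  then have "0 \<le> (\<integral>z. ?P z \<partial>lborel)" by simp
  also have "\<dots> = (\<integral>z. f (z + ?e) * Y (z + ?e) \<partial>lborel) + c * hh n * (\<integral>z. f (z + ?e) \<partial>lborel)
      - (\<Sum>j\<in>stencil n. K n j * (\<integral>z. f (z + ?e) * Y (z + (- j, 0)) \<partial>lborel))"
    by (simp add: iY i1 Bochner_Integration.integral_sum)
  also have "(\<integral>z. f (z + ?e) * Y (z + ?e) \<partial>lborel) = (\<integral>z. f z * Y z \<partial>lborel)"
    by (rule lborel_integral_translate) measurable
  also have "(\<integral>z. f (z + ?e) \<partial>lborel) = (\<integral>z. f z \<partial>lborel)"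
    by (rule lborel_integral_translate) measurable
  also have "(\<Sum>j\<in>stencil n. K n j * (\<integral>z. f (z + ?e) * Y (z + (- j, 0)) \<partial>lborel)) =
      (\<Sum>j\<in>stencil n. K n j * (\<integral>z. f (z + (j, hh n)) * Y z \<partial>lborel))"
    by (simp only: shift)
  also have "(\<integral>z. f z * Y z \<partial>lborel) + c * hh n * (\<integral>z. f z \<partial>lborel)
      - (\<Sum>j\<in>stencil n. K n j * (\<integral>z. f (z + (j, hh n)) * Y z \<partial>lborel)) =
      hh n * (\<integral>z. Y z * heat_quotient n f z \<partial>lborel) + c * hh n * (\<integral>z. f z \<partial>lborel)"
  proof -
    have iY': "integrable lborel (\<lambda>z. f (z + v) * Y z)" for v using iY[of v 0] by simp
    have "hh n * (\<integral>z. Y z * heat_quotient n f z \<partial>lborel) = (\<integral>z. hh n * (Y z * heat_quotient n f z) \<partial>lborel)"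
      by simp
    also have "\<dots> = (\<integral>z. f (z + 0) * Y z - (\<Sum>j\<in>stencil n. K n j * (f (z + (j, hh n)) * Y z)) \<partial>lborel)"
    proof -
      have "hh n * heat_quotient n f z = f z - (\<Sum>j\<in>stencil n. K n j * f (z + (j, hh n)))" for z
        using h by (simp add: heat_quotient_def)
      then show ?thesis
        by (simp only: mult.left_commute[of "hh n"]) (simp add: right_diff_distrib sum_distrib_left ac_simps)
    qed
    also have "\<dots> = (\<integral>z. f z * Y z \<partial>lborel) - (\<Sum>j\<in>stencil n. K n j * (\<integral>z. f (z + (j, hh n)) * Y z \<partial>lborel))"
      using iY'[of 0] by (simp add: iY' Bochner_Integration.integral_sum)
    finally show ?thesis by simp
  qed
  finally have "0 \<le> hh n * ((\<integral>z. Y z * heat_quotient n f z \<partial>lborel) + c * (\<integral>z. f z \<partial>lborel))"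
    by (simp add: algebra_simps)
  then show ?thesis using h by (simp add: zero_le_mult_iff)
qed

text \<open>The discrete quotient is exchanged for \<open>heat_adjoint f\<close> by dominated
  convergence, all supports lying in one ball. Then \<open>Y n\<close> is exchanged for
  \<open>D\<close>. The constant \<open>d\<close> is the part of their distance that persists as n
  grows, coming from the inf-convolution at fixed \<delta>.\<close>

lemma heat_limit:
  assumes f: "smooth_fun f" "compact (closure {z. f z \<noteq> 0})" "\<And>z. 0 \<le> f z"
    and Y: "\<And>n. Y n \<in> borel_measurable borel" "\<And>n z. \<bar>Y n z\<bar> \<le> B"
    and ineq: "\<forall>\<^sub>F n in sequentially. \<forall>x t. f (x, t + hh n) \<noteq> 0 \<longrightarrow>
        (\<Sum>j\<in>stencil n. K n j * Y n (x - j, t)) \<le> Y n (x, t + hh n) + c * hh n"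
    and D: "D \<in> borel_measurable borel" "\<And>z. z \<in> closure {z. f z \<noteq> 0} \<Longrightarrow> \<bar>D z\<bar> \<le> B"
    and conv: "AE z in lborel. z \<in> closure {z. f z \<noteq> 0} \<longrightarrow> (\<forall>\<eta>>d. \<forall>\<^sub>F n in sequentially. \<bar>Y n z - D z\<bar> \<le> \<eta>)"
    and d: "0 \<le> d"
  shows "- c * (\<integral>z. f z \<partial>lborel) - d * (\<integral>z. \<bar>heat_adjoint f z\<bar> \<partial>lborel) \<le> (\<integral>z. D z * heat_adjoint f z \<partial>lborel)"
proof -
  let ?L = "heat_adjoint f" and ?Q = "\<lambda>n. heat_quotient n f" and ?S = "closure {z. f z \<noteq> 0}"
  have B: "0 \<le> B" using Y(2)[of 0 undefined] by linarith
  obtain CL where CL: "0 \<le> CL" "\<And>z. \<bar>?L z\<bar> \<le> CL" using heat_adjoint_bounded[OF f(1,2)] by blast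
  obtain CQ where CQ: "\<And>n z. \<bar>?Q n z\<bar> \<le> CQ" using heat_quotient_bounded[OF f(1,2)] by blast
  obtain \<rho> where \<rho>S: "\<And>z. z \<in> ?S \<Longrightarrow> norm z \<le> \<rho>"
    using compact_imp_bounded[OF f(2)] unfolding bounded_iff by blast
  have \<rho>: "norm z \<le> \<rho>" if "f z \<noteq> 0" for z using that \<rho>S closure_subset[of "{z. f z \<noteq> 0}"] by blast
  have \<rho>L: "norm z \<le> \<rho>" if "?L z \<noteq> 0" for z using that \<rho>S heat_adjoint_zero_outside[of z f] by blast
  have "Bseq hh" using h_lim by (intro convergent_imp_Bseq convergentI)
  then obtain H where H: "\<And>n. \<bar>hh n\<bar> \<le> H" unfolding Bseq_def real_norm_def by blast
  have H0: "0 \<le> H" using H[of 0] by linarith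
  have \<rho>Q: "norm z \<le> \<rho> + (1 + H)" if Q: "?Q n z \<noteq> 0" for n z
  proof (rule ccontr)
    assume neg: "\<not> norm z \<le> \<rho> + (1 + H)"
    have "f z = 0" using \<rho>[of z] neg H0 by fastforce
    moreover have "f (z + (j, hh n)) = 0" if j: "j \<in> stencil n" for j
    proof (rule ccontr)
      assume "f (z + (j, hh n)) \<noteq> 0"
      then have "norm (z + (j, hh n)) \<le> \<rho>" by (rule \<rho>)
      moreover have "norm z \<le> norm (z + (j, hh n)) + norm (j, hh n)"
        using norm_triangle_ineq4[of "z + (j, hh n)" "(j, hh n)"] by simp
      moreover have "norm (j, hh n) \<le> norm j + norm (hh n)"
        by (rule norm_Pair_le)
      moreover have "norm j \<le> 1" using j grid_kernel.stencil_def[OF kernel, of n] by auto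
      moreover have "norm (hh n) \<le> H" using H[of n] by simp
      ultimately show False using neg by linarith
    qed
    ultimately show False using Q by (simp add: heat_quotient_def)
  qed
  have cont: "continuous_on UNIV f" using iter_deriv_continuous[OF f(1), of "[]"] by simp
  have meas [measurable]: "f \<in> borel_measurable borel" "?L \<in> borel_measurable borel" "D \<in> borel_measurable borel"
    "\<And>n. Y n \<in> borel_measurable borel"
    using cont heat_adjoint_continuous[OF f(1)] D Y by (auto intro: borel_measurable_continuous_onI)
  have Q_meas [measurable]: "?Q n \<in> borel_measurable borel" for n
    unfolding heat_quotient_def by measurable
  have ball_fin: "emeasure lborel (cball (0 :: (real^'n) \<times> real) r) < \<infinity>" for r
    by (rule emeasure_bounded_finite) simp
  have s_lim: "(\<lambda>n. \<integral>z. Y n z * (?Q n z - ?L z) \<partial>lborel) \<longlonglongrightarrow> (\<integral>z. 0 \<partial>(lborel :: ((real^'n) \<times> real) measure))"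
  proof (rule integral_dominated_convergence[where w = "\<lambda>z. B * (CQ + CL) * indicator (cball 0 (\<rho> + (1 + H))) z"])
    show "integrable lborel (\<lambda>z :: (real^'n) \<times> real. B * (CQ + CL) * indicator (cball 0 (\<rho> + (1 + H))) z)"
      by (intro integrable_mult_right integrable_real_indicator) (use ball_fin in auto)
    show "AE z in lborel. (\<lambda>n. Y n z * (?Q n z - ?L z)) \<longlonglongrightarrow> 0"
    proof (rule AE_I2)
      fix z
      have "(\<lambda>n. ?Q n z - ?L z) \<longlonglongrightarrow> 0" using heat_quotient_lim[OF f(1,2)] by (simp add: LIM_zero)
      then have "(\<lambda>n. B * \<bar>?Q n z - ?L z\<bar>) \<longlonglongrightarrow> B * \<bar>0\<bar>" by (intro tendsto_intros)
      then have bound: "(\<lambda>n. B * \<bar>?Q n z - ?L z\<bar>) \<longlonglongrightarrow> 0" by simp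
      show "(\<lambda>n. Y n z * (?Q n z - ?L z)) \<longlonglongrightarrow> 0"
      proof (rule Lim_null_comparison[OF _ bound], intro always_eventually allI)
        fix n
        show "norm (Y n z * (?Q n z - ?L z)) \<le> B * \<bar>?Q n z - ?L z\<bar>"
          unfolding real_norm_def abs_mult by (intro mult_right_mono Y(2)) simp
      qed
    qed
    show "AE z in lborel. norm (Y n z * (?Q n z - ?L z)) \<le> B * (CQ + CL) * indicator (cball 0 (\<rho> + (1 + H))) z" for n
    proof (rule AE_I2)
      fix z
      show "norm (Y n z * (?Q n z - ?L z)) \<le> B * (CQ + CL) * indicator (cball 0 (\<rho> + (1 + H))) z"
      proof (cases "norm z \<le> \<rho> + (1 + H)")
        case True
        have "\<bar>?Q n z - ?L z\<bar> \<le> CQ + CL" using CQ[of n z] CL(2)[of z] by linarith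
        then show ?thesis using True Y(2)[of n z] B by (auto simp: abs_mult intro!: mult_mono)
      next
        case False
        have "?Q n z = 0" using \<rho>Q[of n z] False by blast
        moreover have "?L z = 0" using \<rho>L[of z] False H0 by fastforce
        ultimately show ?thesis using False by simp
      qed
    qed
  qed measurable
  \<comment> \<open>The excess of the error over the tolerated \<open>d\<close>; unlike the error
    itself it tends to 0 almost everywhere.\<close>
  let ?E = "\<lambda>n z. max (\<bar>Y n z - D z\<bar> - d) 0 * \<bar>?L z\<bar>"
  have D_bound: "\<bar>D z * ?L z\<bar> \<le> B * CL" for z
    using D(2)[of z] CL(1) CL(2)[of z] heat_adjoint_zero_outside[of z f] B by (cases "z \<in> ?S") (auto simp: abs_mult intro!: mult_mono)
  have E_bound: "\<bar>?E n z\<bar> \<le> 2 * B * CL * indicator (cball 0 \<rho>) z" for n z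
  proof (cases "z \<in> ?S")
    case True
    have "max (\<bar>Y n z - D z\<bar> - d) 0 \<le> 2 * B" using Y(2)[of n z] D(2)[OF True] d B by linarith
    then show ?thesis using \<rho>S[OF True] CL(1) CL(2)[of z] B by (auto simp: abs_mult intro!: mult_mono)
  next
    case False
    then show ?thesis using heat_adjoint_zero_outside[of z f] B CL by simp
  qed
  have ball_int: "integrable lborel (\<lambda>z :: (real^'n) \<times> real. 2 * B * CL * indicator (cball 0 \<rho>) z)"
    by (intro integrable_mult_right integrable_real_indicator) (use ball_fin in auto)
  have E_lim: "(\<lambda>n. \<integral>z. ?E n z \<partial>lborel) \<longlonglongrightarrow> (\<integral>z. 0 \<partial>(lborel :: ((real^'n) \<times> real) measure))"
  proof (rule integral_dominated_convergence[OF _ _ ball_int])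
    show "AE z in lborel. (\<lambda>n. ?E n z) \<longlonglongrightarrow> 0"
      using conv
    proof eventually_elim
      case (elim z)
      show ?case
      proof (cases "z \<in> ?S")
        case True
        have "(\<lambda>n. max (\<bar>Y n z - D z\<bar> - d) 0) \<longlonglongrightarrow> 0"
        proof (rule LIMSEQ_I)
          fix r :: real assume r: "0 < r"
          have "\<forall>\<^sub>F n in sequentially. \<bar>Y n z - D z\<bar> \<le> d + r / 2" using elim True r by auto
          then have "\<forall>\<^sub>F n in sequentially. norm (max (\<bar>Y n z - D z\<bar> - d) 0 - 0) < r"
            by eventually_elim (use r in auto)
          then show "\<exists>no. \<forall>n\<ge>no. norm (max (\<bar>Y n z - D z\<bar> - d) 0 - 0) < r" by (simp only: eventually_sequentially)
        qed
        then have "(\<lambda>n. ?E n z) \<longlonglongrightarrow> 0 * \<bar>?L z\<bar>" by (intro tendsto_intros)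
        then show ?thesis by simp
      next
        case False
        then show ?thesis using heat_adjoint_zero_outside[of z f] by simp
      qed
    qed
    show "AE z in lborel. norm (?E n z) \<le> 2 * B * CL * indicator (cball 0 \<rho>) z" for n
      using E_bound by (intro AE_I2) simp
  qed measurable
  have iDL: "integrable lborel (\<lambda>z. D z * ?L z)"
    by (rule integrable_bounded_support[OF _ D_bound]) (use \<rho>L in auto)
  have iL: "integrable lborel (\<lambda>z. \<bar>?L z\<bar>)"
    by (rule integrable_bounded_support[of _ CL \<rho>]) (use \<rho>L CL in auto)
  have iE: "integrable lborel (?E n)" for n
    by (rule Bochner_Integration.integrable_bound[OF ball_int]) (use E_bound CL B in \<open>auto simp: abs_of_nonneg\<close>)
  have iYL: "integrable lborel (\<lambda>z. Y n z * ?L z)" for n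
  proof (rule integrable_bounded_support)
    show "\<bar>Y n z * ?L z\<bar> \<le> B * CL" for z unfolding abs_mult using Y(2)[of n z] CL B by (intro mult_mono) auto
    show "norm z \<le> \<rho>" if "Y n z * ?L z \<noteq> 0" for z using that \<rho>L[of z] by auto
  qed measurable
  have iYQ: "integrable lborel (\<lambda>z. Y n z * ?Q n z)" for n
  proof (rule integrable_bounded_support)
    show "\<bar>Y n z * ?Q n z\<bar> \<le> B * CQ" for z unfolding abs_mult using Y(2)[of n z] CQ[of n z] B by (intro mult_mono) auto
    show "norm z \<le> \<rho> + (1 + H)" if "Y n z * ?Q n z \<noteq> 0" for z using that \<rho>Q[of n z] by auto
  qed measurable
  have upper: "(\<integral>z. Y n z * ?Q n z \<partial>lborel) \<le> (\<integral>z. Y n z * (?Q n z - ?L z) \<partial>lborel)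
      + ((\<integral>z. D z * ?L z \<partial>lborel) + d * (\<integral>z. \<bar>?L z\<bar> \<partial>lborel) + (\<integral>z. ?E n z \<partial>lborel))" for n
  proof -
    have "(\<integral>z. Y n z * ?Q n z \<partial>lborel) = (\<integral>z. Y n z * (?Q n z - ?L z) \<partial>lborel) + (\<integral>z. Y n z * ?L z \<partial>lborel)"
      by (simp add: right_diff_distrib iYQ iYL)
    also have "(\<integral>z. Y n z * ?L z \<partial>lborel) \<le> (\<integral>z. D z * ?L z + d * \<bar>?L z\<bar> + ?E n z \<partial>lborel)"
    proof (rule integral_mono)
      fix z
      have "Y n z * ?L z - D z * ?L z \<le> \<bar>Y n z - D z\<bar> * \<bar>?L z\<bar>"
        unfolding left_diff_distrib[symmetric] abs_mult[symmetric] by (rule abs_ge_self)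
      also have "\<dots> \<le> (d + max (\<bar>Y n z - D z\<bar> - d) 0) * \<bar>?L z\<bar>" by (intro mult_right_mono) auto
      finally show "Y n z * ?L z \<le> D z * ?L z + d * \<bar>?L z\<bar> + ?E n z" by (simp add: distrib_right)
    qed (use iYL iDL iL iE in auto)
    also have "\<dots> = (\<integral>z. D z * ?L z \<partial>lborel) + d * (\<integral>z. \<bar>?L z\<bar> \<partial>lborel) + (\<integral>z. ?E n z \<partial>lborel)"
      using iDL iL iE by simp
    finally show ?thesis by simp
  qed
  have "(\<lambda>n. (\<integral>z. Y n z * (?Q n z - ?L z) \<partial>lborel)
      + ((\<integral>z. D z * ?L z \<partial>lborel) + d * (\<integral>z. \<bar>?L z\<bar> \<partial>lborel) + (\<integral>z. ?E n z \<partial>lborel)))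
      \<longlonglongrightarrow> 0 + ((\<integral>z. D z * ?L z \<partial>lborel) + d * (\<integral>z. \<bar>?L z\<bar> \<partial>lborel) + 0)"
    using s_lim E_lim by (intro tendsto_add tendsto_const) simp_all
  moreover have "\<forall>\<^sub>F n in sequentially. - c * (\<integral>z. f z \<partial>lborel) \<le> (\<integral>z. Y n z * (?Q n z - ?L z) \<partial>lborel)
      + ((\<integral>z. D z * ?L z \<partial>lborel) + d * (\<integral>z. \<bar>?L z\<bar> \<partial>lborel) + (\<integral>z. ?E n z \<partial>lborel))"
    using ineq
  proof eventually_elim
    case (elim n)
    have "- c * (\<integral>z. f z \<partial>lborel) \<le> (\<integral>z. Y n z * ?Q n z \<partial>lborel)"
      by (rule discrete_heat_inequality_weak[OF f Y]) (use elim in blast)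
    then show ?case using upper[of n] by linarith
  qed
  ultimately have "- c * (\<integral>z. f z \<partial>lborel) \<le> 0 + ((\<integral>z. D z * ?L z \<partial>lborel) + d * (\<integral>z. \<bar>?L z\<bar> \<partial>lborel) + 0)"
    by (rule tendsto_lowerbound) simp
  then show ?thesis by simp
qed

end

section \<open>Compactness in time\<close>

lemma edist_set_lipschitz: "edist_set x A \<le> edist_set y A + ereal (dist x y)"
proof -
  have "edist_set x A - ereal (dist x y) \<le> edist_set y A"
    unfolding edist_set_def[of y]
  proof (rule INF_greatest)
    fix z assume "z \<in> A"
    from edist_set_le[OF this, of x] dist_triangle[of x z y]
    have "edist_set x A \<le> ereal (dist x y + dist y z)" by (meson ereal_less_eq(3) order_trans)
    then show "edist_set x A - ereal (dist x y) \<le> ereal (dist y z)" by (cases "edist_set x A") auto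
  qed
  then show ?thesis by (cases "edist_set x A"; cases "edist_set y A") auto
qed

lemma edist_set_nonneg: "0 \<le> edist_set x A"
  unfolding edist_set_def by (intro INF_greatest) auto

lemma edist_set_empty [simp]: "edist_set x {} = \<infinity>"
  by (simp add: edist_set_def top_ereal_def)

lemma edist_set_lessE:
  assumes "edist_set x A < c"
  obtains y where "y \<in> A" "ereal (dist x y) < c"
  using assms unfolding edist_set_def INF_less_iff by blast

lemma edist_set_eq_infdist:
  assumes "A \<noteq> {}"
  shows "edist_set x A = ereal (infdist x A)"
proof (rule antisym)
  show "edist_set x A \<le> ereal (infdist x A)"
  proof (rule ereal_le_epsilon2)
    fix e :: real assume "0 < e"
    then obtain y where "y \<in> A" "dist x y < infdist x A + e"
      using assms cINF_less_iff[of A "dist x" "infdist x A + e"] by (auto simp: infdist_notempty)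
    then show "edist_set x A \<le> ereal (infdist x A) + ereal e"
      using edist_set_le[of y A x] by (simp add: order_trans)
  qed
  show "ereal (infdist x A) \<le> edist_set x A"
    unfolding edist_set_def by (intro INF_greatest) (auto intro: infdist_le)
qed

lemma tanh_dist_lt_1 [simp]: "tanh x < (1::real)"
  by (rule tanh_real_lt_1)

text \<open>The Lipschitz bound keeps \<open>l\<close> below the distance to each zero, and
  \<open>close\<close> provides a zero at which it is attained. On the \<open>gamma\<close> scale
  the case of no zeros is the constant 1.\<close>

lemma exact_distance:
  fixes l :: "'a::metric_space \<Rightarrow> real"
  assumes range: "\<And>x. 0 \<le> l x" "\<And>x. l x \<le> 1"
    and lip: "\<And>x y. l x \<le> tadd (l y) (tanh (dist x y))"
    and close: "\<And>x. l x < 1 \<Longrightarrow> \<exists>y. l y = 0 \<and> tanh (dist x y) \<le> l x"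
  shows "l x = gamma (edist_set x {y. l y = 0})"
proof (rule antisym)
  show "l x \<le> gamma (edist_set x {y. l y = 0})"
  proof (rule ccontr)
    assume neg: "\<not> l x \<le> gamma (edist_set x {y. l y = 0})"
    obtain v where v: "gamma v = l x" using gamma_surj[of "l x"] range[of x] by auto
    then have "edist_set x {y. l y = 0} < v" using neg by (simp flip: v)
    then obtain y where y: "l y = 0" "ereal (dist x y) < v" by (rule edist_set_lessE) simp
    have "l x \<le> gamma (ereal (dist x y))" using lip[of x y] y by simp
    also have "\<dots> < l x" using y(2) by (simp flip: v del: gamma.simps)
    finally show False by simp
  qed
  show "gamma (edist_set x {y. l y = 0}) \<le> l x"
  proof (cases "l x < 1")
    case True
    then obtain y where y: "l y = 0" "tanh (dist x y) \<le> l x" using close by blast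
    have "gamma (edist_set x {y. l y = 0}) \<le> gamma (ereal (dist x y))"
      unfolding gamma_le_iff using y by (intro edist_set_le) simp
    then show ?thesis using y by simp
  next
    case False
    then show ?thesis using gamma_bounds(2) order_trans not_less by blast
  qed
qed

text \<open>Since \<open>l x < 1\<close>, the tanh of the distances to the approximate zeros stays
  below some \<open>b < 1\<close>, so these zeros remain in a ball and accumulate; the Lipschitz
  bounds make an accumulation point a zero of \<open>l\<close>.\<close>

lemma close_zero_limit:
  fixes f :: "nat \<Rightarrow> 'a::{heine_borel,real_normed_vector} \<Rightarrow> real"
  assumes nonneg: "\<And>n x. 0 \<le> f n x"
    and lip: "\<And>n x y. f n x \<le> f n y + dist x y + e n" and e: "e \<longlonglongrightarrow> 0"
    and close: "\<And>n x. f n x < 1 \<Longrightarrow> \<exists>y. f n y = 0 \<and> tanh (dist x y) \<le> tadd (f n x) (tanh (e n))"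
    and lim: "\<And>x. (\<lambda>n. f n x) \<longlonglongrightarrow> l x" and lx: "l x < 1"
  shows "\<exists>y. l y = 0 \<and> tanh (dist x y) \<le> l x"
proof -
  have l0: "0 \<le> l y" for y by (rule LIMSEQ_le_const[OF lim]) (blast intro: nonneg)
  define b where "b = (1 + l x) / 2"
  have b: "l x < b" "b < 1" using lx by (auto simp: b_def)
  have "\<exists>y. f n x < 1 \<longrightarrow> f n y = 0 \<and> tanh (dist x y) \<le> tadd (f n x) (tanh (e n))" for n
    using close by blast
  then obtain y where y: "\<And>n. f n x < 1 \<Longrightarrow> f n (y n) = 0 \<and> tanh (dist x (y n)) \<le> tadd (f n x) (tanh (e n))"
    by metis
  have ev1: "\<forall>\<^sub>F n in sequentially. f n x < 1" using lim lx by (rule order_tendstoD)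
  have tlim: "(\<lambda>n. tadd (f n x) (tanh (e n))) \<longlonglongrightarrow> l x"
  proof -
    have "(\<lambda>n. tanh (e n)) \<longlonglongrightarrow> tanh 0" by (intro tendsto_tanh e) simp
    from tadd_tendsto[OF lim[of x] this] l0 show ?thesis by simp
  qed
  then have ev2: "\<forall>\<^sub>F n in sequentially. tadd (f n x) (tanh (e n)) < b" using b by (intro order_tendstoD)
  have "\<forall>\<^sub>F r in at_top. b < tanh (r::real)" using tanh_real_at_top b by (intro order_tendstoD)
  then obtain R where R: "b < tanh R" by (metis eventually_at_top_linorder order_refl)
  have "\<forall>\<^sub>F n in sequentially. y n \<in> cball x R"
    using ev1 ev2
  proof eventually_elim
    case (elim n)
    then have "tanh (dist x (y n)) < tanh R" using y[of n] R by linarith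
    then show ?case by simp
  qed
  then obtain N where N: "\<And>n. N \<le> n \<Longrightarrow> y n \<in> cball x R" by (auto simp: eventually_sequentially)
  have "seq_compact (cball x R)" by (simp add: compact_imp_seq_compact)
  moreover have "\<forall>n. y (n + N) \<in> cball x R" using N by simp
  ultimately obtain z s where s: "strict_mono s" "((\<lambda>n. y (n + N)) \<circ> s) \<longlonglongrightarrow> z"
    by (rule seq_compactE)
  define m where "m k = s k + N" for k
  have ym: "(\<lambda>k. y (m k)) \<longlonglongrightarrow> z" using s(2) by (simp add: o_def m_def)
  have m: "filterlim m sequentially sequentially"
    unfolding m_def by (rule filterlim_compose[OF filterlim_add_const_nat_at_top filterlim_subseq[OF s(1)]])
  have evm1: "\<forall>\<^sub>F k in sequentially. f (m k) x < 1" using ev1 m by (rule eventually_compose_filterlim)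
  have "l z \<le> 0"
  proof (rule tendsto_le[OF trivial_limit_sequentially])
    show "(\<lambda>k. f (m k) z) \<longlonglongrightarrow> l z" by (rule filterlim_compose[OF lim m])
    have "(\<lambda>k. dist z (y (m k)) + e (m k)) \<longlonglongrightarrow> dist z z + 0"
      by (intro tendsto_intros ym filterlim_compose[OF e m])
    then show "(\<lambda>k. dist z (y (m k)) + e (m k)) \<longlonglongrightarrow> 0" by simp
    show "\<forall>\<^sub>F k in sequentially. f (m k) z \<le> dist z (y (m k)) + e (m k)"
      using evm1
    proof eventually_elim
      case (elim k)
      then show ?case using lip[of "m k" z "y (m k)"] y[of "m k"] by simp
    qed
  qed
  moreover have "tanh (dist x z) \<le> l x"
  proof (rule tendsto_le[OF trivial_limit_sequentially])
    show "(\<lambda>k. tadd (f (m k) x) (tanh (e (m k)))) \<longlonglongrightarrow> l x" by (rule filterlim_compose[OF tlim m])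
    show "(\<lambda>k. tanh (dist x (y (m k)))) \<longlonglongrightarrow> tanh (dist x z)" by (intro tendsto_tanh tendsto_intros ym) simp
    show "\<forall>\<^sub>F k in sequentially. tanh (dist x (y (m k))) \<le> tadd (f (m k) x) (tanh (e (m k)))"
      using evm1 by eventually_elim (use y in blast)
  qed
  ultimately show ?thesis using l0[of z] by (intro exI[of _ z]) auto
qed

section \<open>The flow as a function of space and time\<close>

locale flow_sequence = kernel_sequence \<epsilon> K
  for \<epsilon> :: "nat \<Rightarrow> real" and K :: "nat \<Rightarrow> real^'n \<Rightarrow> real" +
  fixes u :: "nat \<Rightarrow> nat \<Rightarrow> real^'n \<Rightarrow> ereal" and A0 :: "(real^'n) set"
  assumes flow: "\<And>n. grid_flow (\<epsilon> n) (K n) (u n)"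
    and initial: "\<And>n i. i \<in> grid (\<epsilon> n) \<Longrightarrow>
      edist_set i A0 \<le> max (u n 0 i) 0 + ereal (5 * real CARD('n) * \<epsilon> n)"
    and A0_closed: "closed A0"
begin

definition steps :: "nat \<Rightarrow> real \<Rightarrow> nat" where
  "steps n t = nat \<lfloor>t / hh n\<rfloor>"

definition V :: "nat \<Rightarrow> real^'n \<Rightarrow> real \<Rightarrow> ereal" where
  "V n x t = max (u n (steps n t) (grid_floor (\<epsilon> n) x)) 0"

definition F :: "nat \<Rightarrow> real^'n \<Rightarrow> real \<Rightarrow> real" where
  "F n x t = gamma (V n x t)"

text \<open>A common bound for all rounding errors. The largest is that of the initial datum: five
  cell diameters on the grid and one more for rounding \<open>x\<close>.\<close>

definition mesh :: "nat \<Rightarrow> real" where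
  "mesh n = 6 * real CARD('n) * \<epsilon> n"

definition rate :: real where
  "rate = barrier_rate (real CARD('n))"

text \<open>In \<open>U_speed\<close> a duration \<tau> needs R0^2 = 2 rate \<tau>, and the loss is
  5 R0 / 4.\<close>

definition Cspeed :: real where
  "Cspeed = 5 / 4 * sqrt (2 * rate)"

definition err :: "nat \<Rightarrow> real" where
  "err n = Cspeed * sqrt (hh n) + mesh n"

lemma eps_pos: "0 < \<epsilon> n"
  using grid_kernel.eps_pos[OF kernel] .

lemma mesh_pos: "0 < mesh n"
  using eps_pos by (simp add: mesh_def)

lemma rate_pos: "0 < rate"
  using barrier_rate_pos[of "real CARD('n)"] by (simp add: rate_def Suc_leI)

lemma Cspeed_pos: "0 < Cspeed"
  using rate_pos by (simp add: Cspeed_def)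

lemma mesh_lim: "mesh \<longlonglongrightarrow> 0"
  using tendsto_mult_left[OF eps_lim, of "6 * real CARD('n)"] by (simp add: mesh_def[abs_def])

lemma err_lim: "err \<longlonglongrightarrow> 0"
proof -
  have "(\<lambda>n. Cspeed * sqrt (hh n) + mesh n) \<longlonglongrightarrow> Cspeed * sqrt 0 + 0"
    by (intro tendsto_intros h_lim mesh_lim)
  then show ?thesis by (simp add: err_def[abs_def])
qed

lemma steps_mono: "t \<le> t' \<Longrightarrow> steps n t \<le> steps n t'"
  using hh_pos[of n] by (auto simp: steps_def intro!: nat_mono floor_mono divide_right_mono)

lemma steps_add_h: "0 \<le> t \<Longrightarrow> steps n (t + hh n) = Suc (steps n t)"
  using hh_pos[of n] by (simp add: steps_def add_divide_distrib nat_add_distrib)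

lemma steps_diff:
  assumes "0 \<le> t" "t \<le> t'"
  shows "real (steps n t' - steps n t) * hh n \<le> t' - t + hh n"
proof -
  have h: "0 < hh n" by (rule hh_pos)
  have "0 \<le> t / hh n" "0 \<le> t' / hh n" using assms h by auto
  then have "real (steps n t') \<le> t' / hh n" "t / hh n - 1 \<le> real (steps n t)"
    by (auto simp: steps_def of_nat_nat)
  then have "real (steps n t' - steps n t) \<le> t' / hh n - t / hh n + 1"
    using steps_mono[OF assms(2), of n] by (simp add: of_nat_diff)
  then have "real (steps n t' - steps n t) * hh n \<le> (t' / hh n - t / hh n + 1) * hh n"
    using h by (intro mult_right_mono) auto
  also have "\<dots> = t' - t + hh n" using h by (simp add: algebra_simps)
  finally show ?thesis .
qed

lemma V_nonneg: "0 \<le> V n x t"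
  by (simp add: V_def)

lemma F_range: "0 \<le> F n x t" "F n x t \<le> 1"
  using gamma_bounds(2) V_nonneg by (auto simp: F_def)

lemma norm_grid_floor_diff:
  "norm (grid_floor (\<epsilon> n) x - grid_floor (\<epsilon> n) y) \<le> dist x y + mesh n" for x y :: "real^'n"
proof -
  let ?g = "grid_floor (\<epsilon> n)"
  have "?g x - ?g y = (x - y) - (x - ?g x) + (y - ?g y)" by simp
  then have "norm (?g x - ?g y) \<le> norm (x - y) + norm (x - ?g x) + norm (y - ?g y)"
    using norm_triangle_ineq[of "(x - y) - (x - ?g x)" "y - ?g y"] norm_triangle_ineq4[of "x - y" "x - ?g x"]
    by (simp only:)
  moreover have "0 \<le> real CARD('n) * \<epsilon> n" using eps_pos[of n] by simp
  moreover have "mesh n = 6 * (real CARD('n) * \<epsilon> n)" by (simp add: mesh_def)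
  ultimately show ?thesis
    using norm_grid_floor[OF eps_pos, of x n] norm_grid_floor[OF eps_pos, of y n]
    unfolding dist_norm by linarith
qed

lemma V_lipschitz: "V n x t \<le> V n y t + ereal (dist x y + mesh n)"
proof -
  have "V n x t \<le> V n y t + ereal (norm (grid_floor (\<epsilon> n) x - grid_floor (\<epsilon> n) y))"
    unfolding V_def by (rule grid_flow.U_lipschitz[OF flow]) simp_all
  also have "\<dots> \<le> V n y t + ereal (dist x y + mesh n)"
    using norm_grid_floor_diff by (intro add_left_mono) simp
  finally show ?thesis .
qed

lemma gamma_le_add:
  assumes "0 \<le> x" "x \<le> y + ereal r" "0 \<le> r" "0 \<le> y"
  shows "gamma x \<le> gamma y + r"
proof -
  have "gamma x \<le> tadd (gamma y) (tanh r)" using assms(2) by (simp flip: gamma_add)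
  also have "\<dots> \<le> gamma y + tanh r" using assms by (intro tadd_le_add) auto
  also have "\<dots> \<le> gamma y + r" using tanh_le_self[OF assms(3)] by simp
  finally show ?thesis .
qed

lemma F_lipschitz: "F n x t \<le> tadd (F n y t) (tanh (dist x y + mesh n))"
  using V_lipschitz[of n x t y] by (simp add: F_def flip: gamma_add)

lemma F_lipschitz': "F n x t \<le> F n y t + dist x y + mesh n"
  using gamma_le_add[OF V_nonneg V_lipschitz[of n x t y]] mesh_pos[of n] V_nonneg by (simp add: F_def add.assoc)

lemma V_speed:
  assumes t: "0 \<le> t" "t \<le> t'" and small: "2 * rate * (t' - t + hh n) \<le> 1"
  shows "V n x t \<le> V n x t' + ereal (Cspeed * sqrt (t' - t + hh n) + mesh n)"
proof -
  define R where "R = sqrt (2 * rate * (t' - t + hh n))"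
  have pos: "0 < 2 * rate * (t' - t + hh n)" using rate_pos hh_pos[of n] t by simp
  have R: "0 < R" "R \<le> 1" "R\<^sup>2 = 2 * rate * (t' - t + hh n)"
    using pos small by (auto simp: R_def)
  have "real (steps n t' - steps n t) * rate * hh n \<le> R\<^sup>2 / 2"
    using mult_left_mono[OF steps_diff[OF t, of n], of rate] rate_pos by (simp add: R mult.commute mult.left_commute)
  then have "V n x t \<le> max (u n (steps n t + (steps n t' - steps n t)) (grid_floor (\<epsilon> n) x)) 0
      + ereal (5 * R / 4 + 4 * real CARD('n) * \<epsilon> n)"
    unfolding V_def rate_def by (intro grid_flow.U_speed[OF flow] R) simp_all
  also have "\<dots> \<le> V n x t' + ereal (Cspeed * sqrt (t' - t + hh n) + mesh n)"
  proof -
    have "5 * R / 4 = Cspeed * sqrt (t' - t + hh n)" by (simp add: R_def Cspeed_def real_sqrt_mult)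
    moreover have "4 * real CARD('n) * \<epsilon> n \<le> mesh n" using eps_pos[of n] by (simp add: mesh_def)
    ultimately show ?thesis using steps_mono[OF t(2), of n] unfolding V_def by (intro add_mono) auto
  qed
  finally show ?thesis .
qed

lemma F_speed:
  assumes t: "0 \<le> t" "t \<le> t'"
  shows "F n x t \<le> F n x t' + Cspeed * sqrt (t' - t) + err n"
proof -
  have sqrt_add: "sqrt (t' - t + hh n) \<le> sqrt (t' - t) + sqrt (hh n)"
    using t hh_pos[of n] by (intro sqrt_add_le_add_sqrt) auto
  then have C: "Cspeed * sqrt (t' - t + hh n) \<le> Cspeed * sqrt (t' - t) + Cspeed * sqrt (hh n)"
    using mult_left_mono[OF sqrt_add, of Cspeed] Cspeed_pos by (simp add: distrib_left)
  show ?thesis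
  proof (cases "2 * rate * (t' - t + hh n) \<le> 1")
    case True
    have "F n x t \<le> F n x t' + (Cspeed * sqrt (t' - t + hh n) + mesh n)"
      unfolding F_def using V_speed[OF t True] Cspeed_pos mesh_pos[of n] t hh_pos[of n]
      by (intro gamma_le_add V_nonneg add_nonneg_nonneg mult_nonneg_nonneg) auto
    then show ?thesis using C by (simp add: err_def)
  next
    \<comment> \<open>For durations beyond the reach of \<open>V_speed\<close> the right-hand side
      already exceeds 1, an upper bound of \<open>F\<close>.\<close>
    case False
    then have "1 \<le> sqrt (2 * rate * (t' - t + hh n))" by simp
    also have "\<dots> \<le> Cspeed * sqrt (t' - t + hh n)"
      using rate_pos t hh_pos[of n] by (simp add: Cspeed_def real_sqrt_mult)
    finally show ?thesis using C F_range[of n x t] F_range(1)[of n x t'] mesh_pos[of n] by (simp add: err_def)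
  qed
qed

lemma V_long:
  assumes "0 \<le> t" "t \<le> t'" "4 * rate * hh n \<le> 1" "16 * real CARD('n) * \<epsilon> n \<le> 3" "4 * rate * (t' - t) + 1 \<le> real q"
  shows "V n x t \<le> V n x t' + ereal (2 * real q)"
proof -
  have "real (steps n t' - steps n t) * (4 * rate) * hh n \<le> 4 * rate * (t' - t + hh n)"
    using mult_left_mono[OF steps_diff[OF assms(1,2), of n], of "4 * rate"] rate_pos
    by (simp add: mult.commute mult.left_commute)
  also have "\<dots> \<le> real q" using assms(3,5) by (simp add: algebra_simps)
  finally have "V n x t \<le> max (u n (steps n t + (steps n t' - steps n t)) (grid_floor (\<epsilon> n) x)) 0 + ereal (2 * real q)"
    unfolding V_def rate_def using assms(3,4) rate_pos
    by (intro grid_flow.U_speed_long[OF flow]) (auto simp: rate_def field_simps)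
  then show ?thesis using steps_mono[OF assms(2), of n] by (simp add: V_def)
qed

lemma eventually_small: "\<forall>\<^sub>F n in sequentially. 4 * rate * hh n \<le> 1 \<and> 16 * real CARD('n) * \<epsilon> n \<le> 3"
proof -
  have "(\<lambda>n. 4 * rate * hh n) \<longlonglongrightarrow> 4 * rate * 0" by (intro tendsto_intros h_lim)
  then have "\<forall>\<^sub>F n in sequentially. 4 * rate * hh n < 1" by (rule order_tendstoD) simp
  moreover have "(\<lambda>n. 16 * real CARD('n) * \<epsilon> n) \<longlonglongrightarrow> 16 * real CARD('n) * 0" by (intro tendsto_intros eps_lim)
  then have "\<forall>\<^sub>F n in sequentially. 16 * real CARD('n) * \<epsilon> n < 3" by (rule order_tendstoD) simp
  ultimately show ?thesis by eventually_elim auto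
qed

text \<open>Kept in \<open>tadd\<close> form, since an additive bound says nothing once it exceeds
  1: here a later value below 1 forces the earlier one below 1.\<close>

lemma F_long:
  assumes "0 \<le> t" "t \<le> t'" "4 * rate * (t' - t) + 1 \<le> real q"
  shows "\<forall>\<^sub>F n in sequentially. F n x t \<le> tadd (F n x t') (tanh (2 * real q))"
  using eventually_small
proof eventually_elim
  case (elim n)
  then have "V n x t \<le> V n x t' + ereal (2 * real q)" using assms by (intro V_long) auto
  then show ?case by (simp add: F_def flip: gamma_add)
qed

lemma F_close_zero:
  assumes "F n x t < 1"
  shows "\<exists>y. F n y t = 0 \<and> tanh (dist x y) \<le> tadd (F n x t) (tanh (mesh n))"
proof -
  let ?i = "grid_floor (\<epsilon> n) x"
  have "V n x t < \<infinity>" using assms gamma_less_iff[of "V n x t" \<infinity>] by (simp add: F_def del: gamma_less_iff)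
  then obtain j where j: "j \<in> grid (\<epsilon> n)" "u n (steps n t) j \<le> 0"
    "ereal (norm (?i - j)) \<le> V n x t + ereal (4 * real CARD('n) * \<epsilon> n)"
    using grid_flow.U_close_zero[OF flow, of ?i n "steps n t"] unfolding V_def by auto
  have Fj: "F n j t = 0" using j by (simp add: F_def V_def grid_floor_id[OF eps_pos] max_def)
  have "dist x j \<le> norm (?i - j) + real CARD('n) * \<epsilon> n"
    using norm_grid_floor[OF eps_pos, of x n] norm_triangle_ineq[of "x - ?i" "?i - j"] by (simp add: dist_norm)
  then have "ereal (dist x j) \<le> ereal (norm (?i - j)) + ereal (real CARD('n) * \<epsilon> n)" by simp
  also have "\<dots> \<le> (V n x t + ereal (4 * real CARD('n) * \<epsilon> n)) + ereal (real CARD('n) * \<epsilon> n)"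
    by (intro add_right_mono j)
  also have "\<dots> = V n x t + ereal (5 * (real CARD('n) * \<epsilon> n))" by (simp add: add.assoc mult.commute)
  also have "\<dots> \<le> V n x t + ereal (mesh n)" using eps_pos[of n] by (intro add_left_mono) (simp add: mesh_def)
  finally have "gamma (ereal (dist x j)) \<le> tadd (F n x t) (tanh (mesh n))"
    unfolding F_def gamma_add[symmetric] gamma_le_iff .
  then have "tanh (dist x j) \<le> tadd (F n x t) (tanh (mesh n))" by simp
  then show ?thesis using Fj by blast
qed

text \<open>This direction places zeros at small times near \<open>A0\<close>, which is what makes
  the limiting set close up inside \<open>A0\<close> at time 0.\<close>

lemma F_initial: "gamma (edist_set x A0) \<le> tadd (F n x 0) (tanh (mesh n))"
proof -
  let ?i = "grid_floor (\<epsilon> n) x"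
  have "edist_set x A0 \<le> edist_set ?i A0 + ereal (dist x ?i)" by (rule edist_set_lipschitz)
  also have "\<dots> \<le> (V n x 0 + ereal (5 * real CARD('n) * \<epsilon> n)) + ereal (real CARD('n) * \<epsilon> n)"
    using initial[of ?i n] norm_grid_floor[OF eps_pos, of x n]
    by (intro add_mono) (simp_all add: V_def steps_def dist_norm)
  also have "\<dots> = V n x 0 + ereal (mesh n)" by (simp add: add.assoc mesh_def) (simp add: algebra_simps)
  finally show ?thesis unfolding F_def gamma_add[symmetric] gamma_le_iff .
qed

end

section \<open>The limit at rational times and its left limits\<close>

locale convergent_flow_sequence = flow_sequence \<epsilon> K u A0
  for \<epsilon> and K :: "nat \<Rightarrow> real^'n \<Rightarrow> real" and u A0 +
  assumes conv: "\<And>x r. r \<in> \<rat> \<Longrightarrow> 0 \<le> r \<Longrightarrow> convergent (\<lambda>n. F n x r)"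
begin

definition g :: "real^'n \<Rightarrow> real \<Rightarrow> real" where
  "g x r = lim (\<lambda>n. F n x r)"

definition times :: "real set" where
  "times = {r\<in>\<rat>. 0 \<le> r}"

lemma g_lim: "r \<in> times \<Longrightarrow> (\<lambda>n. F n x r) \<longlonglongrightarrow> g x r"
  using conv[of r x] by (simp add: g_def times_def convergent_LIMSEQ_iff)

lemma times_nonneg: "r \<in> times \<Longrightarrow> 0 \<le> r"
  by (simp add: times_def)

lemma zero_in_times [simp]: "0 \<in> times"
  by (simp add: times_def)

lemma times_between:
  assumes "0 \<le> a" "a < b"
  obtains r where "r \<in> times" "a < r" "r < b"
  using Rats_dense_in_real[OF assms(2)] assms(1) by (auto simp: times_def)

lemma g_range: "r \<in> times \<Longrightarrow> 0 \<le> g x r" "r \<in> times \<Longrightarrow> g x r \<le> 1"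
  using F_range by (auto intro!: LIMSEQ_le_const[OF g_lim] LIMSEQ_le_const2[OF g_lim])

lemma g_lipschitz:
  assumes "r \<in> times"
  shows "g x r \<le> tadd (g y r) (tanh (dist x y))"
proof (rule tendsto_le[OF trivial_limit_sequentially])
  have "(\<lambda>n. tanh (dist x y + mesh n)) \<longlonglongrightarrow> tanh (dist x y + 0)"
    by (intro tendsto_tanh tendsto_intros mesh_lim) simp
  then show "(\<lambda>n. tadd (F n y r) (tanh (dist x y + mesh n))) \<longlonglongrightarrow> tadd (g y r) (tanh (dist x y))"
    using assms by (intro tadd_tendsto g_lim g_range) auto
  show "(\<lambda>n. F n x r) \<longlonglongrightarrow> g x r" by (rule g_lim[OF assms])
qed (use F_lipschitz in auto)

lemma g_speed:
  assumes "r \<in> times" "r' \<in> times" "r \<le> r'"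
  shows "g x r \<le> g x r' + Cspeed * sqrt (r' - r)"
proof (rule tendsto_le[OF trivial_limit_sequentially])
  have "(\<lambda>n. F n x r' + Cspeed * sqrt (r' - r) + err n) \<longlonglongrightarrow> g x r' + Cspeed * sqrt (r' - r) + 0"
    by (intro tendsto_intros g_lim err_lim assms)
  then show "(\<lambda>n. F n x r' + Cspeed * sqrt (r' - r) + err n) \<longlonglongrightarrow> g x r' + Cspeed * sqrt (r' - r)" by simp
  show "(\<lambda>n. F n x r) \<longlonglongrightarrow> g x r" by (rule g_lim[OF assms(1)])
qed (use F_speed[OF times_nonneg[OF assms(1)] assms(3)] in auto)

lemma g_long:
  assumes "r \<in> times" "r' \<in> times" "r \<le> r'" "4 * rate * (r' - r) + 1 \<le> real q"
  shows "g x r \<le> tadd (g x r') (tanh (2 * real q))"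
proof (rule tendsto_le[OF trivial_limit_sequentially])
  show "(\<lambda>n. tadd (F n x r') (tanh (2 * real q))) \<longlonglongrightarrow> tadd (g x r') (tanh (2 * real q))"
    using assms by (intro tadd_tendsto g_lim g_range tendsto_const) auto
  show "\<forall>\<^sub>F n in sequentially. F n x r \<le> tadd (F n x r') (tanh (2 * real q))"
    by (rule F_long[OF times_nonneg[OF assms(1)] assms(3,4)])
qed (use g_lim assms in auto)

lemma g_initial: "gamma (edist_set x A0) \<le> g x 0"
proof (rule tendsto_le[OF trivial_limit_sequentially _ tendsto_const])
  have "(\<lambda>n. tanh (mesh n)) \<longlonglongrightarrow> tanh 0" by (intro tendsto_tanh mesh_lim) simp
  from tadd_tendsto[OF g_lim[of 0 x] this] g_range[of 0 x]
  show "(\<lambda>n. tadd (F n x 0) (tanh (mesh n))) \<longlonglongrightarrow> g x 0" by simp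
qed (use F_initial in auto)

lemma g_close_zero:
  assumes "r \<in> times" "g x r < 1"
  shows "\<exists>y. g y r = 0 \<and> tanh (dist x y) \<le> g x r"
  using F_range(1) F_lipschitz' mesh_lim F_close_zero g_lim[OF assms(1)] assms(2)
  by (rule close_zero_limit[where f = "\<lambda>n x. F n x r" and e = mesh])

text \<open>Because of the speed bound, this is the left limit of \<open>g x\<close> at \<open>t\<close>.\<close>

definition L :: "real^'n \<Rightarrow> real \<Rightarrow> real" where
  "L x t = (SUP r\<in>{r\<in>times. r < t}. g x r - Cspeed * sqrt (t - r))"

lemma L_ge:
  assumes "r \<in> times" "r < t"
  shows "g x r - Cspeed * sqrt (t - r) \<le> L x t"
  unfolding L_def
proof (rule cSUP_upper)
  show "bdd_above ((\<lambda>r. g x r - Cspeed * sqrt (t - r)) ` {r \<in> times. r < t})"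
  proof (rule bdd_aboveI2)
    fix r assume r: "r \<in> {r \<in> times. r < t}"
    then have "0 \<le> Cspeed * sqrt (t - r)" using Cspeed_pos by simp
    then show "g x r - Cspeed * sqrt (t - r) \<le> 1" using g_range(2)[of r x] r by simp
  qed
qed (use assms in auto)

lemma L_less_iff:
  assumes "0 < t"
  shows "c < L x t \<longleftrightarrow> (\<exists>r\<in>times. r < t \<and> c < g x r - Cspeed * sqrt (t - r))"
proof
  assume c: "c < L x t"
  have ne: "{r \<in> times. r < t} \<noteq> {}" using assms by (auto intro: exI[of _ 0])
  show "\<exists>r\<in>times. r < t \<and> c < g x r - Cspeed * sqrt (t - r)"
  proof (rule ccontr)
    assume "\<not> (\<exists>r\<in>times. r < t \<and> c < g x r - Cspeed * sqrt (t - r))"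
    then have "L x t \<le> c" unfolding L_def using ne by (intro cSUP_least) (auto simp: not_less)
    then show False using c by simp
  qed
next
  assume "\<exists>r\<in>times. r < t \<and> c < g x r - Cspeed * sqrt (t - r)"
  then show "c < L x t" using L_ge less_le_trans by blast
qed

text \<open>As for monotone functions, up to the modulus: one rational time with a large value
  bounds all later ones from below, and \<open>L_ge\<close> bounds each
  \<open>g x (\<rho> m)\<close> from above with a correction that vanishes at
  \<open>t\<close>.\<close>

lemma g_tendsto_L:
  assumes t: "0 < t" and \<rho>: "\<And>m. \<rho> m \<in> times" "\<And>m. \<rho> m < t" "\<rho> \<longlonglongrightarrow> t"
  shows "(\<lambda>m. g x (\<rho> m)) \<longlonglongrightarrow> L x t"
proof (rule order_tendstoI)
  fix c assume "c < L x t"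
  then obtain r where r: "r \<in> times" "r < t" "c < g x r - Cspeed * sqrt (t - r)"
    using L_less_iff[OF t] by blast
  have "\<forall>\<^sub>F m in sequentially. r < \<rho> m" using \<rho>(3) r(2) by (rule order_tendstoD)
  then show "\<forall>\<^sub>F m in sequentially. c < g x (\<rho> m)"
  proof eventually_elim
    case (elim m)
    have "g x r \<le> g x (\<rho> m) + Cspeed * sqrt (\<rho> m - r)" using elim r \<rho> by (intro g_speed) auto
    moreover have "Cspeed * sqrt (\<rho> m - r) \<le> Cspeed * sqrt (t - r)"
      using \<rho>(2)[of m] Cspeed_pos by (intro mult_left_mono) (auto simp: less_imp_le)
    ultimately show ?case using r by linarith
  qed
next
  fix c assume c: "L x t < c"
  have "(\<lambda>m. L x t + Cspeed * sqrt (t - \<rho> m)) \<longlonglongrightarrow> L x t + Cspeed * sqrt (t - t)" by (intro tendsto_intros \<rho>)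
  then have "\<forall>\<^sub>F m in sequentially. L x t + Cspeed * sqrt (t - \<rho> m) < c" using c by (intro order_tendstoD) auto
  then show "\<forall>\<^sub>F m in sequentially. g x (\<rho> m) < c"
    by eventually_elim (use L_ge[OF \<rho>(1,2), of x] in \<open>smt (verit)\<close>)
qed

lemma times_approx:
  assumes "0 < t"
  obtains \<rho> where "\<And>m. \<rho> m \<in> times" "\<And>m. \<rho> m < t" "\<rho> \<longlonglongrightarrow> t"
proof -
  have "\<exists>r. r \<in> times \<and> max 0 (t - 1 / real (Suc m)) < r \<and> r < t" for m
    using times_between[of "max 0 (t - 1 / real (Suc m))" t] assms by auto
  then obtain \<rho> where \<rho>: "\<And>m. \<rho> m \<in> times" "\<And>m. max 0 (t - 1 / real (Suc m)) < \<rho> m" "\<And>m. \<rho> m < t"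
    by metis
  have "\<rho> \<longlonglongrightarrow> t"
  proof (rule tendsto_sandwich[of "\<lambda>m. t - 1 / real (Suc m)" _ _ "\<lambda>_. t"])
    have "(\<lambda>m. t - 1 / real (Suc m)) \<longlonglongrightarrow> t - 0" by (intro tendsto_diff tendsto_const LIMSEQ_Suc lim_1_over_n)
    then show "(\<lambda>m. t - 1 / real (Suc m)) \<longlonglongrightarrow> t" by simp
  qed (use \<rho> in \<open>auto intro!: always_eventually simp: less_imp_le\<close>)
  then show thesis using that \<rho> by blast
qed

lemma L_range: "0 < t \<Longrightarrow> 0 \<le> L x t" "0 < t \<Longrightarrow> L x t \<le> 1"
proof -
  assume t: "0 < t"
  obtain \<rho> where \<rho>: "\<And>m. \<rho> m \<in> times" "\<And>m. \<rho> m < t" "\<rho> \<longlonglongrightarrow> t" using times_approx[OF t] by blast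
  show "0 \<le> L x t" "L x t \<le> 1"
    using g_range[OF \<rho>(1)] by (auto intro!: LIMSEQ_le_const[OF g_tendsto_L[OF t \<rho>]] LIMSEQ_le_const2[OF g_tendsto_L[OF t \<rho>]])
qed

lemma L_lipschitz:
  assumes t: "0 < t"
  shows "L x t \<le> tadd (L y t) (tanh (dist x y))"
proof -
  obtain \<rho> where \<rho>: "\<And>m. \<rho> m \<in> times" "\<And>m. \<rho> m < t" "\<rho> \<longlonglongrightarrow> t" using times_approx[OF t] by blast
  show ?thesis
  proof (rule tendsto_le[OF trivial_limit_sequentially])
    show "(\<lambda>m. tadd (g y (\<rho> m)) (tanh (dist x y))) \<longlonglongrightarrow> tadd (L y t) (tanh (dist x y))"
      by (intro tadd_tendsto g_tendsto_L[OF t \<rho>] tendsto_const L_range t) simp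
    show "(\<lambda>m. g x (\<rho> m)) \<longlonglongrightarrow> L x t" by (rule g_tendsto_L[OF t \<rho>])
  qed (use g_lipschitz \<rho> in auto)
qed

lemma L_lipschitz': "0 < t \<Longrightarrow> L x t \<le> L y t + dist x y"
  using L_lipschitz[of t x y] tadd_le_add[of "L y t" "tanh (dist x y)"] L_range[of t y] tanh_le_self[of "dist x y"]
  by simp

lemma L_close_zero:
  assumes t: "0 < t" and "L x t < 1"
  shows "\<exists>y. L y t = 0 \<and> tanh (dist x y) \<le> L x t"
proof -
  obtain \<rho> where \<rho>: "\<And>m. \<rho> m \<in> times" "\<And>m. \<rho> m < t" "\<rho> \<longlonglongrightarrow> t" using times_approx[OF t] by blast
  show ?thesis
  proof (rule close_zero_limit[where f = "\<lambda>m x. g x (\<rho> m)" and e = "\<lambda>_. 0" and l = "\<lambda>x. L x t"])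
    show "g x (\<rho> m) \<le> g y (\<rho> m) + dist x y + 0" for m x y
      using g_lipschitz[OF \<rho>(1), of x m y] tadd_le_add[of "g y (\<rho> m)" "tanh (dist x y)"] g_range[OF \<rho>(1), of y m]
        tanh_le_self[of "dist x y"] by simp
    show "\<exists>y. g y (\<rho> m) = 0 \<and> tanh (dist x y) \<le> tadd (g x (\<rho> m)) (tanh 0)" if "g x (\<rho> m) < 1" for m x
      using g_close_zero[OF \<rho>(1) that] by simp
  qed (use g_range \<rho> g_tendsto_L[OF t \<rho>] assms in auto)
qed

lemma L_speed:
  assumes "0 < t" "t \<le> t'"
  shows "L x t \<le> L x t' + Cspeed * sqrt (t' - t)"
proof -
  obtain \<rho> where \<rho>: "\<And>m. \<rho> m \<in> times" "\<And>m. \<rho> m < t" "\<rho> \<longlonglongrightarrow> t" using times_approx[OF assms(1)] by blast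
  show ?thesis
  proof (rule tendsto_le[OF trivial_limit_sequentially])
    show "(\<lambda>m. L x t' + Cspeed * sqrt (t' - \<rho> m)) \<longlonglongrightarrow> L x t' + Cspeed * sqrt (t' - t)" by (intro tendsto_intros \<rho>)
    show "(\<lambda>m. g x (\<rho> m)) \<longlonglongrightarrow> L x t" by (rule g_tendsto_L[OF assms(1) \<rho>])
    show "\<forall>\<^sub>F m in sequentially. g x (\<rho> m) \<le> L x t' + Cspeed * sqrt (t' - \<rho> m)"
    proof (intro always_eventually allI)
      fix m show "g x (\<rho> m) \<le> L x t' + Cspeed * sqrt (t' - \<rho> m)"
        using L_ge[OF \<rho>(1)[of m], of t' x] \<rho>(2)[of m] assms by simp
    qed
  qed
qed

lemma L_initial: "0 < t \<Longrightarrow> gamma (edist_set x A0) \<le> L x t + Cspeed * sqrt t"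
  using L_ge[of 0 t x] g_initial[of x] by simp

lemma L_long:
  assumes "0 < t" "t \<le> t'" "4 * rate * (t' - t) + 2 \<le> real q"
  shows "L x t \<le> tadd (L x t') (tanh (2 * real q))"
proof -
  have t': "0 < t'" using assms by simp
  obtain \<rho> where \<rho>: "\<And>m. \<rho> m \<in> times" "\<And>m. \<rho> m < t" "\<rho> \<longlonglongrightarrow> t" using times_approx[OF assms(1)] by blast
  obtain \<rho>' where \<rho>': "\<And>m. \<rho>' m \<in> times" "\<And>m. \<rho>' m < t'" "\<rho>' \<longlonglongrightarrow> t'" using times_approx[OF t'] by blast
  have "(\<lambda>m. 4 * rate * (\<rho>' m - \<rho> m) + 1) \<longlonglongrightarrow> 4 * rate * (t' - t) + 1" by (intro tendsto_intros \<rho> \<rho>')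
  moreover have "4 * rate * (t' - t) + 1 < real q" using assms(3) by simp
  ultimately have ev1: "\<forall>\<^sub>F m in sequentially. 4 * rate * (\<rho>' m - \<rho> m) + 1 < real q" by (rule order_tendstoD)
  show ?thesis
  proof (cases "t = t'")
    case True
    have "L x t \<le> tadd (L x t) (tanh (2 * real q))"
    proof -
      have "0 \<le> (1 - (L x t)\<^sup>2) * tanh (2 * real q)"
        using L_range[OF assms(1), of x] by (intro mult_nonneg_nonneg) (auto simp: abs_square_le_1)
      moreover have "0 < 1 + L x t * tanh (2 * real q)" using L_range[OF assms(1), of x] by (simp add: add_pos_nonneg)
      ultimately show ?thesis by (simp add: tadd_def pos_le_divide_eq algebra_simps power2_eq_square)
    qed
    then show ?thesis using True by simp
  next
    case False
    then have lt: "t < t'" using assms by simp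
    show ?thesis
    proof (rule tendsto_le[OF trivial_limit_sequentially])
      show "(\<lambda>m. tadd (g x (\<rho>' m)) (tanh (2 * real q))) \<longlonglongrightarrow> tadd (L x t') (tanh (2 * real q))"
        by (intro tadd_tendsto g_tendsto_L[OF t' \<rho>'] tendsto_const L_range t') simp
      show "(\<lambda>m. g x (\<rho> m)) \<longlonglongrightarrow> L x t" by (rule g_tendsto_L[OF assms(1) \<rho>])
      have "\<forall>\<^sub>F m in sequentially. t < \<rho>' m" using \<rho>'(3) lt by (rule order_tendstoD)
      then show "\<forall>\<^sub>F m in sequentially. g x (\<rho> m) \<le> tadd (g x (\<rho>' m)) (tanh (2 * real q))"
        using ev1
      proof eventually_elim
        case (elim m)
        then show ?case using \<rho>(1,2)[of m] \<rho>'(1)[of m] by (intro g_long) auto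
      qed
    qed
  qed
qed

lemma L_exact: "0 < t \<Longrightarrow> L x t = gamma (edist_set x {y. L y t = 0})"
  by (rule exact_distance[OF L_range L_lipschitz L_close_zero])

lemma L_left_continuous:
  assumes "0 < t"
  shows "((\<lambda>s. L x s) \<longlongrightarrow> L x t) (at_left t)"
proof (rule order_tendstoI)
  fix c assume "c < L x t"
  then obtain r where r: "r \<in> times" "r < t" "c < g x r - Cspeed * sqrt (t - r)"
    using L_less_iff[OF assms] by blast
  have "c < L x s" if s: "r < s" "s < t" for s
  proof -
    have "Cspeed * sqrt (s - r) \<le> Cspeed * sqrt (t - r)"
      using s Cspeed_pos by (intro mult_left_mono) (auto simp: less_imp_le)
    then show ?thesis using L_ge[OF r(1) s(1), of x] r by linarith
  qed
  then show "\<forall>\<^sub>F s in at_left t. c < L x s"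
    using r(2) by (auto simp: eventually_at_left_field)
next
  fix c assume c: "L x t < c"
  have "((\<lambda>s. L x t + Cspeed * sqrt (t - s)) \<longlongrightarrow> L x t + Cspeed * sqrt (t - t)) (at_left t)"
    by (intro tendsto_intros)
  then have "\<forall>\<^sub>F s in at_left t. L x t + Cspeed * sqrt (t - s) < c" using c by (intro order_tendstoD) auto
  moreover have "\<forall>\<^sub>F s in at_left t. 0 < s \<and> s < t" using assms by (auto simp: eventually_at_left_field)
  ultimately show "\<forall>\<^sub>F s in at_left t. L x s < c"
    by eventually_elim (use L_speed[of _ t x] in \<open>smt (verit)\<close>)
qed

text \<open>Times of an upward jump: the left limit is below \<open>a\<close>, while all later
  rational times see, up to the modulus, at least \<open>b\<close>.\<close>

definition bad :: "real^'n \<Rightarrow> real \<Rightarrow> real \<Rightarrow> real set" where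
  "bad x a b = {t. 0 < t \<and> L x t < a \<and> (\<forall>r\<in>times. t < r \<longrightarrow> b \<le> g x r + Cspeed * sqrt (r - t))}"

text \<open>Between two such times the function would fall from about \<open>b\<close> to below
  \<open>a\<close>, which by the speed bound takes at least the time \<open>d\<close>. So the set is
  \<open>d\<close>-separated.\<close>

lemma countable_bad:
  assumes "a < b"
  shows "countable (bad x a b)"
proof -
  define d where "d = ((b - a) / (2 * Cspeed))\<^sup>2"
  have d: "0 < d" using assms Cspeed_pos by (simp add: d_def)
  have gap: "d \<le> t' - t" if t: "t \<in> bad x a b" "t' \<in> bad x a b" "t < t'" for t t'
  proof -
    have "0 < t" using t by (simp add: bad_def)
    then obtain r where r: "r \<in> times" "t < r" "r < t'" using times_between[of t t'] t(3) by auto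
    have "b \<le> g x r + Cspeed * sqrt (r - t)" using t(1) r by (auto simp: bad_def)
    moreover have "g x r - Cspeed * sqrt (t' - r) \<le> L x t'" using r by (intro L_ge)
    moreover have "L x t' < a" using t(2) by (simp add: bad_def)
    moreover have "Cspeed * sqrt (r - t) \<le> Cspeed * sqrt (t' - t)" "Cspeed * sqrt (t' - r) \<le> Cspeed * sqrt (t' - t)"
      using r Cspeed_pos by (auto intro!: mult_left_mono)
    ultimately have "b - a \<le> 2 * (Cspeed * sqrt (t' - t))" by linarith
    then have "(b - a) / (2 * Cspeed) \<le> sqrt (t' - t)" using Cspeed_pos by (simp add: field_simps)
    then have "d \<le> (sqrt (t' - t))\<^sup>2" unfolding d_def using assms Cspeed_pos by (intro power_mono) auto
    then show ?thesis using t(3) by simp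
  qed
  have "inj_on (\<lambda>t. \<lfloor>t / d\<rfloor>) (bad x a b)"
  proof (rule linorder_inj_onI)
    fix t t' assume t: "t < t'" "t \<in> bad x a b" "t' \<in> bad x a b"
    have "(t + d) / d \<le> t' / d" using gap[OF t(2,3,1)] d by (intro divide_right_mono) auto
    then have "t / d + 1 \<le> t' / d" using d by (simp add: add_divide_distrib)
    then show "\<lfloor>t / d\<rfloor> \<noteq> \<lfloor>t' / d\<rfloor>" by linarith
  qed auto
  then show ?thesis by (rule countableI') 
qed

text \<open>An earlier rational time bounds \<open>F n x t\<close> from below at every
  \<open>t\<close>. The bound from above needs a later rational time with a small value, and such a
  time exists because \<open>t\<close> is no jump.\<close>

lemma F_tendsto_L_or_bad:
  assumes t: "0 < t" and good: "\<And>a b. a \<in> \<rat> \<Longrightarrow> b \<in> \<rat> \<Longrightarrow> a < b \<Longrightarrow> t \<notin> bad x a b"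
  shows "(\<lambda>n. F n x t) \<longlonglongrightarrow> L x t"
proof (rule order_tendstoI)
  fix c assume "c < L x t"
  then obtain r where r: "r \<in> times" "r < t" "c < g x r - Cspeed * sqrt (t - r)"
    using L_less_iff[OF t] by blast
  have "(\<lambda>n. F n x r - Cspeed * sqrt (t - r) - err n) \<longlonglongrightarrow> g x r - Cspeed * sqrt (t - r) - 0"
    by (intro tendsto_intros g_lim r err_lim)
  then have "\<forall>\<^sub>F n in sequentially. c < F n x r - Cspeed * sqrt (t - r) - err n"
    using r(3) by (intro order_tendstoD) auto
  then show "\<forall>\<^sub>F n in sequentially. c < F n x t"
    by eventually_elim (use F_speed[OF times_nonneg[OF r(1)], of t _ x] r(2) in \<open>smt (verit)\<close>)
next
  fix c assume c: "L x t < c"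
  obtain a where a: "a \<in> \<rat>" "L x t < a" "a < c" using Rats_dense_in_real[OF c] by blast
  obtain b where b: "b \<in> \<rat>" "a < b" "b < c" using Rats_dense_in_real[OF a(3)] by blast
  have "t \<notin> bad x a b" using good a b by blast
  then obtain r where r: "r \<in> times" "t < r" "g x r + Cspeed * sqrt (r - t) < b"
    using t a by (auto simp: bad_def not_le)
  have "(\<lambda>n. F n x r + Cspeed * sqrt (r - t) + err n) \<longlonglongrightarrow> g x r + Cspeed * sqrt (r - t) + 0"
    by (intro tendsto_intros g_lim r err_lim)
  from order_tendstoD(2)[OF this, of c]
  have "\<forall>\<^sub>F n in sequentially. F n x r + Cspeed * sqrt (r - t) + err n < c"
    using r(3) b by simp
  then show "\<forall>\<^sub>F n in sequentially. F n x t < c"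
    by eventually_elim (use F_speed[of t r _ x] r(2) t in \<open>smt (verit)\<close>)
qed

text \<open>Jumps are collected over a countable dense set of points and rational levels; the
  Lipschitz bounds extend the convergence to all \<open>x\<close> with the same exceptional
  times.\<close>

lemma F_tendsto_L_except_countable:
  "\<exists>N. countable N \<and> (\<forall>t>0. t \<notin> N \<longrightarrow> (\<forall>x. (\<lambda>n. F n x t) \<longlonglongrightarrow> L x t))"
proof -
  obtain Q :: "(real^'n) set" where Q: "countable Q" "\<And>X. open X \<Longrightarrow> X \<noteq> {} \<Longrightarrow> \<exists>d\<in>Q. d \<in> X"
    using countable_dense_setE by blast
  define N where "N = (\<Union>x\<in>Q. \<Union>a\<in>\<rat>. \<Union>b\<in>{b\<in>\<rat>. a < b}. bad x a b)"
  have "countable (\<rat> :: real set)" by (rule countable_rat)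
  then have "countable N" unfolding N_def
    using Q by (intro countable_UN countable_bad) (auto intro: countable_subset)
  moreover have "(\<lambda>n. F n x t) \<longlonglongrightarrow> L x t" if t: "0 < t" "t \<notin> N" for t x
  proof (rule LIMSEQ_I)
    fix e :: real assume e: "0 < e"
    obtain q where q: "q \<in> Q" "q \<in> ball x (e / 4)" using Q(2)[of "ball x (e / 4)"] e by auto
    have dq: "dist x q < e / 4" "dist q x < e / 4" using q by (auto simp: dist_commute)
    have "(\<lambda>n. F n q t) \<longlonglongrightarrow> L q t"
      using t q by (intro F_tendsto_L_or_bad) (auto simp: N_def)
    then have 1: "\<forall>\<^sub>F n in sequentially. \<bar>F n q t - L q t\<bar> < e / 4"
      using e unfolding tendsto_iff dist_real_def by (auto dest: spec[of _ "e / 4"])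
    have 2: "\<forall>\<^sub>F n in sequentially. mesh n < e / 4" using mesh_lim e by (intro order_tendstoD) auto
    have "\<forall>\<^sub>F n in sequentially. norm (F n x t - L x t) < e"
      using 1 2
    proof eventually_elim
      case (elim n)
      show ?case
        using elim F_lipschitz'[of n x t q] F_lipschitz'[of n q t x] L_lipschitz'[OF t(1), of x q] L_lipschitz'[OF t(1), of q x] dq
        unfolding real_norm_def by linarith
    qed
    then show "\<exists>no. \<forall>n\<ge>no. norm (F n x t - L x t) < e" by (simp only: eventually_sequentially)
  qed
  ultimately show ?thesis by blast
qed

end

section \<open>The limit is a superflow\<close>

text \<open>The function factors through the countable set of integer cell indices, on which every
  \<open>G\<close> is measurable.\<close>

lemma measurable_grid_steps:
  fixes G :: "int^'n \<Rightarrow> int \<Rightarrow> real"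
  shows "(\<lambda>z :: (real^'n) \<times> real. G (\<chi> k. \<lfloor>fst z $ k / e\<rfloor>) \<lfloor>snd z / h\<rfloor>) \<in> borel_measurable borel"
proof -
  let ?c = "\<lambda>z :: (real^'n) \<times> real. ((\<chi> k. \<lfloor>fst z $ k / e\<rfloor>) :: int^'n, \<lfloor>snd z / h\<rfloor>)"
  have [measurable]: "(\<lambda>z :: (real^'n) \<times> real. fst z $ k) \<in> borel_measurable borel" for k
    by (intro borel_measurable_continuous_onI continuous_intros)
  have [measurable]: "(snd :: (real^'n) \<times> real \<Rightarrow> real) \<in> borel_measurable borel"
    by (intro borel_measurable_continuous_onI continuous_intros)
  have "?c \<in> measurable borel (count_space UNIV)"
  proof (subst measurable_count_space_eq2_countable, intro conjI ballI)
    fix a :: "(int^'n) \<times> int"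
    have "?c -` {a} \<inter> space borel = {z \<in> space borel. (\<forall>k\<in>UNIV. \<lfloor>fst z $ k / e\<rfloor> = fst a $ k) \<and> \<lfloor>snd z / h\<rfloor> = snd a}"
      by (auto simp: vec_eq_iff prod_eq_iff)
    also have "\<dots> \<in> sets borel" by measurable
    finally show "?c -` {a} \<inter> space borel \<in> sets borel" .
  qed auto
  from measurable_compose[OF this, of "\<lambda>(i, m). G i m" borel] show ?thesis by simp
qed

lemma measurable_grid_function:
  fixes G :: "real^'n \<Rightarrow> nat \<Rightarrow> real"
  shows "(\<lambda>z :: (real^'n) \<times> real. G (grid_floor e (fst z)) (nat \<lfloor>snd z / h\<rfloor>)) \<in> borel_measurable borel"
proof -
  have "(\<lambda>z :: (real^'n) \<times> real. G (grid_floor e (fst z)) (nat \<lfloor>snd z / h\<rfloor>)) =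
      (\<lambda>z. (\<lambda>i m. G (\<chi> k. e * of_int (i $ k)) (nat m)) (\<chi> k. \<lfloor>fst z $ k / e\<rfloor>) \<lfloor>snd z / h\<rfloor>)"
    by (simp add: grid_floor_def)
  then show ?thesis using measurable_grid_steps[of "\<lambda>i m. G (\<chi> k. e * of_int (i $ k)) (nat m)" e h] by simp
qed

lemma tadd_tanh: "tadd (tanh a) (tanh b) = tanh (a + b)"
  by (simp add: tadd_def tanh_real_add)

lemma artanh_measurable [measurable]: "(artanh :: real \<Rightarrow> real) \<in> borel_measurable borel"
  unfolding artanh_def by measurable

section \<open>The zero set of the limit as a superflow\<close>

context convergent_flow_sequence
begin

text \<open>A left limit carries no information at time 0, so the initial slice is set to
  \<open>A0\<close>; \<open>L_initial\<close> guarantees that the union is closed there.\<close>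

definition E :: "((real^'n) \<times> real) set" where
  "E = {(x, t). 0 < t \<and> L x t = 0} \<union> A0 \<times> {0}"

lemma slice_pos: "0 < t \<Longrightarrow> time_slice E t = {x. L x t = 0}"
  by (auto simp: E_def time_slice_def)

lemma slice_zero: "time_slice E 0 = A0"
  by (auto simp: E_def time_slice_def)

text \<open>\<open>L\<close> is an exact distance on the \<open>gamma\<close> scale, so the value 1
  at a single point means infinite distance and no zeros at all.\<close>

lemma slice_empty_iff: "0 < t \<Longrightarrow> time_slice E t = {} \<longleftrightarrow> L x t = 1"
proof -
  assume t: "0 < t"
  show ?thesis
  proof
    assume "time_slice E t = {}"
    then show "L x t = 1" using L_exact[OF t, of x] by (simp add: slice_pos[OF t])
  next
    assume L: "L x t = 1"
    then have "edist_set x (time_slice E t) = \<infinity>" using L_exact[OF t, of x] by (simp add: slice_pos[OF t])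
    then show "time_slice E t = {}" using edist_set_eq_infdist[of "time_slice E t" x] by force
  qed
qed

text \<open>By \<open>L_long\<close> an infinite distance can decrease only by a finite amount in
  finite time, so it stays infinite.\<close>

lemma slice_empty_mono:
  assumes t: "0 < t" "t \<le> s" and empty: "time_slice E t = {}"
  shows "time_slice E s = {}"
proof -
  obtain q :: nat where q: "4 * rate * (s - t) + 2 \<le> real q" using real_arch_simple by blast
  have s: "0 < s" using t by simp
  have "1 \<le> tadd (L 0 s) (tanh (2 * real q))"
    using L_long[OF t q, of 0] slice_empty_iff[OF t(1), of 0] empty by simp
  moreover have "tadd (L 0 s) (tanh (2 * real q)) \<le> 1"
    using L_range[OF s, of 0] by (intro tadd_le_1) (auto simp: less_imp_le)
  ultimately have "L 0 s = 1" using L_range[OF s, of 0] tadd_eq_1_iff[of "L 0 s" "tanh (2 * real q)"] by simp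
  then show ?thesis using slice_empty_iff[OF s, of 0] by simp
qed

lemma slice_empty_mono_zero:
  assumes "A0 = {}" "0 < s"
  shows "time_slice E s = {}"
proof -
  have g: "g 0 r = 1" if r: "r \<in> times" for r
  proof -
    have g0: "g 0 0 = 1" using g_initial[of 0] g_range(2)[of 0 0] assms(1) by simp
    obtain q :: nat where q: "4 * rate * (r - 0) + 1 \<le> real q" using real_arch_simple by blast
    have "1 \<le> tadd (g 0 r) (tanh (2 * real q))" using g_long[OF zero_in_times r times_nonneg[OF r] q, of 0] g0 by simp
    moreover have "tadd (g 0 r) (tanh (2 * real q)) \<le> 1"
      using g_range[OF r, of 0] by (intro tadd_le_1) (auto simp: less_imp_le)
    ultimately show ?thesis using g_range[OF r, of 0] tadd_eq_1_iff[of "g 0 r" "tanh (2 * real q)"] by simp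
  qed
  obtain \<rho> where \<rho>: "\<And>m. \<rho> m \<in> times" "\<And>m. \<rho> m < s" "\<rho> \<longlonglongrightarrow> s" using times_approx[OF assms(2)] by blast
  have "L 0 s = 1" using LIMSEQ_unique[OF g_tendsto_L[OF assms(2) \<rho>, of 0] ] g[OF \<rho>(1)] by simp
  then show ?thesis using slice_empty_iff[OF assms(2), of 0] by simp
qed

lemma gamma_edist_lipschitz: "gamma (edist_set x A) \<le> gamma (edist_set y A) + dist x y"
  using edist_set_lipschitz by (intro gamma_le_add edist_set_nonneg) auto

lemma closed_E: "closed E"
  unfolding closed_sequential_limits
proof (intro allI impI, elim conjE)
  fix z :: "nat \<Rightarrow> (real^'n) \<times> real" and l
  assume z: "\<forall>n. z n \<in> E" "z \<longlonglongrightarrow> l"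
  obtain x t where l: "l = (x, t)" by (cases l)
  define X where "X n = fst (z n)" for n
  define T where "T n = snd (z n)" for n
  have zn: "z n = (X n, T n)" for n by (simp add: X_def T_def)
  have lim: "X \<longlonglongrightarrow> x" "T \<longlonglongrightarrow> t"
    using tendsto_fst[OF z(2)] tendsto_snd[OF z(2)] by (simp_all add: X_def[abs_def] T_def[abs_def] l)
  have E: "0 < T n \<and> L (X n) (T n) = 0 \<or> T n = 0 \<and> X n \<in> A0" for n
    using z(1)[rule_format, of n] unfolding zn E_def by auto
  have dX: "(\<lambda>n. dist x (X n)) \<longlonglongrightarrow> dist x x" by (intro tendsto_intros lim)
  have "0 \<le> t" using E by (intro LIMSEQ_le_const[OF lim(2)]) (force intro: less_imp_le)
  then consider "t = 0" | "0 < t" by linarith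
  then show "l \<in> E"
  proof cases
    case 1
    have "gamma (edist_set x A0) \<le> Cspeed * sqrt t + dist x x"
    proof (rule LIMSEQ_le_const)
      show "(\<lambda>n. Cspeed * sqrt (T n) + dist x (X n)) \<longlonglongrightarrow> Cspeed * sqrt t + dist x x"
        by (intro tendsto_intros lim)
      have "gamma (edist_set x A0) \<le> Cspeed * sqrt (T n) + dist x (X n)" for n
      proof -
        have "gamma (edist_set (X n) A0) \<le> Cspeed * sqrt (T n)"
        proof (cases "0 < T n")
          case True
          then show ?thesis using L_initial[of "T n" "X n"] E[of n] by auto
        next
          case False
          then have "T n = 0" "X n \<in> A0" using E[of n] by auto
          moreover have "edist_set (X n) A0 = 0"
            using edist_set_le[OF \<open>X n \<in> A0\<close>, of "X n"] edist_set_nonneg[of "X n" A0] by (simp add: zero_ereal_def[symmetric])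
          ultimately show ?thesis by simp
        qed
        then show ?thesis using gamma_edist_lipschitz[of x A0 "X n"] by linarith
      qed
      then show "\<exists>N. \<forall>n\<ge>N. gamma (edist_set x A0) \<le> Cspeed * sqrt (T n) + dist x (X n)" by blast
    qed
    then have "gamma (edist_set x A0) \<le> gamma 0" using 1 by simp
    then have e0: "edist_set x A0 = 0" unfolding gamma_le_iff by (rule antisym[OF _ edist_set_nonneg])
    have "A0 \<noteq> {}" using e0 by auto
    then have "infdist x A0 = 0" using e0 edist_set_eq_infdist[of A0 x] by (simp add: zero_ereal_def)
    then have "x \<in> A0" using \<open>A0 \<noteq> {}\<close> A0_closed by (simp add: in_closed_iff_infdist_zero)
    then show ?thesis using 1 by (simp add: l E_def)
  next
    case 2
    have "L x t \<le> 0"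
    proof (rule field_le_epsilon)
      fix \<eta> :: real assume \<eta>: "0 < \<eta>"
      \<comment> \<open>Times approaching \<open>t\<close> from the left are handled by left
        continuity, all others by the speed bound.\<close>
      have "\<forall>\<^sub>F s in at_left t. L x t - \<eta> / 2 < L x s"
        using L_left_continuous[OF 2, of x] \<eta> by (intro order_tendstoD) auto
      then obtain s0 where s0: "s0 < t" "\<And>s. s0 < s \<Longrightarrow> s < t \<Longrightarrow> L x t - \<eta> / 2 < L x s"
        by (auto simp: eventually_at_left_field)
      have ev1: "\<forall>\<^sub>F n in sequentially. max 0 s0 < T n" using lim(2) s0(1) 2 by (intro order_tendstoD) auto
      have "(\<lambda>n. dist x (X n) + Cspeed * sqrt \<bar>T n - t\<bar>) \<longlonglongrightarrow> dist x x + Cspeed * sqrt \<bar>t - t\<bar>"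
        by (intro tendsto_intros lim)
      then have ev2: "\<forall>\<^sub>F n in sequentially. dist x (X n) + Cspeed * sqrt \<bar>T n - t\<bar> < \<eta> / 2"
        using \<eta> by (intro order_tendstoD) auto
      obtain n where n: "max 0 s0 < T n" "dist x (X n) + Cspeed * sqrt \<bar>T n - t\<bar> < \<eta> / 2"
        using eventually_happens[OF eventually_conj[OF ev1 ev2]] by auto
      have "L (X n) (T n) = 0" using E[of n] n(1) by auto
      then have Lx: "L x (T n) \<le> dist x (X n)" using L_lipschitz'[of "T n" x "X n"] n(1) by simp
      have nn: "0 \<le> Cspeed * sqrt \<bar>T n - t\<bar>" using Cspeed_pos by simp
      have "L x t \<le> L x (T n) + \<eta> / 2 + Cspeed * sqrt \<bar>T n - t\<bar>"
      proof (cases "T n < t")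
        case True
        then show ?thesis using s0(2)[of "T n"] n(1) nn by simp
      next
        case False
        then show ?thesis using L_speed[OF 2, of "T n" x] \<eta> by simp
      qed
      then show "L x t \<le> 0 + \<eta>" using Lx n(2) by linarith
    qed
    then have "L x t = 0" using L_range(1)[OF 2, of x] by simp
    then show ?thesis using 2 by (simp add: l E_def)
  qed
qed

text \<open>Left continuity of \<open>L\<close> is turned into convergence of sets: a small value of
  \<open>L x s\<close> means that a zero at time \<open>s\<close> is near \<open>x\<close>, and a
  value bounded away from 0 excludes zeros from a ball around \<open>x\<close>.\<close>

lemma kuratowski_E:
  assumes t: "0 < t"
  shows "kuratowski_tendsto (time_slice E) (time_slice E t) (at_left t)"
proof -
  have pos: "\<forall>\<^sub>F s in at_left t. 0 < s" using t by (auto simp: eventually_at_left_field)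
  have ev: "\<forall>\<^sub>F s in at_left t. time_slice E s \<inter> U \<noteq> {}" if x: "x \<in> time_slice E t" and U: "open U" "x \<in> U" for x U
  proof -
    obtain d where d: "0 < d" "ball x d \<subseteq> U" using U open_contains_ball by blast
    have "L x t < tanh d" "tanh d < 1" using x d by (auto simp: slice_pos[OF t])
    then have "\<forall>\<^sub>F s in at_left t. L x s < tanh d" using L_left_continuous[OF t] by (intro order_tendstoD)
    with pos show ?thesis
    proof eventually_elim
      case (elim s)
      then obtain y where y: "L y s = 0" "tanh (dist x y) \<le> L x s"
        using L_close_zero[of s x] \<open>tanh d < 1\<close> by fastforce
      then have "tanh (dist x y) < tanh d" using elim by linarith
      then have "y \<in> ball x d" by simp
      then show ?case using y(1) d(2) slice_pos[OF elim(1)] by blast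
    qed
  qed
  have freq: "x \<in> time_slice E t" if x: "\<forall>U. open U \<and> x \<in> U \<longrightarrow> (\<exists>\<^sub>F s in at_left t. time_slice E s \<inter> U \<noteq> {})" for x
  proof (rule ccontr)
    assume "x \<notin> time_slice E t"
    then have Lx: "0 < L x t" using L_range(1)[OF t, of x] by (auto simp: slice_pos[OF t])
    define \<eta> where "\<eta> = L x t / 2"
    have \<eta>: "0 < \<eta>" "\<eta> < L x t" using Lx by (auto simp: \<eta>_def)
    have "\<forall>\<^sub>F s in at_left t. \<eta> < L x s" using L_left_continuous[OF t] \<eta> by (intro order_tendstoD)
    with pos have "\<forall>\<^sub>F s in at_left t. \<not> (time_slice E s \<inter> ball x \<eta> \<noteq> {})"
    proof eventually_elim
      case (elim s)
      have "\<not> (L y s = 0 \<and> dist x y < \<eta>)" for y using L_lipschitz'[OF elim(1), of x y] elim(2) by auto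
      then show ?case using slice_pos[OF elim(1)] by auto
    qed
    moreover have "\<exists>\<^sub>F s in at_left t. time_slice E s \<inter> ball x \<eta> \<noteq> {}" using x \<eta> by (auto dest: spec[of _ "ball x \<eta>"])
    ultimately show False by (simp add: frequently_def)
  qed
  have nontriv: "at_left t \<noteq> bot" by (simp add: trivial_limit_at_left_real)
  show ?thesis
    unfolding kuratowski_tendsto_def
  proof (intro conjI set_eqI)
    fix x
    show "x \<in> {x. \<forall>U. open U \<and> x \<in> U \<longrightarrow> (\<forall>\<^sub>F s in at_left t. time_slice E s \<inter> U \<noteq> {})} \<longleftrightarrow> x \<in> time_slice E t"
      using ev freq eventually_frequently[OF nontriv] by blast
    show "x \<in> {x. \<forall>U. open U \<and> x \<in> U \<longrightarrow> (\<exists>\<^sub>F s in at_left t. time_slice E s \<inter> U \<noteq> {})} \<longleftrightarrow> x \<in> time_slice E t"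
      using ev freq eventually_frequently[OF nontriv] by blast
  qed
qed

definition alive :: "((real^'n) \<times> real) set" where
  "alive = {(x, t). 0 < t \<and> ereal t < extinction_time E}"

text \<open>Bounds on the distance run from later to earlier times, so a nonempty slice at a
  strictly later time is what makes them finite.\<close>

lemma alive_later:
  assumes "(x, t) \<in> alive"
  shows "\<exists>t1>t. time_slice E t1 \<noteq> {}"
proof -
  have t: "0 < t" "ereal t < extinction_time E" using assms by (auto simp: alive_def)
  obtain t' where t': "ereal t < ereal t'" "ereal t' < extinction_time E" using ereal_dense2[OF t(2)] by blast
  have "\<not> (0 < t' \<and> (\<forall>s\<ge>t'. time_slice E s = {}))"
  proof
    assume "0 < t' \<and> (\<forall>s\<ge>t'. time_slice E s = {})"
    then have "extinction_time E \<le> ereal t'" unfolding extinction_time_def by (intro Inf_lower) auto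
    then show False using t'(2) by simp
  qed
  then obtain s where "t' \<le> s" "time_slice E s \<noteq> {}" using t t'(1) by auto
  then show ?thesis using t'(1) by (intro exI[of _ s]) auto
qed

lemma alive_nonempty:
  assumes "(x, t) \<in> alive"
  shows "time_slice E t \<noteq> {}"
proof
  assume "time_slice E t = {}"
  moreover obtain t1 where "t < t1" "time_slice E t1 \<noteq> {}" using alive_later[OF assms] by blast
  ultimately show False using slice_empty_mono[of t t1] assms by (auto simp: alive_def)
qed

lemma L_infdist:
  assumes "0 < t" "time_slice E t \<noteq> {}"
  shows "L x t = tanh (infdist x (time_slice E t))"
  using L_exact[OF assms(1), of x] edist_set_eq_infdist[OF assms(2), of x] by (simp add: slice_pos[OF assms(1)])

text \<open>The distance function of the superflow condition, cut off to 0 where that condition does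
  not look; all points of \<open>alive\<close> have nonempty slices.\<close>

definition D :: "(real^'n) \<times> real \<Rightarrow> real" where
  "D z = (if z \<in> alive then infdist (fst z) (time_slice E (snd z)) else 0)"

lemma open_alive: "open alive"
proof -
  have "open ((\<lambda>z :: (real^'n) \<times> real. ereal (snd z)) -` {0 <..< extinction_time E})"
    by (intro open_vimage continuous_intros open_greaterThanLessThan)
  moreover have "(\<lambda>z :: (real^'n) \<times> real. ereal (snd z)) -` {0 <..< extinction_time E} = alive"
    by (auto simp: alive_def)
  ultimately show ?thesis by simp
qed

text \<open>Joint measurability holds because \<open>L\<close> is a supremum over countably many
  times of functions measurable in space-time.\<close>

lemma D_measurable: "D \<in> borel_measurable borel"
proof -
  \<comment> \<open>The index set of \<open>L\<close> depends on \<open>t\<close>. Inadmissible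
    indices repeat the term of index 0, which leaves the supremum unchanged for positive
    times.\<close>
  define f where "f r z = (if r < snd z then g (fst z) r - Cspeed * sqrt (snd z - r) else g (fst z) 0 - Cspeed * sqrt \<bar>snd z\<bar>)"
    for r and z :: "(real^'n) \<times> real"
  have g_cont: "continuous_on UNIV (\<lambda>z :: (real^'n) \<times> real. g (fst z) r)" if "r \<in> times" for r
  proof -
    have le: "g x r \<le> g y r + dist x y" for x y
      using g_lipschitz[OF that, of x y] tadd_le_add[of "g y r" "tanh (dist x y)"] g_range[OF that, of y]
        tanh_le_self[of "dist x y"] by simp
    have "\<bar>g x r - g y r\<bar> \<le> dist x y" for x y using le[of x y] le[of y x] by (simp add: dist_commute)
    then have "1-lipschitz_on UNIV (\<lambda>x. g x r)" by (auto simp: lipschitz_on_def dist_real_def)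
    then have "continuous_on UNIV (\<lambda>x. g x r)" by (rule lipschitz_on_continuous_on)
    then show ?thesis by (rule continuous_on_compose2[of UNIV "\<lambda>x. g x r" UNIV fst]) (auto intro: continuous_intros)
  qed
  have f_meas: "f r \<in> borel_measurable borel" if r: "r \<in> times" for r
  proof -
    have [measurable]: "(\<lambda>z :: (real^'n) \<times> real. g (fst z) r) \<in> borel_measurable borel"
      "(\<lambda>z :: (real^'n) \<times> real. g (fst z) 0) \<in> borel_measurable borel"
      using g_cont[OF r] g_cont[OF zero_in_times] by (auto intro: borel_measurable_continuous_onI)
    have [measurable]: "(snd :: (real^'n) \<times> real \<Rightarrow> real) \<in> borel_measurable borel"
      by (intro borel_measurable_continuous_onI continuous_intros)
    show ?thesis unfolding f_def by measurable
  qed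
  have f_le: "f r z \<le> 1" if "r \<in> times" for r z
  proof -
    have "0 \<le> Cspeed * sqrt (snd z - r)" if "r < snd z" using that Cspeed_pos by simp
    moreover have "0 \<le> Cspeed * sqrt \<bar>snd z\<bar>" using Cspeed_pos by simp
    ultimately show ?thesis using g_range(2)[OF that, of "fst z"] g_range(2)[of 0 "fst z"] by (auto simp: f_def)
  qed
  have "countable times" unfolding times_def by (rule countable_subset[OF _ countable_rat]) auto
  then have sup_meas: "(\<lambda>z. SUP r\<in>times. f r z) \<in> borel_measurable borel"
    using f_meas f_le by (intro borel_measurable_cSUP) (auto intro!: bdd_aboveI2)
  have L_eq: "(SUP r\<in>times. f r (x, t)) = L x t" if t: "0 < t" for x t
  proof -
    have "(\<lambda>r. f r (x, t)) ` times = (\<lambda>r. g x r - Cspeed * sqrt (t - r)) ` {r \<in> times. r < t}"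
    proof (intro equalityI subsetI)
      fix y assume "y \<in> (\<lambda>r. f r (x, t)) ` times"
      then obtain r where r: "r \<in> times" "y = f r (x, t)" by blast
      show "y \<in> (\<lambda>r. g x r - Cspeed * sqrt (t - r)) ` {r \<in> times. r < t}"
      proof (cases "r < t")
        case True
        then show ?thesis using r by (auto simp: f_def)
      next
        case False
        then show ?thesis using r t by (auto simp: f_def intro!: image_eqI[of _ _ 0])
      qed
    qed (auto simp: f_def intro!: image_eqI)
    then show ?thesis by (simp add: L_def)
  qed
  have "D z = (if z \<in> alive then artanh (SUP r\<in>times. f r z) else 0)" for z
  proof (cases z)
    case (Pair x t)
    show ?thesis
    proof (cases "z \<in> alive")
      case True
      then have "0 < t" "time_slice E t \<noteq> {}" using alive_nonempty[of x t] Pair by (auto simp: alive_def)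
      then show ?thesis using True Pair by (simp add: D_def L_eq L_infdist artanh_tanh_real)
    qed (simp add: D_def)
  qed
  then have "D = (\<lambda>z. if z \<in> alive then artanh (SUP r\<in>times. f r z) else 0)" by blast
  moreover have "(\<lambda>z. if z \<in> alive then artanh (SUP r\<in>times. f r z) else 0) \<in> borel_measurable borel"
  proof (rule measurable_If)
    show "(\<lambda>z. artanh (SUP r\<in>times. f r z)) \<in> borel_measurable borel"
      by (rule measurable_compose[OF sup_meas artanh_measurable])
    show "{x \<in> space borel. x \<in> alive} \<in> sets borel" using open_alive by simp
  qed simp
  ultimately show ?thesis by simp
qed

lemma compact_window:
  assumes C: "compact C" "C \<subseteq> alive" "C \<noteq> {}"
  obtains \<rho> tmin tmax t1 where "\<And>x t. (x, t) \<in> C \<Longrightarrow> norm x \<le> \<rho> \<and> tmin \<le> t \<and> t \<le> tmax"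
    "0 < tmin" "0 \<le> \<rho>" "tmin \<le> tmax" "tmax < t1" "time_slice E t1 \<noteq> {}"
proof -
  have cs: "continuous_on C snd" "continuous_on C (\<lambda>z. norm (fst z))" by (intro continuous_intros)+
  obtain z1 where z1: "z1 \<in> C" "\<And>z. z \<in> C \<Longrightarrow> snd z1 \<le> snd z" using continuous_attains_inf[OF C(1,3) cs(1)] by blast
  obtain z2 where z2: "z2 \<in> C" "\<And>z. z \<in> C \<Longrightarrow> snd z \<le> snd z2" using continuous_attains_sup[OF C(1,3) cs(1)] by blast
  obtain z3 where z3: "z3 \<in> C" "\<And>z. z \<in> C \<Longrightarrow> norm (fst z) \<le> norm (fst z3)" using continuous_attains_sup[OF C(1,3) cs(2)] by blast
  have "(fst z2, snd z2) \<in> alive" using z2(1) C(2) by auto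
  then obtain t1 where t1: "snd z2 < t1" "time_slice E t1 \<noteq> {}" using alive_later by blast
  have "0 < snd z1" using z1(1) C(2) by (auto simp: alive_def)
  moreover have "norm x \<le> norm (fst z3) \<and> snd z1 \<le> t \<and> t \<le> snd z2" if "(x, t) \<in> C" for x t
    using z1(2)[OF that] z2(2)[OF that] z3(2)[OF that] by simp
  ultimately show thesis using that[of "norm (fst z3)" "snd z1" "snd z2" t1] t1 z2(2)[OF z1(1)] by simp
qed

lemma infdist_bound:
  assumes t: "0 < t" "t \<le> t1" and ne: "time_slice E t1 \<noteq> {}" and q: "4 * rate * t1 + 2 \<le> real q"
  shows "infdist x (time_slice E t) \<le> infdist 0 (time_slice E t1) + 2 * real q + norm x"
proof -
  have net: "time_slice E t \<noteq> {}" using slice_empty_mono[OF t] ne by blast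
  have t1: "0 < t1" using t by simp
  have "4 * rate * (t1 - t) \<le> 4 * rate * t1" using rate_pos t by (intro mult_left_mono) auto
  then have "L 0 t \<le> tadd (L 0 t1) (tanh (2 * real q))" using q by (intro L_long t) simp
  then have L0: "L 0 t \<le> tanh (infdist 0 (time_slice E t1) + 2 * real q)"
    by (simp add: L_infdist[OF t1 ne] tadd_tanh)
  have "L x t \<le> tadd (L 0 t) (tanh (norm x))" using L_lipschitz[OF t(1), of x 0] by simp
  also have "\<dots> \<le> tadd (tanh (infdist 0 (time_slice E t1) + 2 * real q)) (tanh (norm x))"
    using L0 L_range[OF t(1), of 0] by (intro tadd_mono) (auto simp: less_imp_le abs_tanh_real_less_1)
  finally show ?thesis unfolding tadd_tanh L_infdist[OF t(1) net] by simp
qed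

lemma D_bounded:
  assumes "compact C" "C \<subseteq> alive"
  obtains B where "\<And>z. z \<in> C \<Longrightarrow> \<bar>D z\<bar> \<le> B"
proof (cases "C = {}")
  case False
  obtain \<rho> tmin tmax t1 where w: "\<And>x t. (x, t) \<in> C \<Longrightarrow> norm x \<le> \<rho> \<and> tmin \<le> t \<and> t \<le> tmax"
    "0 < tmin" "tmax < t1" "time_slice E t1 \<noteq> {}"
    using compact_window[OF assms False] by metis
  obtain q :: nat where q: "4 * rate * t1 + 2 \<le> real q" using real_arch_simple by blast
  show thesis
  proof (rule that)
    fix z assume z: "z \<in> C"
    obtain x t where xt: "z = (x, t)" by (cases z)
    have "norm x \<le> \<rho>" "0 < t" "t \<le> t1" using w(1)[of x t] z w(2,3) by (auto simp: xt)
    then have "infdist x (time_slice E t) \<le> infdist 0 (time_slice E t1) + 2 * real q + \<rho>"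
      using infdist_bound[OF _ _ w(4) q, of t x] by simp
    then show "\<bar>D z\<bar> \<le> infdist 0 (time_slice E t1) + 2 * real q + \<rho>"
      using z assms(2) by (auto simp: D_def xt infdist_nonneg)
  qed
qed (use that in auto)

text \<open>One rational time before \<open>t\<close> controls all times near \<open>t\<close> from
  below, so the positivity is uniform even around exceptional times, where convergence may
  fail.\<close>

lemma F_pos_local:
  assumes t: "0 < t" and pos: "0 < L x t"
  obtains c \<eta> where "0 < c" "0 < \<eta>"
    "\<forall>\<^sub>F n in sequentially. \<forall>y s. dist y x < \<eta> \<and> \<bar>s - t\<bar> < \<eta> \<longrightarrow> c \<le> F n y s"
proof -
  define c where "c = L x t / 8"
  have c: "0 < c" "4 * c < L x t" using pos by (auto simp: c_def)
  obtain r where r: "r \<in> times" "r < t" "4 * c < g x r - Cspeed * sqrt (t - r)"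
    using c(2) unfolding L_less_iff[OF t] by blast
  have "((\<lambda>s. Cspeed * sqrt (s - r)) \<longlongrightarrow> Cspeed * sqrt (t - r)) (at t)" by (intro tendsto_intros)
  then have "\<forall>\<^sub>F s in at t. Cspeed * sqrt (s - r) < Cspeed * sqrt (t - r) + c" using c by (intro order_tendstoD) auto
  then obtain d where d: "0 < d" "\<And>s. s \<noteq> t \<Longrightarrow> \<bar>s - t\<bar> < d \<Longrightarrow> Cspeed * sqrt (s - r) < Cspeed * sqrt (t - r) + c"
    by (auto simp: eventually_at dist_real_def)
  define \<eta> where "\<eta> = min c (min d (t - r))"
  have \<eta>: "0 < \<eta>" "\<eta> \<le> c" "\<eta> \<le> d" "\<eta> \<le> t - r" using c d r by (auto simp: \<eta>_def)
  have "(\<lambda>n. F n x r - err n - mesh n) \<longlonglongrightarrow> g x r - 0 - 0" by (intro tendsto_intros g_lim r err_lim mesh_lim)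
  then have "\<forall>\<^sub>F n in sequentially. 4 * c + Cspeed * sqrt (t - r) < F n x r - err n - mesh n"
    using r(3) by (intro order_tendstoD) auto
  then have "\<forall>\<^sub>F n in sequentially. \<forall>y s. dist y x < \<eta> \<and> \<bar>s - t\<bar> < \<eta> \<longrightarrow> c \<le> F n y s"
  proof eventually_elim
    case (elim n)
    show ?case
    proof (intro allI impI)
      fix y s assume ys: "dist y x < \<eta> \<and> \<bar>s - t\<bar> < \<eta>"
      then have "r \<le> s" using \<eta> by (auto simp: abs_less_iff)
      then have 1: "F n x r \<le> F n x s + Cspeed * sqrt (s - r) + err n" by (intro F_speed times_nonneg r)
      have 2: "Cspeed * sqrt (s - r) \<le> Cspeed * sqrt (t - r) + c"
        using d(2)[of s] ys \<eta> c by (cases "s = t") auto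
      have 3: "F n x s \<le> F n y s + dist x y + mesh n" by (rule F_lipschitz')
      have 4: "dist x y \<le> c" using ys \<eta> by (simp add: dist_commute)
      show "c \<le> F n y s" using elim 1 2 3 4 c by linarith
    qed
  qed
  then show thesis using that c \<eta> by blast
qed

lemma F_pos_compact:
  assumes C: "compact C" and pos: "\<And>x t. (x, t) \<in> C \<Longrightarrow> 0 < t \<and> 0 < L x t"
  obtains c where "0 < c" "\<forall>\<^sub>F n in sequentially. \<forall>x t. (x, t) \<in> C \<longrightarrow> c \<le> F n x t"
proof -
  define P where "P z c \<eta> \<longleftrightarrow> 0 < c \<and> 0 < \<eta> \<and>
      (\<forall>\<^sub>F n in sequentially. \<forall>y s. dist y (fst z) < \<eta> \<and> \<bar>s - snd z\<bar> < \<eta> \<longrightarrow> c \<le> F n y s)" for z c \<eta>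
  have "\<exists>c \<eta>. P z c \<eta>" if "z \<in> C" for z
  proof -
    have z: "0 < snd z" "0 < L (fst z) (snd z)" using pos[of "fst z" "snd z"] that by auto
    show ?thesis by (rule F_pos_local[OF z]) (unfold P_def, blast)
  qed
  then obtain c \<eta> where "\<And>z. z \<in> C \<Longrightarrow> P z (c z) (\<eta> z)" by metis
  then have c: "\<And>z. z \<in> C \<Longrightarrow> 0 < c z" "\<And>z. z \<in> C \<Longrightarrow> 0 < \<eta> z"
    "\<And>z. z \<in> C \<Longrightarrow> \<forall>\<^sub>F n in sequentially. \<forall>y s. dist y (fst z) < \<eta> z \<and> \<bar>s - snd z\<bar> < \<eta> z \<longrightarrow> c z \<le> F n y s"
    unfolding P_def by blast+
  have "C \<subseteq> (\<Union>z\<in>C. ball z (\<eta> z))" using c(2) by force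
  then obtain A where A: "A \<subseteq> C" "finite A" "C \<subseteq> (\<Union>z\<in>A. ball z (\<eta> z))"
    using compactE_image[OF C, of C "\<lambda>z. ball z (\<eta> z)"] by blast
  define m where "m = Min (insert 1 (c ` A))"
  have m: "0 < m" "\<And>z. z \<in> A \<Longrightarrow> m \<le> c z" using A c(1) by (auto simp: m_def)
  have "\<forall>\<^sub>F n in sequentially. \<forall>z\<in>A. \<forall>y s. dist y (fst z) < \<eta> z \<and> \<bar>s - snd z\<bar> < \<eta> z \<longrightarrow> c z \<le> F n y s"
    using A c(3) by (intro eventually_ball_finite) auto
  then have "\<forall>\<^sub>F n in sequentially. \<forall>x t. (x, t) \<in> C \<longrightarrow> m \<le> F n x t"
  proof eventually_elim
    case (elim n)
    show ?case
    proof (intro allI impI)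
      fix x t assume "(x, t) \<in> C"
      then obtain z where z: "z \<in> A" "(x, t) \<in> ball z (\<eta> z)" using A(3) by blast
      have "dist (fst z) x \<le> dist z (x, t)" "dist (snd z) t \<le> dist z (x, t)"
        using dist_fst_le[of z "(x, t)"] dist_snd_le[of z "(x, t)"] by simp_all
      then have "dist x (fst z) < \<eta> z" "\<bar>t - snd z\<bar> < \<eta> z" using z(2) by (auto simp: dist_commute dist_real_def)
      then show "m \<le> F n x t" using elim z(1) m(2)[OF z(1)] by (meson order_trans)
    qed
  qed
  then show thesis using that m(1) by blast
qed

text \<open>A finite limit at one time bounds the values there, and \<open>V_long\<close> carries
  the bound back to all earlier times at a fixed cost.\<close>

lemma V_bounded:
  assumes t1: "0 < t1" and lim: "(\<lambda>n. F n 0 t1) \<longlonglongrightarrow> L 0 t1" and ne: "L 0 t1 < 1"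
  obtains B where "\<forall>\<^sub>F n in sequentially. \<forall>t. 0 \<le> t \<and> t \<le> t1 \<longrightarrow> V n 0 t \<le> ereal B"
proof -
  have "\<forall>\<^sub>F r in at_top. L 0 t1 < tanh (r::real)" using tanh_real_at_top ne by (intro order_tendstoD)
  then obtain R where R: "L 0 t1 < tanh R" by (metis eventually_at_top_linorder order_refl)
  obtain q :: nat where q: "4 * rate * t1 + 1 \<le> real q" using real_arch_simple by blast
  have "\<forall>\<^sub>F n in sequentially. F n 0 t1 < tanh R" using lim R by (rule order_tendstoD)
  with eventually_small have "\<forall>\<^sub>F n in sequentially. \<forall>t. 0 \<le> t \<and> t \<le> t1 \<longrightarrow> V n 0 t \<le> ereal (R + 2 * real q)"
  proof eventually_elim
    case (elim n)
    show ?case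
    proof (intro allI impI)
      fix t assume t: "0 \<le> t \<and> t \<le> t1"
      have "gamma (V n 0 t1) < gamma (ereal R)" using elim by (simp add: F_def)
      then have V1: "V n 0 t1 \<le> ereal R" by (simp only: gamma_less_iff less_imp_le)
      have "4 * rate * (t1 - t) \<le> 4 * rate * t1" using rate_pos t by (intro mult_left_mono) auto
      then have "V n 0 t \<le> V n 0 t1 + ereal (2 * real q)" using t elim q by (intro V_long) auto
      also have "\<dots> \<le> ereal R + ereal (2 * real q)" by (intro add_right_mono V1)
      finally show "V n 0 t \<le> ereal (R + 2 * real q)" by simp
    qed
  qed
  then show thesis using that by blast
qed

end

section \<open>The heat inequality for the limiting distance\<close>

context convergent_flow_sequence
begin

text \<open>The order of the limits is essential: for fixed \<delta> the meshes tend to 0, which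
  leaves errors of order \<delta> and \<delta>^3; then \<delta> tends to 0. The support of
  \<open>f\<close> is compact and avoids the zero set, so \<open>F n\<close> is bounded below there
  by a positive \<open>c\<close>, which leaves room for 2 \<delta>.\<close>

lemma heat_inequality_test:
  assumes f: "smooth_fun f" "compact (closure {z. f z \<noteq> 0})" "\<And>z. 0 \<le> f z"
    and S: "closure {z. f z \<noteq> 0} \<subseteq> alive - E"
  shows "0 \<le> (\<integral>z. D z * heat_adjoint f z \<partial>lborel)"
proof (cases "closure {z. f z \<noteq> 0} = {}")
  case True
  have "heat_adjoint f z = 0" for z by (rule heat_adjoint_zero_outside) (unfold True, simp)
  then show ?thesis by simp
next
  case False
  let ?S = "closure {z. f z \<noteq> 0}" and ?\<kappa> = "real CARD('n)"
  obtain N where N: "countable N" "\<And>t x. 0 < t \<Longrightarrow> t \<notin> N \<Longrightarrow> (\<lambda>n. F n x t) \<longlonglongrightarrow> L x t"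
    using F_tendsto_L_except_countable by blast
  have S_alive: "?S \<subseteq> alive" using S by blast
  obtain \<rho> tmin tmax t2 where w: "\<And>x t. (x, t) \<in> ?S \<Longrightarrow> norm x \<le> \<rho> \<and> tmin \<le> t \<and> t \<le> tmax"
    "0 < tmin" "0 \<le> \<rho>" "tmin \<le> tmax" "tmax < t2" "time_slice E t2 \<noteq> {}"
    using compact_window[OF f(2) S_alive False] by metis
  \<comment> \<open>A time after the support, before extinction and outside the exceptional set:
    there \<open>F n 0 t1\<close> converges to a value below 1, which bounds all earlier
    values.\<close>
  have "uncountable {tmax<..<t2}" using w(5) by (simp add: uncountable_open_interval)
  then have "\<not> {tmax<..<t2} \<subseteq> N" using countable_subset[OF _ N(1)] by blast
  then obtain t1 where t1: "tmax < t1" "t1 < t2" "t1 \<notin> N" unfolding subset_iff greaterThanLessThan_iff by blast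
  have t1_pos: "0 < t1" using t1 w by linarith
  have "time_slice E t1 \<noteq> {}" using slice_empty_mono[OF t1_pos, of t2] t1(2) w(6) less_imp_le by blast
  then have "L 0 t1 \<noteq> 1" using slice_empty_iff[OF t1_pos, of 0] by simp
  then have "L 0 t1 < 1" using L_range(2)[OF t1_pos, of 0] by simp
  then obtain BV where BV: "\<forall>\<^sub>F n in sequentially. \<forall>t. 0 \<le> t \<and> t \<le> t1 \<longrightarrow> V n 0 t \<le> ereal BV"
    using V_bounded[OF t1_pos N(2)[OF t1_pos t1(3)]] by blast
  have "0 < t \<and> 0 < L x t" if "(x, t) \<in> ?S" for x t
  proof -
    have "0 < t" "(x, t) \<notin> E" using that S by (auto simp: alive_def)
    then show ?thesis using L_range(1)[of t x] by (auto simp: E_def)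
  qed
  then obtain c where c: "0 < c" "\<forall>\<^sub>F n in sequentially. \<forall>x t. (x, t) \<in> ?S \<longrightarrow> c \<le> F n x t"
    using F_pos_compact[OF f(2)] by blast
  obtain BD where BD: "\<And>z. z \<in> ?S \<Longrightarrow> \<bar>D z\<bar> \<le> BD" using D_bounded[OF f(2) S_alive] by blast
  \<comment> \<open>\<open>\<bar>BV\<bar>\<close> bounds the values at the origin; the window of
    radius \<open>\<rho> + 1\<close>, the roundings and \<delta>^3 / 2 fit into
    \<open>\<rho> + 4\<close>.\<close>
  define B where "B = \<bar>BV\<bar> + \<rho> + 4 + \<bar>BD\<bar>"
  have key: "- (heat_C ?\<kappa> * \<delta>) * (\<integral>z. f z \<partial>lborel) - \<delta> ^ 3 / 2 * (\<integral>z. \<bar>heat_adjoint f z\<bar> \<partial>lborel)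
      \<le> (\<integral>z. D z * heat_adjoint f z \<partial>lborel)" if \<delta>: "0 < \<delta>" "\<delta> \<le> 1/4" "2 * \<delta> < c" for \<delta>
  proof -
    have "(\<lambda>n. heat_M ?\<kappa> * sqrt (hh n)) \<longlonglongrightarrow> heat_M ?\<kappa> * sqrt 0" by (intro tendsto_intros h_lim)
    then have e1: "\<forall>\<^sub>F n in sequentially. heat_M ?\<kappa> * sqrt (hh n) < \<delta> / 8" using \<delta> by (intro order_tendstoD) auto
    have "(\<lambda>n. heat_C3 \<delta> * (tail n (\<delta> / 4) / hh n)) \<longlonglongrightarrow> heat_C3 \<delta> * 0" using \<delta> by (intro tendsto_intros tail_lim) auto
    then have e2: "\<forall>\<^sub>F n in sequentially. heat_C3 \<delta> * (tail n (\<delta> / 4) / hh n) < \<delta>" using \<delta> by (intro order_tendstoD) auto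
    have e3: "\<forall>\<^sub>F n in sequentially. mesh n < min 1 (\<delta> ^ 3 / 64)" using mesh_lim \<delta> by (intro order_tendstoD) auto
    \<comment> \<open>One step before any time in the support the time is still nonnegative.\<close>
    have e4: "\<forall>\<^sub>F n in sequentially. hh n < tmin" using h_lim w(2) by (rule order_tendstoD)
    define good where "good n \<longleftrightarrow> (\<forall>t. 0 \<le> t \<and> t \<le> t1 \<longrightarrow> V n 0 t \<le> ereal BV) \<and>
      (\<forall>x t. (x, t) \<in> ?S \<longrightarrow> c \<le> F n x t) \<and> heat_M ?\<kappa> * sqrt (hh n) < \<delta> / 8 \<and>
      heat_C3 \<delta> * (tail n (\<delta> / 4) / hh n) < \<delta> \<and> mesh n < min 1 (\<delta> ^ 3 / 64) \<and> hh n < tmin" for n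
    have "\<forall>\<^sub>F n in sequentially. good n"
      using BV c(2) e1 e2 e3 e4 by eventually_elim (simp add: good_def)
    then obtain N0 where N0: "\<And>n. N0 \<le> n \<Longrightarrow> good n" by (auto simp: eventually_sequentially)
    let ?Ur = "\<lambda>n x t. grid_flow.Ur (u n) (steps n t) (grid_floor (\<epsilon> n) x)"
    let ?Y = "\<lambda>n x t. grid_flow.Y (\<epsilon> n) (u n) \<delta> (steps n t) (grid_floor (\<epsilon> n) x)"
    have fin: "grid_flow.finite_at (u n) (steps n t)" if "good n" "0 \<le> t" "t \<le> t1" for n t
    proof -
      have g0: "grid_floor (\<epsilon> n) 0 = (0 :: real^'n)" by (simp add: grid_floor_id[OF eps_pos])
      have "V n 0 t \<le> ereal BV" using that by (auto simp: good_def)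
      then show ?thesis unfolding grid_flow.finite_at_def[OF flow] V_def g0 by auto
    qed
    have V_Ur: "V n x t = ereal (?Ur n x t)" if "good n" "0 \<le> t" "t \<le> t1" for n x t
      using grid_flow.ereal_Ur[OF flow fin[OF that], of "grid_floor (\<epsilon> n) x"] by (simp add: V_def)
    have F_Ur: "F n x t = tanh (?Ur n x t)" if "good n" "0 \<le> t" "t \<le> t1" for n x t
      by (simp add: F_def V_Ur[OF that])
    have Ur_le: "?Ur n x t \<le> BV + norm x + 1" if a: "good n" "0 \<le> t" "t \<le> t1" for n x t
    proof -
      have "V n x t \<le> V n 0 t + ereal (dist x 0 + mesh n)" by (rule V_lipschitz)
      also have "\<dots> \<le> ereal BV + ereal (norm x + 1)" using a by (intro add_mono) (auto simp: good_def)
      finally show ?thesis by (simp add: V_Ur[OF a])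
    qed
    have Y_Ur: "?Ur n x t \<le> ?Y n x t" "?Y n x t \<le> ?Ur n x t + mesh n + \<delta> ^ 3 / 2"
      if a: "good n" "0 \<le> t" "t \<le> t1" for n x t
    proof -
      show "?Ur n x t \<le> ?Y n x t" by (rule grid_flow.Y_ge[OF flow \<delta>(1) fin[OF a]]) simp
      have "?Y n x t \<le> ?Ur n x t + 4 * ?\<kappa> * \<epsilon> n + \<delta> ^ 3 / 2"
        by (rule grid_flow.Y_le_Ur[OF flow \<delta>(1) fin[OF a]]) simp
      moreover have "4 * ?\<kappa> * \<epsilon> n \<le> mesh n" using eps_pos[of n] by (simp add: mesh_def)
      ultimately show "?Y n x t \<le> ?Ur n x t + mesh n + \<delta> ^ 3 / 2" by linarith
    qed
    \<comment> \<open>The window exceeds the support by 1, the reach of the stencil. Indices below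
      \<open>N0\<close> are set to 0 because the bound by \<open>B\<close> is required for all
      \<open>n\<close>.\<close>
    define YY where "YY n z = (if N0 \<le> n \<and> norm (fst z) \<le> \<rho> + 1 \<and> 0 \<le> snd z \<and> snd z \<le> tmax
        then ?Y n (fst z) (snd z) else 0)" for n z
    have d3: "0 < \<delta> ^ 3" "\<delta> ^ 3 \<le> 1" using \<delta> by (auto simp: power_le_one)
    have "- (heat_C ?\<kappa> * \<delta>) * (\<integral>z. f z \<partial>lborel) - (\<delta> ^ 3 / 2) * (\<integral>z. \<bar>heat_adjoint f z\<bar> \<partial>lborel)
      \<le> (\<integral>z. D z * heat_adjoint f z \<partial>lborel)"
    proof (rule heat_limit[where Y = YY and B = B])
      show "YY n \<in> borel_measurable borel" for n
      proof -
        have [measurable]: "(\<lambda>z. ?Y n (fst z) (snd z)) \<in> borel_measurable borel"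
          unfolding steps_def by (rule measurable_grid_function)
        have [measurable]: "(\<lambda>z :: (real^'n) \<times> real. norm (fst z)) \<in> borel_measurable borel"
          by (intro borel_measurable_continuous_onI continuous_intros)
        have [measurable]: "(snd :: (real^'n) \<times> real \<Rightarrow> real) \<in> borel_measurable borel"
          by (intro borel_measurable_continuous_onI continuous_intros)
        show ?thesis unfolding YY_def by measurable
      qed
      show "\<bar>YY n z\<bar> \<le> B" for n z
      proof (cases "N0 \<le> n \<and> norm (fst z) \<le> \<rho> + 1 \<and> 0 \<le> snd z \<and> snd z \<le> tmax")
        case True
        then have a: "good n" "0 \<le> snd z" "snd z \<le> t1" using N0 t1 by auto
        have "mesh n \<le> 1" using a(1) by (auto simp: good_def)
        then have "?Y n (fst z) (snd z) \<le> B"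
          using Y_Ur(2)[OF a, of "fst z"] Ur_le[OF a, of "fst z"] True d3 unfolding B_def by linarith
        moreover have "0 \<le> ?Y n (fst z) (snd z)"
          by (rule grid_flow.Y_nonneg[OF flow \<delta>(1) fin[OF a]]) simp
        moreover have "YY n z = ?Y n (fst z) (snd z)" unfolding YY_def by (rule if_P[OF True])
        ultimately show ?thesis by simp
      next
        case False
        have "0 \<le> B" using w(3) by (simp add: B_def)
        moreover have "YY n z = 0" unfolding YY_def by (rule if_not_P[OF False])
        ultimately show ?thesis by simp
      qed
      have "(\<Sum>j\<in>stencil n. K n j * YY n (x - j, t)) \<le> YY n (x, t + hh n) + heat_C ?\<kappa> * \<delta> * hh n"
        if n: "N0 \<le> n" and fx: "f (x, t + hh n) \<noteq> 0" for n x t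
      proof -
        have g: "good n" using N0 n .
        have inS: "(x, t + hh n) \<in> ?S" using fx closure_subset[of "{z. f z \<noteq> 0}"] by blast
        then have xt: "norm x \<le> \<rho>" "tmin \<le> t + hh n" "t + hh n \<le> tmax" using w(1) by auto
        have h: "0 < hh n" "hh n < tmin" using hh_pos g by (auto simp: good_def)
        have t: "0 \<le> t" "t \<le> tmax" "0 \<le> t + hh n" "t + hh n \<le> t1" using xt h t1 by linarith+
        let ?i = "grid_floor (\<epsilon> n) x"
        have st: "steps n (t + hh n) = Suc (steps n t)" by (rule steps_add_h[OF t(1)])
        have fin': "grid_flow.finite_at (u n) (Suc (steps n t))" using fin[OF g t(3,4)] by (simp add: st)
        have "c \<le> F n x (t + hh n)" using g inS by (auto simp: good_def)
        also have "\<dots> = tanh (grid_flow.Ur (u n) (Suc (steps n t)) ?i)" by (simp add: F_Ur[OF g t(3,4)] st)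
        also have "\<dots> \<le> grid_flow.Ur (u n) (Suc (steps n t)) ?i" by (intro tanh_le_self grid_flow.Ur_nonneg[OF flow])
        finally have pos: "2 * \<delta> < grid_flow.Ur (u n) (Suc (steps n t)) ?i" using \<delta>(3) by linarith
        have h2: "heat_C3 \<delta> * tail n (\<delta> / 4) \<le> \<delta> * hh n"
          using g h(1) by (simp add: good_def pos_divide_less_eq less_imp_le)
        have "mesh n < \<delta> ^ 3 / 64" using g by (simp add: good_def)
        then have h3: "6 * ?\<kappa> * \<epsilon> n \<le> \<delta> ^ 3 / 64" by (simp add: mesh_def)
        have h1: "heat_M ?\<kappa> * sqrt (hh n) \<le> \<delta> / 8" using g by (simp add: good_def)
        have "(\<Sum>j\<in>stencil n. K n j * YY n (x - j, t)) =
            (\<Sum>j\<in>stencil n. K n j * grid_flow.Y (\<epsilon> n) (u n) \<delta> (steps n t) (?i - j))"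
        proof (intro sum.cong refl)
          fix j assume "j \<in> stencil n"
          then have j: "j \<in> grid (\<epsilon> n)" "norm j \<le> 1" by (auto simp: grid_kernel.stencil_def[OF kernel])
          have "norm (x - j) \<le> \<rho> + 1" using norm_triangle_ineq4[of x j] xt(1) j(2) by linarith
          then show "K n j * YY n (x - j, t) = K n j * grid_flow.Y (\<epsilon> n) (u n) \<delta> (steps n t) (?i - j)"
            using n t by (simp add: YY_def grid_floor_diff[OF eps_pos j(1)])
        qed
        also have "\<dots> \<le> grid_flow.Y (\<epsilon> n) (u n) \<delta> (Suc (steps n t)) ?i + heat_C ?\<kappa> * \<delta> * hh n"
          by (rule grid_flow.heat_step[OF flow \<delta>(1,2) _ fin' pos h1 h2 h3]) simp
        also have "grid_flow.Y (\<epsilon> n) (u n) \<delta> (Suc (steps n t)) ?i = YY n (x, t + hh n)"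
          using n xt t by (simp add: YY_def st)
        finally show ?thesis .
      qed
      then show "\<forall>\<^sub>F n in sequentially. \<forall>x t. f (x, t + hh n) \<noteq> 0 \<longrightarrow>
          (\<Sum>j\<in>stencil n. K n j * YY n (x - j, t)) \<le> YY n (x, t + hh n) + heat_C ?\<kappa> * \<delta> * hh n"
        by (auto simp: eventually_sequentially)
      show "\<bar>D z\<bar> \<le> B" if "z \<in> ?S" for z using BD[OF that] w(3) by (simp add: B_def)
      \<comment> \<open>Exceptional times become countably many hyperplanes of space-time, which are
        null sets.\<close>
      have "(0 :: real^'n, 1 :: real) \<in> Basis" unfolding Basis_prod_def by (intro UnI2 imageI) simp
      then have "\<forall>t\<in>N. AE z in lborel. z \<bullet> (0 :: real^'n, 1 :: real) \<noteq> t" using AE_lborel_inner_neq by blast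
      then have "AE z in lborel. \<forall>t\<in>N. z \<bullet> (0 :: real^'n, 1 :: real) \<noteq> t" by (simp only: AE_ball_countable[OF N(1)])
      then show "AE z in lborel. z \<in> ?S \<longrightarrow> (\<forall>\<eta>>\<delta> ^ 3 / 2. \<forall>\<^sub>F n in sequentially. \<bar>YY n z - D z\<bar> \<le> \<eta>)"
      proof eventually_elim
        case (elim z)
        show ?case
        proof (intro impI allI)
          fix \<eta> assume z: "z \<in> ?S" and \<eta>: "\<delta> ^ 3 / 2 < \<eta>"
          obtain x t where xt: "z = (x, t)" by (cases z)
          have t: "t \<notin> N" using elim by (auto simp: xt inner_prod_def)
          have al: "(x, t) \<in> alive" using z S_alive by (auto simp: xt)
          then have t0: "0 < t" by (simp add: alive_def)
          have win: "norm x \<le> \<rho> + 1" "t \<le> tmax" "t \<le> t1" using w(1)[of x t] z t1 by (auto simp: xt)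
          have Dz: "L x t = tanh (D z)" using L_infdist[OF t0 alive_nonempty[OF al], of x] al by (simp add: D_def xt)
          have "(\<lambda>n. artanh (F n x t)) \<longlonglongrightarrow> artanh (L x t)"
            using N(2)[OF t0 t, of x] by (intro tendsto_artanh) (auto simp: Dz tanh_real_gt_neg1)
          then have lim: "(\<lambda>n. artanh (F n x t)) \<longlonglongrightarrow> D z" by (simp add: Dz artanh_tanh_real)
          have "(\<lambda>n. mesh n + \<bar>artanh (F n x t) - D z\<bar>) \<longlonglongrightarrow> 0 + \<bar>D z - D z\<bar>"
            by (intro tendsto_intros mesh_lim lim)
          then have "\<forall>\<^sub>F n in sequentially. mesh n + \<bar>artanh (F n x t) - D z\<bar> < \<eta> - \<delta> ^ 3 / 2"
            using \<eta> by (intro order_tendstoD) auto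
          with eventually_ge_at_top[of N0]
          show "\<forall>\<^sub>F n in sequentially. \<bar>YY n z - D z\<bar> \<le> \<eta>"
          proof eventually_elim
            case (elim n)
            have a: "good n" "0 \<le> t" "t \<le> t1" using N0[OF elim(1)] t0 win by auto
            have "artanh (F n x t) = ?Ur n x t" by (simp add: F_Ur[OF a] artanh_tanh_real)
            moreover have "YY n z = ?Y n x t" using elim(1) win t0 by (simp add: YY_def xt)
            ultimately show ?case using Y_Ur[OF a, of x] elim(2) by linarith
          qed
        qed
      qed
    qed (use f D_measurable d3 in auto)
    then show ?thesis .
  qed
  let ?I = "\<integral>z. D z * heat_adjoint f z \<partial>lborel"
  let ?l = "\<lambda>\<delta>. - (heat_C ?\<kappa> * \<delta>) * (\<integral>z. f z \<partial>lborel) - \<delta> ^ 3 / 2 * (\<integral>z. \<bar>heat_adjoint f z\<bar> \<partial>lborel)"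
  have "(?l \<longlongrightarrow> ?l 0) (at_right 0)" by (intro tendsto_intros) simp
  moreover have "\<forall>\<^sub>F \<delta> in at_right 0. ?l \<delta> \<le> ?I"
  proof -
    have "?l \<delta> \<le> ?I" if "0 < \<delta>" "\<delta> < min (1/4) (c / 2)" for \<delta>
      using that by (intro key) auto
    then show ?thesis unfolding eventually_at_right_field using c(1) by (intro exI[of _ "min (1/4) (c / 2)"]) auto
  qed
  ultimately have "?l 0 \<le> ?I" by (rule tendsto_upperbound) simp
  then show ?thesis by simp
qed

lemma heat_supersolution_E:
  "distributional_heat_supersol ({(x, t). 0 < t \<and> ereal t < extinction_time E} - E)
     (\<lambda>(x, t). infdist x (time_slice E t))"
  unfolding distributional_heat_supersol_def alive_def[symmetric]
proof (intro conjI allI impI; elim conjE)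
  let ?u = "\<lambda>(x, t). infdist x (time_slice E t)"
  have u_D: "?u z = D z" if "z \<in> alive" for z using that by (cases z) (auto simp: D_def)
  have [measurable]: "D \<in> borel_measurable borel" by (rule D_measurable)
  fix C assume C: "compact C" "C \<subseteq> alive - E"
  then obtain B where B: "\<And>z. z \<in> C \<Longrightarrow> \<bar>D z\<bar> \<le> B" using D_bounded[of C] by blast
  have "integrable lborel (\<lambda>z. indicator C z *\<^sub>R D z)"
  proof (rule integrableI_bounded_set_indicator[where B = B])
    show "AE z in lborel. z \<in> C \<longrightarrow> norm (D z) \<le> B" using B by (intro AE_I2) simp
    show "emeasure lborel C < \<infinity>" using C(1) by (intro emeasure_bounded_finite compact_imp_bounded)
  qed (use C(1) in \<open>auto intro: borel_compact\<close>)
  moreover have "(\<lambda>z. indicator C z *\<^sub>R D z) = (\<lambda>z. indicator C z *\<^sub>R ?u z)"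
    using u_D C(2) by (fastforce simp: indicator_def fun_eq_iff)
  ultimately show "set_integrable lborel C ?u" unfolding set_integrable_def by simp
next
  let ?u = "\<lambda>(x, t). infdist x (time_slice E t)"
  have u_D: "?u z = D z" if "z \<in> alive" for z using that by (cases z) (auto simp: D_def)
  have [measurable]: "D \<in> borel_measurable borel" by (rule D_measurable)
  fix f :: "(real^'n) \<times> real \<Rightarrow> real" assume tf: "test_function (alive - E) f" and nn: "\<forall>z. 0 \<le> f z"
  then have f: "smooth_fun f" "compact (closure {z. f z \<noteq> 0})" "closure {z. f z \<noteq> 0} \<subseteq> alive - E"
    by (auto simp: test_function_def)
  obtain B where B: "\<And>z. z \<in> closure {z. f z \<noteq> 0} \<Longrightarrow> \<bar>D z\<bar> \<le> B" using D_bounded[OF f(2)] f(3) by blast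
  obtain \<rho> where \<rho>: "\<And>z. z \<in> closure {z. f z \<noteq> 0} \<Longrightarrow> norm z \<le> \<rho>"
    using compact_imp_bounded[OF f(2)] unfolding bounded_iff by blast
  have int: "integrable lborel (\<lambda>z. D z * p z)"
    if p: "continuous_on UNIV p" "\<And>z. \<bar>p z\<bar> \<le> C" "\<And>z. z \<notin> closure {z. f z \<noteq> 0} \<Longrightarrow> p z = 0" for p C
  proof (rule integrable_bounded_support)
    have [measurable]: "p \<in> borel_measurable borel" using p(1) by (rule borel_measurable_continuous_onI)
    show "(\<lambda>z. D z * p z) \<in> borel_measurable borel" by measurable
    show "\<bar>D z * p z\<bar> \<le> \<bar>B\<bar> * C" for z
    proof (cases "z \<in> closure {z. f z \<noteq> 0}")
      case True
      then show ?thesis unfolding abs_mult using B[OF True] p(2)[of z] by (intro mult_mono) auto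
    next
      case False
      have "0 \<le> C" using p(2)[of z] by linarith
      then show ?thesis using p(3)[OF False] by simp
    qed
    show "norm z \<le> \<rho>" if "D z * p z \<noteq> 0" for z using that p(3)[of z] \<rho>[of z] by auto
  qed
  have eq: "?u z * p z = D z * p z" if "\<And>z. z \<notin> closure {z. f z \<noteq> 0} \<Longrightarrow> p z = 0" for p :: "(real^'n) \<times> real \<Rightarrow> real" and z
  proof (cases "z \<in> closure {z. f z \<noteq> 0}")
    case True
    then have "z \<in> alive" using f(3) by blast
    then show ?thesis by (simp only: u_D)
  qed (simp add: that)
  have zero: "time_deriv f z = 0" "space_laplacian f z = 0" if "z \<notin> closure {z. f z \<noteq> 0}" for z
    using that by (simp_all add: time_deriv_def space_laplacian_def iter_deriv_zero_outside del: iter_deriv.simps)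
  have eq1: "?u z * time_deriv f z = D z * time_deriv f z" for z by (rule eq) (rule zero)
  have eq2: "?u z * space_laplacian f z = D z * space_laplacian f z" for z by (rule eq) (rule zero)
  obtain C1 where C1: "\<And>z. \<bar>time_deriv f z\<bar> \<le> C1"
    using iter_deriv_bounded[OF f(1,2), of "[(0, 1)]"] unfolding time_deriv_def by blast
  obtain C2 where C2: "\<And>z. \<bar>heat_adjoint f z\<bar> \<le> C2" using heat_adjoint_bounded[OF f(1,2)] by blast
  have lap: "space_laplacian f z = - time_deriv f z - heat_adjoint f z" for z
    unfolding heat_adjoint_def by simp
  have i1: "integrable lborel (\<lambda>z. D z * time_deriv f z)"
  proof (rule int)
    show "continuous_on UNIV (time_deriv f)" unfolding time_deriv_def by (rule iter_deriv_continuous[OF f(1)])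
  qed (rule C1, rule zero(1))
  have i2: "integrable lborel (\<lambda>z. D z * heat_adjoint f z)"
    by (rule int[OF heat_adjoint_continuous[OF f(1)] C2 heat_adjoint_zero_outside])
  have "(\<integral>z. ?u z * space_laplacian f z \<partial>lborel) = (\<integral>z. D z * space_laplacian f z \<partial>lborel)"
    by (simp only: eq2)
  also have "\<dots> = (\<integral>z. - (D z * time_deriv f z) - D z * heat_adjoint f z \<partial>lborel)"
    by (simp only: lap right_diff_distrib mult_minus_right)
  also have "\<dots> = - (\<integral>z. D z * time_deriv f z \<partial>lborel) - (\<integral>z. D z * heat_adjoint f z \<partial>lborel)"
    using i1 i2 by (subst Bochner_Integration.integral_diff) simp_all
  also have "\<dots> \<le> - (\<integral>z. D z * time_deriv f z \<partial>lborel)"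
    using heat_inequality_test[OF f(1,2) _ f(3)] nn by simp
  also have "\<dots> = - (\<integral>z. ?u z * time_deriv f z \<partial>lborel)" by (simp only: eq1)
  finally show "(\<integral>z. ?u z * space_laplacian f z \<partial>lborel) \<le> - (\<integral>z. ?u z * time_deriv f z \<partial>lborel)" .
qed

lemma superflow_E: "superflow A0 E"
  unfolding superflow_def
proof (intro conjI allI impI)
  show "E \<subseteq> UNIV \<times> {0..}" by (auto simp: E_def)
  show "time_slice E 0 \<subseteq> A0" by (simp add: slice_zero)
  fix t s :: real assume "0 \<le> t" "time_slice E t = {}" "t < s"
  then show "time_slice E s = {}"
    using slice_empty_mono[of t s] slice_empty_mono_zero[of s] by (cases "t = 0") (auto simp: slice_zero)
qed (intro closed_E kuratowski_E heat_supersolution_E; assumption?)+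

lemma limit_theorem:
  "\<exists>E N. superflow A0 E \<and> countable N \<and>
    (\<forall>t>0. t \<notin> N \<longrightarrow> (\<forall>x. (\<lambda>n. F n x t) \<longlonglongrightarrow> gamma (edist_set x (time_slice E t))))"
proof -
  obtain N where N: "countable N" "\<And>t x. 0 < t \<Longrightarrow> t \<notin> N \<Longrightarrow> (\<lambda>n. F n x t) \<longlonglongrightarrow> L x t"
    using F_tendsto_L_except_countable by blast
  have "(\<lambda>n. F n x t) \<longlonglongrightarrow> gamma (edist_set x (time_slice E t))" if "0 < t" "t \<notin> N" for t x
    using N(2)[OF that, of x] L_exact[OF that(1), of x] by (simp add: slice_pos[OF that(1)])
  then show ?thesis using superflow_E N(1) by blast
qed

end

section \<open>Subsequences\<close>

lemma diagonal_convergent_subsequence: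
  fixes f :: "nat \<Rightarrow> nat \<Rightarrow> real"
  assumes "\<And>n i. f n i \<in> {0..1}"
  obtains r where "strict_mono r" "\<And>i. convergent (\<lambda>n. f (r n) i)"
proof -
  interpret subseqs "\<lambda>i s. convergent (\<lambda>n. f (s n) i)"
  proof
    fix i and s :: "nat \<Rightarrow> nat"
    have "seq_compact {0..1 :: real}" by (simp add: compact_imp_seq_compact)
    moreover have "\<forall>n. f (s n) i \<in> {0..1}" using assms by blast
    ultimately obtain l r where "strict_mono r" "((\<lambda>n. f (s n) i) \<circ> r) \<longlonglongrightarrow> l" by (rule seq_compactE)
    then show "\<exists>r'. strict_mono r' \<and> convergent (\<lambda>n. f ((s \<circ> r') n) i)" by (auto simp: o_def convergent_def)
  qed
  have "convergent (\<lambda>n. f (diagseq n) i)" for i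
  proof -
    have "convergent (\<lambda>n. f ((diagseq \<circ> (+) (Suc i)) n) i)"
    proof (rule diagseq_holds)
      fix r s :: "nat \<Rightarrow> nat" and k assume "strict_mono r" "convergent (\<lambda>n. f (s n) k)"
      then show "convergent (\<lambda>n. f ((s \<circ> r) n) k)"
        using convergent_subseq_convergent[of "\<lambda>n. f (s n) k" r] by (simp add: o_def)
    qed
    then have "convergent (\<lambda>n. f (diagseq (n + Suc i)) i)" by (simp add: o_def add.commute)
    then show ?thesis by (rule convergent_ignore_initial_segment[THEN iffD1])
  qed
  then show thesis using that subseq_diagseq by blast
qed

context flow_sequence
begin

lemma subsequence:
  assumes "strict_mono r"
  shows "flow_sequence (\<epsilon> \<circ> r) (K \<circ> r) (u \<circ> r) A0"
    and "flow_sequence.F (\<epsilon> \<circ> r) (K \<circ> r) (u \<circ> r) n = F (r n)"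
proof -
  note lim = LIMSEQ_subseq_LIMSEQ[OF _ assms, unfolded o_def]
  show fs: "flow_sequence (\<epsilon> \<circ> r) (K \<circ> r) (u \<circ> r) A0"
  proof (intro flow_sequence.intro kernel_sequence.intro flow_sequence_axioms.intro, unfold o_def)
    show "(\<lambda>n. (1 - kernel_fourier (\<epsilon> (r n)) (K (r n)) \<xi>) / complex_of_real (hh (r n)))
        \<longlonglongrightarrow> complex_of_real (4 * pi\<^sup>2 * (norm \<xi>)\<^sup>2)" for \<xi>
      by (rule lim[OF fourier_lim])
  qed (rule kernel flow initial A0_closed lim[OF eps_lim] lim[OF h_lim]; assumption?)+
  show "flow_sequence.F (\<epsilon> \<circ> r) (K \<circ> r) (u \<circ> r) n = F (r n)"
    by (simp add: fun_eq_iff flow_sequence.F_def[OF fs] flow_sequence.V_def[OF fs] flow_sequence.steps_def[OF fs]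
        F_def V_def steps_def)
qed

text \<open>The functions are equicontinuous up to \<open>mesh\<close>, which tends to 0, so the
  Cauchy property passes from dense points to all points.\<close>

lemma convergent_of_dense:
  assumes r: "strict_mono r" and Q: "\<And>X. open X \<Longrightarrow> X \<noteq> {} \<Longrightarrow> \<exists>q\<in>Q. q \<in> X"
    and conv: "\<And>q s. q \<in> Q \<Longrightarrow> s \<in> \<rat> \<Longrightarrow> 0 \<le> s \<Longrightarrow> convergent (\<lambda>n. F (r n) q s)"
  shows "convergent_flow_sequence (\<epsilon> \<circ> r) (K \<circ> r) (u \<circ> r) A0"
proof -
  interpret sub: flow_sequence "\<epsilon> \<circ> r" "K \<circ> r" "u \<circ> r" A0 by (rule subsequence(1)[OF r])
  show ?thesis
  proof
    fix x :: "real^'n" and s :: real assume s: "s \<in> \<rat>" "0 \<le> s"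
    have "Cauchy (\<lambda>n. sub.F n x s)"
    proof (rule CauchyI')
      fix e :: real assume e: "0 < e"
      obtain q where q: "q \<in> Q" "q \<in> ball x (e / 8)" using Q[of "ball x (e / 8)"] e by auto
      have dq: "dist x q < e / 8" "dist q x < e / 8" using q by (auto simp: dist_commute)
      have "Cauchy (\<lambda>n. sub.F n q s)"
        using conv[OF q(1) s] by (simp add: subsequence(2)[OF r] convergent_Cauchy)
      then obtain N1 where N1: "\<And>m n. N1 \<le> m \<Longrightarrow> N1 \<le> n \<Longrightarrow> \<bar>sub.F m q s - sub.F n q s\<bar> < e / 4"
        using e unfolding Cauchy_def dist_real_def by (metis divide_pos_pos zero_less_numeral)
      have "\<forall>\<^sub>F n in sequentially. sub.mesh n < e / 8" using sub.mesh_lim e by (intro order_tendstoD) auto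
      then obtain N2 where N2: "\<And>n. N2 \<le> n \<Longrightarrow> sub.mesh n < e / 8" by (auto simp: eventually_sequentially)
      have "dist (sub.F m x s) (sub.F n x s) < e" if "max N1 N2 \<le> m" "m < n" for m n
      proof -
        have "\<bar>sub.F m q s - sub.F n q s\<bar> < e / 4" "sub.mesh m < e / 8" "sub.mesh n < e / 8"
          using N1[of m n] N2[of m] N2[of n] that by auto
        then show ?thesis
          using dq sub.F_lipschitz'[of m x s q] sub.F_lipschitz'[of m q s x] sub.F_lipschitz'[of n x s q] sub.F_lipschitz'[of n q s x]
          unfolding dist_real_def by linarith
      qed
      then show "\<exists>M. \<forall>m\<ge>M. \<forall>n>m. dist (sub.F m x s) (sub.F n x s) < e" by blast
    qed
    then show "convergent (\<lambda>n. sub.F n x s)" by (simp add: Cauchy_convergent_iff)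
  qed
qed

end

section \<open>Locally uniform convergence\<close>

lemma signed_limit:
  fixes w :: "nat \<Rightarrow> ereal"
  assumes p: "(\<lambda>n. gamma (max (w n) 0)) \<longlonglongrightarrow> tanh a" and m: "(\<lambda>n. gamma (max (- w n) 0)) \<longlonglongrightarrow> tanh b"
    and e: "0 < e"
  shows "\<forall>\<^sub>F n in sequentially. \<bar>w n - ereal (a - b)\<bar> < ereal e"
proof -
  have "(\<lambda>n. artanh (gamma (max (w n) 0)) - artanh (gamma (max (- w n) 0))) \<longlonglongrightarrow> artanh (tanh a) - artanh (tanh b)"
    using p m by (intro tendsto_diff tendsto_artanh) (auto simp: tanh_real_gt_neg1)
  then have "(\<lambda>n. artanh (gamma (max (w n) 0)) - artanh (gamma (max (- w n) 0))) \<longlonglongrightarrow> a - b"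
    by (simp add: artanh_tanh_real)
  then have "\<forall>\<^sub>F n in sequentially. \<bar>artanh (gamma (max (w n) 0)) - artanh (gamma (max (- w n) 0)) - (a - b)\<bar> < e"
    using e unfolding tendsto_iff dist_real_def by blast
  moreover have "\<forall>\<^sub>F n in sequentially. gamma (max (w n) 0) < 1" using p by (rule order_tendstoD) simp
  moreover have "\<forall>\<^sub>F n in sequentially. gamma (max (- w n) 0) < 1" using m by (rule order_tendstoD) simp
  ultimately show ?thesis
  proof eventually_elim
    case (elim n)
    have "w n \<noteq> \<infinity>" "w n \<noteq> - \<infinity>" using elim(2,3) by auto
    then obtain r where r: "w n = ereal r" by (cases "w n") auto
    have "gamma (max (w n) 0) = tanh (max r 0)" by (simp add: r max_def zero_ereal_def)
    moreover have "gamma (max (- w n) 0) = tanh (max (- r) 0)" by (simp add: r max_def zero_ereal_def)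
    ultimately have "\<bar>max r 0 - max (- r) 0 - (a - b)\<bar> < e" using elim(1) by (simp add: artanh_tanh_real)
    then show ?case by (simp add: r max_def split: if_splits)
  qed
qed

lemma locally_uniform_limit_PInf:
  fixes w :: "nat \<Rightarrow> 'a::real_normed_vector \<Rightarrow> ereal"
  assumes lip: "\<And>n x y. w n x \<le> w n y + ereal (dist x y + \<mu> n)" and \<mu>: "\<mu> \<longlonglongrightarrow> 0"
    and lim: "(\<lambda>n. gamma (max (w n 0) 0)) \<longlonglongrightarrow> 1" and C: "compact C"
  shows "\<forall>\<^sub>F n in sequentially. \<forall>x\<in>C. ereal M < w n x"
proof -
  obtain \<rho> where \<rho>: "\<And>x. x \<in> C \<Longrightarrow> norm x \<le> \<rho>" using compact_imp_bounded[OF C] unfolding bounded_iff by blast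
  define R where "R = \<bar>M\<bar> + \<bar>\<rho>\<bar> + 2"
  have "\<forall>\<^sub>F n in sequentially. tanh R < gamma (max (w n 0) 0)" using lim by (rule order_tendstoD) simp
  moreover have "\<forall>\<^sub>F n in sequentially. \<mu> n < 1" using \<mu> by (rule order_tendstoD) simp
  ultimately show ?thesis
  proof eventually_elim
    case (elim n)
    have "gamma (ereal R) < gamma (max (w n 0) 0)" using elim by simp
    then have "ereal R < max (w n 0) 0" by (simp only: gamma_less_iff)
    then have R: "ereal R < w n 0" by (simp add: R_def max_def zero_ereal_def split: if_splits)
    show ?case
    proof
      fix x assume x: "x \<in> C"
      have "w n 0 \<le> w n x + ereal (dist 0 x + \<mu> n)" by (rule lip)
      then have "ereal R < w n x + ereal (dist 0 x + \<mu> n)" using R by (rule less_le_trans[rotated])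
      moreover have "M + (dist 0 x + \<mu> n) < R" using \<rho>[OF x] elim by (simp add: R_def)
      ultimately show "ereal M < w n x" by (cases "w n x") auto
    qed
  qed
qed

lemma locally_uniform_limit_real:
  fixes w :: "nat \<Rightarrow> 'a::real_normed_vector \<Rightarrow> ereal"
  assumes lip: "\<And>n x y. w n x \<le> w n y + ereal (dist x y + \<mu> n)" and \<mu>: "\<mu> \<longlonglongrightarrow> 0"
    and lim: "\<And>x e. 0 < e \<Longrightarrow> \<forall>\<^sub>F n in sequentially. \<bar>w n x - ereal (g x)\<bar> < ereal e"
    and g: "\<And>x y. \<bar>g x - g y\<bar> \<le> 2 * dist x y" and C: "compact C" and e: "0 < e"
  shows "\<forall>\<^sub>F n in sequentially. \<forall>x\<in>C. \<bar>w n x - ereal (g x)\<bar> < ereal e"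
proof -
  have "C \<subseteq> (\<Union>y\<in>C. ball y (e / 8))" using e by force
  then obtain A where A: "A \<subseteq> C" "finite A" "C \<subseteq> (\<Union>y\<in>A. ball y (e / 8))"
    using compactE_image[OF C, of C "\<lambda>y. ball y (e / 8)"] by blast
  have "\<forall>\<^sub>F n in sequentially. \<forall>y\<in>A. \<bar>w n y - ereal (g y)\<bar> < ereal (e / 4)"
    using A e by (intro eventually_ball_finite ballI lim) auto
  moreover have "\<forall>\<^sub>F n in sequentially. \<mu> n < e / 8" using \<mu> e by (intro order_tendstoD) auto
  ultimately show ?thesis
  proof eventually_elim
    case (elim n)
    show ?case
    proof
      fix x assume "x \<in> C"
      then obtain y where y: "y \<in> A" "dist y x < e / 8" using A(3) by auto
      have "\<bar>w n y - ereal (g y)\<bar> < ereal (e / 4)" using elim y by blast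
      then obtain b where b: "w n y = ereal b" "\<bar>b - g y\<bar> < e / 4" by (cases "w n y") auto
      then obtain a where a: "w n x = ereal a" using lip[of n x y] lip[of n y x] by (cases "w n x") auto
      have "a \<le> b + (dist x y + \<mu> n)" "b \<le> a + (dist y x + \<mu> n)"
        using lip[of n x y] lip[of n y x] by (auto simp: a b)
      then have "\<bar>a - g x\<bar> < e" using b(2) g[of x y] y(2) elim(2) unfolding dist_commute[of y x] by linarith
      then show "\<bar>w n x - ereal (g x)\<bar> < ereal e" by (simp add: a)
    qed
  qed
qed

text \<open>Where the distance to \<open>A\<close> is positive, \<open>w n\<close> is eventually
  positive and its negative part is 0. So the two distances are never both positive, their
  difference is never indeterminate, and at most one of the sets is empty.\<close>

lemma locally_uniform_limit_signed:
  fixes w :: "nat \<Rightarrow> 'a::real_normed_vector \<Rightarrow> ereal"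
  assumes lip: "\<And>n x y. w n x \<le> w n y + ereal (dist x y + \<mu> n)" and \<mu>: "\<mu> \<longlonglongrightarrow> 0"
    and p: "\<And>x. (\<lambda>n. gamma (max (w n x) 0)) \<longlonglongrightarrow> gamma (edist_set x A)"
    and m: "\<And>x. (\<lambda>n. gamma (max (- w n x) 0)) \<longlonglongrightarrow> gamma (edist_set x B)"
  shows "locally_uniform_limit w (\<lambda>x. edist_set x A - edist_set x B) sequentially"
    and "max (edist_set x A - edist_set x B) 0 = edist_set x A"
    and "max (- (edist_set x A - edist_set x B)) 0 = edist_set x B"
proof -
  have one: "edist_set x B = 0" if "0 < edist_set x A" for x
  proof -
    have "\<forall>\<^sub>F n in sequentially. 0 < gamma (max (w n x) 0)" using p that by (intro order_tendstoD) auto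
    then have "\<forall>\<^sub>F n in sequentially. gamma (max (- w n x) 0) = 0"
    proof eventually_elim
      case (elim n)
      then show ?case by (cases "w n x") (auto simp: max_def split: if_splits)
    qed
    then have "(\<lambda>n. gamma (max (- w n x) 0)) \<longlonglongrightarrow> 0" by (rule tendsto_eventually)
    then have "gamma (edist_set x B) = 0" by (rule LIMSEQ_unique[OF m])
    then show ?thesis by simp
  qed
  have two: "edist_set x A = 0 \<or> edist_set x B = 0" for x
    using one[of x] edist_set_nonneg[of x A] by (auto simp: order.order_iff_strict)
  show "max (edist_set x A - edist_set x B) 0 = edist_set x A"
    using two[of x] edist_set_nonneg[of x A] edist_set_nonneg[of x B] by (auto simp: max_def)
  show "max (- (edist_set x A - edist_set x B)) 0 = edist_set x B"
    using two[of x] edist_set_nonneg[of x A] edist_set_nonneg[of x B] by (auto simp: max_def)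
  consider "A = {}" | "B = {}" | "A \<noteq> {}" "B \<noteq> {}" by blast
  then show "locally_uniform_limit w (\<lambda>x. edist_set x A - edist_set x B) sequentially"
  proof cases
    case 1
    have "edist_set x B = 0" for x using one[of x] 1 by simp
    then have "(\<lambda>x. edist_set x A - edist_set x B) = (\<lambda>x. \<infinity>)" using 1 by simp
    moreover have "\<forall>\<^sub>F n in sequentially. \<forall>x\<in>C. ereal M < w n x" if "compact C" for C M
      using p[of 0] 1 that by (intro locally_uniform_limit_PInf[OF lip \<mu>]) auto
    ultimately show ?thesis unfolding locally_uniform_limit_def by blast
  next
    case 2
    have "edist_set x A = 0" for x using two[of x] 2 by simp
    then have "(\<lambda>x. edist_set x A - edist_set x B) = (\<lambda>x. - \<infinity>)" using 2 by simp
    moreover have "\<forall>\<^sub>F n in sequentially. \<forall>x\<in>C. w n x < ereal M" if "compact C" for C M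
    proof -
      have lip': "- w n x \<le> - w n y + ereal (dist x y + \<mu> n)" for n x y
        using lip[of n y x] by (cases "w n x"; cases "w n y") (auto simp: dist_commute)
      have "\<forall>\<^sub>F n in sequentially. \<forall>x\<in>C. ereal (- M) < - w n x"
        using m[of 0] 2 that by (intro locally_uniform_limit_PInf[OF lip' \<mu>]) auto
      then show ?thesis
      proof eventually_elim
        case (elim n)
        show ?case
        proof
          fix x assume "x \<in> C"
          then have "ereal (- M) < - w n x" using elim by blast
          then show "w n x < ereal M" by (cases "w n x") auto
        qed
      qed
    qed
    ultimately show ?thesis unfolding locally_uniform_limit_def by blast
  next
    case 3
    define g where "g x = infdist x A - infdist x B" for x
    have eq: "edist_set x A = ereal (infdist x A)" "edist_set x B = ereal (infdist x B)" for x
      using 3 by (simp_all add: edist_set_eq_infdist)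
    have lim: "\<forall>\<^sub>F n in sequentially. \<bar>w n x - ereal (g x)\<bar> < ereal e" if "0 < e" for x e
      unfolding g_def using p[of x] m[of x] that by (intro signed_limit) (simp_all add: eq)
    have "\<bar>g x - g y\<bar> \<le> 2 * dist x y" for x y
      using infdist_triangle[of x A y] infdist_triangle[of y A x] infdist_triangle[of x B y] infdist_triangle[of y B x]
      by (simp add: g_def dist_commute)
    then have "\<forall>\<^sub>F n in sequentially. \<forall>x\<in>C. \<bar>w n x - ereal (g x)\<bar> < ereal e" if "compact C" "0 < e" for C e
      using that by (intro locally_uniform_limit_real[OF lip \<mu> lim]) auto
    moreover have "(\<lambda>x. edist_set x A - edist_set x B) = (\<lambda>x. ereal (g x))" by (simp add: eq g_def)
    ultimately show ?thesis unfolding locally_uniform_limit_def by blast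
  qed
qed

text \<open>A single diagonal extraction over points, times and a Boolean tag for the two flows
  yields one subsequence for both.\<close>

lemma common_convergent_subsequence:
  fixes K :: "nat \<Rightarrow> real^'n \<Rightarrow> real"
  assumes "flow_sequence \<epsilon> K u A" "flow_sequence \<epsilon> K v B"
  obtains r where "strict_mono r" "convergent_flow_sequence (\<epsilon> \<circ> r) (K \<circ> r) (u \<circ> r) A"
    "convergent_flow_sequence (\<epsilon> \<circ> r) (K \<circ> r) (v \<circ> r) B"
proof -
  interpret p: flow_sequence \<epsilon> K u A by (rule assms)
  interpret m: flow_sequence \<epsilon> K v B by (rule assms)
  obtain Q :: "(real^'n) set" where Q: "countable Q" "\<And>X. open X \<Longrightarrow> X \<noteq> {} \<Longrightarrow> \<exists>q\<in>Q. q \<in> X"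
    using countable_dense_exists[where 'a = "real^'n"] by blast
  define f where "f n z = (if snd z then p.F n else m.F n) (fst (fst z)) (snd (fst z))" for n and z :: "((real^'n) \<times> real) \<times> bool"
  define Z where "Z = (Q \<times> (\<rat> :: real set)) \<times> (UNIV :: bool set)"
  have Z: "countable Z" unfolding Z_def by (intro countable_SIGMA Q countable_rat) simp_all
  have "f n (from_nat_into Z i) \<in> {0..1}" for n i using p.F_range m.F_range by (simp add: f_def)
  then obtain r where r: "strict_mono r" "\<And>i. convergent (\<lambda>n. f (r n) (from_nat_into Z i))"
    using diagonal_convergent_subsequence[of "\<lambda>n i. f n (from_nat_into Z i)"] by blast
  have conv: "convergent (\<lambda>n. f (r n) z)" if "z \<in> Z" for z
    using r(2)[of "to_nat_on Z z"] by (simp only: from_nat_into_to_nat_on[OF Z that])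
  show thesis
  proof (rule that[OF r(1)])
    show "convergent_flow_sequence (\<epsilon> \<circ> r) (K \<circ> r) (u \<circ> r) A"
    proof (rule p.convergent_of_dense[OF r(1) Q(2)])
      show "convergent (\<lambda>n. p.F (r n) q s)" if "q \<in> Q" "s \<in> \<rat>" for q s
        using conv[of "((q, s), True)"] that by (simp add: f_def Z_def)
    qed
    show "convergent_flow_sequence (\<epsilon> \<circ> r) (K \<circ> r) (v \<circ> r) B"
    proof (rule m.convergent_of_dense[OF r(1) Q(2)])
      show "convergent (\<lambda>n. m.F (r n) q s)" if "q \<in> Q" "s \<in> \<rat>" for q s
        using conv[of "((q, s), False)"] that by (simp add: f_def Z_def)
    qed
  qed
qed

theorem theorem5p4:
  fixes E0 :: "(real^'n) set"
    and K :: "real \<Rightarrow> real^'n \<Rightarrow> real"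
    and w :: "real \<Rightarrow> real^'n \<Rightarrow> ereal"
    and sd :: "real \<Rightarrow> (real^'n \<Rightarrow> ereal) \<Rightarrow> real^'n \<Rightarrow> ereal"
  assumes "closed E0" and "E0 \<noteq> {}"
    and kernel_sym: "\<And>\<epsilon> j. 0 < \<epsilon> \<Longrightarrow> j \<in> grid \<epsilon> \<Longrightarrow> K \<epsilon> j = K \<epsilon> (- j)"
    and kernel_nonneg: "\<And>\<epsilon> j. 0 < \<epsilon> \<Longrightarrow> j \<in> grid \<epsilon> \<Longrightarrow> 0 \<le> K \<epsilon> j"
    and kernel_mass: "\<And>\<epsilon>. 0 < \<epsilon> \<Longrightarrow> (K \<epsilon> has_sum 1) (grid \<epsilon>)"
    and kernel_moment: "\<And>\<epsilon>. 0 < \<epsilon> \<Longrightarrow> (\<lambda>j. (norm j)\<^sup>2 * K \<epsilon> j) summable_on grid \<epsilon>"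
    and h_tendsto: "((\<lambda>\<epsilon>. kernel_h \<epsilon> (K \<epsilon>)) \<longlongrightarrow> 0) (at_right 0)"
    and kernel_consistent: "\<And>\<xi>. ((\<lambda>\<epsilon>. (1 - kernel_fourier \<epsilon> (K \<epsilon>) \<xi>) / of_real (kernel_h \<epsilon> (K \<epsilon>)))
           \<longlongrightarrow> of_real (4 * pi\<^sup>2 * (norm \<xi>)\<^sup>2)) (at_right 0)"
    and h_ge: "\<And>\<epsilon>. 0 < \<epsilon> \<Longrightarrow> \<epsilon>\<^sup>2 \<le> kernel_h \<epsilon> (K \<epsilon>)"
    and sd: "sd = sd_plus \<or> sd = sd_minus"
    and w_lipschitz: "\<And>\<epsilon>. 0 < \<epsilon> \<Longrightarrow> grid_1_lipschitz \<epsilon> (w \<epsilon>)"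
    and w_neg: "\<And>\<epsilon> i. 0 < \<epsilon> \<Longrightarrow> i \<in> initial_grid_set \<epsilon> E0 \<Longrightarrow> w \<epsilon> i < 0"
    and w_pos: "\<And>\<epsilon> i. 0 < \<epsilon> \<Longrightarrow> i \<in> grid \<epsilon> - initial_grid_set \<epsilon> E0 \<Longrightarrow> 0 < w \<epsilon> i"
  shows "\<forall>\<epsilon> :: nat \<Rightarrow> real. (\<forall>n. 0 < \<epsilon> n) \<and> \<epsilon> \<longlonglongrightarrow> 0 \<longrightarrow>
    (\<exists>r :: nat \<Rightarrow> nat. \<exists>d :: real^'n \<Rightarrow> real \<Rightarrow> ereal. strict_mono r \<and>
      (AE t in lborel. 0 \<le> t \<longrightarrow>
         locally_uniform_limit
           (\<lambda>n. grid_extension (\<epsilon> (r n))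
              (discrete_flow sd (\<epsilon> (r n)) (K (\<epsilon> (r n))) (w (\<epsilon> (r n))) t))
           (\<lambda>x. d x t) sequentially) \<and>
      (\<exists>E. superflow E0 E \<and>
         (AE t in lborel. 0 \<le> t \<longrightarrow> (\<forall>x. max (d x t) 0 = edist_set x (time_slice E t)))) \<and>
      (\<exists>E. superflow (closure (- E0)) E \<and>
         (AE t in lborel. 0 \<le> t \<longrightarrow> (\<forall>x. max (- d x t) 0 = edist_set x (time_slice E t)))))"
proof (intro allI impI; elim conjE)
  fix \<epsilon> :: "nat \<Rightarrow> real" assume pos: "\<forall>n. 0 < \<epsilon> n" and lim: "\<epsilon> \<longlonglongrightarrow> 0"
  have right: "filterlim \<epsilon> (at_right 0) sequentially"
    using pos lim by (simp add: filterlim_at less_le)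
  have kernel: "grid_kernel \<delta> (K \<delta>)" if "0 < \<delta>" for \<delta>
    by unfold_locales
      (simp_all add: that kernel_sym[OF that, symmetric] kernel_nonneg[OF that] kernel_mass[OF that] kernel_moment[OF that] h_ge[OF that])
  have "redistancing sd" using sd redistancing_sd_plus redistancing_sd_minus by blast
  then have rs: "redistancing_scheme \<delta> (K \<delta>) sd (w \<delta>)" if "0 < \<delta>" for \<delta>
    using kernel[OF that] w_lipschitz[OF that] that
    by (intro redistancing_scheme.intro redistancing_scheme_axioms.intro)
  define k where "k n = K (\<epsilon> n)" for n
  define u where "u n = scheme sd (\<epsilon> n) (K (\<epsilon> n)) (w (\<epsilon> n))" for n
  \<comment> \<open>Negation turns the negative part of the scheme into a positive part, so the same
    results apply with the closure of the complement as initial set.\<close>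
  define v where "v n j i = - u n j i" for n j i
  have ks: "kernel_sequence \<epsilon> k"
    unfolding k_def using kernel pos lim
    by (intro kernel_sequence.intro filterlim_compose[OF h_tendsto right]
        filterlim_compose[OF kernel_consistent right]) auto
  have fp: "flow_sequence \<epsilon> k u E0"
    using ks
  proof (intro flow_sequence.intro flow_sequence_axioms.intro)
    show "grid_flow (\<epsilon> n) (k n) (u n)" for n
      unfolding k_def u_def using pos rs redistancing_scheme.grid_flow_scheme by blast
    show "edist_set i E0 \<le> max (u n 0 i) 0 + ereal (5 * real CARD('n) * \<epsilon> n)" if "i \<in> grid (\<epsilon> n)" for n i
      unfolding u_def using pos w_pos that by (intro redistancing_scheme.initial_ge[OF rs]) auto
  qed (use \<open>closed E0\<close> in auto)
  have fm: "flow_sequence \<epsilon> k v (closure (- E0))"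
    using ks
  proof (intro flow_sequence.intro flow_sequence_axioms.intro)
    show "grid_flow (\<epsilon> n) (k n) (v n)" for n
      unfolding k_def u_def v_def using pos rs redistancing_scheme.grid_flow_uminus_scheme by blast
    show "edist_set i (closure (- E0)) \<le> max (v n 0 i) 0 + ereal (5 * real CARD('n) * \<epsilon> n)"
      if "i \<in> grid (\<epsilon> n)" for n i
      unfolding u_def v_def using pos w_neg that by (intro redistancing_scheme.initial_ge_neg[OF rs]) auto
  qed auto
  obtain r where r: "strict_mono r" and cp: "convergent_flow_sequence (\<epsilon> \<circ> r) (k \<circ> r) (u \<circ> r) E0"
    and cm: "convergent_flow_sequence (\<epsilon> \<circ> r) (k \<circ> r) (v \<circ> r) (closure (- E0))"
    by (rule common_convergent_subsequence[OF fp fm])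
  interpret p: convergent_flow_sequence "\<epsilon> \<circ> r" "k \<circ> r" "u \<circ> r" E0 by (rule cp)
  interpret m: convergent_flow_sequence "\<epsilon> \<circ> r" "k \<circ> r" "v \<circ> r" "closure (- E0)" by (rule cm)
  obtain E N where E: "superflow E0 E" "countable N"
    "\<forall>t>0. t \<notin> N \<longrightarrow> (\<forall>x. (\<lambda>n. p.F n x t) \<longlonglongrightarrow> gamma (edist_set x (time_slice E t)))"
    using p.limit_theorem by blast
  obtain E' N' where E': "superflow (closure (- E0)) E'" "countable N'"
    "\<forall>t>0. t \<notin> N' \<longrightarrow> (\<forall>x. (\<lambda>n. m.F n x t) \<longlonglongrightarrow> gamma (edist_set x (time_slice E' t)))"
    using m.limit_theorem by blast
  let ?W = "\<lambda>t n. grid_extension (\<epsilon> (r n)) (discrete_flow sd (\<epsilon> (r n)) (K (\<epsilon> (r n))) (w (\<epsilon> (r n))) t)"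
  have W: "?W t n x = u (r n) (p.steps n t) (grid_floor (\<epsilon> (r n)) x)" for t n x
    using pos by (simp add: grid_extension_eq discrete_flow_def u_def p.steps_def k_def)
  have W_lip: "?W t n x \<le> ?W t n y + ereal (dist x y + p.mesh n)" for t n x y
  proof -
    have "grid_1_lipschitz (\<epsilon> (r n)) (u (r n) (p.steps n t))"
      unfolding u_def using pos rs redistancing_scheme.scheme_lipschitz by blast
    then have "?W t n x \<le> ?W t n y + ereal (norm (grid_floor (\<epsilon> (r n)) x - grid_floor (\<epsilon> (r n)) y))"
      unfolding W by (rule grid_1_lipschitzD) simp_all
    also have "\<dots> \<le> ?W t n y + ereal (dist x y + p.mesh n)"
      using p.norm_grid_floor_diff[of n x y] by (intro add_left_mono) simp
    finally show ?thesis .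
  qed
  \<comment> \<open>Away from the exceptional times at most one of the two distances is nonzero, so
    this difference recovers both as its positive and negative part.\<close>
  define d where "d x t = edist_set x (time_slice E t) - edist_set x (time_slice E' t)" for x t
  have d: "locally_uniform_limit (?W t) (\<lambda>x. d x t) sequentially"
    "max (d x t) 0 = edist_set x (time_slice E t)" "max (- d x t) 0 = edist_set x (time_slice E' t)"
    if t: "0 < t" "t \<notin> N" "t \<notin> N'" for t x
  proof -
    have lp: "(\<lambda>n. gamma (max (?W t n x) 0)) \<longlonglongrightarrow> gamma (edist_set x (time_slice E t))" for x
      using E(3) t unfolding p.F_def p.V_def W by simp
    have lm: "(\<lambda>n. gamma (max (- ?W t n x) 0)) \<longlonglongrightarrow> gamma (edist_set x (time_slice E' t))" for x
      using E'(3) t unfolding m.F_def m.V_def W by (simp add: v_def m.steps_def p.steps_def)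
    note * = locally_uniform_limit_signed[OF W_lip p.mesh_lim lp lm, folded d_def]
    show "locally_uniform_limit (?W t) (\<lambda>x. d x t) sequentially"
      "max (d x t) 0 = edist_set x (time_slice E t)" "max (- d x t) 0 = edist_set x (time_slice E' t)"
      by (rule *)+
  qed
  \<comment> \<open>Time 0 is discarded as well, since the convergence was established for positive
    times.\<close>
  have "N \<union> N' \<union> {0} \<in> null_sets lborel" using E(2) E'(2) by (intro countable_imp_null_set_lborel) auto
  then have ae: "AE t in lborel. t \<notin> N \<union> N' \<union> {0}" by (rule AE_not_in)
  show "\<exists>r d. strict_mono r \<and>
      (AE t in lborel. 0 \<le> t \<longrightarrow> locally_uniform_limit
         (\<lambda>n. grid_extension (\<epsilon> (r n)) (discrete_flow sd (\<epsilon> (r n)) (K (\<epsilon> (r n))) (w (\<epsilon> (r n))) t))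
         (\<lambda>x. d x t) sequentially) \<and>
      (\<exists>E. superflow E0 E \<and>
         (AE t in lborel. 0 \<le> t \<longrightarrow> (\<forall>x. max (d x t) 0 = edist_set x (time_slice E t)))) \<and>
      (\<exists>E. superflow (closure (- E0)) E \<and>
         (AE t in lborel. 0 \<le> t \<longrightarrow> (\<forall>x. max (- d x t) 0 = edist_set x (time_slice E t))))"
  proof (intro exI conjI)
    show "AE t in lborel. 0 \<le> t \<longrightarrow> locally_uniform_limit (?W t) (\<lambda>x. d x t) sequentially"
      using ae by eventually_elim (auto intro: d(1))
    show "AE t in lborel. 0 \<le> t \<longrightarrow> (\<forall>x. max (d x t) 0 = edist_set x (time_slice E t))"
      using ae by eventually_elim (auto intro: d(2))
    show "AE t in lborel. 0 \<le> t \<longrightarrow> (\<forall>x. max (- d x t) 0 = edist_set x (time_slice E' t))"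
      using ae by eventually_elim (auto intro: d(3))
  qed (rule r E(1) E'(1))+
qed

end
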